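(* Let $\Omega\subset\mathbb{R}^n$ be a bounded $C^{1,1}$-domain, $\alpha\in(0,1)$, $\gamma>0$, and let $G$ be continuous on the inner boundary strips $\Gamma_\varepsilon$ for all small $\varepsilon>0$. For each small $\varepsilon>0$ let $u_\varepsilon$ be the function on $\overline\Omega$ satisfying, for all $x\in\overline\Omega$, $$u_\varepsilon(x)=\big(1-(1-\alpha)\gamma s_\varepsilon(x)\big)\Big\{\frac{\alpha}{2}\Big(\sup_{B_{\varepsilon d'_x}(x)}u_\varepsilon+\inf_{B_{\varepsilon d'_x}(x)}u_\varepsilon\Big)+\frac{1-\alpha}{|B_\varepsilon(x)\cap\Omega|}\int_{B_\varepsilon(x)\cap\Omega}u_\varepsilon(y)\,dy\Big\}+(1-\alpha)\gamma s_\varepsilon(x)G(x).$$ Let $\sigma\in(0,1)$ be the interior Hölder exponent described in the context. Then there exist $\delta_0\in(0,1)$ and a constant $C$ depending on $n,\alpha,\gamma,\sigma$ and $\Omega$ such that for every $\delta\in(0,\delta_0)$, every $\varepsilon>0$ sufficiently small depending on $\delta$ ($\varepsilon\ll\delta$), and all $x_0,y_0\in\overline\Omega$ with $|x_0-y_0|\le\delta$ and $\operatorname{dist}(x_0,\partial\Omega),\operatorname{dist}(y_0,\partial\Omega)\le\delta^{1/2}$, $$|u_\varepsilon(x_0)-u_\varepsilon(y_0)|\le C\,\|G\|_{L^\infty(\Gamma_\varepsilon)}\,\delta^{\sigma/2}.$$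
   Context: $\Gamma_\varepsilon=\{x\in\overline\Omega:\operatorname{dist}(x,\partial\Omega)\le\varepsilon\}$. For $x\in\overline\Omega$: $d_x=\min\{1,\frac1\varepsilon\operatorname{dist}(x,\partial\Omega)\}$, $d'_x=\min\{\frac12,\frac1\varepsilon\operatorname{dist}(x,\partial\Omega)\}$. $B_r(x)$ is the closed ball, with $B_0(x)=\{x\}$. $B^k_r$ is the $k$-dimensional ball of radius $r$ centred at $0$, $B^n_{1,d}=B^n_1\cap\{y_n<d\}$, and $$s_\varepsilon(x)=\frac{|B_1^{n-1}|}{(n+1)|B^n_{1,d_x}|}\,\varepsilon\,(1-d_x^2)^{\frac{n+1}{2}},$$ so $s_\varepsilon(x)=0$ when $\operatorname{dist}(x,\partial\Omega)\ge\varepsilon$ (the term involving $G$ is then $0$). Small $\varepsilon$ includes $(1-\alpha)\gamma s_\varepsilon\le1$. Interior Hölder exponent: $\sigma\in(0,1)$ is an exponent, independent of $\varepsilon$, for which there is a constant $C_1>0$ independent of $\varepsilon$ such that whenever $B_{2R}(z_0)\subset\Omega$, one has $|u_\varepsilon(x)-u_\varepsilon(z)|\le C_1\|u_\varepsilon\|_{L^\infty(B_{2R}(z_0))}\big(\frac{|x-z|^\sigma}{R^\sigma}+\frac{\varepsilon^\sigma}{R^\sigma}\big)$ for all $x,z\in B_R(z_0)$. *)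

theory Defs
  imports "HOL-Analysis.Analysis" "HOL-Probability.Essential_Supremum"
begin

definition C11_function :: "(real^'n \<Rightarrow> real) \<Rightarrow> bool" where
  "C11_function \<phi> \<longleftrightarrow>
     (\<exists>g L. (\<forall>x. (\<phi> has_derivative (\<lambda>h. g x \<bullet> h)) (at x)) \<and> L-lipschitz_on UNIV g)"

text \<open>The unit vector \<open>\<nu>\<close> is the last axis of a rotated coordinate system: \<open>x \<bullet> \<nu>\<close> is the last
  coordinate of \<open>x\<close> and \<open>x - (x \<bullet> \<nu>) *\<^sub>R \<nu>\<close> its projection to the hyperplane \<open>\<nu>\<close>-perp.  The graph
  function \<open>\<phi>\<close> is only used on that hyperplane; it is defined on the whole space because a
  function on the hyperplane extends constantly in direction \<open>\<nu>\<close> with the same regularity.\<close>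

definition C11_domain :: "(real^'n) set \<Rightarrow> bool" where
  "C11_domain \<Omega> \<longleftrightarrow> open \<Omega> \<and> connected \<Omega> \<and> \<Omega> \<noteq> {} \<and>
     (\<forall>z\<in>frontier \<Omega>. \<exists>r>0. \<exists>\<nu> \<phi>. norm \<nu> = 1 \<and> C11_function \<phi> \<and>
        \<Omega> \<inter> ball z r = {x \<in> ball z r. x \<bullet> \<nu> > \<phi> (x - (x \<bullet> \<nu>) *\<^sub>R \<nu>)})"

definition bdist :: "(real^'n) set \<Rightarrow> real^'n \<Rightarrow> real" where
  "bdist \<Omega> x = infdist x (frontier \<Omega>)"

definition strip :: "(real^'n) set \<Rightarrow> real \<Rightarrow> (real^'n) set" where
  "strip \<Omega> \<epsilon> = {x \<in> closure \<Omega>. bdist \<Omega> x \<le> \<epsilon>}"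

definition dcut :: "(real^'n) set \<Rightarrow> real \<Rightarrow> real^'n \<Rightarrow> real" where
  "dcut \<Omega> \<epsilon> x = min 1 (bdist \<Omega> x / \<epsilon>)"

definition dcut' :: "(real^'n) set \<Rightarrow> real \<Rightarrow> real^'n \<Rightarrow> real" where
  "dcut' \<Omega> \<epsilon> x = min (1/2) (bdist \<Omega> x / \<epsilon>)"

text \<open>The index type carries no order, so an arbitrary but fixed index plays the role of the
  \<open>n\<close>-th one.  Only the volume of \<open>cut_ball d\<close> is used, and by symmetry that does not depend on
  the choice.\<close>

definition last_coord :: "'n::finite" where
  "last_coord = (SOME i. True)"

definition cut_ball :: "real \<Rightarrow> (real^'n) set" where
  "cut_ball d = {y \<in> cball 0 1. y $ last_coord < d}"

definition s_eps :: "(real^'n) set \<Rightarrow> real \<Rightarrow> real^'n \<Rightarrow> real" where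
  "s_eps \<Omega> \<epsilon> x =
     unit_ball_vol (real CARD('n) - 1)
       / ((real CARD('n) + 1) * measure lebesgue (cut_ball (dcut \<Omega> \<epsilon> x) :: (real^'n) set))
     * \<epsilon> * (1 - (dcut \<Omega> \<epsilon> x)\<^sup>2) powr ((real CARD('n) + 1) / 2)"

definition Linf_norm :: "(real^'n) set \<Rightarrow> (real^'n \<Rightarrow> real) \<Rightarrow> real" where
  "Linf_norm S f = real_of_ereal (esssup (lebesgue_on S) (\<lambda>x. ereal \<bar>f x\<bar>))"

text \<open>Boundedness and measurability are what the suprema, infima and integrals in the equation
  presuppose; only the values of \<open>v\<close> on \<open>closure \<Omega>\<close> matter.\<close>

definition dpp_solution ::
  "(real^'n) set \<Rightarrow> real \<Rightarrow> real \<Rightarrow> real \<Rightarrow> (real^'n \<Rightarrow> real) \<Rightarrow> (real^'n \<Rightarrow> real) \<Rightarrow> bool" where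
  "dpp_solution \<Omega> \<alpha> \<gamma> \<epsilon> G v \<longleftrightarrow>
     bounded (v ` closure \<Omega>) \<and> v \<in> borel_measurable (lebesgue_on (closure \<Omega>)) \<and>
     (\<forall>x\<in>closure \<Omega>.
        v x = (1 - (1 - \<alpha>) * \<gamma> * s_eps \<Omega> \<epsilon> x) *
                (\<alpha> / 2 * ((SUP y\<in>cball x (\<epsilon> * dcut' \<Omega> \<epsilon> x). v y)
                          + (INF y\<in>cball x (\<epsilon> * dcut' \<Omega> \<epsilon> x). v y))
                 + (1 - \<alpha>) / measure lebesgue (cball x \<epsilon> \<inter> \<Omega>)
                     * (LINT y:(cball x \<epsilon> \<inter> \<Omega>)|lebesgue. v y))
              + (1 - \<alpha>) * \<gamma> * s_eps \<Omega> \<epsilon> x * G x)"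

text \<open>\<open>u \<epsilon>\<close> is the function \<open>u\<^sub>\<epsilon>\<close>; the small values of \<open>\<epsilon>\<close> are those in \<open>(0, \<epsilon>\<^sub>1)\<close>.\<close>

definition dpp_family ::
  "(real^'n) set \<Rightarrow> real \<Rightarrow> real \<Rightarrow> real \<Rightarrow> (real^'n \<Rightarrow> real) \<Rightarrow> (real \<Rightarrow> real^'n \<Rightarrow> real) \<Rightarrow> bool" where
  "dpp_family \<Omega> \<alpha> \<gamma> \<epsilon>\<^sub>1 G u \<longleftrightarrow>
     (\<forall>\<epsilon>. 0 < \<epsilon> \<and> \<epsilon> < \<epsilon>\<^sub>1 \<longrightarrow>
        continuous_on (strip \<Omega> \<epsilon>) G \<and>
        (\<forall>x\<in>closure \<Omega>. (1 - \<alpha>) * \<gamma> * s_eps \<Omega> \<epsilon> x \<le> 1) \<and>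
        dpp_solution \<Omega> \<alpha> \<gamma> \<epsilon> G (u \<epsilon>))"

text \<open>The constant \<open>C\<^sub>1\<close> and the range \<open>(0, \<epsilon>\<^sub>2)\<close> of small \<open>\<epsilon>\<close> belong to the equation, not to the
  particular datum \<open>G\<close>: this is what allows constants depending on the data only through
  \<open>\<Omega>\<close>, \<open>\<alpha>\<close>, \<open>\<gamma>\<close> and \<open>\<sigma>\<close>.\<close>

definition interior_Hoelder_exponent ::
  "(real^'n) set \<Rightarrow> real \<Rightarrow> real \<Rightarrow> real \<Rightarrow> bool" where
  "interior_Hoelder_exponent \<Omega> \<alpha> \<gamma> \<sigma> \<longleftrightarrow> 0 < \<sigma> \<and> \<sigma> < 1 \<and>
     (\<exists>C\<^sub>1>0. \<exists>\<epsilon>\<^sub>2>0. \<forall>\<epsilon>\<^sub>1 G u. dpp_family \<Omega> \<alpha> \<gamma> \<epsilon>\<^sub>1 G u \<longrightarrow>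
        (\<forall>\<epsilon>. 0 < \<epsilon> \<and> \<epsilon> < \<epsilon>\<^sub>1 \<and> \<epsilon> < \<epsilon>\<^sub>2 \<longrightarrow>
          (\<forall>z\<^sub>0. \<forall>R>0. cball z\<^sub>0 (2 * R) \<subseteq> \<Omega> \<longrightarrow>
            (\<forall>x\<in>cball z\<^sub>0 R. \<forall>z\<in>cball z\<^sub>0 R.
               \<bar>u \<epsilon> x - u \<epsilon> z\<bar>
                 \<le> C\<^sub>1 * Linf_norm (cball z\<^sub>0 (2 * R)) (u \<epsilon>)
                     * (norm (x - z) powr \<sigma> / R powr \<sigma> + \<epsilon> powr \<sigma> / R powr \<sigma>)))))"

end

theory Submission
  imports Defs
begin

text \<open>
  By the maximum principle \<open>\<bar>u\<bar> \<le> \<parallel>G\<parallel>\<close>, so one may assume that \<open>G\<close> and \<open>u\<close> are bounded by \<open>1\<close>. Doubling the variables,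
  \<open>u x - u x'\<close> is compared on a boundary chart with the barrier \<open>A * q powr \<sigma> + B * (norm (x - x\<^sub>0))\<^sup>2\<close>, where \<open>q\<close> is
  \<open>norm (x - x')\<close> plus a small corrector that decreases along the inner normal. Let \<open>S\<close> be the supremum of the
  difference, assumed to be positive, and take a pair at which it is almost attained.

  If the distance of the pair is large compared with \<open>\<epsilon>\<close>, one step of the game gains a multiple of \<open>\<epsilon>\<^sup>2\<close>, which is
  impossible. In the tug-of-war part, an almost optimal move of one player is answered by the opposite move if it is
  nearly in the direction of \<open>x - x'\<close>, where the strict concavity of the power gives the gain, and otherwise by
  pulling the two points straight together. In the noise part, the two points move synchronously on the common part
  of their balls. Near the boundary, where that part is smaller and the killing term is present, the mean displacement
  points inward and the corrector turns it into a gain that dominates both losses.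

  If the distance is comparable to \<open>\<epsilon>\<close>, one noise step into the interior followed by a bounded number of tug-of-war
  steps merges the two points with a probability bounded below, which forces \<open>S\<close> to be of order \<open>\<epsilon> powr \<sigma>\<close>.
\<close>

section \<open>Averages over measurable sets\<close>

text \<open>The two sources of gain degenerate in complementary regions. The tug-of-war radius is at
  most the distance to the boundary, so the gain from concavity fades on approach to it, while the
  drift of the noise exists only there. They overlap enough: a point closer than
  \<open>\<epsilon> / 4\<close> has inward drift of order \<epsilon>, and a pair of tug radii with
  sum at least \<open>\<epsilon> / 4\<close> still gains from concavity. The weight \<open>a\<close>
  of the corrector multiplies its benefit as well as its second-order error. Where there is a tug
  gain, the error must stay below it, which fixes \<open>a\<close> in terms of \<alpha>, \<sigma>
  and \<open>L\<close>. Where there is none, an error of order \<open>\<epsilon>\<^sup>2 / t\<close>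
  competes with a drift of order \<epsilon>, which is won only if the distance \<open>t\<close> is a
  large multiple of \<epsilon>. This is the threshold between the two regimes. Both drift and weight
  of \<open>G\<close> have the profile \<open>\<epsilon> * (1 - d) powr ((n + 1) / 2)\<close>,
  \<open>d\<close> being the distance to the boundary divided by \<epsilon>; this is why the drift
  can pay for the killing. Since \<open>u\<close> is only bounded and measurable, suprema are
  approached and never assumed to be attained.\<close>

lemma translation_invariant_eq_lborel:
  fixes \<mu> :: "'a::euclidean_space measure"
  assumes sets: "sets \<mu> = sets borel"
    and inv: "\<And>a. distr \<mu> borel ((+) a) = \<mu>"
    and ball: "\<And>r. emeasure \<mu> (ball 0 r) = emeasure lborel (ball (0::'a) r)"
  shows "\<mu> = lborel"
proof -
  have [measurable_cong]: "sets \<mu> = sets borel" by (rule sets)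
  have sp: "space \<mu> = UNIV" using sets_eq_imp_space_eq[OF sets] by simp
  interpret mu: sigma_finite_measure \<mu>
  proof
    show "\<exists>A. countable A \<and> A \<subseteq> sets \<mu> \<and> \<Union> A = space \<mu> \<and> (\<forall>a\<in>A. emeasure \<mu> a \<noteq> \<infinity>)"
    proof (intro exI[of _ "range (\<lambda>n::nat. ball (0::'a) (real n))"] conjI ballI)
      show "\<Union> (range (\<lambda>n::nat. ball (0::'a) (real n))) = space \<mu>"
        using reals_Archimedean2 by (auto simp: sp)
      show "emeasure \<mu> a \<noteq> \<infinity>" if "a \<in> range (\<lambda>n::nat. ball (0::'a) (real n))" for a
        using that emeasure_lborel_ball_finite[where 'a='a] by (auto simp: ball less_top[symmetric])
    qed (auto simp: sets)
  qed
  interpret P: pair_sigma_finite lborel \<mu> ..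
  have refl: "(\<integral>\<^sup>+x. g (y - x) \<partial>lborel) = (\<integral>\<^sup>+x. g x \<partial>lborel)"
    if [measurable]: "g \<in> borel_measurable borel" for g :: "'a \<Rightarrow> ennreal" and y
  proof -
    have "lborel = distr lborel borel (\<lambda>x::'a. y + (-1) *\<^sub>R x)"
      using lborel_affine[of "-1" y] by (simp add: density_1)
    then have "(\<integral>\<^sup>+x. g x \<partial>lborel) = (\<integral>\<^sup>+x. g x \<partial>distr lborel borel (\<lambda>x::'a. y + (-1) *\<^sub>R x))"
      by simp
    also have "\<dots> = (\<integral>\<^sup>+x. g (y - x) \<partial>lborel)"
      by (subst nn_integral_distr) auto
    finally show ?thesis by simp
  qed
  have trl: "(\<integral>\<^sup>+x. f (x + a) \<partial>lborel) = (\<integral>\<^sup>+x. f x \<partial>lborel)"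
    if [measurable]: "f \<in> borel_measurable borel" for f :: "'a \<Rightarrow> ennreal" and a
  proof -
    have "(\<integral>\<^sup>+x. f x \<partial>lborel) = (\<integral>\<^sup>+x. f x \<partial>distr lborel borel ((+) a))"
      by (simp add: lborel_distr_plus)
    also have "\<dots> = (\<integral>\<^sup>+x. f (x + a) \<partial>lborel)"
      by (subst nn_integral_distr) (auto simp: add.commute)
    finally show ?thesis by simp
  qed
  have trm: "(\<integral>\<^sup>+x. f (x + a) \<partial>\<mu>) = (\<integral>\<^sup>+x. f x \<partial>\<mu>)"
    if [measurable]: "f \<in> borel_measurable borel" for f :: "'a \<Rightarrow> ennreal" and a
  proof -
    have "(\<integral>\<^sup>+x. f x \<partial>\<mu>) = (\<integral>\<^sup>+x. f x \<partial>distr \<mu> borel ((+) a))"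
      by (simp add: inv)
    also have "\<dots> = (\<integral>\<^sup>+x. f (x + a) \<partial>\<mu>)"
      by (subst nn_integral_distr) (auto simp: add.commute)
    finally show ?thesis by simp
  qed
  \<comment> \<open>Uniqueness of Haar measure by Fubini: both sides equal the double integral of
    \<open>f (x + y) * g y\<close>. Translation of the Lebesgue variable by \<open>y\<close> yields
    the left side; translation of the other variable by \<open>x\<close>, followed by a reflection
    in the Lebesgue variable, yields the right side. The indicators of a Borel set and of the unit
    ball are inserted at the end.\<close>
  have key: "(\<integral>\<^sup>+x. f x \<partial>lborel) * (\<integral>\<^sup>+x. g x \<partial>\<mu>) = (\<integral>\<^sup>+x. f x \<partial>\<mu>) * (\<integral>\<^sup>+x. g x \<partial>lborel)"
    if [measurable]: "f \<in> borel_measurable borel" "g \<in> borel_measurable borel"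
    for f g :: "'a \<Rightarrow> ennreal"
  proof -
    have "(\<integral>\<^sup>+x. f x \<partial>lborel) * (\<integral>\<^sup>+x. g x \<partial>\<mu>) = (\<integral>\<^sup>+y. (\<integral>\<^sup>+x. f x \<partial>lborel) * g y \<partial>\<mu>)"
      by (simp add: nn_integral_cmult)
    also have "\<dots> = (\<integral>\<^sup>+y. (\<integral>\<^sup>+x. f (x + y) * g y \<partial>lborel) \<partial>\<mu>)"
      by (simp add: nn_integral_multc trl)
    also have "\<dots> = (\<integral>\<^sup>+x. (\<integral>\<^sup>+y. f (x + y) * g y \<partial>\<mu>) \<partial>lborel)"
      by (rule P.Fubini') measurable
    also have "\<dots> = (\<integral>\<^sup>+x. (\<integral>\<^sup>+y. f y * g (y - x) \<partial>\<mu>) \<partial>lborel)"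
    proof (rule nn_integral_cong)
      fix x
      have "(\<integral>\<^sup>+y. f y * g (y - x) \<partial>\<mu>) = (\<integral>\<^sup>+y. f (y + x) * g (y + x - x) \<partial>\<mu>)"
        by (rule trm[symmetric]) measurable
      then show "(\<integral>\<^sup>+y. f (x + y) * g y \<partial>\<mu>) = (\<integral>\<^sup>+y. f y * g (y - x) \<partial>\<mu>)"
        by (simp add: add.commute)
    qed
    also have "\<dots> = (\<integral>\<^sup>+y. (\<integral>\<^sup>+x. f y * g (y - x) \<partial>lborel) \<partial>\<mu>)"
      by (rule P.Fubini'[symmetric]) measurable
    also have "\<dots> = (\<integral>\<^sup>+y. f y * (\<integral>\<^sup>+x. g x \<partial>lborel) \<partial>\<mu>)"
      by (auto simp: nn_integral_cmult refl)
    also have "\<dots> = (\<integral>\<^sup>+x. f x \<partial>\<mu>) * (\<integral>\<^sup>+x. g x \<partial>lborel)"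
      by (simp add: nn_integral_multc)
    finally show ?thesis .
  qed
  let ?b = "emeasure lborel (ball (0::'a) 1)"
  have b: "?b \<noteq> 0" "?b \<noteq> \<infinity>"
    using content_ball_pos[of 1 "0::'a"] emeasure_lborel_ball_finite[of "0::'a" 1]
    by (auto simp: measure_def)
  show ?thesis
  proof (rule measure_eqI)
    fix X assume "X \<in> sets \<mu>"
    then have [measurable]: "X \<in> sets borel" by (simp add: sets)
    have "emeasure lborel X * ?b = emeasure \<mu> X * ?b"
    proof -
      have m: "(indicator X :: 'a \<Rightarrow> ennreal) \<in> borel_measurable borel"
        "(indicator (ball 0 1) :: 'a \<Rightarrow> ennreal) \<in> borel_measurable borel"
        by (simp_all add: borel_measurable_indicator)
      show ?thesis using key[OF m] ball[of 1] by (simp add: sets)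
    qed
    then show "emeasure \<mu> X = emeasure lborel X"
      using b by (metis mult_divide_eq_ennreal infinity_ennreal_def)
  qed (simp add: sets)
qed

text \<open>The image measure is translation invariant because \<open>a + T x = T (b + x)\<close>
  whenever \<open>T b = a\<close>; since \<open>T\<close> preserves balls about 0, the normalisation
  is the same.\<close>

lemma lborel_distr_orthogonal:
  fixes T :: "'a::euclidean_space \<Rightarrow> 'a"
  assumes T: "orthogonal_transformation T"
  shows "distr lborel borel T = lborel"
proof (rule translation_invariant_eq_lborel)
  have lin: "linear T" using T orthogonal_transformation_linear by blast
  have [measurable]: "T \<in> borel_measurable borel"
    using lin by (simp add: borel_measurable_continuous_onI linear_continuous_on linear_conv_bounded_linear)
  have "surj T" by (rule orthogonal_transformation_surj[OF T])
  show "distr (distr lborel borel T) borel ((+) a) = distr lborel borel T" for a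
  proof -
    obtain b where b: "T b = a" using \<open>surj T\<close> by (metis surjD)
    have eq: "(\<lambda>x. a + T x) = (\<lambda>x. T (b + x))"
      using lin by (auto simp: linear_add b)
    have "distr (distr lborel borel T) borel ((+) a) = distr lborel borel (\<lambda>x. a + T x)"
      by (subst distr_distr) (auto simp: comp_def)
    also have "\<dots> = distr (distr lborel borel ((+) b)) borel T"
      by (subst distr_distr) (auto simp: comp_def eq)
    finally show ?thesis by (simp add: lborel_distr_plus)
  qed
  show "emeasure (distr lborel borel T) (ball 0 r) = emeasure lborel (ball (0::'a) r)" for r
  proof -
    have "T -` ball 0 r = (ball 0 r :: 'a set)"
      using orthogonal_transformation_norm[OF T] by auto
    then show ?thesis by (subst emeasure_distr) auto
  qed
qed simp


section \<open>Translations in the completed Lebesgue measure\<close>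

lemma lebesgue_distr_translation:
  "distr lebesgue lebesgue ((+) a) = (lebesgue :: 'a::euclidean_space measure)"
proof -
  have "(lebesgue :: 'a measure) = density (distr lebesgue lebesgue ((+) a)) (\<lambda>_. 1)"
    using lebesgue_affine_euclidean[of "\<lambda>_. 1" a] by (simp add: euclidean_representation)
  then show ?thesis by (simp add: density_1)
qed

lemma measurable_translation_lebesgue: "(+) a \<in> lebesgue \<rightarrow>\<^sub>M (lebesgue :: 'a::euclidean_space measure)"
  using lebesgue_affine_measurable[of "\<lambda>_. 1" a] by (simp add: euclidean_representation)

lemma set_integrable_translation:
  fixes f :: "'a::euclidean_space \<Rightarrow> 'b::{banach, second_countable_topology}"
  assumes "set_integrable lebesgue A f"
  shows "set_integrable lebesgue {h. a + h \<in> A} (\<lambda>h. f (a + h))"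
proof -
  have "integrable (distr lebesgue lebesgue ((+) a)) (\<lambda>y. indicator A y *\<^sub>R f y)"
    using assms by (simp add: set_integrable_def lebesgue_distr_translation)
  then have "integrable lebesgue (\<lambda>h. indicator A (a + h) *\<^sub>R f (a + h))"
    by (rule integrable_distr[OF measurable_translation_lebesgue])
  moreover have "(\<lambda>h. indicator A (a + h) *\<^sub>R f (a + h)) = (\<lambda>h. indicator {h. a + h \<in> A} h *\<^sub>R f (a + h))"
    by (auto simp: indicator_def)
  ultimately show ?thesis unfolding set_integrable_def by simp
qed

lemma set_integral_translation:
  fixes f :: "'a::euclidean_space \<Rightarrow> 'b::{banach, second_countable_topology}"
  assumes "set_integrable lebesgue A f"
  shows "(LINT h:{h. a + h \<in> A}|lebesgue. f (a + h)) = (LINT y:A|lebesgue. f y)"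
proof -
  have m: "(\<lambda>y. indicator A y *\<^sub>R f y) \<in> borel_measurable lebesgue"
    using assms by (simp add: set_integrable_def)
  have "(LINT y:A|lebesgue. f y) = (\<integral>y. indicator A y *\<^sub>R f y \<partial>distr lebesgue lebesgue ((+) a))"
    by (simp add: set_lebesgue_integral_def lebesgue_distr_translation)
  also have "\<dots> = (\<integral>h. indicator A (a + h) *\<^sub>R f (a + h) \<partial>lebesgue)"
    by (rule integral_distr[OF measurable_translation_lebesgue m])
  also have "(\<lambda>h. indicator A (a + h) *\<^sub>R f (a + h)) = (\<lambda>h. indicator {h. a + h \<in> A} h *\<^sub>R f (a + h))"
    by (auto simp: indicator_def)
  finally show ?thesis unfolding set_lebesgue_integral_def by simp
qed

section \<open>Estimates for averages over a set\<close>

definition avg :: "'a::euclidean_space set \<Rightarrow> ('a \<Rightarrow> real) \<Rightarrow> real" where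
  "avg A f = (LINT y:A|lebesgue. f y) / measure lebesgue A"

lemma set_integrable_const_lmeasurable:
  "A \<in> lmeasurable \<Longrightarrow> set_integrable lebesgue A (\<lambda>_. c::real)"
  unfolding set_integrable_def by (auto simp: fmeasurable_def less_top)

lemma set_integral_const_lmeasurable:
  "A \<in> lmeasurable \<Longrightarrow> (LINT y:A|lebesgue. (c::real)) = c * measure lebesgue A"
  unfolding set_lebesgue_integral_def by (simp add: fmeasurable_def measure_def)

lemma set_integral_split:
  fixes f :: "'a::euclidean_space \<Rightarrow> real"
  assumes f: "set_integrable lebesgue A f" and E: "E \<in> sets lebesgue" "E \<subseteq> A" and A: "A \<in> sets lebesgue"
  shows "(LINT y:A|lebesgue. f y) = (LINT y:E|lebesgue. f y) + (LINT y:A - E|lebesgue. f y)"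
proof -
  have "(LINT y:E \<union> (A - E)|lebesgue. f y) = (LINT y:E|lebesgue. f y) + (LINT y:A - E|lebesgue. f y)"
    by (rule set_integral_Un) (use assms in \<open>auto intro: set_integrable_subset\<close>)
  moreover have "E \<union> (A - E) = A" using E by blast
  ultimately show ?thesis by simp
qed

lemma set_integral_le_const:
  fixes f :: "'a::euclidean_space \<Rightarrow> real"
  assumes f: "set_integrable lebesgue A f" and A: "A \<in> lmeasurable" and le: "\<And>y. y \<in> A \<Longrightarrow> f y \<le> b"
  shows "(LINT y:A|lebesgue. f y) \<le> b * measure lebesgue A"
proof -
  have "(LINT y:A|lebesgue. f y) \<le> (LINT y:A|lebesgue. b)"
    by (rule set_integral_mono[OF f set_integrable_const_lmeasurable[OF A]]) (use le in auto)
  then show ?thesis by (simp add: set_integral_const_lmeasurable[OF A])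
qed

lemma set_integral_ge_const:
  fixes f :: "'a::euclidean_space \<Rightarrow> real"
  assumes f: "set_integrable lebesgue A f" and A: "A \<in> lmeasurable" and le: "\<And>y. y \<in> A \<Longrightarrow> b \<le> f y"
  shows "b * measure lebesgue A \<le> (LINT y:A|lebesgue. f y)"
proof -
  have "(LINT y:A|lebesgue. b) \<le> (LINT y:A|lebesgue. f y)"
    by (rule set_integral_mono[OF set_integrable_const_lmeasurable[OF A] f]) (use le in auto)
  then show ?thesis by (simp add: set_integral_const_lmeasurable[OF A])
qed

lemma measure_Diff_lmeasurable:
  assumes "A \<in> lmeasurable" "E \<in> sets lebesgue" "E \<subseteq> A"
  shows "measure lebesgue (A - E) = measure lebesgue A - measure lebesgue E"
    and "E \<in> lmeasurable" and "A - E \<in> lmeasurable"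
proof -
  show "E \<in> lmeasurable" using assms fmeasurableI2 by blast
  then show "measure lebesgue (A - E) = measure lebesgue A - measure lebesgue E" "A - E \<in> lmeasurable"
    using assms by (auto simp: measurable_measure_Diff fmeasurable.Diff)
qed

lemma avg_le:
  assumes "set_integrable lebesgue A f" "A \<in> lmeasurable" "0 < measure lebesgue A" "\<And>y. y \<in> A \<Longrightarrow> f y \<le> b"
  shows "avg A f \<le> b"
  using set_integral_le_const[OF assms(1,2,4)] assms(3) by (simp add: avg_def divide_le_eq)

text \<open>The form in which an event of probability at least \<open>c\<close> enters later:
  \<open>f\<close> is smaller by \<open>d\<close> on the event and bounded by \<open>b\<close>
  elsewhere.\<close>

lemma avg_le_subset:
  assumes f: "set_integrable lebesgue A f" and A: "A \<in> lmeasurable" "0 < measure lebesgue A"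
    and E: "E \<in> sets lebesgue" "E \<subseteq> A" and c: "c * measure lebesgue A \<le> measure lebesgue E"
    and d: "0 \<le> d" and b: "\<And>y. y \<in> A \<Longrightarrow> f y \<le> b" "\<And>y. y \<in> E \<Longrightarrow> f y \<le> b - d"
  shows "avg A f \<le> b - c * d"
proof -
  note m = measure_Diff_lmeasurable[OF A(1) E]
  have "(LINT y:A|lebesgue. f y) \<le> (b - d) * measure lebesgue E + b * measure lebesgue (A - E)"
    unfolding set_integral_split[OF f E fmeasurableD[OF A(1)]]
    by (intro add_mono set_integral_le_const)
       (use m f E b A in \<open>auto intro: set_integrable_subset\<close>)
  also have "\<dots> = b * measure lebesgue A - d * measure lebesgue E" by (simp add: m algebra_simps)
  also have "\<dots> \<le> b * measure lebesgue A - d * (c * measure lebesgue A)"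
    using mult_left_mono[OF c d] by simp
  also have "\<dots> = (b - c * d) * measure lebesgue A" by (simp add: algebra_simps)
  finally show ?thesis using A by (simp add: avg_def pos_divide_le_eq)
qed

lemma avg_diff:
  "set_integrable lebesgue A f \<Longrightarrow> set_integrable lebesgue A g \<Longrightarrow> avg A (\<lambda>y. f y - g y) = avg A f - avg A g"
  by (simp add: avg_def diff_divide_distrib)

lemma avg_cmult: "avg A (\<lambda>y. c * f y) = c * avg A f"
  by (simp add: avg_def)

text \<open>The two averages are coupled by moving synchronously on \<open>A \<inter> A'\<close> and independently elsewhere: every value
  outside the common part is compared with the average of the other function.\<close>

lemma avg_coupling:
  assumes A: "A \<in> lmeasurable" "0 < measure lebesgue A" "A \<subseteq> B"
    and A': "A' \<in> lmeasurable" "0 < measure lebesgue A'" "A' \<subseteq> B"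
    and B: "B \<in> lmeasurable"
    and g: "set_integrable lebesgue A g" and h: "set_integrable lebesgue A' h"
    and q0: "\<And>y y'. y \<in> A \<Longrightarrow> y' \<in> A' \<Longrightarrow> g y - h y' \<le> q\<^sub>0"
    and q1: "\<And>y. y \<in> A \<Longrightarrow> y \<in> A' \<Longrightarrow> g y - h y \<le> q\<^sub>1" and q: "q\<^sub>1 \<le> q\<^sub>0"
  shows "avg A g - avg A' h \<le>
    q\<^sub>1 + (q\<^sub>0 - q\<^sub>1) * (measure lebesgue (B - A) + measure lebesgue (B - A')) / measure lebesgue B"
proof -
  let ?I = "A \<inter> A'" and ?m = "measure lebesgue"
  define m m' where "m = avg A g" and "m' = avg A' h"
  have I: "?I \<in> sets lebesgue" "?I \<subseteq> A" "?I \<subseteq> A'" using A(1) A'(1) by auto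
  note mA = measure_Diff_lmeasurable[OF A(1) I(1,2)] and mA' = measure_Diff_lmeasurable[OF A'(1) I(1,3)]
  have g_le: "g y \<le> m' + q\<^sub>0" if "y \<in> A" for y
  proof -
    have "(g y - q\<^sub>0) * ?m A' \<le> (LINT y:A'|lebesgue. h y)"
      by (rule set_integral_ge_const[OF h A'(1)]) (use q0[OF that] in \<open>auto simp: algebra_simps\<close>)
    then have "g y - q\<^sub>0 \<le> m'" using A'(2) by (simp add: m'_def avg_def pos_le_divide_eq)
    then show ?thesis by simp
  qed
  have h_ge: "m - q\<^sub>0 \<le> h y'" if "y' \<in> A'" for y'
  proof -
    have "(LINT y:A|lebesgue. g y) \<le> (h y' + q\<^sub>0) * ?m A"
      by (rule set_integral_le_const[OF g A(1)]) (use q0[OF _ that] in \<open>auto simp: algebra_simps\<close>)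
    then have "m \<le> h y' + q\<^sub>0" using A(2) by (simp add: m_def avg_def pos_divide_le_eq)
    then show ?thesis by simp
  qed
  have gI: "set_integrable lebesgue ?I g" "set_integrable lebesgue ?I h"
    using set_integrable_subset[OF g I(1,2)] set_integrable_subset[OF h I(1,3)] by auto
  have 1: "m * ?m A \<le> (LINT y:?I|lebesgue. g y) + (m' + q\<^sub>0) * (?m A - ?m ?I)"
  proof -
    have "m * ?m A = (LINT y:A|lebesgue. g y)" using A(2) by (simp add: m_def avg_def)
    also have "\<dots> = (LINT y:?I|lebesgue. g y) + (LINT y:A - ?I|lebesgue. g y)"
      by (rule set_integral_split[OF g I(1,2) fmeasurableD[OF A(1)]])
    also have "(LINT y:A - ?I|lebesgue. g y) \<le> (m' + q\<^sub>0) * ?m (A - ?I)"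
      by (rule set_integral_le_const) (use g_le mA in \<open>auto intro: set_integrable_subset[OF g]\<close>)
    finally show ?thesis by (simp add: mA)
  qed
  have 2: "(LINT y:?I|lebesgue. h y) + (m - q\<^sub>0) * (?m A' - ?m ?I) \<le> m' * ?m A'"
  proof -
    have "(m - q\<^sub>0) * ?m (A' - ?I) \<le> (LINT y:A' - ?I|lebesgue. h y)"
      by (rule set_integral_ge_const) (use h_ge mA' in \<open>auto intro: set_integrable_subset[OF h]\<close>)
    also have "(LINT y:?I|lebesgue. h y) + (LINT y:A' - ?I|lebesgue. h y) = (LINT y:A'|lebesgue. h y)"
      by (rule set_integral_split[OF h I(1,3) fmeasurableD[OF A'(1)], symmetric])
    also have "\<dots> = m' * ?m A'" using A'(2) by (simp add: m'_def avg_def)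
    finally show ?thesis by (simp add: mA')
  qed
  have 3: "(LINT y:?I|lebesgue. g y) - (LINT y:?I|lebesgue. h y) \<le> q\<^sub>1 * ?m ?I"
  proof -
    have "(LINT y:?I|lebesgue. g y - h y) \<le> q\<^sub>1 * ?m ?I"
      by (rule set_integral_le_const) (use q1 mA gI in auto)
    then show ?thesis using gI by simp
  qed
  \<comment> \<open>The measure of the union. The estimates \<open>1\<close> and \<open>2\<close>
    contain both averages, because unmatched values are compared with the other average; when
    \<open>m - m'\<close> is collected, exactly this factor remains.\<close>
  let ?U = "?m A + ?m A' - ?m ?I"
  have Upos: "0 < ?U" "?m ?I \<le> ?m A'" "?m ?I \<le> ?m A" "0 \<le> ?m ?I"
    using A(2) measure_mono_fmeasurable[OF I(3,1) A'(1)] measure_mono_fmeasurable[OF I(2,1) A(1)] by auto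
  have mm: "(m - m') * ?U \<le> q\<^sub>0 * ?U - (q\<^sub>0 - q\<^sub>1) * ?m ?I"
    using 1 2 3 by (simp add: algebra_simps)
  have div: "x * U \<le> p * U - r * i \<Longrightarrow> x \<le> p - r * (i / U)" if "0 < U" for x U p r i :: real
  proof -
    assume "x * U \<le> p * U - r * i"
    then have "x \<le> (p * U - r * i) / U" using that by (simp add: pos_le_divide_eq)
    also have "\<dots> = p - r * (i / U)" using that by (simp add: diff_divide_distrib)
    finally show ?thesis .
  qed
  have "m - m' \<le> q\<^sub>0 - (q\<^sub>0 - q\<^sub>1) * (?m ?I / ?U)"
    by (rule div[OF Upos(1) mm])
  moreover have UB: "?U \<le> ?m B"
  proof -
    have "?m (A \<union> A') \<le> ?m B" using A A' B by (intro measure_mono_fmeasurable) auto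
    then show ?thesis using measure_Un3[OF A(1) A'(1)] by simp
  qed
  have mB: "?m (B - A) = ?m B - ?m A" "?m (B - A') = ?m B - ?m A'"
    by (rule measure_Diff_lmeasurable(1)[OF B fmeasurableD[OF A(1)] A(3)],
        rule measure_Diff_lmeasurable(1)[OF B fmeasurableD[OF A'(1)] A'(3)])
  have "1 - ?m ?I / ?U \<le> (?m (B - A) + ?m (B - A')) / ?m B"
  proof -
    have "?m ?I / ?m B \<le> ?m ?I / ?U" using UB Upos by (intro divide_left_mono) auto
    moreover have "1 - ?m ?I / ?m B = (?m B - ?m ?I) / ?m B" using UB Upos by (simp add: diff_divide_distrib)
    moreover have "(?m B - ?m ?I) / ?m B \<le> (?m (B - A) + ?m (B - A')) / ?m B"
      using UB by (intro divide_right_mono) (auto simp: mB)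
    ultimately show ?thesis by linarith
  qed
  then have "(q\<^sub>0 - q\<^sub>1) * (1 - ?m ?I / ?U) \<le> (q\<^sub>0 - q\<^sub>1) * ((?m (B - A) + ?m (B - A')) / ?m B)"
    using q by (intro mult_left_mono) auto
  ultimately have "m - m' \<le> q\<^sub>1 + (q\<^sub>0 - q\<^sub>1) * ((?m (B - A) + ?m (B - A')) / ?m B)"
    by (simp add: algebra_simps)
  then show ?thesis by (simp add: m_def m'_def)
qed

section \<open>Half balls and caps\<close>

text \<open>Shifts of the slab by multiples of \<open>3 * w\<close> in the height
  \<open>N \<bullet> y\<close> are disjoint, the slab being of height \<open>2 * w\<close>. Since
  \<open>norm N\<close> is at least 1, about \<open>\<epsilon> / (3 * w)\<close> of them fit into
  the ball of double radius. Such a slab contains the points at which a curved boundary and its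
  tangent half space can disagree.\<close>

lemma slab_volume:
  fixes N x :: "'a::euclidean_space"
  assumes N: "1 \<le> norm N" and w: "0 < w" "3 * w \<le> \<epsilon>"
  shows "measure lebesgue {y \<in> cball x \<epsilon>. \<bar>N \<bullet> (y - x) + c\<bar> \<le> w}
    \<le> 6 * w / \<epsilon> * measure lebesgue (cball x (2 * \<epsilon>))"
proof -
  let ?S = "{y \<in> cball x \<epsilon>. \<bar>N \<bullet> (y - x) + c\<bar> \<le> w}"
  define v where "v j = (3 * w * real j / (norm N)\<^sup>2) *\<^sub>R N" for j :: nat
  define J where "J = nat \<lfloor>\<epsilon> / (3 * w)\<rfloor>"
  have "1 \<le> \<epsilon> / (3 * w)" using w by (simp add: le_divide_eq)
  then have "1 \<le> \<lfloor>\<epsilon> / (3 * w)\<rfloor>" by simp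
  then have J: "real J \<le> \<epsilon> / (3 * w)" "\<epsilon> / (3 * w) < real J + 1" "1 \<le> real J"
    unfolding J_def by linarith+
  have Nv: "N \<bullet> v j = 3 * w * real j" for j
    using N by (auto simp: v_def power2_norm_eq_inner[symmetric])
  have nv: "norm (v j) \<le> \<epsilon>" if "j < J" for j
  proof -
    have "norm ((a / (norm N)\<^sup>2) *\<^sub>R N) = a / norm N" if "0 \<le> a" for a
      using that N by (simp add: power2_eq_square)
    moreover have "0 \<le> 3 * w * real j" using w by simp
    ultimately have "norm (v j) = 3 * w * real j / norm N" unfolding v_def by blast
    also have "\<dots> \<le> 3 * w * real j / 1" using N w by (intro divide_left_mono) auto
    also have "3 * w * real j / 1 = 3 * w * real j" by simp
    also have "\<dots> \<le> 3 * w * real J" using that w by simp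
    also have "\<dots> \<le> \<epsilon>" using J(1) w by (simp add: pos_le_divide_eq mult.commute)
    finally show ?thesis .
  qed
  have "closed {y. \<bar>N \<bullet> (y - x) + c\<bar> \<le> w}"
    by (intro closed_Collect_le continuous_intros)
  moreover have "?S = cball x \<epsilon> \<inter> {y. \<bar>N \<bullet> (y - x) + c\<bar> \<le> w}" by auto
  ultimately have "compact ?S" by (simp add: compact_Int_closed)
  then have S: "?S \<in> lmeasurable" by (rule lmeasurable_compact)
  let ?T = "\<lambda>j. (+) (v j) ` ?S"
  have T: "?T j \<in> lmeasurable" for j using measurable_translation[OF S] .
  have disj: "pairwise (\<lambda>i j. disjnt (?T i) (?T j)) {..<J}"
  proof (rule pairwiseI)
    fix i j :: nat assume "i \<noteq> j"
    have False if "y \<in> ?T i" "y \<in> ?T j" for y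
    proof -
      have sub: "y - v \<in> S" if "y \<in> (+) v ` S" for v and S :: "'a set"
        using that by (metis add_diff_cancel_left' imageE)
      have "y - v i \<in> ?S" "y - v j \<in> ?S" by (rule sub[OF that(1)], rule sub[OF that(2)])
      then have a: "\<bar>N \<bullet> (y - v i - x) + c\<bar> \<le> w" "\<bar>N \<bullet> (y - v j - x) + c\<bar> \<le> w" by blast+
      have "\<bar>N \<bullet> v i - N \<bullet> v j\<bar> \<le> 2 * w" using a unfolding inner_diff_right by linarith
      then have "3 * w * \<bar>real i - real j\<bar> \<le> 2 * w"
        using w by (simp add: Nv abs_mult right_diff_distrib[symmetric])
      moreover have "1 \<le> \<bar>real i - real j\<bar>" using \<open>i \<noteq> j\<close> by linarith
      then have "3 * w * 1 \<le> 3 * w * \<bar>real i - real j\<bar>" using w by (intro mult_left_mono) auto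
      ultimately show False using w by linarith
    qed
    then show "disjnt (?T i) (?T j)" unfolding disjnt_def by blast
  qed
  have "(\<Sum>j<J. measure lebesgue (?T j)) = measure lebesgue (\<Union>j<J. ?T j)"
    by (rule measure_UNION'[symmetric]) (use T disj in auto)
  also have "\<dots> \<le> measure lebesgue (cball x (2 * \<epsilon>))"
  proof (rule measure_mono_fmeasurable)
    show "(\<Union>j<J. ?T j) \<subseteq> cball x (2 * \<epsilon>)"
    proof clarsimp
      fix j y assume "j < J" "dist x y \<le> \<epsilon>"
      then show "dist x (v j + y) \<le> 2 * \<epsilon>"
        using nv[of j] norm_triangle_ineq4[of "x - y" "v j"] by (simp add: dist_norm algebra_simps)
    qed
    show "(\<Union>j<J. ?T j) \<in> sets lebesgue" using T by (intro sets.finite_UN) auto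
  qed auto
  also have "(\<Sum>j<J. measure lebesgue (?T j)) = real J * measure lebesgue ?S"
    by (simp add: measure_translation)
  finally have le: "real J * measure lebesgue ?S \<le> measure lebesgue (cball x (2 * \<epsilon>))" .
  have "\<epsilon> < (real J + 1) * (3 * w)" using J(2) w by (simp add: pos_divide_less_eq)
  also have "\<dots> \<le> (2 * real J) * (3 * w)" using J(3) w by (intro mult_right_mono) auto
  finally have "\<epsilon> \<le> 6 * w * real J" by (simp add: mult_ac)
  then have "\<epsilon> * measure lebesgue ?S \<le> 6 * w * (real J * measure lebesgue ?S)"
    using mult_right_mono[of \<epsilon> "6 * w * real J" "measure lebesgue ?S"] by (simp add: mult.assoc)
  also have "\<dots> \<le> 6 * w * measure lebesgue (cball x (2 * \<epsilon>))"
    using le w by (intro mult_left_mono) auto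
  finally show ?thesis using w by (simp add: pos_le_divide_eq mult.commute)
qed

text \<open>The change of variables by \<open>T\<close> turns the integral into its
  negative.\<close>

lemma odd_set_integral_eq_0:
  fixes T :: "'a::euclidean_space \<Rightarrow> 'a" and f :: "'a \<Rightarrow> real"
  assumes T: "orthogonal_transformation T" and f[measurable]: "f \<in> borel_measurable borel"
    and A[measurable]: "A \<in> sets borel"
    and TA: "\<And>y. T y \<in> A \<longleftrightarrow> y \<in> A" and odd: "\<And>y. f (T y) = - f y"
  shows "(LINT y:A|lebesgue. f y) = 0"
proof -
  have [measurable]: "T \<in> borel_measurable borel"
    using orthogonal_transformation_linear[OF T]
    by (simp add: borel_measurable_continuous_onI linear_continuous_on linear_conv_bounded_linear)
  have eq: "(LINT y:A|lebesgue. f y) = (\<integral>y. indicator A y *\<^sub>R f y \<partial>lborel)"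
    unfolding set_lebesgue_integral_def by (rule integral_completion) measurable
  also have "\<dots> = (\<integral>y. indicator A y *\<^sub>R f y \<partial>distr lborel borel T)"
    by (simp add: lborel_distr_orthogonal[OF T])
  also have "\<dots> = (\<integral>y. indicator A (T y) *\<^sub>R f (T y) \<partial>lborel)"
    by (rule integral_distr) measurable
  also have "\<dots> = (\<integral>y. - (indicator A y *\<^sub>R f y) \<partial>lborel)"
    by (rule Bochner_Integration.integral_cong) (auto simp: odd TA indicator_def)
  also have "\<dots> = - (\<integral>y. indicator A y *\<^sub>R f y \<partial>lborel)" by simp
  finally show ?thesis using eq by linarith
qed

lemma orthogonal_transformation_reflection:
  fixes e :: "'a::euclidean_space"
  assumes "e \<noteq> 0"
  shows "orthogonal_transformation (\<lambda>y. y - (2 * (e \<bullet> y) / (e \<bullet> e)) *\<^sub>R e)"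
proof -
  have ee: "e \<bullet> e \<noteq> 0" using assms by simp
  show ?thesis
    unfolding orthogonal_transformation_def
  proof (intro conjI allI)
    show "linear (\<lambda>y. y - (2 * (e \<bullet> y) / (e \<bullet> e)) *\<^sub>R e)"
      by (rule linearI) (auto simp: algebra_simps inner_simps add_divide_distrib)
    fix v w
    let ?a = "2 * (e \<bullet> v) / (e \<bullet> e)" and ?b = "2 * (e \<bullet> w) / (e \<bullet> e)"
    have "(v - ?a *\<^sub>R e) \<bullet> (w - ?b *\<^sub>R e) = v \<bullet> w - ?b * (e \<bullet> v) - ?a * (e \<bullet> w) + ?a * ?b * (e \<bullet> e)"
      by (simp add: inner_simps algebra_simps inner_commute)
    also have "?a * ?b * (e \<bullet> e) = ?b * (e \<bullet> v) + ?a * (e \<bullet> w)"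
      using ee by (simp add: field_simps)
    finally show "(v - ?a *\<^sub>R e) \<bullet> (w - ?b *\<^sub>R e) = v \<bullet> w" by simp
  qed
qed

text \<open>The reflection in the hyperplane orthogonal to \<open>e\<close> preserves the cut ball,
  as \<open>e\<close> is orthogonal to \<open>N\<close>, and reverses the sign of the integrand. The
  whole ball is included as the case \<open>N = 0\<close>, \<open>c = 0\<close>.\<close>

lemma half_ball_tangential_moment:
  fixes e N x :: "'a::euclidean_space"
  assumes eN: "e \<bullet> N = 0"
  shows "(LINT y:{y \<in> cball x \<epsilon>. N \<bullet> (y - x) \<le> c}|lebesgue. e \<bullet> (y - x)) = 0"
proof (cases "e = 0")
  case True then show ?thesis by simp
next
  case False
  let ?F = "{y \<in> cball x \<epsilon>. N \<bullet> (y - x) \<le> c}" and ?G = "{h \<in> cball 0 \<epsilon>. N \<bullet> h \<le> c}"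
  let ?T = "\<lambda>y. y - (2 * (e \<bullet> y) / (e \<bullet> e)) *\<^sub>R e"
  have T: "orthogonal_transformation ?T" by (rule orthogonal_transformation_reflection[OF False])
  have "closed {y. N \<bullet> (y - x) \<le> c}" by (intro closed_Collect_le continuous_intros)
  moreover have "?F = cball x \<epsilon> \<inter> {y. N \<bullet> (y - x) \<le> c}" by auto
  ultimately have "compact ?F" by (simp add: compact_Int_closed)
  then have "set_integrable lborel ?F (\<lambda>y. e \<bullet> (y - x))"
    by (rule borel_integrable_compact[folded set_integrable_def]) (intro continuous_intros)
  then have int: "set_integrable lebesgue ?F (\<lambda>y. e \<bullet> (y - x))"
    unfolding set_integrable_def
    by (subst integrable_completion) (auto dest: borel_measurable_integrable)
  have "(LINT h:{h. x + h \<in> ?F}|lebesgue. e \<bullet> (x + h - x)) = (LINT y:?F|lebesgue. e \<bullet> (y - x))"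
    by (rule set_integral_translation[OF int])
  moreover have "{h. x + h \<in> ?F} = ?G" by (auto simp: dist_norm)
  moreover have "(LINT h:?G|lebesgue. e \<bullet> h) = 0"
  proof (rule odd_set_integral_eq_0[OF T])
    show "?G \<in> sets borel" by measurable
    fix y
    have "N \<bullet> ?T y = N \<bullet> y" using eN by (simp add: inner_simps inner_commute)
    moreover have "norm (?T y) = norm y" by (rule orthogonal_transformation_norm[OF T])
    ultimately show "?T y \<in> ?G \<longleftrightarrow> y \<in> ?G" by simp
    show "e \<bullet> ?T y = - (e \<bullet> y)" using False by (simp add: inner_simps)
  qed simp
  ultimately show ?thesis by simp
qed

text \<open>The volume of a box with one side \<open>1 / 4\<close> and all others
  \<open>sqrt (3 / n)\<close>, divided by that of the unit ball: this is the box of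
  \<open>box_in_cap\<close> at \<open>d = 0\<close>.\<close>

definition cap_const :: "'n::finite itself \<Rightarrow> real" where
  "cap_const _ = (1/4) * (sqrt (3 / real CARD('n))) ^ (CARD('n) - 1) / unit_ball_vol (real CARD('n))"

lemma cap_const_pos: "0 < cap_const TYPE('n::finite)"
  by (auto simp: cap_const_def intro!: divide_pos_pos mult_pos_pos)

text \<open>A box of height \<open>1 - d\<close> and width \<open>sqrt (1 - d)\<close> has, up to a factor depending only on the dimension, the
  volume of the cap above height \<open>d\<close>; this is where the exponent \<open>(n + 1) / 2\<close> of \<open>s_eps\<close> comes from.\<close>

lemma box_in_cap:
  fixes e x :: "real^'n"
  assumes e: "norm e = 1" and d: "0 \<le> d" "d < 1" and \<epsilon>: "0 < \<epsilon>"
  obtains E where "E \<in> sets lebesgue" "E \<subseteq> cball x \<epsilon>"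
    "\<And>y. y \<in> E \<Longrightarrow> d * \<epsilon> < e \<bullet> (y - x)" "\<And>y. y \<in> E \<Longrightarrow> \<epsilon> / 4 \<le> e \<bullet> (y - x)"
    "measure lebesgue E = cap_const TYPE('n) * (1 - d) powr ((real CARD('n) + 1) / 2) * measure lebesgue (cball x \<epsilon>)"
proof -
  define k :: 'n where "k = (SOME i. True)"
  let ?n = "CARD('n)"
  obtain T where T: "orthogonal_transformation T" and Tk: "T (axis k (1::real)) = e"
    by (rule orthogonal_transformation_exists_1[of "axis k (1::real)" e]) (use e in simp_all)
  \<comment> \<open>The width is chosen so that the lateral coordinates contribute at most
    \<open>3 * (1 - d) / 4\<close> to the squared norm; together with the top height
    \<open>(1 + d) / 2\<close> this stays below 1 because \<open>d * d \<le> d\<close>. The bottom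
    height \<open>(1 + 3 * d) / 4\<close> exceeds both \<open>d\<close> and, up to equality at
    \<open>d = 0\<close>, \<open>1 / 4\<close>.\<close>
  define r where "r = sqrt (3 * (1 - d) / (4 * real ?n))"
  have r0: "0 < r" using d by (auto simp: r_def)
  define lo hi :: "real^'n" where
    "lo = (\<chi> i. if i = k then (1 + 3 * d) / 4 else - r)" and
    "hi = (\<chi> i. if i = k then (1 + d) / 2 else r)"
  let ?C = "cbox lo hi"
  have ne: "?C \<noteq> {}" using d r0 by (auto simp: interval_ne_empty_cart lo_def hi_def)
  have C_ball: "norm y \<le> 1" if "y \<in> ?C" for y
  proof -
    have yk: "(1 + 3 * d) / 4 \<le> y $ k" "y $ k \<le> (1 + d) / 2"
      using that by (auto simp: mem_box_cart lo_def hi_def split: if_splits dest: spec[of _ k])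
    have yi: "(y $ i)\<^sup>2 \<le> r\<^sup>2" if "i \<noteq> k" for i
    proof -
      have "- r \<le> y $ i" "y $ i \<le> r"
        using \<open>y \<in> ?C\<close> that by (auto simp: mem_box_cart lo_def hi_def split: if_splits dest: spec[of _ i])
      then show ?thesis by (simp add: abs_le_square_iff[symmetric] abs_le_iff)
    qed
    have "(norm y)\<^sup>2 = (\<Sum>i\<in>UNIV. (y $ i)\<^sup>2)"
      by (simp add: norm_vec_def L2_set_def sum_nonneg)
    also have "\<dots> = (y $ k)\<^sup>2 + (\<Sum>i\<in>UNIV - {k}. (y $ i)\<^sup>2)" by (simp add: sum.remove)
    also have "\<dots> \<le> ((1 + d) / 2)\<^sup>2 + (\<Sum>i\<in>UNIV - {k}. r\<^sup>2)"
    proof (intro add_mono sum_mono)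
      show "(y $ k)\<^sup>2 \<le> ((1 + d) / 2)\<^sup>2" using yk d by (intro power_mono) auto
      show "(y $ i)\<^sup>2 \<le> r\<^sup>2" if "i \<in> UNIV - {k}" for i using that yi by blast
    qed
    also have "(\<Sum>i\<in>UNIV - {k}. r\<^sup>2) \<le> real ?n * r\<^sup>2"
      by (simp add: mult_right_mono card_Diff_subset)
    also have "real ?n * r\<^sup>2 = 3 * (1 - d) / 4" using d by (simp add: r_def)
    also have "((1 + d) / 2)\<^sup>2 + 3 * (1 - d) / 4 \<le> 1"
    proof -
      have "d * d \<le> d * 1" using d by (intro mult_left_mono) auto
      then show ?thesis by (simp add: power2_eq_square field_simps)
    qed
    finally have "(norm y)\<^sup>2 \<le> 1\<^sup>2" by simp
    then show ?thesis by (rule power2_le_imp_le) simp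
  qed
  have mC: "measure lebesgue ?C = (1 - d) / 4 * (2 * r) ^ (?n - 1)"
  proof -
    have "measure lebesgue ?C = prod (\<lambda>i. hi $ i - lo $ i) UNIV"
      using content_cbox_cart[OF ne] by simp
    also have "\<dots> = (hi $ k - lo $ k) * prod (\<lambda>i. hi $ i - lo $ i) (UNIV - {k})"
      by (simp add: prod.remove)
    also have "prod (\<lambda>i. hi $ i - lo $ i) (UNIV - {k}) = prod (\<lambda>i. 2 * r) (UNIV - {k})"
      by (rule prod.cong) (auto simp: lo_def hi_def)
    also have "\<dots> = (2 * r) ^ (?n - 1)" by (simp add: card_Diff_subset)
    also have "hi $ k - lo $ k = (1 - d) / 4" by (simp add: lo_def hi_def field_simps)
    finally show ?thesis .
  qed
  have rr: "2 * r = sqrt (3 / real ?n) * (1 - d) powr (1/2)"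
  proof -
    have "2 * r = sqrt 4 * r" by simp
    also have "\<dots> = sqrt (4 * (3 * (1 - d) / (4 * real ?n)))" by (simp only: r_def real_sqrt_mult)
    also have "4 * (3 * (1 - d) / (4 * real ?n)) = 3 / real ?n * (1 - d)" by (simp add: field_simps)
    also have "sqrt (3 / real ?n * (1 - d)) = sqrt (3 / real ?n) * sqrt (1 - d)" by (rule real_sqrt_mult)
    also have "sqrt (1 - d) = (1 - d) powr (1/2)" using d by (simp add: powr_half_sqrt)
    finally show ?thesis .
  qed
  have pw: "(1 - d) * ((1 - d) powr (1/2)) ^ (?n - 1) = (1 - d) powr ((real ?n + 1) / 2)"
  proof -
    have "((1 - d) powr (1/2)) ^ (?n - 1) = (1 - d) powr (real (?n - 1) * (1/2))"
      using d by (intro powr_power) auto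
    also have "(1 - d) * \<dots> = (1 - d) powr (1 + real (?n - 1) * (1/2))"
      using d by (simp add: powr_add)
    also have "1 + real (?n - 1) * (1/2) = (real ?n + 1) / 2"
      by (simp add: of_nat_diff Suc_leI field_simps)
    finally show ?thesis .
  qed
  have TC: "T ` ?C \<in> sets lebesgue" "measure lebesgue (T ` ?C) = measure lebesgue ?C"
  proof -
    obtain S where S: "orthogonal_transformation S" "S \<circ> T = id" "T \<circ> S = id"
      using orthogonal_transformation_inv[OF T] orthogonal_transformation_bij[OF T]
      by (metis bij_is_inj bij_is_surj inj_iff surj_iff)
    have ST: "S (T c) = c" "T (S c) = c" for c using S(2,3) by (metis comp_apply id_apply)+
    have im: "T ` ?C = S -` ?C"
    proof (intro set_eqI iffI)
      fix y assume "y \<in> S -` ?C"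
      then show "y \<in> T ` ?C" using ST(2)[of y] by (metis image_eqI vimageE)
    qed (auto simp: ST)
    have [measurable]: "S \<in> borel_measurable borel"
      using orthogonal_transformation_linear[OF S(1)]
      by (simp add: borel_measurable_continuous_onI linear_continuous_on linear_conv_bounded_linear)
    have bor: "S -` ?C \<in> sets borel" using measurable_sets_borel[of S borel ?C] by simp
    then show "T ` ?C \<in> sets lebesgue" unfolding im by simp
    have "emeasure lborel ?C = emeasure (distr lborel borel S) ?C"
      by (simp add: lborel_distr_orthogonal[OF S(1)])
    also have "\<dots> = emeasure lborel (S -` ?C)" by (subst emeasure_distr) auto
    finally have "emeasure lebesgue (S -` ?C) = emeasure lebesgue ?C" using bor by simp
    then show "measure lebesgue (T ` ?C) = measure lebesgue ?C" by (simp add: im measure_def)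
  qed
  define E where "E = (\<lambda>h. \<epsilon> *\<^sub>R h + x) ` (T ` ?C)"
  have Ed: "\<exists>c\<in>?C. e \<bullet> (y - x) = \<epsilon> * (c $ k) \<and> norm (y - x) \<le> \<epsilon>" if "y \<in> E" for y
  proof -
    from that obtain c where c: "c \<in> ?C" "y = \<epsilon> *\<^sub>R T c + x" unfolding E_def by blast
    have "e \<bullet> T c = c $ k"
      using T unfolding orthogonal_transformation_def Tk[symmetric] by (simp add: inner_axis' )
    moreover have "norm (T c) \<le> 1" using C_ball[OF c(1)] orthogonal_transformation_norm[OF T] by simp
    ultimately show ?thesis using c \<epsilon> by (intro bexI[of _ c]) auto
  qed
  have Ck: "(1 + 3 * d) / 4 \<le> c $ k" if "c \<in> ?C" for c
    using that by (auto simp: mem_box_cart lo_def hi_def split: if_splits dest: spec[of _ k])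
  show thesis
  proof (rule that[of E])
    show "E \<in> sets lebesgue" unfolding E_def
      using orthogonal_transformation_linear[OF T]
      by (intro fmeasurableD lmeasurable_compact compact_continuous_image continuous_intros linear_continuous_on)
         (auto simp: linear_conv_bounded_linear)
    show "E \<subseteq> cball x \<epsilon>" using Ed by (force simp: dist_norm norm_minus_commute)
    show "d * \<epsilon> < e \<bullet> (y - x)" if "y \<in> E" for y
    proof -
      from Ed[OF that] obtain c where c: "c \<in> ?C" "e \<bullet> (y - x) = \<epsilon> * (c $ k)" by blast
      have "d < c $ k" using Ck[OF c(1)] d by simp
      then show ?thesis using c \<epsilon> by simp
    qed
    show "\<epsilon> / 4 \<le> e \<bullet> (y - x)" if "y \<in> E" for y
    proof -
      from Ed[OF that] obtain c where c: "c \<in> ?C" "e \<bullet> (y - x) = \<epsilon> * (c $ k)" by blast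
      have "1 / 4 \<le> c $ k" using Ck[OF c(1)] d by simp
      then have "\<epsilon> * (1/4) \<le> \<epsilon> * (c $ k)" using \<epsilon> by (intro mult_left_mono) auto
      then show ?thesis using c by simp
    qed
    have "measure lebesgue E = \<epsilon> ^ ?n * measure lebesgue ?C"
      unfolding E_def using \<epsilon> by (simp add: measure_lebesgue_affine TC)
    also have "\<dots> = cap_const TYPE('n) * (1 - d) powr ((real ?n + 1) / 2) * measure lebesgue (cball x \<epsilon>)"
    proof -
      have "measure lebesgue ?C = (1 / 4) * sqrt (3 / real ?n) ^ (?n - 1) * (1 - d) powr ((real ?n + 1) / 2)"
        unfolding mC rr pw[symmetric] by (simp add: power_mult_distrib)
      moreover have "unit_ball_vol (real ?n) \<noteq> 0" using unit_ball_vol_pos[of "real ?n"] by linarith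
      ultimately show ?thesis using \<epsilon> by (simp add: cap_const_def content_cball)
    qed
    finally show "measure lebesgue E = cap_const TYPE('n) * (1 - d) powr ((real ?n + 1) / 2) * measure lebesgue (cball x \<epsilon>)" .
  qed
qed

section \<open>Noise steps near the boundary\<close>

lemma ball_bdist_subset:
  assumes "open \<Omega>" "frontier \<Omega> \<noteq> {}" "x \<in> closure \<Omega>" "0 < bdist \<Omega> x"
  shows "ball x (bdist \<Omega> x) \<subseteq> \<Omega>"
proof (rule ccontr)
  assume ne: "\<not> ball x (bdist \<Omega> x) \<subseteq> \<Omega>"
  have "x \<notin> frontier \<Omega>" using assms(4) by (auto simp: bdist_def)
  then have "x \<in> \<Omega>" using assms(1,3) by (simp add: frontier_def interior_open)
  then have "ball x (bdist \<Omega> x) \<inter> \<Omega> \<noteq> {}" using assms(4) by force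
  moreover have "ball x (bdist \<Omega> x) - \<Omega> \<noteq> {}" using ne by blast
  ultimately have "ball x (bdist \<Omega> x) \<inter> frontier \<Omega> \<noteq> {}"
    by (intro connected_Int_frontier) auto
  then obtain w where "w \<in> frontier \<Omega>" "dist x w < bdist \<Omega> x" by auto
  then show False using infdist_le[of w "frontier \<Omega>" x] by (simp add: bdist_def)
qed

text \<open>A tug-of-war ball may touch the boundary, so the inclusion of the open ball has to pass
  to the closure. At a boundary point the ball is the point itself, the case
  \<open>b = 0\<close>.\<close>

lemma cball_bdist_subset:
  assumes "open \<Omega>" "frontier \<Omega> \<noteq> {}" "x \<in> closure \<Omega>" "b \<le> bdist \<Omega> x"
  shows "cball x b \<subseteq> closure \<Omega>"
proof (cases "0 < b")
  case True
  then have "ball x b \<subseteq> \<Omega>" using ball_bdist_subset[OF assms(1-3)] assms(4) by (meson dual_order.strict_trans1 order_trans subset_ball)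
  then have "closure (ball x b) \<subseteq> closure \<Omega>" by (rule closure_mono)
  then show ?thesis using True by simp
next
  case False
  then show ?thesis using assms(3) by (cases "b = 0") auto
qed

lemma bdist_nonneg: "0 \<le> bdist \<Omega> x"
  by (simp add: bdist_def infdist_nonneg)

lemma bdist_attained:
  assumes "frontier \<Omega> \<noteq> {}"
  obtains y where "y \<in> frontier \<Omega>" "bdist \<Omega> x = dist x y"
  using infdist_attains_inf[OF frontier_closed assms, of x] by (auto simp: bdist_def)

definition step_set :: "(real^'n) set \<Rightarrow> real \<Rightarrow> real^'n \<Rightarrow> (real^'n) set" where
  "step_set \<Omega> \<epsilon> x = cball x \<epsilon> \<inter> \<Omega>"

definition drift :: "(real^'n) set \<Rightarrow> real \<Rightarrow> real^'n \<Rightarrow> real^'n" where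
  "drift \<Omega> \<epsilon> x = (1 / measure lebesgue (step_set \<Omega> \<epsilon> x)) *\<^sub>R (LINT y:step_set \<Omega> \<epsilon> x|lebesgue. y - x)"

text \<open>The share of the ball that lies outside the domain. The sum of these shares at two
  points bounds the part of two noise steps that cannot be moved synchronously.\<close>

definition hit :: "(real^'n) set \<Rightarrow> real \<Rightarrow> real^'n \<Rightarrow> real" where
  "hit \<Omega> \<epsilon> x = measure lebesgue (cball x \<epsilon> - step_set \<Omega> \<epsilon> x) / measure lebesgue (cball x \<epsilon>)"

lemma set_integrable_continuous_bounded:
  fixes f :: "'a::euclidean_space \<Rightarrow> 'b::euclidean_space"
  assumes "continuous_on UNIV f" "A \<subseteq> cball x \<epsilon>" "A \<in> sets lebesgue"
  shows "set_integrable lebesgue A f"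
proof -
  have "set_integrable lborel (cball x \<epsilon>) f"
    unfolding set_integrable_def
    by (rule borel_integrable_compact) (use assms(1) continuous_on_subset in auto)
  then have "set_integrable lebesgue (cball x \<epsilon>) f"
    unfolding set_integrable_def by (subst integrable_completion) (auto dest: borel_measurable_integrable)
  then show ?thesis by (rule set_integrable_subset) (use assms in auto)
qed

lemma step_set_lmeasurable: "open \<Omega> \<Longrightarrow> step_set \<Omega> \<epsilon> x \<in> lmeasurable"
  unfolding step_set_def
  by (rule fmeasurable_Int_fmeasurable[OF lmeasurable_cball]) (simp add: borel_open)

lemma avg_inner_drift:
  assumes "open \<Omega>"
  shows "avg (step_set \<Omega> \<epsilon> x) (\<lambda>y. e \<bullet> (y - x)) = e \<bullet> drift \<Omega> \<epsilon> x"
proof -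
  have "set_integrable lebesgue (step_set \<Omega> \<epsilon> x) (\<lambda>y. y - x)"
  proof (rule set_integrable_continuous_bounded[of _ _ x \<epsilon>])
    show "step_set \<Omega> \<epsilon> x \<in> sets lebesgue" by (intro fmeasurableD step_set_lmeasurable assms)
  qed (auto intro!: continuous_intros simp: step_set_def)
  then have "(LINT y:step_set \<Omega> \<epsilon> x|lebesgue. e \<bullet> (y - x)) = e \<bullet> (LINT y:step_set \<Omega> \<epsilon> x|lebesgue. y - x)"
    unfolding set_lebesgue_integral_def set_integrable_def by (simp flip: integral_inner_right)
  then show ?thesis by (simp add: avg_def drift_def)
qed

text \<open>\<rho> is a defining function of the domain and \<open>N\<close> plays the role of its
  gradient. What remains of the regularity of class C11 is the quadratic bound
  \<open>expand\<close>, required for all pairs of points; only the sign of \<rho> and the size of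
  \<open>N\<close> are tied to the ball. The radius and \<open>L\<close> are explicit so that
  constants can be chosen before the chart.\<close>

locale boundary_chart =
  fixes \<Omega> :: "(real^'n) set" and z :: "real^'n" and r L :: real
    and \<rho> :: "real^'n \<Rightarrow> real" and N :: "real^'n \<Rightarrow> real^'n"
  assumes open_dom: "open \<Omega>" and r: "0 < r" "r \<le> 1" and L: "1 \<le> L"
    and expand: "\<bar>\<rho> y - \<rho> x - N x \<bullet> (y - x)\<bar> \<le> L * (norm (y - x))\<^sup>2"
    and N_ge: "x \<in> ball z r \<Longrightarrow> 1 \<le> norm (N x)" and N_le: "x \<in> ball z r \<Longrightarrow> norm (N x) \<le> L"
    and dom: "x \<in> ball z r \<Longrightarrow> x \<in> \<Omega> \<longleftrightarrow> 0 < \<rho> x"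
    and z: "z \<in> frontier \<Omega>"
begin

section \<open>The defining function and the distance to the boundary\<close>

lemma frontier_ne: "frontier \<Omega> \<noteq> {}" using z by auto

lemma isCont_rho: "isCont \<rho> x"
proof -
  have "((\<lambda>y. \<rho> y - \<rho> x) \<longlongrightarrow> 0) (at x)"
  proof (rule Lim_null_comparison)
    show "\<forall>\<^sub>F y in at x. norm (\<rho> y - \<rho> x) \<le> norm (N x) * norm (y - x) + L * (norm (y - x))\<^sup>2"
    proof (intro always_eventually allI)
      fix y
      show "norm (\<rho> y - \<rho> x) \<le> norm (N x) * norm (y - x) + L * (norm (y - x))\<^sup>2"
        using expand[of y x] Cauchy_Schwarz_ineq2[of "N x" "y - x"] by (simp add: abs_le_iff)
    qed
    have "((\<lambda>y. norm (N x) * norm (y - x) + L * (norm (y - x))\<^sup>2) \<longlongrightarrow> norm (N x) * norm (x - x) + L * (norm (x - x))\<^sup>2) (at x)"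
      by (intro tendsto_intros)
    then show "((\<lambda>y. norm (N x) * norm (y - x) + L * (norm (y - x))\<^sup>2) \<longlongrightarrow> 0) (at x)" by simp
  qed
  then show ?thesis unfolding isCont_def by (simp add: LIM_zero_iff)
qed

lemma rho_nonneg:
  assumes "x \<in> closure \<Omega>" "x \<in> ball z r"
  shows "0 \<le> \<rho> x"
proof (rule ccontr)
  assume "\<not> 0 \<le> \<rho> x"
  have "open (\<rho> -` {..<0})"
    using isCont_rho by (intro open_vimage) (auto simp: continuous_on_eq_continuous_at)
  then have "open (\<rho> -` {..<0} \<inter> ball z r)" by auto
  moreover have "x \<in> \<rho> -` {..<0} \<inter> ball z r" using \<open>\<not> 0 \<le> \<rho> x\<close> assms by auto
  ultimately have "(\<rho> -` {..<0} \<inter> ball z r) \<inter> \<Omega> \<noteq> {}"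
    using assms(1) by (metis IntI closure_iff_nhds_not_empty empty_iff subset_refl inf_commute open_Int_closure_eq_empty)
  then show False using dom by force
qed

lemma rho_frontier:
  assumes "x \<in> frontier \<Omega>" "x \<in> ball z r"
  shows "\<rho> x = 0"
  using rho_nonneg[of x] dom[of x] assms open_dom by (auto simp: frontier_def interior_open)

text \<open>The expansion at \<open>x\<close> is evaluated at a nearest boundary point, where \<rho>
  vanishes. Staying within \<open>r / 2\<close> of \<open>z\<close> guarantees that this point still
  lies in the chart.\<close>

lemma rho_le_bdist:
  assumes "dist z x < r / 2"
  shows "\<rho> x \<le> norm (N x) * bdist \<Omega> x + L * (bdist \<Omega> x)\<^sup>2" "bdist \<Omega> x < r / 2"
proof -
  obtain y where y: "y \<in> frontier \<Omega>" "bdist \<Omega> x = dist x y"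
    using bdist_attained[OF frontier_ne] by blast
  show b: "bdist \<Omega> x < r / 2"
    using infdist_le[OF z, of x] assms by (simp add: bdist_def dist_commute)
  have "dist z y < r" using dist_triangle[of z y x] assms b y(2) by simp
  then have "\<rho> y = 0" using rho_frontier[OF y(1)] by simp
  then have "\<rho> x \<le> - (N x \<bullet> (y - x)) + L * (norm (y - x))\<^sup>2" using expand[of y x] by simp
  also have "- (N x \<bullet> (y - x)) \<le> norm (N x) * norm (y - x)"
    using Cauchy_Schwarz_ineq2[of "N x" "y - x"] by simp
  finally show "\<rho> x \<le> norm (N x) * bdist \<Omega> x + L * (bdist \<Omega> x)\<^sup>2"
    using y(2) by (simp add: dist_norm norm_minus_commute)
qed

lemma rho_le_bdist':
  assumes "dist z x < r / 2"
  shows "\<rho> x \<le> 2 * L * bdist \<Omega> x"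
proof -
  have x: "x \<in> ball z r" using assms r by simp
  have b: "0 \<le> bdist \<Omega> x" "bdist \<Omega> x \<le> 1" using rho_le_bdist(2)[OF assms] r by (auto simp: bdist_nonneg)
  have "norm (N x) * bdist \<Omega> x \<le> L * bdist \<Omega> x" using N_le[OF x] b by (intro mult_right_mono)
  moreover have "L * (bdist \<Omega> x)\<^sup>2 \<le> L * bdist \<Omega> x"
    using b L by (intro mult_left_mono) (auto simp: power2_eq_square mult_left_le_one_le)
  ultimately show ?thesis using rho_le_bdist(1)[OF assms] by linarith
qed

lemma rho_expand:
  assumes "norm (y - x) \<le> \<epsilon>"
  shows "\<rho> y \<le> \<rho> x + N x \<bullet> (y - x) + L * \<epsilon>\<^sup>2" "\<rho> x + N x \<bullet> (y - x) - L * \<epsilon>\<^sup>2 \<le> \<rho> y"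
proof -
  have "L * (norm (y - x))\<^sup>2 \<le> L * \<epsilon>\<^sup>2" using assms L by (intro mult_left_mono power_mono) auto
  then show "\<rho> y \<le> \<rho> x + N x \<bullet> (y - x) + L * \<epsilon>\<^sup>2" "\<rho> x + N x \<bullet> (y - x) - L * \<epsilon>\<^sup>2 \<le> \<rho> y"
    using expand[of y x] by linarith+
qed

text \<open>Moving by \<open>\<epsilon> / 2\<close> along the inner normal and allowing a deviation
  \<open>\<epsilon> / 4\<close> raises the linear part of \<rho> by at least
  \<open>\<epsilon> / 4\<close>, of which curvature takes at most \<open>\<epsilon> / 8\<close>.
  Hence a fixed share of the ball lies well inside the domain, however close \<open>x\<close> is to
  the boundary.\<close>

lemma deep_ball:
  assumes x: "x \<in> closure \<Omega>" "dist z x < r / 2" and \<epsilon>: "0 < \<epsilon>" "\<epsilon> < r / 2" "8 * L * \<epsilon> \<le> 1"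
  defines "E \<equiv> cball (x + (\<epsilon> / 2) *\<^sub>R sgn (N x)) (\<epsilon> / 4)"
  shows "E \<subseteq> step_set \<Omega> \<epsilon> x" "\<And>y. y \<in> E \<Longrightarrow> \<epsilon> / 8 \<le> \<rho> y"
    "measure lebesgue E = (1/4) ^ CARD('n) * measure lebesgue (cball x \<epsilon>)"
proof -
  have xb: "x \<in> ball z r" using x(2) r by simp
  have N1: "1 \<le> norm (N x)" by (rule N_ge[OF xb])
  then have N0: "norm (N x) \<noteq> 0" by linarith
  have Le: "L * \<epsilon>\<^sup>2 \<le> \<epsilon> / 8"
    using mult_right_mono[OF \<epsilon>(3), of \<epsilon>] \<epsilon>(1) by (simp add: power2_eq_square)
  have E: "norm (y - x) \<le> \<epsilon> \<and> \<epsilon> / 8 \<le> \<rho> y" if "y \<in> E" for y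
  proof -
    let ?w = "y - x - (\<epsilon> / 2) *\<^sub>R sgn (N x)"
    have w: "norm ?w \<le> \<epsilon> / 4" using that by (simp add: E_def dist_norm norm_minus_commute algebra_simps)
    have eq: "y - x = (\<epsilon> / 2) *\<^sub>R sgn (N x) + ?w" by simp
    have "norm (y - x) \<le> norm ((\<epsilon> / 2) *\<^sub>R sgn (N x)) + norm ?w"
      by (subst eq) (rule norm_triangle_ineq)
    also have "norm ((\<epsilon> / 2) *\<^sub>R sgn (N x)) \<le> \<epsilon> / 2" using \<epsilon> by (simp add: norm_sgn)
    finally have ny: "norm (y - x) \<le> \<epsilon>" using w \<epsilon> by linarith
    have "N x \<bullet> sgn (N x) = norm (N x)"
      using N0 by (simp add: sgn_div_norm power2_norm_eq_inner[symmetric] power2_eq_square)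
    then have "N x \<bullet> (y - x) = (\<epsilon> * norm (N x)) / 2 + N x \<bullet> ?w"
      by (subst eq) (simp only: inner_add_right inner_scaleR_right)
    moreover have "\<bar>N x \<bullet> ?w\<bar> \<le> (\<epsilon> * norm (N x)) / 4"
      using order_trans[OF Cauchy_Schwarz_ineq2[of "N x" ?w] mult_left_mono[OF w norm_ge_zero[of "N x"]]]
      by (simp only: times_divide_eq_right mult.commute)
    moreover have "\<epsilon> \<le> \<epsilon> * norm (N x)" using N1 \<epsilon> by simp
    ultimately have "\<epsilon> / 4 \<le> N x \<bullet> (y - x)" unfolding abs_le_iff by linarith
    then have "\<epsilon> / 8 \<le> \<rho> y" using rho_expand(2)[OF ny] rho_nonneg[OF x(1) xb] Le by linarith
    then show ?thesis using ny by simp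
  qed
  then show "\<And>y. y \<in> E \<Longrightarrow> \<epsilon> / 8 \<le> \<rho> y" by blast
  show "E \<subseteq> step_set \<Omega> \<epsilon> x"
  proof
    fix y assume "y \<in> E"
    then have y: "norm (y - x) \<le> \<epsilon>" "0 < \<rho> y" using E \<epsilon> by force+
    have "dist z y \<le> dist z x + dist x y" by (rule dist_triangle)
    then have "y \<in> ball z r" using x(2) y(1) \<epsilon> by (simp add: dist_norm norm_minus_commute)
    then show "y \<in> step_set \<Omega> \<epsilon> x" using y dom by (simp add: step_set_def dist_norm norm_minus_commute)
  qed
  show "measure lebesgue E = (1/4) ^ CARD('n) * measure lebesgue (cball x \<epsilon>)"
    using \<epsilon> by (simp add: E_def content_cball power_divide)
qed

end

text \<open>A ball of radius \<open>1 / 4\<close> around minus half the axis vector fits into every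
  cut ball with \<open>d \<ge> 0\<close>. This keeps the denominator of \<open>s_eps\<close> between
  two positive constants.\<close>

lemma measure_cut_ball_ge:
  assumes "0 \<le> d"
  shows "unit_ball_vol (real CARD('n)) / 4 ^ CARD('n) \<le> measure lebesgue (cut_ball d :: (real^'n) set)"
    and "measure lebesgue (cut_ball d :: (real^'n) set) \<le> unit_ball_vol (real CARD('n))"
proof -
  let ?k = "last_coord :: 'n"
  let ?C = "cut_ball d :: (real^'n) set"
  have eq: "?C = cball 0 1 \<inter> {y. y $ ?k < d}" by (auto simp: cut_ball_def)
  have "?C \<in> sets borel" unfolding eq
    by (intro sets.Int borel_closed borel_open open_Collect_less continuous_intros) auto
  then have C: "?C \<in> lmeasurable"
    by (intro bounded_set_imp_lmeasurable) (auto simp: eq intro: bounded_Int)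
  have sub: "cball (- (1/2) *\<^sub>R axis ?k 1) (1/4) \<subseteq> ?C"
  proof
    fix y :: "real^'n" assume "y \<in> cball (- (1/2) *\<^sub>R axis ?k 1) (1/4)"
    then have y: "norm (y + (1/2) *\<^sub>R axis ?k 1) \<le> 1/4" by (simp add: dist_norm norm_minus_commute)
    have "norm y \<le> norm (y + (1/2) *\<^sub>R axis ?k 1) + norm ((1/2) *\<^sub>R axis ?k (1::real))"
      using norm_triangle_ineq4[of "y + (1/2) *\<^sub>R axis ?k 1" "(1/2) *\<^sub>R axis ?k 1"] by simp
    then have "norm y \<le> 1" using y by simp
    moreover have "\<bar>(y + (1/2) *\<^sub>R axis ?k 1) $ ?k\<bar> \<le> 1/4"
      using component_le_norm_cart[of "y + (1/2) *\<^sub>R axis ?k 1" ?k] y by linarith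
    then have "\<bar>y $ ?k + 1/2\<bar> \<le> 1/4" by simp
    then have "y $ ?k < d" using assms by linarith
    ultimately show "y \<in> ?C" by (simp add: eq)
  qed
  have "measure lebesgue (cball (- (1/2) *\<^sub>R axis ?k 1 :: real^'n) (1/4)) \<le> measure lebesgue ?C"
    by (rule measure_mono_fmeasurable[OF sub _ C]) simp
  then show "unit_ball_vol (real CARD('n)) / 4 ^ CARD('n) \<le> measure lebesgue ?C"
    by (simp add: content_cball power_divide)
  have "measure lebesgue ?C \<le> measure lebesgue (cball (0::real^'n) 1)"
    by (rule measure_mono_fmeasurable) (use C eq in auto)
  then show "measure lebesgue ?C \<le> unit_ball_vol (real CARD('n))" by (simp add: content_cball)
qed

section \<open>The mean displacement of a noise step from a point of the chart\<close>

context boundary_chart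
begin

context
  fixes x \<epsilon>
  assumes x: "x \<in> closure \<Omega>" "dist z x < r / 2" and eps: "0 < \<epsilon>" "\<epsilon> < r / 2" "8 * L * \<epsilon> \<le> 1"
begin

definition "ball_vol = measure lebesgue (cball x \<epsilon>)"
definition "lost_part = cball x \<epsilon> - step_set \<Omega> \<epsilon> x"

lemma x_in_chart: "x \<in> ball z r" using x(2) r by simp

lemma cball_in_chart: "y \<in> cball x \<epsilon> \<Longrightarrow> y \<in> ball z r"
  using dist_triangle[of z y x] x(2) eps by simp

lemma L_eps: "L * \<epsilon>\<^sup>2 \<le> \<epsilon> / 8" "0 < L * \<epsilon>\<^sup>2" "\<epsilon> \<le> 1 / 8"
proof -
  show "L * \<epsilon>\<^sup>2 \<le> \<epsilon> / 8" using mult_right_mono[OF eps(3), of \<epsilon>] eps(1) by (simp add: power2_eq_square)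
  show "0 < L * \<epsilon>\<^sup>2" using eps L by simp
  have "8 * L * \<epsilon> = 8 * (L * \<epsilon>)" by simp
  then show "\<epsilon> \<le> 1 / 8" using mult_right_mono[OF L, of \<epsilon>] eps by linarith
qed

lemma ball_vol_pos: "0 < ball_vol" using eps by (simp add: ball_vol_def)

lemma step_set_measure:
  "0 < measure lebesgue (step_set \<Omega> \<epsilon> x)" "ball_vol \<le> 4 ^ CARD('n) * measure lebesgue (step_set \<Omega> \<epsilon> x)"
  "measure lebesgue (step_set \<Omega> \<epsilon> x) \<le> ball_vol"
proof -
  note dE = deep_ball[OF x eps]
  let ?E = "cball (x + (\<epsilon> / 2) *\<^sub>R sgn (N x)) (\<epsilon> / 4)"
  have "measure lebesgue ?E \<le> measure lebesgue (step_set \<Omega> \<epsilon> x)"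
    by (rule measure_mono_fmeasurable[OF dE(1)]) (auto intro!: step_set_lmeasurable open_dom)
  then have le: "(1/4) ^ CARD('n) * ball_vol \<le> measure lebesgue (step_set \<Omega> \<epsilon> x)" using dE(3) by (simp add: ball_vol_def)
  moreover have "0 < (1/4 :: real) ^ CARD('n) * ball_vol" using ball_vol_pos by simp
  ultimately show "0 < measure lebesgue (step_set \<Omega> \<epsilon> x)" by linarith
  show "ball_vol \<le> 4 ^ CARD('n) * measure lebesgue (step_set \<Omega> \<epsilon> x)"
    using mult_left_mono[OF le, of "4 ^ CARD('n)"] by (simp add: power_divide)
  show "measure lebesgue (step_set \<Omega> \<epsilon> x) \<le> ball_vol"
    unfolding ball_vol_def by (rule measure_mono_fmeasurable) (auto simp: step_set_def[of \<Omega> \<epsilon> x] intro!: fmeasurableD step_set_lmeasurable[unfolded step_set_def] open_dom)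
qed

lemma lost_part_props: "lost_part \<in> sets lebesgue" "lost_part \<subseteq> cball x \<epsilon>" "lost_part \<in> lmeasurable" "measure lebesgue lost_part \<le> ball_vol"
  "\<And>y. y \<in> lost_part \<longleftrightarrow> y \<in> cball x \<epsilon> \<and> \<rho> y \<le> 0"
proof -
  show s: "lost_part \<in> sets lebesgue" unfolding lost_part_def by (intro sets.Diff fmeasurableD step_set_lmeasurable open_dom) auto
  show sub: "lost_part \<subseteq> cball x \<epsilon>" by (auto simp: lost_part_def)
  show "lost_part \<in> lmeasurable" by (rule measure_Diff_lmeasurable(2)[OF lmeasurable_cball s sub])
  show "measure lebesgue lost_part \<le> ball_vol" unfolding ball_vol_def by (rule measure_mono_fmeasurable[OF sub s]) simp
  show "y \<in> lost_part \<longleftrightarrow> y \<in> cball x \<epsilon> \<and> \<rho> y \<le> 0" for y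
    using dom[OF cball_in_chart, of y] by (auto simp: lost_part_def step_set_def not_less)
qed

lemma int_inner: "A \<subseteq> cball x \<epsilon> \<Longrightarrow> A \<in> sets lebesgue \<Longrightarrow> set_integrable lebesgue A (\<lambda>y. e \<bullet> (y - x))"
  by (rule set_integrable_continuous_bounded) (auto intro!: continuous_intros)

text \<open>The full ball has mean displacement 0, so the moment of the admissible part is the
  negative of the moment of the lost part.\<close>

lemma drift_lost_part:
  "(e \<bullet> drift \<Omega> \<epsilon> x) * measure lebesgue (step_set \<Omega> \<epsilon> x) = - (LINT y:lost_part|lebesgue. e \<bullet> (y - x))"
proof -
  have sS: "step_set \<Omega> \<epsilon> x \<in> sets lebesgue" by (intro fmeasurableD step_set_lmeasurable open_dom)
  have subS: "step_set \<Omega> \<epsilon> x \<subseteq> cball x \<epsilon>" by (auto simp: step_set_def)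
  have "(LINT y:cball x \<epsilon>|lebesgue. e \<bullet> (y - x)) = 0"
  proof -
    have "{y \<in> cball x \<epsilon>. 0 \<bullet> (y - x) \<le> 0} = cball x \<epsilon>" by auto
    then show ?thesis using half_ball_tangential_moment[of e 0 x \<epsilon> 0] by (simp only: inner_zero_right)
  qed
  moreover have "(LINT y:cball x \<epsilon>|lebesgue. e \<bullet> (y - x))
    = (LINT y:step_set \<Omega> \<epsilon> x|lebesgue. e \<bullet> (y - x)) + (LINT y:lost_part|lebesgue. e \<bullet> (y - x))"
    unfolding lost_part_def by (rule set_integral_split) (use int_inner[of "cball x \<epsilon>" e] sS subS in auto)
  moreover have "(e \<bullet> drift \<Omega> \<epsilon> x) * measure lebesgue (step_set \<Omega> \<epsilon> x) = (LINT y:step_set \<Omega> \<epsilon> x|lebesgue. e \<bullet> (y - x))"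
    using avg_inner_drift[OF open_dom, of \<epsilon> x e] step_set_measure(1) by (simp add: avg_def field_simps)
  ultimately show ?thesis by linarith
qed

text \<open>If the lost part were exactly the cap cut off by the tangent half space, its tangential
  moment would vanish by reflection. The two sets differ only within a slab of half width
  \<open>L * \<epsilon>\<^sup>2\<close>, a share of order \<epsilon> of the ball, on which
  displacements are at most \<epsilon>.\<close>

lemma drift_tangential:
  assumes e: "e \<bullet> N x = 0"
  shows "e \<bullet> drift \<Omega> \<epsilon> x \<le> 12 * 8 ^ CARD('n) * L * \<epsilon>\<^sup>2 * norm e"
proof -
  let ?F = "{y \<in> cball x \<epsilon>. N x \<bullet> (y - x) \<le> - \<rho> x}"
  let ?S = "{y \<in> cball x \<epsilon>. \<bar>N x \<bullet> (y - x) + \<rho> x\<bar> \<le> L * \<epsilon>\<^sup>2}"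
  let ?f = "\<lambda>y. e \<bullet> (y - x)"
  have "closed {y. N x \<bullet> (y - x) \<le> - \<rho> x}" "closed {y. \<bar>N x \<bullet> (y - x) + \<rho> x\<bar> \<le> L * \<epsilon>\<^sup>2}"
    by (intro closed_Collect_le continuous_intros)+
  moreover have "?F = cball x \<epsilon> \<inter> {y. N x \<bullet> (y - x) \<le> - \<rho> x}"
    "?S = cball x \<epsilon> \<inter> {y. \<bar>N x \<bullet> (y - x) + \<rho> x\<bar> \<le> L * \<epsilon>\<^sup>2}" by auto
  ultimately have "compact ?F" "compact ?S" by (simp_all add: compact_Int_closed)
  then have F: "?F \<in> sets lebesgue" and S: "?S \<in> lmeasurable" by (auto intro: lmeasurable_compact fmeasurableD)
  have vS: "measure lebesgue ?S \<le> 6 * L * \<epsilon> * 2 ^ CARD('n) * ball_vol"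
  proof -
    have "measure lebesgue ?S \<le> 6 * (L * \<epsilon>\<^sup>2) / \<epsilon> * measure lebesgue (cball x (2 * \<epsilon>))"
      by (rule slab_volume[OF N_ge[OF x_in_chart] L_eps(2)]) (use L_eps(1) eps in linarith)
    also have "measure lebesgue (cball x (2 * \<epsilon>)) = 2 ^ CARD('n) * ball_vol"
      using eps by (simp add: ball_vol_def content_cball power_mult_distrib)
    also have "6 * (L * \<epsilon>\<^sup>2) / \<epsilon> = 6 * L * \<epsilon>" using eps by (simp add: power2_eq_square)
    finally show ?thesis by (simp add: mult.assoc)
  qed
  have small: "\<bar>LINT y:A|lebesgue. ?f y\<bar> \<le> norm e * \<epsilon> * (6 * L * \<epsilon> * 2 ^ CARD('n) * ball_vol)"
    if A: "A \<in> sets lebesgue" "A \<subseteq> ?S" for A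
  proof -
    have Al: "A \<in> lmeasurable" by (rule measure_Diff_lmeasurable(2)[OF S A])
    have Ac: "A \<subseteq> cball x \<epsilon>" using A(2) by auto
    have b: "\<bar>?f y\<bar> \<le> norm e * \<epsilon>" if "y \<in> A" for y
    proof -
      have "\<bar>?f y\<bar> \<le> norm e * norm (y - x)" by (rule Cauchy_Schwarz_ineq2)
      also have "norm (y - x) \<le> \<epsilon>" using that Ac by (auto simp: dist_norm norm_minus_commute)
      finally show ?thesis by (simp add: mult_left_mono)
    qed
    have "(LINT y:A|lebesgue. ?f y) \<le> (norm e * \<epsilon>) * measure lebesgue A"
      by (rule set_integral_le_const[OF int_inner[OF Ac A(1)] Al]) (use b in \<open>auto simp: abs_le_iff\<close>)
    moreover have "(- (norm e * \<epsilon>)) * measure lebesgue A \<le> (LINT y:A|lebesgue. ?f y)"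
      by (rule set_integral_ge_const[OF int_inner[OF Ac A(1)] Al]) (use b in \<open>force simp: abs_le_iff\<close>)
    moreover have "(norm e * \<epsilon>) * measure lebesgue A \<le> (norm e * \<epsilon>) * (6 * L * \<epsilon> * 2 ^ CARD('n) * ball_vol)"
      using measure_mono_fmeasurable[OF A(2,1) S] vS eps by (intro mult_left_mono) auto
    ultimately show ?thesis by (simp add: abs_le_iff)
  qed
  have OF: "(LINT y:lost_part|lebesgue. ?f y) = (LINT y:lost_part \<inter> ?F|lebesgue. ?f y) + (LINT y:lost_part - lost_part \<inter> ?F|lebesgue. ?f y)"
    by (rule set_integral_split[OF int_inner[OF lost_part_props(2,1)]]) (use F lost_part_props(1) in auto)
  have FO: "(LINT y:?F|lebesgue. ?f y) = (LINT y:lost_part \<inter> ?F|lebesgue. ?f y) + (LINT y:?F - lost_part \<inter> ?F|lebesgue. ?f y)"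
  proof -
    have Fs: "?F \<subseteq> cball x \<epsilon>" by auto
    show ?thesis by (rule set_integral_split[OF int_inner[OF Fs F]]) (use F lost_part_props(1) in auto)
  qed
  have F0: "(LINT y:?F|lebesgue. ?f y) = 0" by (rule half_ball_tangential_moment[OF e])
  have near: "\<rho> y \<le> \<rho> x + N x \<bullet> (y - x) + L * \<epsilon>\<^sup>2" "\<rho> x + N x \<bullet> (y - x) - L * \<epsilon>\<^sup>2 \<le> \<rho> y"
    if "y \<in> cball x \<epsilon>" for y
    using rho_expand[of y x \<epsilon>] that by (auto simp: dist_norm norm_minus_commute)
  have s1: "lost_part - lost_part \<inter> ?F \<subseteq> ?S"
  proof
    fix y assume "y \<in> lost_part - lost_part \<inter> ?F"
    then show "y \<in> ?S" using near[of y] lost_part_props(5)[of y] by (auto simp: abs_le_iff)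
  qed
  have s2: "?F - lost_part \<inter> ?F \<subseteq> ?S"
  proof
    fix y assume "y \<in> ?F - lost_part \<inter> ?F"
    then show "y \<in> ?S" using near[of y] lost_part_props(5)[of y] by (auto simp: abs_le_iff)
  qed
  have "\<bar>LINT y:lost_part|lebesgue. ?f y\<bar> \<le> 2 * (norm e * \<epsilon> * (6 * L * \<epsilon> * 2 ^ CARD('n) * ball_vol))"
  proof -
    have "lost_part - lost_part \<inter> ?F \<in> sets lebesgue" "?F - lost_part \<inter> ?F \<in> sets lebesgue"
      by (rule sets.Diff[OF lost_part_props(1) sets.Int[OF lost_part_props(1) F]], rule sets.Diff[OF F sets.Int[OF lost_part_props(1) F]])
    from small[OF this(1) s1] small[OF this(2) s2] show ?thesis using OF FO F0 by linarith
  qed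
  then have "(e \<bullet> drift \<Omega> \<epsilon> x) * measure lebesgue (step_set \<Omega> \<epsilon> x) \<le> 12 * 2 ^ CARD('n) * L * \<epsilon>\<^sup>2 * norm e * ball_vol"
  proof -
    assume a: "\<bar>LINT y:lost_part|lebesgue. ?f y\<bar> \<le> 2 * (norm e * \<epsilon> * (6 * L * \<epsilon> * 2 ^ CARD('n) * ball_vol))"
    have "2 * (norm e * \<epsilon> * (6 * L * \<epsilon> * 2 ^ CARD('n) * ball_vol)) = 12 * 2 ^ CARD('n) * L * \<epsilon>\<^sup>2 * norm e * ball_vol"
      by (simp add: power2_eq_square)
    with a show ?thesis unfolding drift_lost_part by linarith
  qed
  also have "\<dots> \<le> 12 * 2 ^ CARD('n) * L * \<epsilon>\<^sup>2 * norm e * (4 ^ CARD('n) * measure lebesgue (step_set \<Omega> \<epsilon> x))"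
    using L by (intro mult_left_mono step_set_measure) auto
  also have "\<dots> = 12 * (2 ^ CARD('n) * 4 ^ CARD('n)) * L * \<epsilon>\<^sup>2 * norm e * measure lebesgue (step_set \<Omega> \<epsilon> x)"
    by (simp add: mult_ac)
  also have "(2::real) ^ CARD('n) * 4 ^ CARD('n) = 8 ^ CARD('n)" by (simp flip: power_mult_distrib)
  finally show ?thesis using step_set_measure(1) by (simp add: mult_le_cancel_right)
qed

text \<open>Every lost point lies on the outer side of \<open>x\<close>, up to
  \<open>L * \<epsilon>\<^sup>2\<close>, so its removal pushes the mean inward. The set
  \<open>E\<close> collects lost points at depth at least \<open>\<epsilon> / 4\<close>, each of
  which contributes a push of that size.\<close>

lemma drift_normal:
  assumes E: "E \<in> sets lebesgue" "E \<subseteq> lost_part" and e: "\<And>y. y \<in> E \<Longrightarrow> N x \<bullet> (y - x) \<le> - (\<epsilon> / 4)"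
  shows "\<epsilon> / 4 * (measure lebesgue E / ball_vol) - 4 ^ CARD('n) * L * \<epsilon>\<^sup>2 \<le> N x \<bullet> drift \<Omega> \<epsilon> x"
proof -
  let ?f = "\<lambda>y. N x \<bullet> (y - x)" and ?A = "measure lebesgue (step_set \<Omega> \<epsilon> x)"
  note mE = measure_Diff_lmeasurable[OF lost_part_props(3) E]
  have Ec: "E \<subseteq> cball x \<epsilon>" "lost_part - E \<subseteq> cball x \<epsilon>" using E(2) lost_part_props(2) by auto
  have "(LINT y:lost_part|lebesgue. ?f y) = (LINT y:E|lebesgue. ?f y) + (LINT y:lost_part - E|lebesgue. ?f y)"
    by (rule set_integral_split[OF int_inner E]) (use lost_part_props in auto)
  also have "(LINT y:E|lebesgue. ?f y) \<le> - (\<epsilon> / 4) * measure lebesgue E"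
    by (rule set_integral_le_const[OF int_inner[OF Ec(1) E(1)] mE(2)]) (rule e)
  also have "(LINT y:lost_part - E|lebesgue. ?f y) \<le> (L * \<epsilon>\<^sup>2) * measure lebesgue (lost_part - E)"
  proof (rule set_integral_le_const[OF int_inner[OF Ec(2)] mE(3)])
    show "lost_part - E \<in> sets lebesgue" using mE(3) by auto
    fix y assume "y \<in> lost_part - E"
    then have "y \<in> cball x \<epsilon>" "\<rho> y \<le> 0" using lost_part_props(5) by auto
    then show "?f y \<le> L * \<epsilon>\<^sup>2"
      using rho_expand(2)[of y x \<epsilon>] rho_nonneg[OF x(1) x_in_chart] by (auto simp: dist_norm norm_minus_commute)
  qed
  also have "(L * \<epsilon>\<^sup>2) * measure lebesgue (lost_part - E) \<le> (L * \<epsilon>\<^sup>2) * ball_vol"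
  proof (rule mult_left_mono)
    show "measure lebesgue (lost_part - E) \<le> ball_vol" using mE(1) lost_part_props(4) measure_nonneg[of lebesgue E] by linarith
  qed (use L_eps(2) in simp)
  finally have 1: "\<epsilon> / 4 * measure lebesgue E - L * \<epsilon>\<^sup>2 * ball_vol \<le> (N x \<bullet> drift \<Omega> \<epsilon> x) * ?A"
    unfolding drift_lost_part by simp
  have a: "L * \<epsilon>\<^sup>2 * ball_vol \<le> L * \<epsilon>\<^sup>2 * (4 ^ CARD('n) * ?A)"
    using L_eps(2) step_set_measure(2) by (intro mult_left_mono) auto
  have b: "\<epsilon> / 4 * (measure lebesgue E / ball_vol) * ?A \<le> \<epsilon> / 4 * (measure lebesgue E / ball_vol) * ball_vol"
    using eps ball_vol_pos step_set_measure(3) by (intro mult_left_mono) auto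
  have c: "\<epsilon> / 4 * (measure lebesgue E / ball_vol) * ball_vol = \<epsilon> / 4 * measure lebesgue E" using ball_vol_pos by simp
  have "(\<epsilon> / 4 * (measure lebesgue E / ball_vol) - 4 ^ CARD('n) * L * \<epsilon>\<^sup>2) * ?A \<le> (N x \<bullet> drift \<Omega> \<epsilon> x) * ?A"
  proof -
    have "4 ^ CARD('n) * L * \<epsilon>\<^sup>2 * ?A = L * \<epsilon>\<^sup>2 * (4 ^ CARD('n) * ?A)" by simp
    with 1 a b c show ?thesis unfolding left_diff_distrib by linarith
  qed
  then show ?thesis using step_set_measure(1) by (simp add: mult_le_cancel_right)
qed

text \<open>The coefficient of \<open>N x\<close> in the orthogonal decomposition of the drift, cut
  off at 0: its negative part is of order \<open>\<epsilon>\<^sup>2\<close> and is moved to the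
  error.\<close>

definition "normal_drift = max 0 ((N x \<bullet> drift \<Omega> \<epsilon> x) / (N x \<bullet> N x))"

lemma NN: "1 \<le> N x \<bullet> N x" "N x \<bullet> N x \<le> L\<^sup>2" "0 < norm (N x)"
proof -
  show "1 \<le> N x \<bullet> N x" using power_mono[OF N_ge[OF x_in_chart], of 2] by (simp add: power2_norm_eq_inner)
  show "N x \<bullet> N x \<le> L\<^sup>2" using power_mono[OF N_le[OF x_in_chart], of 2] by (simp add: power2_norm_eq_inner)
  show "0 < norm (N x)" using N_ge[OF x_in_chart] by linarith
qed

lemma normal_drift_ge: "N x \<bullet> drift \<Omega> \<epsilon> x \<le> L\<^sup>2 * normal_drift" "0 \<le> normal_drift"
proof -
  show m: "0 \<le> normal_drift" by (simp add: normal_drift_def)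
  have "(N x \<bullet> drift \<Omega> \<epsilon> x) / (N x \<bullet> N x) \<le> normal_drift" by (simp add: normal_drift_def)
  then have "N x \<bullet> drift \<Omega> \<epsilon> x \<le> normal_drift * (N x \<bullet> N x)" using NN by (simp add: pos_divide_le_eq)
  also have "\<dots> \<le> normal_drift * L\<^sup>2" using NN m by (intro mult_left_mono) auto
  finally show "N x \<bullet> drift \<Omega> \<epsilon> x \<le> L\<^sup>2 * normal_drift" by (simp add: mult.commute)
qed

lemma drift_near_normal: "norm (drift \<Omega> \<epsilon> x - normal_drift *\<^sub>R N x) \<le> 13 * 8 ^ CARD('n) * L * \<epsilon>\<^sup>2"
proof -
  let ?D = "drift \<Omega> \<epsilon> x"
  define e where "e = ?D - ((N x \<bullet> ?D) / (N x \<bullet> N x)) *\<^sub>R N x"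
  have eN: "e \<bullet> N x = 0"
    unfolding e_def inner_diff_left inner_scaleR_left using NN by (simp add: inner_commute[of ?D "N x"])
  have "e \<bullet> e = e \<bullet> ?D - ((N x \<bullet> ?D) / (N x \<bullet> N x)) * (e \<bullet> N x)"
    by (subst (2) e_def) (simp only: inner_diff_right inner_scaleR_right)
  then have "(norm e)\<^sup>2 = e \<bullet> ?D" by (simp only: eN power2_norm_eq_inner mult_zero_right diff_zero)
  also have "\<dots> \<le> 12 * 8 ^ CARD('n) * L * \<epsilon>\<^sup>2 * norm e" by (rule drift_tangential[OF eN])
  \<comment> \<open>The tangential component is tested against itself, so one factor
    \<open>norm e\<close> can be cancelled.\<close>
  finally have ee: "norm e * norm e \<le> 12 * 8 ^ CARD('n) * L * \<epsilon>\<^sup>2 * norm e" by (simp only: power2_eq_square)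
  have e: "norm e \<le> 12 * 8 ^ CARD('n) * L * \<epsilon>\<^sup>2"
  proof (cases "e = 0")
    case False
    then have "0 < norm e" by simp
    with ee show ?thesis by (rule mult_right_le_imp_le)
  qed (use L in simp)
  \<comment> \<open>With the empty set the estimate only says that the noise pushes outward by no
    more than order \<open>\<epsilon>\<^sup>2\<close>.\<close>
  have Dlow: "- (4 ^ CARD('n) * L * \<epsilon>\<^sup>2) \<le> N x \<bullet> ?D" using drift_normal[of "{}"] by simp
  have "\<bar>(N x \<bullet> ?D) / (N x \<bullet> N x) - normal_drift\<bar> * norm (N x) \<le> 4 ^ CARD('n) * L * \<epsilon>\<^sup>2"
  proof (cases "0 \<le> N x \<bullet> ?D")
    case True
    then show ?thesis using NN L by (simp add: normal_drift_def)
  next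
    case False
    then have "(N x \<bullet> ?D) / (N x \<bullet> N x) \<le> 0" using NN by (intro divide_nonpos_pos) auto
    then have "normal_drift = 0" by (simp add: normal_drift_def)
    then have "\<bar>(N x \<bullet> ?D) / (N x \<bullet> N x) - normal_drift\<bar> * norm (N x) = \<bar>N x \<bullet> ?D\<bar> / norm (N x)"
      using NN by (simp add: power2_norm_eq_inner[symmetric] power2_eq_square)
    also have "\<dots> \<le> \<bar>N x \<bullet> ?D\<bar> / 1" using NN N_ge[OF x_in_chart] by (intro divide_left_mono) auto
    finally show ?thesis using Dlow False by simp
  qed
  then have "norm (((N x \<bullet> ?D) / (N x \<bullet> N x) - normal_drift) *\<^sub>R N x) \<le> 4 ^ CARD('n) * L * \<epsilon>\<^sup>2" by simp
  moreover have "(4::real) ^ CARD('n) * (L * \<epsilon>\<^sup>2) \<le> 8 ^ CARD('n) * (L * \<epsilon>\<^sup>2)"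
    using L by (intro mult_right_mono power_mono) auto
  moreover have "?D - normal_drift *\<^sub>R N x = e + ((N x \<bullet> ?D) / (N x \<bullet> N x) - normal_drift) *\<^sub>R N x"
    by (simp add: e_def scaleR_diff_left)
  ultimately show ?thesis using e norm_triangle_ineq[of e "((N x \<bullet> ?D) / (N x \<bullet> N x) - normal_drift) *\<^sub>R N x"]
    by (simp add: mult.assoc)
qed

text \<open>In units of \<epsilon> and in the direction of the outer normal, the height beyond which
  points of the ball surely lie outside the domain; the summand
  \<open>L * \<epsilon>\<^sup>2\<close> allows for curvature.\<close>

definition "cap_height = (\<rho> x + L * \<epsilon>\<^sup>2) / (norm (N x) * \<epsilon>)"

definition "cap_bound = 4 * (L\<^sup>2 + 4 ^ CARD('n) * L) / cap_const TYPE('n)"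

text \<open>The box inscribed in the cap above \<open>cap_height\<close> is entirely lost and lies
  at depth at least \<open>\<epsilon> / 4\<close>, so its volume bounds the inward drift from
  below.\<close>

lemma cap_drift:
  assumes d: "cap_height < 1"
  shows "\<epsilon> * (1 - cap_height) powr ((real CARD('n) + 1) / 2) \<le> cap_bound * (normal_drift + \<epsilon>\<^sup>2)"
proof -
  let ?e = "- sgn (N x)" and ?k = "cap_const TYPE('n)"
  have e1: "norm ?e = 1" using NN by (simp add: norm_sgn)
  have N0: "norm (N x) \<noteq> 0" using NN by simp
  have d0: "0 \<le> cap_height" using rho_nonneg[OF x(1) x_in_chart] L_eps eps by (simp add: cap_height_def)
  obtain E where E: "E \<in> sets lebesgue" "E \<subseteq> cball x \<epsilon>"
    "\<And>y. y \<in> E \<Longrightarrow> cap_height * \<epsilon> < ?e \<bullet> (y - x)" "\<And>y. y \<in> E \<Longrightarrow> \<epsilon> / 4 \<le> ?e \<bullet> (y - x)"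
    "measure lebesgue E = ?k * (1 - cap_height) powr ((real CARD('n) + 1) / 2) * measure lebesgue (cball x \<epsilon>)"
    using box_in_cap[OF e1 d0 d eps(1), of x] by blast
  have Ne: "N x \<bullet> (y - x) = - (norm (N x) * (?e \<bullet> (y - x)))" for y
    using N0 by (simp add: sgn_div_norm)
  have sub: "E \<subseteq> lost_part"
  proof
    fix y assume y: "y \<in> E"
    have yc: "norm (y - x) \<le> \<epsilon>" using E(2) y by (auto simp: dist_norm norm_minus_commute)
    have "norm (N x) * (cap_height * \<epsilon>) \<le> norm (N x) * (?e \<bullet> (y - x))"
      using E(3)[OF y] by (intro mult_left_mono) auto
    moreover have "norm (N x) * (cap_height * \<epsilon>) = \<rho> x + L * \<epsilon>\<^sup>2" using N0 eps by (simp add: cap_height_def)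
    ultimately have "\<rho> y \<le> 0" using rho_expand(1)[OF yc] Ne[of y] by linarith
    then show "y \<in> lost_part" using lost_part_props(5) E(2) y by auto
  qed
  have "N x \<bullet> (y - x) \<le> - (\<epsilon> / 4)" if y: "y \<in> E" for y
  proof -
    have "1 * (\<epsilon> / 4) \<le> norm (N x) * (?e \<bullet> (y - x))"
      using E(4)[OF y] N_ge[OF x_in_chart] eps by (intro mult_mono) auto
    then show ?thesis using Ne[of y] by linarith
  qed
  from drift_normal[OF E(1) sub this]
  have "\<epsilon> / 4 * (?k * (1 - cap_height) powr ((real CARD('n) + 1) / 2)) - 4 ^ CARD('n) * L * \<epsilon>\<^sup>2 \<le> L\<^sup>2 * normal_drift"
    using E(5) ball_vol_pos normal_drift_ge(1) unfolding ball_vol_def by simp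
  moreover have "0 \<le> 4 ^ CARD('n) * L * normal_drift" "0 \<le> L\<^sup>2 * \<epsilon>\<^sup>2" using L normal_drift_ge(2) by auto
  ultimately have "\<epsilon> / 4 * (?k * (1 - cap_height) powr ((real CARD('n) + 1) / 2))
      \<le> L\<^sup>2 * normal_drift + L\<^sup>2 * \<epsilon>\<^sup>2 + 4 ^ CARD('n) * L * normal_drift + 4 ^ CARD('n) * L * \<epsilon>\<^sup>2"
    by linarith
  also have "\<dots> = (L\<^sup>2 + 4 ^ CARD('n) * L) * (normal_drift + \<epsilon>\<^sup>2)" by (simp add: algebra_simps)
  finally have "\<epsilon> / 4 * (?k * (1 - cap_height) powr ((real CARD('n) + 1) / 2))
      \<le> (L\<^sup>2 + 4 ^ CARD('n) * L) * (normal_drift + \<epsilon>\<^sup>2)" .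
  then show ?thesis using cap_const_pos[where 'n='n] by (simp add: cap_bound_def field_simps)
qed

lemma hit_eq: "hit \<Omega> \<epsilon> x = measure lebesgue lost_part / ball_vol"
  by (simp add: hit_def ball_vol_def lost_part_def)

lemma cap_height_le: "cap_height \<le> (\<rho> x / norm (N x)) / \<epsilon> + L * \<epsilon>"
proof -
  have "L * \<epsilon>\<^sup>2 / (norm (N x) * \<epsilon>) = L * \<epsilon> / norm (N x)" using eps by (simp add: power2_eq_square)
  also have "\<dots> \<le> L * \<epsilon> / 1" using N_ge[OF x_in_chart] L eps by (intro divide_left_mono) auto
  finally show ?thesis by (simp add: cap_height_def add_divide_distrib)
qed

text \<open>If \<open>\<rho> x\<close> is at least \<open>\<epsilon> / 2\<close>, all lost points
  lie at depth \<open>\<epsilon> / 4\<close>, and the lost volume itself drives the drift. Otherwise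
  the cap height is at most \<open>5 / 8\<close>, the drift is of order \<epsilon>, and the trivial
  bound 1 for the share suffices; \<open>8 / 3\<close> is the reciprocal of
  \<open>1 - 5 / 8\<close>.\<close>

lemma hit_le:
  "hit \<Omega> \<epsilon> x \<le> (4 * L\<^sup>2 + 4 * 4 ^ CARD('n) * L + cap_bound * (8/3) powr ((real CARD('n) + 1) / 2)) * (normal_drift / \<epsilon> + \<epsilon>)"
proof -
  let ?\<mu> = "(real CARD('n) + 1) / 2" and ?M = "normal_drift / \<epsilon> + \<epsilon>"
  have M0: "0 \<le> ?M" using normal_drift_ge(2) eps by simp
  have cb: "0 \<le> cap_bound" using L cap_const_pos[where 'n='n] by (simp add: cap_bound_def)
  show ?thesis
  proof (cases "\<epsilon> / 2 \<le> \<rho> x")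
    case True
    have "N x \<bullet> (y - x) \<le> - (\<epsilon> / 4)" if "y \<in> lost_part" for y
    proof -
      have "norm (y - x) \<le> \<epsilon>" "\<rho> y \<le> 0" using that lost_part_props(5)[of y] by (auto simp: dist_norm norm_minus_commute)
      then show ?thesis using rho_expand(2)[of y x \<epsilon>] True L_eps(1) eps by linarith
    qed
    then have "\<epsilon> / 4 * hit \<Omega> \<epsilon> x - 4 ^ CARD('n) * L * \<epsilon>\<^sup>2 \<le> L\<^sup>2 * normal_drift"
      using drift_normal[OF lost_part_props(1) order_refl] normal_drift_ge(1) unfolding hit_eq by simp
    then have "\<epsilon> * hit \<Omega> \<epsilon> x \<le> 4 * (L\<^sup>2 * normal_drift) + 4 * (4 ^ CARD('n) * L * \<epsilon>\<^sup>2)" by simp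
    then have "hit \<Omega> \<epsilon> x \<le> (4 * (L\<^sup>2 * normal_drift) + 4 * (4 ^ CARD('n) * L * \<epsilon>\<^sup>2)) / \<epsilon>"
      using eps by (simp add: pos_le_divide_eq mult.commute)
    also have "\<dots> = 4 * L\<^sup>2 * (normal_drift / \<epsilon>) + 4 * 4 ^ CARD('n) * L * \<epsilon>"
      using eps by (simp add: add_divide_distrib power2_eq_square)
    also have "\<dots> \<le> 4 * L\<^sup>2 * ?M + 4 * 4 ^ CARD('n) * L * ?M"
      using L eps normal_drift_ge(2) by (intro add_mono mult_left_mono) auto
    also have "\<dots> \<le> 4 * L\<^sup>2 * ?M + 4 * 4 ^ CARD('n) * L * ?M + cap_bound * (8/3) powr ?\<mu> * ?M"
      using cb M0 by simp
    also have "\<dots> = (4 * L\<^sup>2 + 4 * 4 ^ CARD('n) * L + cap_bound * (8/3) powr ?\<mu>) * ?M" by (simp only: distrib_right)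
    finally show ?thesis .
  next
    case False
    have "\<rho> x / norm (N x) \<le> \<rho> x / 1"
      using N_ge[OF x_in_chart] rho_nonneg[OF x(1) x_in_chart] by (intro divide_left_mono) auto
    then have "\<rho> x / norm (N x) \<le> \<epsilon> / 2" using False by linarith
    then have "\<rho> x / norm (N x) / \<epsilon> \<le> (\<epsilon> / 2) / \<epsilon>" using eps by (intro divide_right_mono) auto
    then have d: "cap_height \<le> 5 / 8" using cap_height_le eps by simp
    have "\<epsilon> * (3/8) powr ?\<mu> \<le> \<epsilon> * (1 - cap_height) powr ?\<mu>" using d eps by (intro mult_left_mono powr_mono2) auto
    also have "\<dots> \<le> cap_bound * (normal_drift + \<epsilon>\<^sup>2)" using cap_drift d by simp
    finally have "(\<epsilon> * (3/8) powr ?\<mu>) * (8/3) powr ?\<mu> \<le> (cap_bound * (normal_drift + \<epsilon>\<^sup>2)) * (8/3) powr ?\<mu>"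
      by (intro mult_right_mono) auto
    moreover have "(3/8) powr ?\<mu> * (8/3) powr ?\<mu> = 1" by (simp flip: powr_mult)
    ultimately have "\<epsilon> \<le> (cap_bound * (normal_drift + \<epsilon>\<^sup>2)) * (8/3) powr ?\<mu>" by (simp add: mult.assoc)
    then have "1 \<le> (cap_bound * (normal_drift + \<epsilon>\<^sup>2)) * (8/3) powr ?\<mu> / \<epsilon>"
      using eps by simp
    also have "\<dots> = cap_bound * (8/3) powr ?\<mu> * ?M" using eps by (simp add: field_simps power2_eq_square)
    also have "\<dots> \<le> 4 * L\<^sup>2 * ?M + 4 * 4 ^ CARD('n) * L * ?M + cap_bound * (8/3) powr ?\<mu> * ?M"
      using M0 L by simp
    also have "\<dots> = (4 * L\<^sup>2 + 4 * 4 ^ CARD('n) * L + cap_bound * (8/3) powr ?\<mu>) * ?M" by (simp only: distrib_right)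
    finally have "1 \<le> (4 * L\<^sup>2 + 4 * 4 ^ CARD('n) * L + cap_bound * (8/3) powr ?\<mu>) * ?M" .
    moreover have "hit \<Omega> \<epsilon> x \<le> 1" unfolding hit_eq using lost_part_props(4) ball_vol_pos by simp
    ultimately show ?thesis by linarith
  qed
qed

text \<open>Here the cap height is at most \<open>1 / 2\<close>: the distance contributes
  \<open>1 / 4\<close>, and the curvature terms contribute \<open>1 / 8\<close> twice.\<close>

lemma near_le:
  assumes "bdist \<Omega> x < \<epsilon> / 4"
  shows "\<epsilon> \<le> cap_bound * 2 powr ((real CARD('n) + 1) / 2) * (normal_drift + \<epsilon>\<^sup>2)"
proof -
  let ?\<mu> = "(real CARD('n) + 1) / 2"
  have "\<rho> x \<le> norm (N x) * (\<epsilon> / 4) + L * \<epsilon>\<^sup>2"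
  proof -
    have "norm (N x) * bdist \<Omega> x \<le> norm (N x) * (\<epsilon> / 4)" using assms by (intro mult_left_mono) auto
    moreover have "L * (bdist \<Omega> x)\<^sup>2 \<le> L * \<epsilon>\<^sup>2"
      using assms L eps bdist_nonneg[of \<Omega> x] by (intro mult_left_mono power_mono) auto
    ultimately show ?thesis using rho_le_bdist(1)[OF x(2)] by linarith
  qed
  also have "\<dots> \<le> norm (N x) * (\<epsilon> / 4) + norm (N x) * (\<epsilon> / 8)"
  proof -
    have "1 * (\<epsilon> / 8) \<le> norm (N x) * (\<epsilon> / 8)" using N_ge[OF x_in_chart] eps by (intro mult_right_mono) auto
    then show ?thesis using L_eps(1) by linarith
  qed
  finally have "\<rho> x \<le> norm (N x) * (3 * \<epsilon> / 8)" by (simp add: field_simps)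
  then have "\<rho> x / norm (N x) / \<epsilon> \<le> 3 / 8" using NN eps by (simp add: field_simps)
  moreover have "L * \<epsilon> \<le> 1 / 8" using eps(3) by simp
  ultimately have d: "cap_height \<le> 1 / 2" using cap_height_le by linarith
  have "\<epsilon> * (1/2) powr ?\<mu> \<le> \<epsilon> * (1 - cap_height) powr ?\<mu>" using d eps by (intro mult_left_mono powr_mono2) auto
  also have "\<dots> \<le> cap_bound * (normal_drift + \<epsilon>\<^sup>2)" using cap_drift d by simp
  finally have "(\<epsilon> * (1/2) powr ?\<mu>) * 2 powr ?\<mu> \<le> (cap_bound * (normal_drift + \<epsilon>\<^sup>2)) * 2 powr ?\<mu>"
    by (intro mult_right_mono) auto
  moreover have "(\<epsilon> * (1/2) powr ?\<mu>) * 2 powr ?\<mu> = \<epsilon>"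
    unfolding mult.assoc powr_mult[symmetric] by simp
  ultimately show ?thesis by (simp only: mult_ac)
qed

text \<open>The bound of \<open>cap_drift\<close> is transferred to the relative distance
  \<open>d = bdist \<Omega> x / \<epsilon>\<close>, which is the variable in \<open>s_eps\<close>.
  The two heights differ by at most \<open>2 * L * \<epsilon>\<close>. Either this is at most
  \<open>1 - cap_height\<close>, and \<open>1 - d\<close> is at most twice that, or
  \<open>1 - d\<close> is of order \<epsilon>, and the left side is of order
  \<open>\<epsilon>\<^sup>2\<close> since the exponent is at least 1.\<close>

lemma height_le:
  assumes b: "bdist \<Omega> x < \<epsilon>"
  shows "\<epsilon> * (1 - bdist \<Omega> x / \<epsilon>) powr ((real CARD('n) + 1) / 2)
    \<le> (cap_bound * 2 powr ((real CARD('n) + 1) / 2) + 4 * L) * (normal_drift + \<epsilon>\<^sup>2)"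
proof -
  let ?\<mu> = "(real CARD('n) + 1) / 2" and ?d = "bdist \<Omega> x / \<epsilon>"
  have mu: "1 \<le> ?\<mu>" by simp
  have cb: "0 \<le> cap_bound" using L cap_const_pos[where 'n='n] by (simp add: cap_bound_def)
  have m0: "0 \<le> normal_drift + \<epsilon>\<^sup>2" using normal_drift_ge(2) by simp
  have d: "0 \<le> ?d" "?d < 1" using b eps bdist_nonneg[of \<Omega> x] by auto
  have Le4: "0 \<le> 4 * L * \<epsilon>" "4 * L * \<epsilon> \<le> 1" using eps L by auto
  have dd1: "cap_height \<le> ?d + 2 * (L * \<epsilon>)"
  proof -
    have bd: "(bdist \<Omega> x)\<^sup>2 \<le> \<epsilon>\<^sup>2" using b bdist_nonneg[of \<Omega> x] by (intro power_mono) auto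
    have "1 * (L * \<epsilon>\<^sup>2) \<le> norm (N x) * (L * \<epsilon>\<^sup>2)" using N_ge[OF x_in_chart] L_eps by (intro mult_right_mono) auto
    moreover have "L * (bdist \<Omega> x)\<^sup>2 \<le> L * \<epsilon>\<^sup>2" using bd L by (intro mult_left_mono) auto
    ultimately have "\<rho> x \<le> norm (N x) * (bdist \<Omega> x + L * \<epsilon>\<^sup>2)"
      using rho_le_bdist(1)[OF x(2)] by (simp add: distrib_left)
    then have "\<rho> x / norm (N x) \<le> bdist \<Omega> x + L * \<epsilon>\<^sup>2" using NN by (simp add: pos_divide_le_eq mult.commute)
    then have "\<rho> x / norm (N x) / \<epsilon> \<le> (bdist \<Omega> x + L * \<epsilon>\<^sup>2) / \<epsilon>" using eps by (intro divide_right_mono) auto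
    also have "\<dots> = ?d + L * \<epsilon>" using eps by (simp add: add_divide_distrib power2_eq_square)
    finally show ?thesis using cap_height_le by linarith
  qed
  have pw: "(4 * L * \<epsilon>) powr ?\<mu> \<le> 4 * L * \<epsilon>"
  proof -
    have "(4 * L * \<epsilon>) powr ?\<mu> \<le> (4 * L * \<epsilon>) powr 1" using Le4 mu by (intro powr_mono') auto
    then show ?thesis using Le4 by simp
  qed
  have "\<epsilon> * (1 - ?d) powr ?\<mu> \<le> cap_bound * 2 powr ?\<mu> * (normal_drift + \<epsilon>\<^sup>2) + \<epsilon> * (4 * L * \<epsilon>)"
  proof (cases "2 * (L * \<epsilon>) \<le> 1 - cap_height")
    case True
    then have dl: "cap_height < 1" using L eps by (smt (verit) mult_pos_pos)
    have "(1 - ?d) powr ?\<mu> \<le> (2 * (1 - cap_height)) powr ?\<mu>" using dd1 True d by (intro powr_mono2) auto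
    also have "\<dots> = 2 powr ?\<mu> * (1 - cap_height) powr ?\<mu>" by (rule powr_mult)
    finally have "\<epsilon> * (1 - ?d) powr ?\<mu> \<le> \<epsilon> * (2 powr ?\<mu> * (1 - cap_height) powr ?\<mu>)"
      using eps by (intro mult_left_mono) auto
    also have "\<dots> = 2 powr ?\<mu> * (\<epsilon> * (1 - cap_height) powr ?\<mu>)" by simp
    also have "\<dots> \<le> 2 powr ?\<mu> * (cap_bound * (normal_drift + \<epsilon>\<^sup>2))" by (rule mult_left_mono[OF cap_drift[OF dl]]) simp
    also have "\<dots> = cap_bound * 2 powr ?\<mu> * (normal_drift + \<epsilon>\<^sup>2)" by simp
    moreover have "0 \<le> \<epsilon> * (4 * L * \<epsilon>)" using eps Le4 by simp
    ultimately show ?thesis by linarith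
  next
    case False
    have "(1 - ?d) powr ?\<mu> \<le> (4 * L * \<epsilon>) powr ?\<mu>" using dd1 False d by (intro powr_mono2) auto
    then have "\<epsilon> * (1 - ?d) powr ?\<mu> \<le> \<epsilon> * (4 * L * \<epsilon>)" using pw eps by (intro mult_left_mono) auto
    moreover have "0 \<le> cap_bound * 2 powr ?\<mu> * (normal_drift + \<epsilon>\<^sup>2)" using cb m0 by simp
    ultimately show ?thesis by linarith
  qed
  also have "\<epsilon> * (4 * L * \<epsilon>) \<le> 4 * L * (normal_drift + \<epsilon>\<^sup>2)"
    using L normal_drift_ge(2) by (simp add: power2_eq_square algebra_simps)
  finally show ?thesis by (simp only: distrib_right)
qed

text \<open>The lost part is contained in the sphere, hence a null set.\<close>

lemma far_drift:
  assumes "\<epsilon> \<le> bdist \<Omega> x"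
  shows "normal_drift = 0"
proof -
  have "ball x (bdist \<Omega> x) \<subseteq> \<Omega>" by (rule ball_bdist_subset[OF open_dom frontier_ne x(1)]) (use assms eps in simp)
  then have "ball x \<epsilon> \<subseteq> \<Omega>" using assms by (meson order_trans subset_ball)
  then have "lost_part \<subseteq> cball x \<epsilon> - ball x \<epsilon>" by (auto simp: lost_part_def step_set_def)
  then have "lost_part \<subseteq> sphere x \<epsilon>" by (simp only: cball_diff_eq_sphere)
  then have "negligible lost_part" using negligible_sphere negligible_subset by blast
  then have m0: "measure lebesgue lost_part = 0" using negligible_iff_measure by blast
  let ?f = "\<lambda>y. N x \<bullet> (y - x)"
  have b: "\<bar>?f y\<bar> \<le> norm (N x) * \<epsilon>" if "y \<in> lost_part" for y
  proof -
    have "\<bar>?f y\<bar> \<le> norm (N x) * norm (y - x)" by (rule Cauchy_Schwarz_ineq2)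
    also have "norm (y - x) \<le> \<epsilon>" using that lost_part_props(2) by (auto simp: dist_norm norm_minus_commute)
    finally show ?thesis by (simp add: mult_left_mono)
  qed
  have i: "set_integrable lebesgue lost_part ?f" by (rule int_inner[OF lost_part_props(2,1)])
  have "(LINT y:lost_part|lebesgue. ?f y) \<le> (norm (N x) * \<epsilon>) * measure lebesgue lost_part"
    by (rule set_integral_le_const[OF i lost_part_props(3)]) (use b in \<open>auto simp: abs_le_iff\<close>)
  moreover have "(- (norm (N x) * \<epsilon>)) * measure lebesgue lost_part \<le> (LINT y:lost_part|lebesgue. ?f y)"
    by (rule set_integral_ge_const[OF i lost_part_props(3)]) (use b in \<open>force simp: abs_le_iff\<close>)
  ultimately have "(LINT y:lost_part|lebesgue. ?f y) = 0" using m0 by simp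
  then have "N x \<bullet> drift \<Omega> \<epsilon> x = 0" using drift_lost_part[of "N x"] step_set_measure(1) by simp
  then show ?thesis by (simp add: normal_drift_def)
qed

end

end

section \<open>Upper bounds for the weight of the boundary datum\<close>

lemma s_eps_nonneg:
  assumes "0 \<le> \<epsilon>"
  shows "0 \<le> s_eps \<Omega> \<epsilon> (x :: real^'n)"
proof -
  have "0 \<le> real CARD('n) - 1" using zero_less_card_finite[where 'a='n] by linarith
  then show ?thesis using assms by (auto simp: s_eps_def intro!: mult_nonneg_nonneg divide_nonneg_nonneg)
qed

text \<open>The prefactor of \<open>s_eps\<close> with the volume of the cut ball replaced by its
  lower bound, \<open>4 ^ n\<close> being the price of the inscribed ball of radius
  \<open>1 / 4\<close>.\<close>

definition s_const :: "'n::finite itself \<Rightarrow> real" where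
  "s_const _ = unit_ball_vol (real CARD('n) - 1) * 4 ^ CARD('n) / ((real CARD('n) + 1) * unit_ball_vol (real CARD('n)))"

lemma s_const_nonneg: "0 \<le> s_const TYPE('n::finite)"
proof -
  have "0 \<le> real CARD('n) - 1" using zero_less_card_finite[where 'a='n] by linarith
  then show ?thesis by (auto simp: s_const_def intro!: mult_nonneg_nonneg divide_nonneg_nonneg)
qed

lemma s_eps_le:
  fixes x :: "real^'n"
  assumes \<epsilon>: "0 < \<epsilon>"
  shows "s_eps \<Omega> \<epsilon> x \<le> s_const TYPE('n) * \<epsilon> * (1 - (dcut \<Omega> \<epsilon> x)\<^sup>2) powr ((real CARD('n) + 1) / 2)"
proof -
  let ?n = "real CARD('n)" and ?U = "unit_ball_vol (real CARD('n))"
  let ?d = "dcut \<Omega> \<epsilon> x"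
  have d: "0 \<le> ?d" using \<epsilon> bdist_nonneg[of \<Omega> x] by (simp add: dcut_def)
  have n1: "0 \<le> ?n - 1" using zero_less_card_finite[where 'a='n] by linarith
  have U: "0 < ?U" by simp
  have "unit_ball_vol (?n - 1) / ((?n + 1) * measure lebesgue (cut_ball ?d :: (real^'n) set))
    \<le> unit_ball_vol (?n - 1) / ((?n + 1) * (?U / 4 ^ CARD('n)))"
    using measure_cut_ball_ge(1)[OF d, where 'n='n] n1 U
    by (intro divide_left_mono mult_left_mono mult_pos_pos) (auto intro: less_le_trans[of 0 "?U / 4 ^ CARD('n)"])
  also have "\<dots> = s_const TYPE('n)" by (simp add: s_const_def)
  finally show ?thesis unfolding s_eps_def using \<epsilon> by (intro mult_right_mono) auto
qed

lemma s_eps_eq_0: "0 < \<epsilon> \<Longrightarrow> \<epsilon> \<le> bdist \<Omega> x \<Longrightarrow> s_eps \<Omega> \<epsilon> x = 0"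
  by (simp add: s_eps_def dcut_def)

lemma s_eps_le_linear:
  fixes x :: "real^'n"
  assumes \<epsilon>: "0 < \<epsilon>"
  shows "s_eps \<Omega> \<epsilon> x \<le> s_const TYPE('n) * \<epsilon>"
proof -
  have d: "0 \<le> dcut \<Omega> \<epsilon> x" "dcut \<Omega> \<epsilon> x \<le> 1" using \<epsilon> bdist_nonneg[of \<Omega> x] by (auto simp: dcut_def)
  then have "(dcut \<Omega> \<epsilon> x)\<^sup>2 \<le> 1" by (simp add: power_le_one)
  then have "(1 - (dcut \<Omega> \<epsilon> x)\<^sup>2) powr ((real CARD('n) + 1) / 2) \<le> 1"
    by (intro powr_le1) auto
  then have "s_const TYPE('n) * \<epsilon> * (1 - (dcut \<Omega> \<epsilon> x)\<^sup>2) powr ((real CARD('n) + 1) / 2) \<le> s_const TYPE('n) * \<epsilon> * 1"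
    using s_const_nonneg[where 'n='n] \<epsilon> by (intro mult_left_mono) auto
  then show ?thesis using s_eps_le[OF \<epsilon>, of \<Omega> x] by linarith
qed

text \<open>The scalar \<open>m\<close> is the speed at which the noise is reflected into the domain. That it also dominates the lost
  part of the ball and the weight \<open>s_eps\<close> is what allows a barrier decreasing along \<open>N\<close> to absorb both.\<close>

lemma drift_estimate:
  fixes L :: real
  assumes L: "1 \<le> L"
  obtains C where "1 \<le> C"
    "\<And>(\<Omega>::(real^'n) set) z r \<rho> N x \<epsilon>. boundary_chart \<Omega> z r L \<rho> N \<Longrightarrow> x \<in> closure \<Omega> \<Longrightarrow> dist z x < r / 2 \<Longrightarrow>
      0 < \<epsilon> \<Longrightarrow> \<epsilon> < r / 2 \<Longrightarrow> 8 * L * \<epsilon> \<le> 1 \<Longrightarrow>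
      \<exists>m\<ge>0. norm (drift \<Omega> \<epsilon> x - m *\<^sub>R N x) \<le> C * \<epsilon>\<^sup>2 \<and> hit \<Omega> \<epsilon> x \<le> C * (m / \<epsilon> + \<epsilon>) \<and>
        s_eps \<Omega> \<epsilon> x \<le> C * (m + \<epsilon>\<^sup>2) \<and> (bdist \<Omega> x < \<epsilon> / 4 \<longrightarrow> \<epsilon> \<le> C * (m + \<epsilon>\<^sup>2)) \<and>
        (\<epsilon> \<le> bdist \<Omega> x \<longrightarrow> m = 0)"
proof -
  let ?\<mu> = "(real CARD('n) + 1) / 2" and ?k = "s_const TYPE('n)"
  define cb where "cb = 4 * (L\<^sup>2 + 4 ^ CARD('n) * L) / cap_const TYPE('n)"
  define K1 where "K1 = 13 * 8 ^ CARD('n) * L"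
  define K2 where "K2 = 4 * L\<^sup>2 + 4 * 4 ^ CARD('n) * L + cb * (8/3) powr ?\<mu>"
  define K3 where "K3 = cb * 2 powr ?\<mu>"
  define K4 where "K4 = ?k * 2 powr ?\<mu> * (cb * 2 powr ?\<mu> + 4 * L)"
  have cb0: "0 \<le> cb" using L cap_const_pos[where 'n='n] by (simp add: cb_def)
  have K0: "0 \<le> K1" "0 \<le> K2" "0 \<le> K3" "0 \<le> K4"
    using L cb0 s_const_nonneg[where 'n='n] by (auto simp: K1_def K2_def K3_def K4_def)
  define C where "C = 1 + K1 + K2 + K3 + K4"
  have CK: "1 \<le> C" "K1 \<le> C" "K2 \<le> C" "K3 \<le> C" "K4 \<le> C" using K0 by (auto simp: C_def)
  show thesis
  proof (rule that[of C])
    show "1 \<le> C" by fact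
    fix \<Omega> :: "(real^'n) set" and z r \<rho> N x \<epsilon>
    assume "boundary_chart \<Omega> z r L \<rho> N" and x: "x \<in> closure \<Omega>" "dist z x < r / 2"
      and eps: "0 < \<epsilon>" "\<epsilon> < r / 2" "8 * L * \<epsilon> \<le> 1"
    then interpret boundary_chart \<Omega> z r L \<rho> N by simp
    note a = x eps
    define m where "m = normal_drift x \<epsilon>"
    have m0: "0 \<le> m" "0 \<le> m / \<epsilon> + \<epsilon>" "0 \<le> m + \<epsilon>\<^sup>2"
      using normal_drift_ge(2)[OF a] eps by (auto simp: m_def)
    have cbe: "cap_bound = cb" by (simp add: cap_bound_def[OF a] cb_def)
    have 1: "norm (drift \<Omega> \<epsilon> x - m *\<^sub>R N x) \<le> C * \<epsilon>\<^sup>2"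
      using drift_near_normal[OF a] mult_right_mono[OF CK(2), of "\<epsilon>\<^sup>2"] by (simp add: K1_def m_def)
    have 2: "hit \<Omega> \<epsilon> x \<le> C * (m / \<epsilon> + \<epsilon>)"
      using hit_le[OF a] mult_right_mono[OF CK(3) m0(2)] unfolding cbe K2_def m_def by linarith
    have 3: "\<epsilon> \<le> C * (m + \<epsilon>\<^sup>2)" if "bdist \<Omega> x < \<epsilon> / 4"
      using near_le[OF a that] mult_right_mono[OF CK(4) m0(3)] unfolding cbe K3_def m_def by linarith
    have 4: "s_eps \<Omega> \<epsilon> x \<le> C * (m + \<epsilon>\<^sup>2)"
    proof (cases "bdist \<Omega> x < \<epsilon>")
      case False
      then show ?thesis using s_eps_eq_0[OF eps(1), of \<Omega> x] m0 CK(1) by simp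
    next
      case True
      let ?d = "bdist \<Omega> x / \<epsilon>"
      have d: "0 \<le> ?d" "?d < 1" using True eps bdist_nonneg[of \<Omega> x] by auto
      have "dcut \<Omega> \<epsilon> x = ?d" using d by (simp add: dcut_def)
      then have "s_eps \<Omega> \<epsilon> x \<le> ?k * \<epsilon> * (1 - ?d\<^sup>2) powr ?\<mu>" using s_eps_le[OF eps(1), of \<Omega> x] by simp
      \<comment> \<open>Factoring \<open>1 - d\<^sup>2\<close> brings the profile in
        \<open>s_eps\<close> to the one controlled by the drift.\<close>
      also have "(1 - ?d\<^sup>2) powr ?\<mu> \<le> (2 * (1 - ?d)) powr ?\<mu>"
      proof (rule powr_mono2)
        have "(1 + ?d) * (1 - ?d) \<le> 2 * (1 - ?d)" using d by (intro mult_right_mono) auto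
        then show "1 - ?d\<^sup>2 \<le> 2 * (1 - ?d)" by (simp add: power2_eq_square algebra_simps)
        show "0 \<le> 1 - ?d\<^sup>2" using d by (simp add: power_le_one)
      qed simp
      also have "(2 * (1 - ?d)) powr ?\<mu> = 2 powr ?\<mu> * (1 - ?d) powr ?\<mu>" by (rule powr_mult)
      also have "?k * \<epsilon> * (2 powr ?\<mu> * (1 - ?d) powr ?\<mu>) = ?k * 2 powr ?\<mu> * (\<epsilon> * (1 - ?d) powr ?\<mu>)" by simp
      also have "\<dots> \<le> ?k * 2 powr ?\<mu> * ((cb * 2 powr ?\<mu> + 4 * L) * (m + \<epsilon>\<^sup>2))"
        using height_le[OF a True] s_const_nonneg[where 'n='n] unfolding cbe m_def by (intro mult_left_mono) auto
      also have "\<dots> = K4 * (m + \<epsilon>\<^sup>2)" by (simp add: K4_def)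
      also have "\<dots> \<le> C * (m + \<epsilon>\<^sup>2)" by (rule mult_right_mono[OF CK(5) m0(3)])
      finally show ?thesis using s_const_nonneg[where 'n='n] eps by (simp add: mult_left_mono)
    qed
    have 5: "m = 0" if "\<epsilon> \<le> bdist \<Omega> x" using far_drift[OF a that] by (simp add: m_def)
    show "\<exists>m\<ge>0. norm (drift \<Omega> \<epsilon> x - m *\<^sub>R N x) \<le> C * \<epsilon>\<^sup>2 \<and> hit \<Omega> \<epsilon> x \<le> C * (m / \<epsilon> + \<epsilon>) \<and>
        s_eps \<Omega> \<epsilon> x \<le> C * (m + \<epsilon>\<^sup>2) \<and> (bdist \<Omega> x < \<epsilon> / 4 \<longrightarrow> \<epsilon> \<le> C * (m + \<epsilon>\<^sup>2)) \<and>
        (\<epsilon> \<le> bdist \<Omega> x \<longrightarrow> m = 0)"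
      using m0 1 2 3 4 5 by blast
  qed
qed

section \<open>The barrier and the tug-of-war gain\<close>

lemma sqrt_le_tangent:
  assumes "0 < s" "0 \<le> s'"
  shows "sqrt s' \<le> sqrt s + (s' - s) / (2 * sqrt s)"
proof -
  have "0 \<le> (sqrt s' - sqrt s)\<^sup>2" by simp
  then have "2 * sqrt s * sqrt s' \<le> s + s'" using assms by (simp add: power2_diff mult_ac add.commute)
  then have "sqrt s' \<le> (s + s') / (2 * sqrt s)" using assms by (simp add: pos_le_divide_eq mult.commute)
  also have "\<dots> = sqrt s + (s' - s) / (2 * sqrt s)"
    using assms by (simp add: field_simps)
  finally show ?thesis .
qed

lemma norm_add_squared:
  fixes w h :: "'a::real_inner"
  shows "(norm (w + h))\<^sup>2 = (norm w)\<^sup>2 + 2 * (w \<bullet> h) + (norm h)\<^sup>2"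
  by (simp add: power2_norm_eq_inner inner_add_left inner_add_right inner_commute)

text \<open>Only the component of \<open>h\<close> orthogonal to \<open>w\<close> enters at second
  order. Moves along the line through the two points are therefore free of loss, and nearly aligned
  moves almost so.\<close>

lemma norm_le_expansion:
  fixes w h :: "'a::real_inner"
  assumes w: "w \<noteq> 0" and h: "norm h \<le> norm w / 2"
  shows "norm (w + h) \<le> norm w + sgn w \<bullet> h + ((norm h)\<^sup>2 - (sgn w \<bullet> h)\<^sup>2) / norm w"
proof -
  let ?t = "norm w" and ?c = "sgn w \<bullet> h"
  let ?p = "(norm h)\<^sup>2 - ?c\<^sup>2"
  have t: "0 < ?t" using w by simp
  have c: "\<bar>?c\<bar> \<le> norm h" using Cauchy_Schwarz_ineq2[of "sgn w" h] w by (simp add: norm_sgn)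
  then have p: "0 \<le> ?p" by (simp add: abs_le_square_iff[symmetric])
  have tc: "?t / 2 \<le> ?t + ?c" using c h by linarith
  then have tp: "0 < ?t + ?c" using t by linarith
  have wh: "w \<bullet> h = ?t * ?c" using w by (simp add: sgn_div_norm)
  have "(norm (w + h))\<^sup>2 = (?t + ?c)\<^sup>2 + ?p"
    unfolding norm_add_squared wh by (simp add: power2_sum)
  then have "norm (w + h) = sqrt ((?t + ?c)\<^sup>2 + ?p)" by (metis norm_ge_zero real_sqrt_abs abs_of_nonneg)
  also have "\<dots> \<le> sqrt ((?t + ?c)\<^sup>2) + ((?t + ?c)\<^sup>2 + ?p - (?t + ?c)\<^sup>2) / (2 * sqrt ((?t + ?c)\<^sup>2))"
    using tp p by (intro sqrt_le_tangent) auto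
  also have "\<dots> = ?t + ?c + ?p / (2 * (?t + ?c))" using tp by simp
  also have "?p / (2 * (?t + ?c)) \<le> ?p / ?t"
  proof (rule divide_left_mono[OF _ p])
    show "?t \<le> 2 * (?t + ?c)" using tc by simp
    have "0 < 2 * ((?t + ?c) * ?t)" using mult_pos_pos[OF tp t] by linarith
    then show "0 < (2 * (?t + ?c)) * ?t" by (simp only: mult.assoc)
  qed
  finally show ?thesis by simp
qed

text \<open>The square root is bounded by its tangent at the old argument. Division by
  \<open>norm w\<close> instead of \<open>V\<close> in the error makes the estimate uniform in
  \<open>b\<close>.\<close>

lemma sqrt_sum_squares_expansion:
  fixes w h :: "'a::real_inner" and b b' :: real
  assumes w: "w \<noteq> 0"
  defines "V \<equiv> sqrt ((norm w)\<^sup>2 + b\<^sup>2)"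
  shows "sqrt ((norm (w + h))\<^sup>2 + b'\<^sup>2) \<le> V + norm w / V * (sgn w \<bullet> h) + b / V * (b' - b) + ((norm h)\<^sup>2 + (b' - b)\<^sup>2) / (2 * norm w)"
proof -
  have t: "0 < norm w" using w by simp
  then have V: "norm w \<le> V" "0 < V" unfolding V_def by (auto intro: real_le_rsqrt real_sqrt_gt_zero add_pos_nonneg)
  have wh: "w \<bullet> h = norm w * (sgn w \<bullet> h)" using w by (simp add: sgn_div_norm)
  have "sqrt ((norm (w + h))\<^sup>2 + b'\<^sup>2) \<le> V + (((norm (w + h))\<^sup>2 + b'\<^sup>2) - ((norm w)\<^sup>2 + b\<^sup>2)) / (2 * V)"
    unfolding V_def using t by (intro sqrt_le_tangent) (auto intro: add_pos_nonneg)
  also have "((norm (w + h))\<^sup>2 + b'\<^sup>2) - ((norm w)\<^sup>2 + b\<^sup>2)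
      = 2 * (norm w * (sgn w \<bullet> h) + b * (b' - b)) + ((norm h)\<^sup>2 + (b' - b)\<^sup>2)"
    unfolding wh[symmetric] norm_add_squared by (simp add: power2_eq_square algebra_simps)
  also have "\<dots> / (2 * V) = norm w / V * (sgn w \<bullet> h) + b / V * (b' - b) + ((norm h)\<^sup>2 + (b' - b)\<^sup>2) / (2 * V)"
    using V by (simp add: add_divide_distrib)
  also have "((norm h)\<^sup>2 + (b' - b)\<^sup>2) / (2 * V) \<le> ((norm h)\<^sup>2 + (b' - b)\<^sup>2) / (2 * norm w)"
    using V t by (intro divide_left_mono mult_pos_pos) (linarith | simp)+
  finally show ?thesis by simp
qed

lemma powr_le_tangent:
  fixes q q' \<sigma> :: real
  assumes "0 < \<sigma>" "\<sigma> < 1" "0 < q" "0 \<le> q'"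
  shows "q' powr \<sigma> \<le> q powr \<sigma> + \<sigma> * q powr (\<sigma> - 1) * (q' - q)"
proof (cases "q' = 0")
  case True
  have "q powr (\<sigma> - 1) * q = q powr \<sigma>" using assms by (simp add: powr_diff)
  then have "\<sigma> * q powr (\<sigma> - 1) * q = \<sigma> * q powr \<sigma>" by (simp add: mult.assoc)
  also have "\<dots> \<le> 1 * q powr \<sigma>" using assms by (intro mult_right_mono) auto
  finally show ?thesis using True by simp
next
  case False
  then have q': "0 < q'" using assms by simp
  have "q' powr \<sigma> * q powr (1 - \<sigma>) \<le> \<sigma> * q' + (1 - \<sigma>) * q"
    by (rule Youngs_inequality_0) (use assms q' in auto)
  then have "q' powr \<sigma> * q powr (1 - \<sigma>) * q powr (\<sigma> - 1) \<le> (\<sigma> * q' + (1 - \<sigma>) * q) * q powr (\<sigma> - 1)"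
    by (rule mult_right_mono) simp
  moreover have "q powr (1 - \<sigma>) * q powr (\<sigma> - 1) = 1" using assms by (simp flip: powr_add)
  then have "q' powr \<sigma> * q powr (1 - \<sigma>) * q powr (\<sigma> - 1) = q' powr \<sigma>" by (simp add: mult.assoc)
  moreover have "q powr (\<sigma> - 1) * q = q powr \<sigma>" using assms by (simp add: powr_diff)
  then have "(\<sigma> * q' + (1 - \<sigma>) * q) * q powr (\<sigma> - 1) = q powr \<sigma> + \<sigma> * q powr (\<sigma> - 1) * (q' - q)"
    by (simp add: algebra_simps)
  ultimately show ?thesis by simp
qed

text \<open>On this interval \<open>(1 + s) powr (\<sigma> - 2)\<close> is at least
  \<open>1 / 4\<close>, so the power remains concave after
  \<open>\<sigma> * (1 - \<sigma>) / 8 * s\<^sup>2\<close> is added, and it lies below its tangent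
  at 0. This is the origin of the constant \<kappa> used later.\<close>

lemma one_plus_powr_le:
  fixes u \<sigma> :: real
  assumes \<sigma>: "0 < \<sigma>" "\<sigma> < 1" and u: "\<bar>u\<bar> \<le> 1 / 2"
  shows "(1 + u) powr \<sigma> \<le> 1 + \<sigma> * u - \<sigma> * (1 - \<sigma>) / 8 * u\<^sup>2"
proof -
  let ?\<kappa> = "\<sigma> * (1 - \<sigma>) / 8"
  define f where "f s = - ((1 + s) powr \<sigma>) - ?\<kappa> * s\<^sup>2" for s :: real
  define f' where "f' s = - (\<sigma> * (1 + s) powr (\<sigma> - 1)) - ?\<kappa> * (2 * s)" for s :: real
  define f'' where "f'' s = - (\<sigma> * ((\<sigma> - 1) * (1 + s) powr (\<sigma> - 1 - 1))) - ?\<kappa> * 2" for s :: real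
  let ?I = "{-1/2..1/2::real}"
  have d1: "(f has_real_derivative f' s) (at s)" if "s \<in> ?I" for s
    unfolding f_def f'_def using that by (auto intro!: derivative_eq_intros simp: power2_eq_square)
  have d2: "(f' has_real_derivative f'' s) (at s)" if "s \<in> ?I" for s
    unfolding f'_def f''_def using that by (auto intro!: derivative_eq_intros)
  have pos: "0 \<le> f'' s" if "s \<in> ?I" for s
  proof -
    have "(1/4::real) \<le> 2 powr (-2)" by (simp add: powr_minus powr_numeral)
    also have "\<dots> \<le> 2 powr (\<sigma> - 1 - 1)" using \<sigma> by (intro powr_mono) auto
    also have "\<dots> \<le> (1 + s) powr (\<sigma> - 1 - 1)" using that \<sigma> by (intro powr_mono2') auto
    finally have "\<sigma> * (1 - \<sigma>) * (1/4) \<le> \<sigma> * (1 - \<sigma>) * (1 + s) powr (\<sigma> - 1 - 1)"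
      using \<sigma> by (intro mult_left_mono) auto
    moreover have "f'' s = \<sigma> * (1 - \<sigma>) * (1 + s) powr (\<sigma> - 1 - 1) - \<sigma> * (1 - \<sigma>) * (1/4)"
      unfolding f''_def by (simp add: algebra_simps add_divide_distrib diff_divide_distrib)
    ultimately show ?thesis by linarith
  qed
  have "convex_on ?I f"
    by (rule f''_ge0_imp_convex[OF _ d1 d2 pos]) auto
  then have "f' 0 * (u - 0) \<le> f u - f 0"
    by (rule convex_on_imp_above_tangent[where A = ?I])
       (use u d1[of 0] in \<open>auto simp: abs_le_iff interior_atLeastAtMost_real intro: has_field_derivative_at_within\<close>)
  then show ?thesis by (simp add: f_def f'_def)
qed

lemma powr_plus_le:
  fixes q \<xi> \<sigma> :: real
  assumes \<sigma>: "0 < \<sigma>" "\<sigma> < 1" and q: "0 < q" and \<xi>: "\<bar>\<xi>\<bar> \<le> q / 2"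
  shows "(q + \<xi>) powr \<sigma> \<le> q powr \<sigma> + \<sigma> * q powr (\<sigma> - 1) * \<xi> - \<sigma> * (1 - \<sigma>) / 8 * q powr (\<sigma> - 2) * \<xi>\<^sup>2"
proof -
  let ?u = "\<xi> / q"
  have u: "\<bar>?u\<bar> \<le> 1 / 2" using \<xi> q by (simp add: abs_divide pos_divide_le_eq)
  have "(q + \<xi>) powr \<sigma> = (q * (1 + ?u)) powr \<sigma>" using q by (simp add: distrib_left)
  also have "\<dots> = q powr \<sigma> * (1 + ?u) powr \<sigma>" by (simp add: powr_mult)
  also have "\<dots> \<le> q powr \<sigma> * (1 + \<sigma> * ?u - \<sigma> * (1 - \<sigma>) / 8 * ?u\<^sup>2)"
    by (intro mult_left_mono one_plus_powr_le[OF \<sigma> u]) simp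
  also have "\<dots> = q powr \<sigma> + \<sigma> * (q powr \<sigma> / q) * \<xi> - \<sigma> * (1 - \<sigma>) / 8 * (q powr \<sigma> / q\<^sup>2) * \<xi>\<^sup>2"
    by (simp add: algebra_simps power_divide)
  also have "q powr \<sigma> / q = q powr (\<sigma> - 1)" using q by (simp add: powr_diff)
  also have "q powr \<sigma> / q\<^sup>2 = q powr (\<sigma> - 2)" using q by (simp add: powr_diff powr_numeral)
  finally show ?thesis .
qed

text \<open>The first-order effects of \<open>l\<close> and \<open>- l\<close> cancel and leave the
  curvature of the power as a gain; a common error \<open>e\<close> does not cancel and is paid for
  at first order.\<close>

lemma symmetric_powr_gain:
  fixes q q1 q2 l e \<sigma> :: real
  assumes \<sigma>: "0 < \<sigma>" "\<sigma> < 1" and q: "0 < q" and le: "\<bar>l\<bar> + e \<le> q / 2" and e: "0 \<le> e"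
    and q1: "0 \<le> q1" "q1 \<le> q + l + e" and q2: "0 \<le> q2" "q2 \<le> q - l + e"
  shows "q1 powr \<sigma> + q2 powr \<sigma> \<le>
    2 * q powr \<sigma> + 2 * \<sigma> * q powr (\<sigma> - 1) * e - \<sigma> * (1 - \<sigma>) / 4 * q powr (\<sigma> - 2) * l\<^sup>2"
proof -
  let ?\<kappa> = "\<sigma> * (1 - \<sigma>) / 8" and ?A = "q powr (\<sigma> - 1)" and ?D = "q powr (\<sigma> - 2)"
  have "q1 powr \<sigma> \<le> (q + (l + e)) powr \<sigma>" using q1 \<sigma> by (intro powr_mono2) auto
  also have "\<dots> \<le> q powr \<sigma> + \<sigma> * ?A * (l + e) - ?\<kappa> * ?D * (l + e)\<^sup>2"
    using le e by (intro powr_plus_le[OF \<sigma> q]) linarith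
  finally have 1: "q1 powr \<sigma> \<le> q powr \<sigma> + \<sigma> * ?A * (l + e) - ?\<kappa> * ?D * (l + e)\<^sup>2" .
  have "q2 powr \<sigma> \<le> (q + (- l + e)) powr \<sigma>" using q2 \<sigma> by (intro powr_mono2) auto
  also have "\<dots> \<le> q powr \<sigma> + \<sigma> * ?A * (- l + e) - ?\<kappa> * ?D * (- l + e)\<^sup>2"
    using le e by (intro powr_plus_le[OF \<sigma> q]) linarith
  finally have 2: "q2 powr \<sigma> \<le> q powr \<sigma> + \<sigma> * ?A * (- l + e) - ?\<kappa> * ?D * (- l + e)\<^sup>2" .
  have k: "0 \<le> ?\<kappa> * ?D" using \<sigma> by simp
  have "(l + e)\<^sup>2 + (- l + e)\<^sup>2 = 2 * l\<^sup>2 + 2 * e\<^sup>2" by (simp add: power2_eq_square algebra_simps)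
  then have "2 * l\<^sup>2 \<le> (l + e)\<^sup>2 + (- l + e)\<^sup>2" by simp
  from mult_left_mono[OF this k]
  have 3: "?\<kappa> * ?D * (2 * l\<^sup>2) \<le> ?\<kappa> * ?D * (l + e)\<^sup>2 + ?\<kappa> * ?D * (- l + e)\<^sup>2" by (simp only: distrib_left)
  have 4: "\<sigma> * ?A * (l + e) + \<sigma> * ?A * (- l + e) = 2 * \<sigma> * ?A * e" by (simp add: algebra_simps)
  have 5: "?\<kappa> * ?D * (2 * l\<^sup>2) = \<sigma> * (1 - \<sigma>) / 4 * ?D * l\<^sup>2" by simp
  show ?thesis using 1 2 3 4 5 by linarith
qed

text \<open>A distance comparable to \<open>norm (x - z)\<close>: for \<open>t = norm (x - z)\<close> the corrector \<open>sqrt (t\<^sup>2 + \<rho>\<^sup>2) - \<rho>\<close> lies between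
  \<open>0\<close> and \<open>t\<close>, and its derivative in \<open>\<rho>\<close> is close to \<open>-1\<close> where \<open>\<rho>\<close> is small compared with \<open>t\<close>.\<close>

definition qdist :: "real \<Rightarrow> (real^'n \<Rightarrow> real) \<Rightarrow> real^'n \<Rightarrow> real^'n \<Rightarrow> real" where
  "qdist a \<rho> x z = norm (x - z) +
     a * ((sqrt ((norm (x - z))\<^sup>2 + (\<rho> x)\<^sup>2) - \<rho> x) + (sqrt ((norm (x - z))\<^sup>2 + (\<rho> z)\<^sup>2) - \<rho> z))"

lemma sqrt_minus_bounds:
  fixes t b :: real
  shows "0 \<le> sqrt (t\<^sup>2 + b\<^sup>2) - b" "0 \<le> b \<Longrightarrow> 0 \<le> t \<Longrightarrow> sqrt (t\<^sup>2 + b\<^sup>2) - b \<le> t"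
proof -
  have "b \<le> \<bar>b\<bar>" by simp
  also have "\<bar>b\<bar> = sqrt (b\<^sup>2)" by simp
  also have "\<dots> \<le> sqrt (t\<^sup>2 + b\<^sup>2)" by (simp only: real_sqrt_le_iff) simp
  finally show "0 \<le> sqrt (t\<^sup>2 + b\<^sup>2) - b" by simp
  assume "0 \<le> b" "0 \<le> t"
  then show "sqrt (t\<^sup>2 + b\<^sup>2) - b \<le> t" using sqrt_sum_squares_le_sum[of t b] by simp
qed

lemma qdist_bounds:
  assumes "0 \<le> a"
  shows "norm (x - z) \<le> qdist a \<rho> x z" "0 \<le> qdist a \<rho> x z"
    "0 \<le> \<rho> x \<Longrightarrow> 0 \<le> \<rho> z \<Longrightarrow> qdist a \<rho> x z \<le> (1 + 2 * a) * norm (x - z)"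
proof -
  note s = sqrt_minus_bounds(1)[of "norm (x - z)" "\<rho> x"] sqrt_minus_bounds(1)[of "norm (x - z)" "\<rho> z"]
  show 1: "norm (x - z) \<le> qdist a \<rho> x z" using assms s by (auto simp: qdist_def intro!: mult_nonneg_nonneg)
  then show "0 \<le> qdist a \<rho> x z" using norm_ge_zero[of "x - z"] by linarith
  assume r: "0 \<le> \<rho> x" "0 \<le> \<rho> z"
  have "a * ((sqrt ((norm (x - z))\<^sup>2 + (\<rho> x)\<^sup>2) - \<rho> x) + (sqrt ((norm (x - z))\<^sup>2 + (\<rho> z)\<^sup>2) - \<rho> z))
     \<le> a * (norm (x - z) + norm (x - z))"
    using assms r by (intro mult_left_mono add_mono sqrt_minus_bounds(2)) auto
  then show "qdist a \<rho> x z \<le> (1 + 2 * a) * norm (x - z)" by (simp add: qdist_def algebra_simps)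
qed

section \<open>Expansion of the corrected distance\<close>

context boundary_chart
begin

lemma rho_diff_le:
  assumes x: "x \<in> ball z r" and y: "norm y \<le> R" and R: "R \<le> 1"
  shows "\<bar>\<rho> (x + y) - \<rho> x\<bar> \<le> 2 * L * R"
proof -
  have R0: "0 \<le> R" using y norm_ge_zero[of y] by linarith
  have "\<bar>N x \<bullet> y\<bar> \<le> norm (N x) * norm y" by (rule Cauchy_Schwarz_ineq2)
  also have "\<dots> \<le> L * R" using N_le[OF x] y L by (intro mult_mono) auto
  finally have 1: "\<bar>N x \<bullet> y\<bar> \<le> L * R" .
  have "(norm y)\<^sup>2 \<le> R * 1" unfolding power2_eq_square using y R R0 by (intro mult_mono) auto
  then have "L * (norm y)\<^sup>2 \<le> L * (R * 1)" using L by (intro mult_left_mono) auto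
  then show ?thesis using expand[of "x + y" x] 1 by simp
qed

text \<open>The partial derivative of the corrector in \<rho> is
  \<open>- (1 - \<rho> x / V)\<close>, a number between -1 and 0, so a displacement along
  \<open>N x\<close> lowers it. The displacement \<open>h\<close> of the difference is kept separate
  from the displacement \<open>y\<close> of the point, since \<open>h\<close> also involves the
  other point.\<close>

lemma corrector_expand:
  fixes w h :: "real^'n"
  assumes x: "x \<in> ball z r" "0 \<le> \<rho> x" and w: "w \<noteq> 0" "norm w \<le> 1"
    and y: "norm y \<le> R" "R \<le> 1" and h: "norm h \<le> 2 * R"
  defines "V \<equiv> sqrt ((norm w)\<^sup>2 + (\<rho> x)\<^sup>2)"
  shows "sqrt ((norm (w + h))\<^sup>2 + (\<rho> (x + y))\<^sup>2) - \<rho> (x + y)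
    \<le> V - \<rho> x + norm w / V * (sgn w \<bullet> h) - (1 - \<rho> x / V) * (N x \<bullet> y) + (2 + 2 * L\<^sup>2 + L) * R\<^sup>2 / norm w"
proof -
  let ?t = "norm w" and ?d = "\<rho> (x + y) - \<rho> x"
  have t: "0 < ?t" using w by simp
  have R0: "0 \<le> R" using y(1) norm_ge_zero[of y] by linarith
  have "\<bar>\<rho> x\<bar> \<le> V" unfolding V_def by (rule real_le_rsqrt) simp
  moreover have "0 < V" unfolding V_def using t by (intro real_sqrt_gt_zero add_pos_nonneg) auto
  ultimately have \<tau>: "0 \<le> 1 - \<rho> x / V" "1 - \<rho> x / V \<le> 1" using x(2) by auto
  have d2: "?d\<^sup>2 \<le> (2 * L * R)\<^sup>2" using rho_diff_le[OF x(1) y] L R0 by (simp add: abs_le_square_iff[symmetric])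
  have h2: "(norm h)\<^sup>2 \<le> (2 * R)\<^sup>2" using h by (intro power_mono) auto
  have "((norm h)\<^sup>2 + ?d\<^sup>2) / (2 * ?t) \<le> ((2 * R)\<^sup>2 + (2 * L * R)\<^sup>2) / (2 * ?t)"
    using d2 h2 t by (intro divide_right_mono) auto
  also have "\<dots> = (2 + 2 * L\<^sup>2) * R\<^sup>2 / ?t" using t by (simp add: field_simps power2_eq_square)
  finally have e1: "((norm h)\<^sup>2 + ?d\<^sup>2) / (2 * ?t) \<le> (2 + 2 * L\<^sup>2) * R\<^sup>2 / ?t" .
  have "(norm y)\<^sup>2 \<le> R\<^sup>2" using y by (intro power_mono) auto
  then have "L * (norm y)\<^sup>2 \<le> L * R\<^sup>2" using L by (intro mult_left_mono) auto
  then have d: "N x \<bullet> y - L * R\<^sup>2 \<le> ?d" using expand[of "x + y" x] by simp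
  have "(1 - \<rho> x / V) * (N x \<bullet> y - L * R\<^sup>2) \<le> (1 - \<rho> x / V) * ?d" by (rule mult_left_mono[OF d \<tau>(1)])
  moreover have "(1 - \<rho> x / V) * (L * R\<^sup>2) \<le> 1 * (L * R\<^sup>2)" using \<tau> L by (intro mult_right_mono) auto
  moreover have "L * R\<^sup>2 \<le> L * R\<^sup>2 / ?t"
  proof -
    have "L * R\<^sup>2 / 1 \<le> L * R\<^sup>2 / ?t" using t w(2) L by (intro divide_left_mono) auto
    then show ?thesis by simp
  qed
  ultimately have e2: "- ((1 - \<rho> x / V) * ?d) \<le> - ((1 - \<rho> x / V) * (N x \<bullet> y)) + L * R\<^sup>2 / ?t"
    by (simp add: right_diff_distrib)
  have "sqrt ((norm (w + h))\<^sup>2 + (\<rho> (x + y))\<^sup>2) \<le> V + ?t / V * (sgn w \<bullet> h) + \<rho> x / V * ?d + ((norm h)\<^sup>2 + ?d\<^sup>2) / (2 * ?t)"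
    unfolding V_def by (rule sqrt_sum_squares_expansion[OF w(1)])
  moreover have "\<rho> x / V * ?d = ?d - (1 - \<rho> x / V) * ?d" by (simp add: left_diff_distrib)
  moreover have "(2 + 2 * L\<^sup>2 + L) * R\<^sup>2 / ?t = (2 + 2 * L\<^sup>2) * R\<^sup>2 / ?t + L * R\<^sup>2 / ?t"
    by (simp add: distrib_right add_divide_distrib)
  ultimately show ?thesis using e1 e2 by linarith
qed

text \<open>The second-order part of the norm is kept in its sharp transversal form, whereas all
  errors of the two correctors carry the factor \<open>a\<close> and can be made small.\<close>

lemma qdist_expand:
  fixes x x' y y' :: "real^'n"
  assumes a: "0 \<le> a" and x: "x \<in> ball z r" "0 \<le> \<rho> x" and x': "x' \<in> ball z r" "0 \<le> \<rho> x'"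
    and ne: "x \<noteq> x'" and t1: "norm (x - x') \<le> 1"
    and y: "norm y \<le> R" "norm y' \<le> R" and R: "4 * R \<le> norm (x - x')"
  defines "t \<equiv> norm (x - x')" and "e \<equiv> sgn (x - x')" and "V \<equiv> sqrt ((norm (x - x'))\<^sup>2 + (\<rho> x)\<^sup>2)" and "V' \<equiv> sqrt ((norm (x - x'))\<^sup>2 + (\<rho> x')\<^sup>2)"
  shows "qdist a \<rho> (x + y) (x' + y') \<le> qdist a \<rho> x x' + (1 + a * (t / V + t / V')) * (e \<bullet> (y - y'))
    - a * (1 - \<rho> x / V) * (N x \<bullet> y) - a * (1 - \<rho> x' / V') * (N x' \<bullet> y')
    + ((norm (y - y'))\<^sup>2 - (e \<bullet> (y - y'))\<^sup>2) / t + a * (4 + 4 * L\<^sup>2 + 2 * L) * R\<^sup>2 / t"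
proof -
  let ?w = "x - x'" and ?h = "y - y'"
  let ?E = "(2 + 2 * L\<^sup>2 + L) * R\<^sup>2 / t" and ?S = "\<lambda>u. sqrt ((norm (?w + ?h))\<^sup>2 + (\<rho> u)\<^sup>2) - \<rho> u"
  have w: "?w \<noteq> 0" using ne by simp
  have h: "norm ?h \<le> 2 * R" using norm_triangle_ineq4[of y y'] y by linarith
  have R1: "R \<le> 1" using R t1 by linarith
  have wh: "x + y - (x' + y') = ?w + ?h" by simp
  have n: "norm (?w + ?h) \<le> t + e \<bullet> ?h + ((norm ?h)\<^sup>2 - (e \<bullet> ?h)\<^sup>2) / t"
    unfolding t_def e_def by (rule norm_le_expansion[OF w]) (use h R in linarith)
  have c1: "?S (x + y) \<le> V - \<rho> x + t / V * (e \<bullet> ?h) - (1 - \<rho> x / V) * (N x \<bullet> y) + ?E"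
    unfolding V_def t_def e_def by (rule corrector_expand[OF x w t1 y(1) R1 h])
  have c2: "?S (x' + y') \<le> V' - \<rho> x' + t / V' * (e \<bullet> ?h) - (1 - \<rho> x' / V') * (N x' \<bullet> y') + ?E"
    unfolding V'_def t_def e_def by (rule corrector_expand[OF x' w t1 y(2) R1 h])
  have "a * (?S (x + y) + ?S (x' + y')) \<le> a * ((V - \<rho> x + t / V * (e \<bullet> ?h) - (1 - \<rho> x / V) * (N x \<bullet> y) + ?E)
      + (V' - \<rho> x' + t / V' * (e \<bullet> ?h) - (1 - \<rho> x' / V') * (N x' \<bullet> y') + ?E))"
    by (intro mult_left_mono add_mono c1 c2 a)
  also have "\<dots> = a * ((V - \<rho> x) + (V' - \<rho> x')) + a * (t / V + t / V') * (e \<bullet> ?h)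
      - a * (1 - \<rho> x / V) * (N x \<bullet> y) - a * (1 - \<rho> x' / V') * (N x' \<bullet> y') + a * (2 * ?E)"
    by (simp add: algebra_simps)
  also have "a * (2 * ?E) = a * (4 + 4 * L\<^sup>2 + 2 * L) * R\<^sup>2 / t" by (simp add: algebra_simps add_divide_distrib)
  finally have q: "a * (?S (x + y) + ?S (x' + y')) \<le> a * ((V - \<rho> x) + (V' - \<rho> x')) + a * (t / V + t / V') * (e \<bullet> ?h)
      - a * (1 - \<rho> x / V) * (N x \<bullet> y) - a * (1 - \<rho> x' / V') * (N x' \<bullet> y') + a * (4 + 4 * L\<^sup>2 + 2 * L) * R\<^sup>2 / t" .
  have e1: "qdist a \<rho> (x + y) (x' + y') = norm (?w + ?h) + a * (?S (x + y) + ?S (x' + y'))"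
    unfolding qdist_def wh by simp
  have e2: "qdist a \<rho> x x' = t + a * ((V - \<rho> x) + (V' - \<rho> x'))" by (simp add: qdist_def t_def V_def V'_def)
  have e3: "(1 + a * (t / V + t / V')) * (e \<bullet> ?h) = e \<bullet> ?h + a * (t / V + t / V') * (e \<bullet> ?h)"
    by (simp add: distrib_right)
  show ?thesis unfolding e1 e2 e3 using n q by linarith
qed

text \<open>The linear part is a small perturbation of \<open>e \<bullet> (y - y')\<close>, so the
  corrector does not disturb the analysis of directions in the tug-of-war. In contrast to
  \<open>qdist_expand\<close>, here \<open>R\<close> bounds the sum of the two
  displacements.\<close>

lemma linear_part_bound:
  fixes x x' y y' :: "real^'n"
  assumes a: "0 \<le> a" and x: "x \<in> ball z r" "0 \<le> \<rho> x" and x': "x' \<in> ball z r" "0 \<le> \<rho> x'" and ne: "x \<noteq> x'"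
    and y: "norm y + norm y' \<le> R"
  defines "t \<equiv> norm (x - x')" and "e \<equiv> sgn (x - x')" and "V \<equiv> sqrt ((norm (x - x'))\<^sup>2 + (\<rho> x)\<^sup>2)" and "V' \<equiv> sqrt ((norm (x - x'))\<^sup>2 + (\<rho> x')\<^sup>2)"
  shows "\<bar>(1 + a * (t / V + t / V')) * (e \<bullet> (y - y')) - a * (1 - \<rho> x / V) * (N x \<bullet> y) - a * (1 - \<rho> x' / V') * (N x' \<bullet> y')
     - e \<bullet> (y - y')\<bar> \<le> a * (2 + L) * R"
    and "0 \<le> t / V" "t / V \<le> 1" "0 \<le> t / V'" "t / V' \<le> 1"
    and "0 \<le> 1 - \<rho> x / V" "1 - \<rho> x / V \<le> 1" "0 \<le> 1 - \<rho> x' / V'" "1 - \<rho> x' / V' \<le> 1"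
proof -
  have t0: "0 < t" using ne by (simp add: t_def)
  have V: "t \<le> V" "\<rho> x \<le> V" "t \<le> V'" "\<rho> x' \<le> V'" unfolding V_def V'_def t_def by (auto intro: real_le_rsqrt)
  have Vp: "0 < V" "0 < V'" using t0 V by auto
  show tV: "0 \<le> t / V" "t / V \<le> 1" "0 \<le> t / V'" "t / V' \<le> 1" using V Vp t0 by auto
  show \<tau>: "0 \<le> 1 - \<rho> x / V" "1 - \<rho> x / V \<le> 1" "0 \<le> 1 - \<rho> x' / V'" "1 - \<rho> x' / V' \<le> 1"
    using V Vp x x' by auto
  have R: "0 \<le> R" using y norm_ge_zero[of y] norm_ge_zero[of y'] by linarith
  have "\<bar>e \<bullet> (y - y')\<bar> \<le> norm e * norm (y - y')" by (rule Cauchy_Schwarz_ineq2)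
  also have "\<dots> \<le> 1 * R"
    using ne y norm_triangle_ineq4[of y y'] by (intro mult_mono) (auto simp: e_def norm_sgn)
  finally have c: "\<bar>e \<bullet> (y - y')\<bar> \<le> R" by simp
  have "\<bar>(t / V + t / V') * (e \<bullet> (y - y'))\<bar> \<le> 2 * R"
    unfolding abs_mult using tV c by (intro mult_mono) auto
  moreover have "\<bar>(1 - \<rho> x / V) * (N x \<bullet> y)\<bar> \<le> L * norm y"
  proof -
    have "\<bar>N x \<bullet> y\<bar> \<le> L * norm y"
      using order_trans[OF Cauchy_Schwarz_ineq2[of "N x" y] mult_right_mono[OF N_le[OF x(1)] norm_ge_zero[of y]]] .
    then have "\<bar>1 - \<rho> x / V\<bar> * \<bar>N x \<bullet> y\<bar> \<le> 1 * (L * norm y)" using \<tau> by (intro mult_mono) auto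
    then show ?thesis by (simp add: abs_mult)
  qed
  moreover have "\<bar>(1 - \<rho> x' / V') * (N x' \<bullet> y')\<bar> \<le> L * norm y'"
  proof -
    have "\<bar>N x' \<bullet> y'\<bar> \<le> L * norm y'"
      using order_trans[OF Cauchy_Schwarz_ineq2[of "N x'" y'] mult_right_mono[OF N_le[OF x'(1)] norm_ge_zero[of y']]] .
    then have "\<bar>1 - \<rho> x' / V'\<bar> * \<bar>N x' \<bullet> y'\<bar> \<le> 1 * (L * norm y')" using \<tau> by (intro mult_mono) auto
    then show ?thesis by (simp add: abs_mult)
  qed
  moreover have "L * norm y + L * norm y' \<le> L * R"
    using mult_left_mono[OF y, of L] L by (simp add: distrib_left)
  ultimately have s: "\<bar>(t / V + t / V') * (e \<bullet> (y - y')) - (1 - \<rho> x / V) * (N x \<bullet> y) - (1 - \<rho> x' / V') * (N x' \<bullet> y')\<bar> \<le> 2 * R + L * R"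
    unfolding abs_le_iff by linarith
  have eq: "(1 + a * (t / V + t / V')) * (e \<bullet> (y - y')) - a * (1 - \<rho> x / V) * (N x \<bullet> y) - a * (1 - \<rho> x' / V') * (N x' \<bullet> y')
     - e \<bullet> (y - y') = a * ((t / V + t / V') * (e \<bullet> (y - y')) - (1 - \<rho> x / V) * (N x \<bullet> y) - (1 - \<rho> x' / V') * (N x' \<bullet> y'))"
    by (simp add: algebra_simps)
  have "a * (2 * R + L * R) = a * (2 + L) * R" by (simp add: algebra_simps)
  with mult_left_mono[OF s a] show "\<bar>(1 + a * (t / V + t / V')) * (e \<bullet> (y - y')) - a * (1 - \<rho> x / V) * (N x \<bullet> y) - a * (1 - \<rho> x' / V') * (N x' \<bullet> y')
     - e \<bullet> (y - y')\<bar> \<le> a * (2 + L) * R"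
    unfolding eq abs_mult abs_of_nonneg[OF a] by simp
qed

end

text \<open>The localising term involves the first point only; the second one is held near the first
  by the power of the distance.\<close>

definition barrier :: "real \<Rightarrow> real \<Rightarrow> real \<Rightarrow> real \<Rightarrow> (real^'n \<Rightarrow> real) \<Rightarrow> real^'n \<Rightarrow> real^'n \<Rightarrow> real^'n \<Rightarrow> real" where
  "barrier \<sigma> a A B \<rho> x\<^sub>0 x z = A * qdist a \<rho> x z powr \<sigma> + B * (norm (x - x\<^sub>0))\<^sup>2"

context boundary_chart
begin

lemma tug_gain:
  fixes x x' x\<^sub>0 y y' :: "real^'n" and \<sigma> a A B :: real
  defines "\<kappa> \<equiv> \<sigma> * (1 - \<sigma>) / 8"
  defines "\<theta> \<equiv> \<kappa> / 64"
  assumes \<sigma>: "0 < \<sigma>" "\<sigma> < 1" and a: "0 < a" "a \<le> 1/4" "a * (2 + L) \<le> \<theta> / 16" "a * (4 + 4 * L\<^sup>2 + 2 * L) \<le> \<kappa> / 32"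
    and x: "x \<in> ball z r" "0 \<le> \<rho> x" and x': "x' \<in> ball z r" "0 \<le> \<rho> x'"
    and ne: "x \<noteq> x'" and t1: "norm (x - x') \<le> 1/2"
    and y: "norm y \<le> r\<^sub>1" "norm y' \<le> r\<^sub>2" and R: "16 * (r\<^sub>1 + r\<^sub>2) \<le> \<theta> * norm (x - x')"
    and s: "norm (x - x\<^sub>0) \<le> s" "r\<^sub>1 + r\<^sub>2 \<le> s"
    and B: "0 \<le> B" and A: "0 < A" "16 * B \<le> A * \<kappa>" "24 * B * s \<le> A * \<sigma> * \<theta>"
  shows "\<exists>v v'. norm v \<le> r\<^sub>1 \<and> norm v' \<le> r\<^sub>2 \<and>
    barrier \<sigma> a A B \<rho> x\<^sub>0 (x + y) (x' + y') + barrier \<sigma> a A B \<rho> x\<^sub>0 (x + v) (x' + v')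
    \<le> 2 * barrier \<sigma> a A B \<rho> x\<^sub>0 x x' - \<kappa> / 8 * A * qdist a \<rho> x x' powr (\<sigma> - 2) * (r\<^sub>1 + r\<^sub>2)\<^sup>2"
proof -
  define t where "t = norm (x - x')"
  define e where "e = sgn (x - x')"
  define V where "V = sqrt ((norm (x - x'))\<^sup>2 + (\<rho> x)\<^sup>2)"
  define V' where "V' = sqrt ((norm (x - x'))\<^sup>2 + (\<rho> x')\<^sup>2)"
  define R where "R = r\<^sub>1 + r\<^sub>2"
  define q where "q = qdist a \<rho> x x'"
  define K where "K = 4 + 4 * L\<^sup>2 + 2 * L"
  define l where "l u u' = (1 + a * (t / V + t / V')) * (e \<bullet> (u - u')) - a * (1 - \<rho> x / V) * (N x \<bullet> u) - a * (1 - \<rho> x' / V') * (N x' \<bullet> u')" for u u'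
  let ?Q = "\<lambda>u u'. qdist a \<rho> (x + u) (x' + u')" and ?D = "q powr (\<sigma> - 2)"
  have \<kappa>: "0 < \<kappa>" "\<kappa> \<le> \<sigma> / 8" "\<kappa> \<le> 1/8" using \<sigma> by (auto simp: \<kappa>_def mult_le_cancel_left2 intro: order_trans[OF mult_mono[of \<sigma> 1 "1 - \<sigma>" 1]])
  have \<theta>: "0 < \<theta>" "\<theta> \<le> 1/512" using \<kappa> by (auto simp: \<theta>_def)
  have r0: "0 \<le> r\<^sub>1" "0 \<le> r\<^sub>2" using order_trans[OF norm_ge_zero y(1)] order_trans[OF norm_ge_zero y(2)] by auto
  have R0: "0 \<le> R" using r0 by (simp add: R_def)
  have t0: "0 < t" "t \<le> 1/2" using ne t1 by (auto simp: t_def)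
  have Rt: "16 * R \<le> \<theta> * t" using R by (simp add: R_def t_def)
  have Rt': "8192 * R \<le> t"
  proof -
    have "\<theta> * t \<le> 1/512 * t" using \<theta> t0 by (intro mult_right_mono) auto
    then show ?thesis using Rt by simp
  qed
  have q: "t \<le> q" "q \<le> 3/2 * t"
  proof -
    show "t \<le> q" using qdist_bounds(1)[of a x x' \<rho>] a by (simp add: q_def t_def)
    have "q \<le> (1 + 2 * a) * t" using qdist_bounds(3)[of a \<rho> x x'] a x x' by (simp add: q_def t_def)
    also have "\<dots> \<le> 3/2 * t" using a t0 by (intro mult_right_mono) auto
    finally show "q \<le> 3/2 * t" .
  qed
  have q0: "0 < q" "q \<le> 1" using q t0 by auto
  have e1: "norm e = 1" using ne by (simp add: e_def norm_sgn)
  have aK: "0 \<le> a * K" "a * K \<le> \<kappa> / 32" using a L by (auto simp: K_def intro!: mult_nonneg_nonneg add_nonneg_nonneg)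
  have exp: "?Q u u' \<le> q + l u u' + ((norm (u - u'))\<^sup>2 - (e \<bullet> (u - u'))\<^sup>2) / t + a * K * R\<^sup>2 / t"
    if "norm u \<le> r\<^sub>1" "norm u' \<le> r\<^sub>2" for u u'
    using qdist_expand[OF less_imp_le[OF a(1)] x x' ne _ _ _, of u R u'] that r0 t0 Rt'
    unfolding l_def q_def K_def t_def e_def V_def V'_def R_def by simp
  have lin: "\<bar>l u u' - e \<bullet> (u - u')\<bar> \<le> \<theta> / 16 * R" if "norm u \<le> r\<^sub>1" "norm u' \<le> r\<^sub>2" for u u'
  proof -
    have "\<bar>l u u' - e \<bullet> (u - u')\<bar> \<le> a * (2 + L) * R"
      using linear_part_bound(1)[OF less_imp_le[OF a(1)] x x' ne, of u u' R] that
      unfolding l_def t_def e_def V_def V'_def R_def by simp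
    also have "\<dots> \<le> \<theta> / 16 * R" by (rule mult_right_mono[OF a(3) R0])
    finally show ?thesis .
  qed
  have hn: "norm (u - u') \<le> R" if "norm u \<le> r\<^sub>1" "norm u' \<le> r\<^sub>2" for u u' :: "real^'n"
    using norm_triangle_ineq4[of u u'] that by (simp add: R_def)
  have RRt: "R\<^sup>2 / t \<le> \<theta> / 16 * R"
  proof -
    have "R * R \<le> (\<theta> / 16 * t) * R" using Rt R0 by (intro mult_right_mono) auto
    then show ?thesis using t0 by (simp add: pos_divide_le_eq power2_eq_square mult_ac)
  qed
  have Q0: "0 \<le> ?Q u u'" for u u' by (rule qdist_bounds(2)[OF less_imp_le[OF a(1)]])
  have D1: "1 \<le> ?D"
  proof -
    have "1 powr (\<sigma> - 2) \<le> q powr (\<sigma> - 2)" using q0 \<sigma> by (intro powr_mono2') auto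
    then show ?thesis by simp
  qed
  have qD: "q powr (\<sigma> - 1) = ?D * q"
  proof -
    have "q powr (\<sigma> - 1) = q powr (\<sigma> - 2 + 1)" by simp
    also have "\<dots> = ?D * q powr 1" by (rule powr_add)
    also have "q powr 1 = q" using q0 by simp
    finally show ?thesis .
  qed
  have sq: "(norm (x + u - x\<^sub>0))\<^sup>2 = (norm (x - x\<^sub>0))\<^sup>2 + 2 * ((x - x\<^sub>0) \<bullet> u) + (norm u)\<^sup>2" for u
    using norm_add_squared[of "x - x\<^sub>0" u] by (simp add: algebra_simps)
  show ?thesis
  proof (cases "(1 - \<theta>) * R \<le> e \<bullet> (y - y')")
    case True
    let ?c = "e \<bullet> (y - y')"
    \<comment> \<open>The common error of the two opposite moves: the first part is transversal and
      limited by the alignment, the second comes from the corrector. It costs at most half of the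
      concavity gain with factor \<open>\<kappa> / 2\<close>, and the localising term costs half of
      the remainder.\<close>
    define E where "E = (2 * \<theta> + a * K) * R\<^sup>2 / t"
    have E0: "0 \<le> E" using \<theta> aK t0 by (simp add: E_def)
    have my: "norm (- y) \<le> r\<^sub>1" "norm (- y') \<le> r\<^sub>2" using y by auto
    have "((1 - \<theta>) * R)\<^sup>2 \<le> ?c\<^sup>2" using True \<theta> R0 by (intro power_mono) auto
    moreover have "(norm (y - y'))\<^sup>2 \<le> R\<^sup>2" using hn[OF y] by (intro power_mono) auto
    moreover have "R\<^sup>2 - ((1 - \<theta>) * R)\<^sup>2 = 2 * \<theta> * R\<^sup>2 - (\<theta> * R)\<^sup>2" by (simp add: power2_eq_square algebra_simps)
    then have "R\<^sup>2 - ((1 - \<theta>) * R)\<^sup>2 \<le> 2 * \<theta> * R\<^sup>2" using zero_le_power2[of "\<theta> * R"] by linarith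
    ultimately have "(norm (y - y'))\<^sup>2 - ?c\<^sup>2 \<le> 2 * \<theta> * R\<^sup>2" by linarith
    then have "((norm (y - y'))\<^sup>2 - ?c\<^sup>2) / t \<le> 2 * \<theta> * R\<^sup>2 / t" using t0 by (intro divide_right_mono) auto
    then have Ey: "((norm (y - y'))\<^sup>2 - ?c\<^sup>2) / t + a * K * R\<^sup>2 / t \<le> E"
      by (simp add: E_def distrib_right add_divide_distrib)
    have q1: "?Q y y' \<le> q + l y y' + E" using exp[OF y] Ey by linarith
    have nn: "norm (- y - - y') = norm (y - y')" "e \<bullet> (- y - - y') = - ?c"
      using norm_minus_commute[of y y'] by (auto simp: inner_diff_right)
    have ln: "l (- y) (- y') = - l y y'"
      unfolding l_def nn(2) inner_minus_right by (simp add: algebra_simps)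
    have q2: "?Q (- y) (- y') \<le> q - l y y' + E"
      using exp[OF my, unfolded nn ln power2_minus] Ey by linarith
    have l1: "R / 2 \<le> l y y'" "\<bar>l y y'\<bar> \<le> 2 * R"
    proof -
      have "\<theta> * R \<le> 1/512 * R" using \<theta> R0 by (intro mult_right_mono) auto
      moreover have "\<bar>?c\<bar> \<le> R"
        using Cauchy_Schwarz_ineq2[of e "y - y'"] e1 hn[OF y] by simp
      ultimately show "R / 2 \<le> l y y'" "\<bar>l y y'\<bar> \<le> 2 * R"
        using lin[OF y] True R0 unfolding abs_le_iff left_diff_distrib by linarith+
    qed
    have E1: "E \<le> R"
    proof -
      have "E = (2 * \<theta> + a * K) * (R\<^sup>2 / t)" by (simp add: E_def)
      also have "\<dots> \<le> 1 * (\<theta> / 16 * R)" using RRt \<theta> aK \<kappa> t0 by (intro mult_mono) auto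
      also have "\<dots> \<le> R" using mult_right_mono[OF \<theta>(2) R0] R0 by linarith
      finally show ?thesis .
    qed
    have "?Q y y' powr \<sigma> + ?Q (- y) (- y') powr \<sigma> \<le>
        2 * q powr \<sigma> + 2 * \<sigma> * q powr (\<sigma> - 1) * E - \<sigma> * (1 - \<sigma>) / 4 * ?D * (l y y')\<^sup>2"
      by (rule symmetric_powr_gain[OF \<sigma> q0(1) _ E0 Q0 q1 Q0 q2]) (use l1 E1 Rt' q R0 in linarith)
    moreover have "2 * \<sigma> * q powr (\<sigma> - 1) * E \<le> \<kappa> / 4 * ?D * R\<^sup>2"
    proof -
      have "q * E = (2 * \<theta> + a * K) * R\<^sup>2 * (q / t)" by (simp add: E_def)
      also have "\<dots> \<le> (2 * \<theta> + a * K) * R\<^sup>2 * 2"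
        using q t0 \<theta> aK by (intro mult_left_mono) (auto simp: pos_divide_le_eq)
      also have "\<dots> \<le> (\<kappa> / 16) * R\<^sup>2 * 2" using aK by (intro mult_right_mono) (auto simp: \<theta>_def)
      finally have qE: "q * E \<le> \<kappa> / 8 * R\<^sup>2" by simp
      have "2 * \<sigma> * q powr (\<sigma> - 1) * E = 2 * \<sigma> * ?D * (q * E)" by (simp add: qD)
      also have "\<dots> \<le> 2 * \<sigma> * ?D * (\<kappa> / 8 * R\<^sup>2)" using \<sigma> by (intro mult_left_mono qE) auto
      also have "\<dots> \<le> 2 * 1 * ?D * (\<kappa> / 8 * R\<^sup>2)" using \<sigma> \<kappa> by (intro mult_right_mono) auto
      finally show ?thesis by (simp add: mult_ac)
    qed
    moreover have "\<kappa> / 2 * ?D * R\<^sup>2 \<le> \<sigma> * (1 - \<sigma>) / 4 * ?D * (l y y')\<^sup>2"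
    proof -
      have "(R / 2)\<^sup>2 \<le> (l y y')\<^sup>2" using l1 R0 by (intro power_mono) auto
      then have "2 * \<kappa> * ?D * (R / 2)\<^sup>2 \<le> 2 * \<kappa> * ?D * (l y y')\<^sup>2" using \<kappa> by (intro mult_left_mono) auto
      then show ?thesis by (simp add: \<kappa>_def power_divide)
    qed
    ultimately have "?Q y y' powr \<sigma> + ?Q (- y) (- y') powr \<sigma> \<le> 2 * q powr \<sigma> - \<kappa> / 4 * ?D * R\<^sup>2" by linarith
    then have main: "A * (?Q y y' powr \<sigma> + ?Q (- y) (- y') powr \<sigma>) \<le> A * (2 * q powr \<sigma> - \<kappa> / 4 * ?D * R\<^sup>2)"
      using A by (intro mult_left_mono) auto
    have "(norm y)\<^sup>2 \<le> R\<^sup>2" using y r0 by (intro power_mono) (auto simp: R_def)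
    then have "2 * B * (norm y)\<^sup>2 \<le> 2 * B * R\<^sup>2" using B by (intro mult_left_mono) auto
    also have "\<dots> \<le> A * \<kappa> / 8 * R\<^sup>2" using A by (intro mult_right_mono) auto
    also have "\<dots> \<le> A * \<kappa> / 8 * R\<^sup>2 * ?D"
      using mult_left_mono[OF D1, of "A * \<kappa> / 8 * R\<^sup>2"] A \<kappa> by simp
    finally have by': "2 * B * (norm y)\<^sup>2 \<le> \<kappa> / 8 * A * ?D * R\<^sup>2" by (simp add: mult_ac)
    have "barrier \<sigma> a A B \<rho> x\<^sub>0 (x + y) (x' + y') + barrier \<sigma> a A B \<rho> x\<^sub>0 (x + - y) (x' + - y')
      = A * (?Q y y' powr \<sigma> + ?Q (- y) (- y') powr \<sigma>) + 2 * (B * (norm (x - x\<^sub>0))\<^sup>2) + 2 * B * (norm y)\<^sup>2"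
      unfolding barrier_def sq by (simp add: algebra_simps)
    also have "\<dots> \<le> A * (2 * q powr \<sigma> - \<kappa> / 4 * ?D * R\<^sup>2) + 2 * (B * (norm (x - x\<^sub>0))\<^sup>2) + \<kappa> / 8 * A * ?D * R\<^sup>2"
      using main by' by linarith
    also have "\<dots> = 2 * barrier \<sigma> a A B \<rho> x\<^sub>0 x x' - \<kappa> / 8 * A * ?D * R\<^sup>2"
      unfolding barrier_def q_def by (simp add: algebra_simps)
    finally show ?thesis using my unfolding q_def R_def by blast
  next
    case False
    let ?c = "e \<bullet> (y - y')"
    \<comment> \<open>Both points move straight towards each other as far as possible. The
      difference moves along \<open>e\<close>, so the second-order part of the norm vanishes, and
      the full decrease \<open>R\<close> outweighs the increase of the given move, which is less
      than \<open>(1 - \<theta>) * R\<close> up to small errors.\<close>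
    define v v' where "v = - r\<^sub>1 *\<^sub>R e" and "v' = r\<^sub>2 *\<^sub>R e"
    have v: "norm v \<le> r\<^sub>1" "norm v' \<le> r\<^sub>2" using e1 r0 by (auto simp: v_def v'_def)
    have vv: "v - v' = - R *\<^sub>R e" by (simp add: v_def v'_def R_def algebra_simps)
    have vn: "(norm (v - v'))\<^sup>2 - (e \<bullet> (v - v'))\<^sup>2 = 0" "e \<bullet> (v - v') = - R"
      using e1 unfolding vv by (auto simp: power2_norm_eq_inner[symmetric] power2_eq_square)
    have q1: "?Q y y' - q \<le> l y y' + R\<^sup>2 / t + a * K * R\<^sup>2 / t"
    proof -
      have "(norm (y - y'))\<^sup>2 \<le> R\<^sup>2" using hn[OF y] by (intro power_mono) auto
      then have "(norm (y - y'))\<^sup>2 - ?c\<^sup>2 \<le> R\<^sup>2" using zero_le_power2[of ?c] by linarith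
      then have "((norm (y - y'))\<^sup>2 - ?c\<^sup>2) / t \<le> R\<^sup>2 / t" using t0 by (intro divide_right_mono) auto
      then show ?thesis using exp[OF y] by linarith
    qed
    have q2: "?Q v v' - q \<le> l v v' + a * K * R\<^sup>2 / t" using exp[OF v] vn by simp
    have aKR: "a * K * R\<^sup>2 / t \<le> 1/2 * (R\<^sup>2 / t)"
    proof -
      have "a * K * (R\<^sup>2 / t) \<le> 1/2 * (R\<^sup>2 / t)" using aK \<kappa> t0 by (intro mult_right_mono) auto
      then show ?thesis by simp
    qed
    \<comment> \<open>The misalignment leaves \<open>- \<theta> * R\<close>. The two linear errors,
      the transversal term and the two corrector errors together take at most a quarter of
      it.\<close>
    have sum: "(?Q y y' - q) + (?Q v v' - q) \<le> - (\<theta> / 2 * R)"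
    proof -
      have "0 \<le> \<theta> * R" using \<theta> R0 by simp
      moreover have "?c < R - \<theta> * R" using False by (simp add: left_diff_distrib)
      moreover have "R\<^sup>2 / t \<le> \<theta> * R / 16" using RRt by simp
      moreover have "l y y' - ?c \<le> \<theta> * R / 16" "l v v' - - R \<le> \<theta> * R / 16"
        using abs_le_D1[OF lin[OF y]] abs_le_D1[OF lin[OF v]] unfolding vn(2) by simp_all
      moreover have "Q1 + Q2 \<le> - (k / 2)"
        if "0 \<le> k" "c < r - k" "p \<le> k / 16" "l1 - c \<le> k / 16" "l2 - - r \<le> k / 16"
          "Q1 \<le> l1 + p + p'" "Q2 \<le> l2 + p'" "p' \<le> 1/2 * p" for Q1 Q2 k c r p p' l1 l2 :: real
        using that by linarith
      ultimately have "(?Q y y' - q) + (?Q v v' - q) \<le> - (\<theta> * R / 2)" using q1 q2 aKR by blast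
      then show ?thesis by simp
    qed
    have A1: "0 \<le> \<sigma> * q powr (\<sigma> - 1)" using \<sigma> by simp
    have "?Q y y' powr \<sigma> + ?Q v v' powr \<sigma> \<le> 2 * q powr \<sigma> + \<sigma> * q powr (\<sigma> - 1) * ((?Q y y' - q) + (?Q v v' - q))"
      using powr_le_tangent[OF \<sigma> q0(1) Q0[of y y']] powr_le_tangent[OF \<sigma> q0(1) Q0[of v v']]
      unfolding distrib_left by linarith
    also have "\<dots> \<le> 2 * q powr \<sigma> + \<sigma> * q powr (\<sigma> - 1) * (- (\<theta> / 2 * R))"
      using mult_left_mono[OF sum A1] by linarith
    finally have "?Q y y' powr \<sigma> + ?Q v v' powr \<sigma> \<le> 2 * q powr \<sigma> - \<sigma> * \<theta> / 2 * q powr (\<sigma> - 1) * R" by (simp add: mult_ac)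
    then have main: "A * (?Q y y' powr \<sigma> + ?Q v v' powr \<sigma>) \<le> A * (2 * q powr \<sigma> - \<sigma> * \<theta> / 2 * q powr (\<sigma> - 1) * R)"
      using A by (intro mult_left_mono) auto
    have sqb: "(norm (x + u - x\<^sub>0))\<^sup>2 \<le> (norm (x - x\<^sub>0))\<^sup>2 + 3 * s * R" if "norm u \<le> R" for u
    proof -
      have "(x - x\<^sub>0) \<bullet> u \<le> norm (x - x\<^sub>0) * norm u" by (rule norm_cauchy_schwarz)
      also have "\<dots> \<le> s * R" using s that R0 order_trans[OF norm_ge_zero s(1)] by (intro mult_mono) auto
      finally have 1: "(x - x\<^sub>0) \<bullet> u \<le> s * R" .
      have "(norm u)\<^sup>2 \<le> s * R" unfolding power2_eq_square using that s R0 by (intro mult_mono) (auto simp: R_def)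
      then show ?thesis unfolding sq using 1 by simp
    qed
    have yR: "norm y \<le> R" "norm v \<le> R" using y v r0 by (auto simp: R_def)
    have "B * ((norm (x + y - x\<^sub>0))\<^sup>2 + (norm (x + v - x\<^sub>0))\<^sup>2) \<le> B * (2 * (norm (x - x\<^sub>0))\<^sup>2 + 6 * s * R)"
      using sqb[OF yR(1)] sqb[OF yR(2)] B by (intro mult_left_mono) auto
    moreover have "B * (6 * s * R) \<le> A * \<sigma> * \<theta> / 4 * R"
      using mult_right_mono[OF A(3) R0] by simp
    moreover have "A * \<sigma> * \<theta> / 4 * R \<le> A * \<sigma> * \<theta> / 4 * R * q powr (\<sigma> - 1)"
    proof -
      have "1 powr (\<sigma> - 1) \<le> q powr (\<sigma> - 1)" using q0 \<sigma> by (intro powr_mono2') auto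
      then have "A * \<sigma> * \<theta> / 4 * R * 1 \<le> A * \<sigma> * \<theta> / 4 * R * q powr (\<sigma> - 1)"
        using A \<sigma> \<theta> R0 by (intro mult_left_mono) auto
      then show ?thesis by simp
    qed
    \<comment> \<open>The first-order gain is converted into the second-order form claimed; this
      uses \<open>16 * R \<le> \<theta> * t\<close>.\<close>
    moreover have "\<kappa> / 8 * A * ?D * R\<^sup>2 \<le> A * \<sigma> * \<theta> / 4 * R * q powr (\<sigma> - 1)"
    proof -
      have "\<kappa> / 8 * R \<le> \<sigma> * \<theta> / 4 * q"
      proof -
        have "\<kappa> / 8 * R \<le> \<sigma> / 64 * R" using \<kappa> R0 by (intro mult_right_mono) auto
        also have "\<dots> \<le> \<sigma> / 4 * (16 * R)" using \<sigma> R0 by simp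
        also have "\<dots> \<le> \<sigma> / 4 * (\<theta> * t)" using Rt \<sigma> by (intro mult_left_mono) auto
        also have "\<dots> \<le> \<sigma> / 4 * (\<theta> * q)" using q \<sigma> \<theta> by (intro mult_left_mono) auto
        finally show ?thesis by simp
      qed
      then have "A * R * ?D * (\<kappa> / 8 * R) \<le> A * R * ?D * (\<sigma> * \<theta> / 4 * q)"
        using A R0 by (intro mult_left_mono) auto
      then show ?thesis by (simp add: qD power2_eq_square mult_ac)
    qed
    moreover have "barrier \<sigma> a A B \<rho> x\<^sub>0 (x + y) (x' + y') + barrier \<sigma> a A B \<rho> x\<^sub>0 (x + v) (x' + v')
      = A * (?Q y y' powr \<sigma> + ?Q v v' powr \<sigma>) + B * ((norm (x + y - x\<^sub>0))\<^sup>2 + (norm (x + v - x\<^sub>0))\<^sup>2)"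
      unfolding barrier_def by (simp add: algebra_simps)
    moreover have "2 * barrier \<sigma> a A B \<rho> x\<^sub>0 x x' = A * (2 * q powr \<sigma>) + B * (2 * (norm (x - x\<^sub>0))\<^sup>2)"
      unfolding barrier_def q_def by (simp add: algebra_simps)
    ultimately have "barrier \<sigma> a A B \<rho> x\<^sub>0 (x + y) (x' + y') + barrier \<sigma> a A B \<rho> x\<^sub>0 (x + v) (x' + v')
        \<le> 2 * barrier \<sigma> a A B \<rho> x\<^sub>0 x x' - \<kappa> / 8 * A * ?D * R\<^sup>2"
      using main by (simp add: right_diff_distrib distrib_left mult_ac)
    then show ?thesis using v unfolding q_def R_def by blast
  qed
qed

end

section \<open>Pairs at a distance large compared with the step size\<close>

lemma lmeasurable_translation_preimage:
  fixes A :: "'a::euclidean_space set"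
  assumes "A \<in> lmeasurable"
  shows "{h. a + h \<in> A} \<in> lmeasurable" "measure lebesgue {h. a + h \<in> A} = measure lebesgue A"
proof -
  have eq: "{h. a + h \<in> A} = (+) (- a) ` A" by (force simp: image_iff)
  show "{h. a + h \<in> A} \<in> lmeasurable" unfolding eq by (rule measurable_translation[OF assms])
  show "measure lebesgue {h. a + h \<in> A} = measure lebesgue A" unfolding eq by (rule measure_translation)
qed

lemma avg_translation:
  fixes A :: "'a::euclidean_space set"
  assumes "A \<in> lmeasurable" "set_integrable lebesgue A f"
  shows "avg {h. a + h \<in> A} (\<lambda>h. f (a + h)) = avg A f"
  by (simp add: avg_def set_integral_translation[OF assms(2)] lmeasurable_translation_preimage[OF assms(1)])

lemma set_integrable_bounded_measurable:
  fixes v :: "'a::euclidean_space \<Rightarrow> real"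
  assumes v: "v \<in> borel_measurable (lebesgue_on S)" and b: "\<And>y. y \<in> S \<Longrightarrow> \<bar>v y\<bar> \<le> M"
    and S: "S \<in> sets lebesgue" and A: "A \<in> lmeasurable" "A \<subseteq> S"
  shows "set_integrable lebesgue A v"
proof -
  have "set_integrable lebesgue A (\<lambda>_. M)" by (rule set_integrable_const_lmeasurable[OF A(1)])
  then show ?thesis
  proof (rule set_integrable_bound)
    have "v \<in> borel_measurable (lebesgue_on A)" by (rule measurable_restrict_mono[OF v A(2)])
    then show "set_borel_measurable lebesgue A v"
      unfolding set_borel_measurable_def using A by (subst (asm) borel_measurable_restrict_space_iff) auto
    show "AE x in lebesgue. x \<in> A \<longrightarrow> norm (v x) \<le> norm M"
      using b A(2) by (intro always_eventually) force
  qed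
qed

lemma avg_abs_le:
  assumes "set_integrable lebesgue A f" "A \<in> lmeasurable" "\<And>y. y \<in> A \<Longrightarrow> \<bar>f y\<bar> \<le> b" "0 \<le> b"
  shows "\<bar>avg A f\<bar> \<le> b"
proof (cases "measure lebesgue A = 0")
  case True
  then show ?thesis using assms(4) by (simp add: avg_def)
next
  case False
  then have pos: "0 < measure lebesgue A" using measure_nonneg[of lebesgue A] by linarith
  have "avg A f \<le> b" by (rule avg_le[OF assms(1,2) pos]) (use assms(3) in \<open>auto simp: abs_le_iff\<close>)
  moreover have "(- b) * measure lebesgue A \<le> (LINT y:A|lebesgue. f y)"
    by (rule set_integral_ge_const[OF assms(1,2)]) (use assms(3) in \<open>force simp: abs_le_iff\<close>)
  then have "- b \<le> avg A f" using pos by (simp add: avg_def pos_le_divide_eq)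
  ultimately show ?thesis by simp
qed

text \<open>The datum is bounded only at points closer than \<epsilon> to the boundary: elsewhere
  its weight is 0, and these are the points at which an essential supremum over the strip controls a
  continuous function pointwise.\<close>

locale normalized_dpp =
  fixes \<Omega> :: "(real^'n) set" and \<alpha> \<gamma> \<epsilon> :: real and G u :: "real^'n \<Rightarrow> real"
  assumes open_\<Omega>: "open \<Omega>" and front: "frontier \<Omega> \<noteq> {}"
    and \<alpha>: "0 < \<alpha>" "\<alpha> < 1" and \<gamma>: "0 < \<gamma>" and \<epsilon>: "0 < \<epsilon>"
    and sol: "dpp_solution \<Omega> \<alpha> \<gamma> \<epsilon> G u"
    and u1: "\<And>x. x \<in> closure \<Omega> \<Longrightarrow> \<bar>u x\<bar> \<le> 1"
    and G1: "\<And>x. x \<in> closure \<Omega> \<Longrightarrow> bdist \<Omega> x < \<epsilon> \<Longrightarrow> \<bar>G x\<bar> \<le> 1"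
begin

definition tug_radius :: "real^'n \<Rightarrow> real" where
  "tug_radius x = \<epsilon> * dcut' \<Omega> \<epsilon> x"

lemma tug_radius_eq: "tug_radius x = min (\<epsilon> / 2) (bdist \<Omega> x)"
  using \<epsilon> by (simp add: tug_radius_def dcut'_def min_mult_distrib_left)

lemma tug_radius: "0 \<le> tug_radius x" "tug_radius x \<le> bdist \<Omega> x" "tug_radius x \<le> \<epsilon> / 2"
  using \<epsilon> bdist_nonneg[of \<Omega> x] by (auto simp: tug_radius_eq)

lemma tug_ball: "x \<in> closure \<Omega> \<Longrightarrow> cball x (tug_radius x) \<subseteq> closure \<Omega>"
  by (rule cball_bdist_subset[OF open_\<Omega> front _ tug_radius(2)])

lemma u_integrable: "set_integrable lebesgue (step_set \<Omega> \<epsilon> x) u"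
proof (rule set_integrable_bounded_measurable[where S = "closure \<Omega>"])
  show "u \<in> borel_measurable (lebesgue_on (closure \<Omega>))" using sol by (simp add: dpp_solution_def)
  show "step_set \<Omega> \<epsilon> x \<subseteq> closure \<Omega>" using closure_subset by (auto simp: step_set_def)
qed (auto intro: u1 step_set_lmeasurable[OF open_\<Omega>])

text \<open>The hypothesis replaces optimal moves. For every pair \<open>y\<close>,
  \<open>y'\<close> the answer gives \<open>u y - u y' \<le> P - (In x - Su z)\<close>; the supremum
  over \<open>y\<close> and the infimum over \<open>y'\<close> then bound the difference of the
  tug-of-war parts by \<open>P\<close>.\<close>

lemma dpp_diff:
  assumes x: "x \<in> closure \<Omega>" and z: "z \<in> closure \<Omega>"
    and P: "\<And>y y'. y \<in> cball x (tug_radius x) \<Longrightarrow> y' \<in> cball z (tug_radius z) \<Longrightarrow>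
      \<exists>w\<in>cball x (tug_radius x). \<exists>w'\<in>cball z (tug_radius z). (u y - u y') + (u w - u w') \<le> P"
  shows "u x - u z \<le> \<alpha> / 2 * P + (1 - \<alpha>) * (avg (step_set \<Omega> \<epsilon> x) u - avg (step_set \<Omega> \<epsilon> z) u)
    + 2 * (1 - \<alpha>) * \<gamma> * (s_eps \<Omega> \<epsilon> x + s_eps \<Omega> \<epsilon> z)"
proof -
  define Su where "Su x = (SUP y\<in>cball x (tug_radius x). u y)" for x
  define In where "In x = (INF y\<in>cball x (tug_radius x). u y)" for x
  define X where "X x = \<alpha> / 2 * (Su x + In x) + (1 - \<alpha>) * avg (step_set \<Omega> \<epsilon> x) u" for x
  define k where "k x = (1 - \<alpha>) * \<gamma> * s_eps \<Omega> \<epsilon> x" for x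
  have bd: "bdd_above (u ` cball x (tug_radius x))" "bdd_below (u ` cball x (tug_radius x))" if "x \<in> closure \<Omega>" for x
    using u1 tug_ball[OF that] by (auto intro!: bdd_aboveI[of _ 1] bdd_belowI[of _ "-1"] simp: abs_le_iff)
  have ne: "cball x (tug_radius x) \<noteq> {}" for x using tug_radius(1)[of x] by simp
  have Su: "u y \<le> Su x" "In x \<le> u y" if "x \<in> closure \<Omega>" "y \<in> cball x (tug_radius x)" for x y
    unfolding Su_def In_def using that bd by (auto intro: cSUP_upper cINF_lower)
  have X1: "\<bar>X x\<bar> \<le> 1" if "x \<in> closure \<Omega>" for x
  proof -
    have ub: "\<bar>u y\<bar> \<le> 1" if "y \<in> cball x (tug_radius x)" for y
      using that \<open>x \<in> closure \<Omega>\<close> tug_ball u1 by blast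
    have "Su x \<le> 1" unfolding Su_def by (rule cSUP_least[OF ne]) (use ub in \<open>auto simp: abs_le_iff\<close>)
    moreover have "-1 \<le> In x" unfolding In_def by (rule cINF_greatest[OF ne]) (use ub in \<open>force simp: abs_le_iff\<close>)
    moreover have "In x \<le> u x" "u x \<le> Su x" using Su[OF that, of x] tug_radius(1) by auto
    ultimately have si: "\<bar>Su x + In x\<bar> \<le> 2" using u1[OF that] by (simp add: abs_le_iff)
    have av: "\<bar>avg (step_set \<Omega> \<epsilon> x) u\<bar> \<le> 1"
      by (rule avg_abs_le[OF u_integrable step_set_lmeasurable[OF open_\<Omega>]])
         (use u1 closure_subset in \<open>auto simp: step_set_def\<close>)
    have "\<bar>X x\<bar> \<le> \<bar>\<alpha> / 2 * (Su x + In x)\<bar> + \<bar>(1 - \<alpha>) * avg (step_set \<Omega> \<epsilon> x) u\<bar>"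
      unfolding X_def by (rule abs_triangle_ineq)
    also have "\<dots> \<le> \<alpha> / 2 * 2 + (1 - \<alpha>) * 1"
      unfolding abs_mult using \<alpha> si av by (intro add_mono mult_mono) auto
    finally show ?thesis by simp
  qed
  have eq: "u x = (1 - k x) * X x + k x * G x" if "x \<in> closure \<Omega>" for x
    using sol that unfolding dpp_solution_def X_def k_def Su_def In_def tug_radius_def avg_def step_set_def
    by (simp add: mult.assoc)
  \<comment> \<open>The value without killing and the datum are both bounded by 1, so killing with
    weight \<open>k x\<close> changes the value by at most twice that weight.\<close>
  have dev: "\<bar>u x - X x\<bar> \<le> 2 * k x" if "x \<in> closure \<Omega>" for x
  proof (cases "bdist \<Omega> x < \<epsilon>")
    case True
    have k0: "0 \<le> k x" using \<alpha> \<gamma> s_eps_nonneg[of \<epsilon> \<Omega> x] \<epsilon> by (simp add: k_def)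
    have "u x - X x = k x * (G x - X x)" by (simp add: eq[OF that] algebra_simps)
    moreover have "\<bar>G x - X x\<bar> \<le> 2" using X1[OF that] G1[OF that True] by (simp add: abs_le_iff)
    ultimately show ?thesis using mult_left_mono[of "\<bar>G x - X x\<bar>" 2 "k x"] k0 by (simp add: abs_mult)
  next
    case False
    then have "k x = 0" using s_eps_eq_0[OF \<epsilon>, of \<Omega> x] by (simp add: k_def)
    then show ?thesis using eq[OF that] by simp
  qed
  have "Su x + In x - Su z - In z \<le> P"
  proof -
    have "u y \<le> P - (In x - Su z) + u y'" if y: "y \<in> cball x (tug_radius x)" "y' \<in> cball z (tug_radius z)" for y y'
    proof -
      obtain w w' where "w \<in> cball x (tug_radius x)" "w' \<in> cball z (tug_radius z)" "(u y - u y') + (u w - u w') \<le> P"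
        using P[OF y] by blast
      then show ?thesis using Su(2)[OF x, of w] Su(1)[OF z, of w'] by linarith
    qed
    then have "Su x \<le> P - (In x - Su z) + u y'" if "y' \<in> cball z (tug_radius z)" for y'
      unfolding Su_def[of x] using that by (intro cSUP_least[OF ne]) auto
    then have "Su x - P + (In x - Su z) \<le> In z"
      unfolding In_def[of z] by (intro cINF_greatest[OF ne]) force
    then show ?thesis by linarith
  qed
  then have "\<alpha> / 2 * (Su x + In x - Su z - In z) \<le> \<alpha> / 2 * P" using \<alpha> by (intro mult_left_mono) auto
  moreover have "X x - X z = \<alpha> / 2 * (Su x + In x - Su z - In z) + (1 - \<alpha>) * (avg (step_set \<Omega> \<epsilon> x) u - avg (step_set \<Omega> \<epsilon> z) u)"
    by (simp add: X_def algebra_simps)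
  moreover have "2 * k x + 2 * k z = 2 * (1 - \<alpha>) * \<gamma> * (s_eps \<Omega> \<epsilon> x + s_eps \<Omega> \<epsilon> z)"
    by (simp add: k_def algebra_simps)
  ultimately show ?thesis using dev[OF x] dev[OF z] by (simp add: abs_le_iff)
qed

end

section \<open>One step of the equation compared with the barrier\<close>

context boundary_chart
begin

text \<open>The linear part is written with separate coefficient vectors for \<open>y\<close> and
  \<open>y'\<close>, because averages over the two different step sets see them only through the two
  drifts. For the noise, the tangent bound for the power is enough.\<close>

lemma barrier_expand:
  fixes x x' x\<^sub>0 y y' :: "real^'n" and \<sigma> a A B :: real
  assumes \<sigma>: "0 < \<sigma>" "\<sigma> < 1" and a: "0 \<le> a" and A: "0 \<le> A" and B: "0 \<le> B"
    and x: "x \<in> ball z r" "0 \<le> \<rho> x" and x': "x' \<in> ball z r" "0 \<le> \<rho> x'"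
    and ne: "x \<noteq> x'" and t1: "norm (x - x') \<le> 1"
    and y: "norm y \<le> R" "norm y' \<le> R" and R: "4 * R \<le> norm (x - x')"
  defines "t \<equiv> norm (x - x')" and "e \<equiv> sgn (x - x')" and "V \<equiv> sqrt ((norm (x - x'))\<^sup>2 + (\<rho> x)\<^sup>2)" and "V' \<equiv> sqrt ((norm (x - x'))\<^sup>2 + (\<rho> x')\<^sup>2)"
  defines "X \<equiv> A * \<sigma> * qdist a \<rho> x x' powr (\<sigma> - 1)"
  shows "barrier \<sigma> a A B \<rho> x\<^sub>0 (x + y) (x' + y') \<le> barrier \<sigma> a A B \<rho> x\<^sub>0 x x'
    + (X *\<^sub>R ((1 + a * (t / V + t / V')) *\<^sub>R e - (a * (1 - \<rho> x / V)) *\<^sub>R N x) + (2 * B) *\<^sub>R (x - x\<^sub>0)) \<bullet> y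
    + (X *\<^sub>R ((1 + a * (t / V + t / V')) *\<^sub>R (- e) - (a * (1 - \<rho> x' / V')) *\<^sub>R N x')) \<bullet> y'
    + X * (((norm (y - y'))\<^sup>2 - (e \<bullet> (y - y'))\<^sup>2) / t + a * (4 + 4 * L\<^sup>2 + 2 * L) * R\<^sup>2 / t) + B * R\<^sup>2"
proof -
  let ?q = "qdist a \<rho> x x'" and ?q' = "qdist a \<rho> (x + y) (x' + y')"
  define l where "l = (1 + a * (t / V + t / V')) * (e \<bullet> (y - y')) - a * (1 - \<rho> x / V) * (N x \<bullet> y) - a * (1 - \<rho> x' / V') * (N x' \<bullet> y')"
  define E where "E = ((norm (y - y'))\<^sup>2 - (e \<bullet> (y - y'))\<^sup>2) / t + a * (4 + 4 * L\<^sup>2 + 2 * L) * R\<^sup>2 / t"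
  have t0: "0 < norm (x - x')" using ne by simp
  have q0: "0 < ?q" using qdist_bounds(1)[OF a, of x x' \<rho>] t0 by linarith
  have X0: "0 \<le> X" using A \<sigma> by (simp add: X_def)
  have "?q' \<le> ?q + l + E"
    using qdist_expand[OF a x x' ne t1 y R] unfolding l_def E_def t_def e_def V_def V'_def by linarith
  then have "X * (?q' - ?q) \<le> X * (l + E)" using X0 by (intro mult_left_mono) auto
  moreover have "A * ?q' powr \<sigma> \<le> A * (?q powr \<sigma> + \<sigma> * ?q powr (\<sigma> - 1) * (?q' - ?q))"
    by (intro mult_left_mono powr_le_tangent[OF \<sigma> q0] qdist_bounds(2) a A)
  moreover have "A * (?q powr \<sigma> + \<sigma> * ?q powr (\<sigma> - 1) * (?q' - ?q)) = A * ?q powr \<sigma> + X * (?q' - ?q)"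
    by (simp add: X_def algebra_simps)
  ultimately have 1: "A * ?q' powr \<sigma> \<le> A * ?q powr \<sigma> + X * l + X * E" unfolding distrib_left by linarith
  have "B * (norm y)\<^sup>2 \<le> B * R\<^sup>2" using y B by (intro mult_left_mono power_mono) auto
  moreover have "(norm (x + y - x\<^sub>0))\<^sup>2 = (norm (x - x\<^sub>0))\<^sup>2 + 2 * ((x - x\<^sub>0) \<bullet> y) + (norm y)\<^sup>2"
    using norm_add_squared[of "x - x\<^sub>0" y] by (simp add: algebra_simps)
  then have "B * (norm (x + y - x\<^sub>0))\<^sup>2 = B * (norm (x - x\<^sub>0))\<^sup>2 + 2 * B * ((x - x\<^sub>0) \<bullet> y) + B * (norm y)\<^sup>2"
    by (simp only: distrib_left)
  ultimately have 2: "B * (norm (x + y - x\<^sub>0))\<^sup>2 \<le> B * (norm (x - x\<^sub>0))\<^sup>2 + 2 * B * ((x - x\<^sub>0) \<bullet> y) + B * R\<^sup>2"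
    by linarith
  have 3: "(X *\<^sub>R ((1 + a * (t / V + t / V')) *\<^sub>R e - (a * (1 - \<rho> x / V)) *\<^sub>R N x) + (2 * B) *\<^sub>R (x - x\<^sub>0)) \<bullet> y
    + (X *\<^sub>R ((1 + a * (t / V + t / V')) *\<^sub>R (- e) - (a * (1 - \<rho> x' / V')) *\<^sub>R N x')) \<bullet> y' = X * l + 2 * B * ((x - x\<^sub>0) \<bullet> y)"
    unfolding l_def by (simp add: inner_add_left inner_diff_left inner_diff_right algebra_simps)
  show ?thesis unfolding barrier_def E_def[symmetric] using 1 2 3 by linarith
qed

text \<open>Close to the boundary \<open>e\<close> is nearly tangential or points outward, so that the sign is decided by the
  contribution \<open>- a * \<tau>\<close> of the corrector.\<close>

lemma drift_gain:
  fixes x e p D :: "real^'n"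
  assumes x: "x \<in> ball z r" and X: "0 \<le> X" and a: "0 \<le> a" "a \<le> 1/4" and e: "norm e = 1"
    and \<mu>: "1 \<le> \<mu>" "\<mu> \<le> 2" and \<tau>: "0 \<le> \<tau>" "\<tau> \<le> 1"
    and m: "0 \<le> m" "0 < m \<Longrightarrow> e \<bullet> N x \<le> a / 8" "0 < m \<Longrightarrow> 1/2 \<le> \<tau>"
    and p: "norm p * L \<le> X * a / 8" "norm p \<le> X" and D: "norm (D - m *\<^sub>R N x) \<le> C * \<epsilon>\<^sup>2"
  shows "(X *\<^sub>R (\<mu> *\<^sub>R e - (a * \<tau>) *\<^sub>R N x) + p) \<bullet> D \<le> - (X * a * m / 8) + X * (3 + L) * C * \<epsilon>\<^sup>2"
proof -
  let ?l = "X *\<^sub>R (\<mu> *\<^sub>R e - (a * \<tau>) *\<^sub>R N x) + p"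
  have NN: "1 \<le> N x \<bullet> N x" using power_mono[OF N_ge[OF x], of 2] by (simp add: power2_norm_eq_inner)
  have a\<tau>: "0 \<le> a * \<tau>" "a * \<tau> \<le> 1" using a \<tau> mult_mono[of a 1 \<tau> 1] by auto
  have "norm ?l \<le> X * norm (\<mu> *\<^sub>R e - (a * \<tau>) *\<^sub>R N x) + norm p"
    using norm_triangle_ineq[of "X *\<^sub>R (\<mu> *\<^sub>R e - (a * \<tau>) *\<^sub>R N x)" p] X by simp
  also have "norm (\<mu> *\<^sub>R e - (a * \<tau>) *\<^sub>R N x) \<le> norm (\<mu> *\<^sub>R e) + norm ((a * \<tau>) *\<^sub>R N x)" by (rule norm_triangle_ineq4)
  also have "norm (\<mu> *\<^sub>R e) \<le> 2" using \<mu> e by simp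
  also have "norm ((a * \<tau>) *\<^sub>R N x) \<le> 1 * L" unfolding norm_scaleR using a\<tau> N_le[OF x] by (intro mult_mono) auto
  finally have "norm ?l \<le> X * (2 + 1 * L) + norm p" using X by (auto intro: mult_left_mono)
  then have nl: "norm ?l \<le> X * (3 + L)" using p(2) by (simp add: algebra_simps)
  have C0: "0 \<le> C * \<epsilon>\<^sup>2" using D norm_ge_zero order_trans by blast
  have "?l \<bullet> (D - m *\<^sub>R N x) \<le> norm ?l * norm (D - m *\<^sub>R N x)" by (rule norm_cauchy_schwarz)
  also have "\<dots> \<le> (X * (3 + L)) * (C * \<epsilon>\<^sup>2)" using nl D C0 by (intro mult_mono) (auto intro: order_trans[OF norm_ge_zero])
  finally have 1: "?l \<bullet> (D - m *\<^sub>R N x) \<le> X * (3 + L) * C * \<epsilon>\<^sup>2" by (simp add: mult.assoc)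
  have 2: "m * (?l \<bullet> N x) \<le> - (X * a * m / 8)"
  proof (cases "m = 0")
    case False
    then have m0: "0 < m" using m by simp
    \<comment> \<open>The outward effect of the distance is at most \<open>a / 4\<close>, against at
      least \<open>a / 2\<close> from the corrector; the localising term takes half of the
      difference.\<close>
    have "\<mu> * (e \<bullet> N x) \<le> a / 4"
    proof (cases "0 \<le> e \<bullet> N x")
      case True
      then have "\<mu> * (e \<bullet> N x) \<le> 2 * (a / 8)" using \<mu> m(2)[OF m0] by (intro mult_mono) auto
      then show ?thesis by simp
    next
      case False
      then have "\<mu> * (e \<bullet> N x) \<le> 0" using \<mu> by (simp add: mult_le_0_iff)
      then show ?thesis using a by simp
    qed
    moreover have "a * (1/2) * 1 \<le> a * \<tau> * (N x \<bullet> N x)" using m(3)[OF m0] NN a \<tau> by (intro mult_mono) auto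
    ultimately have "\<mu> * (e \<bullet> N x) - a * \<tau> * (N x \<bullet> N x) \<le> - (a / 4)" by simp
    then have "X * (\<mu> * (e \<bullet> N x) - a * \<tau> * (N x \<bullet> N x)) \<le> X * (- (a / 4))" using X by (rule mult_left_mono)
    moreover have "p \<bullet> N x \<le> X * a / 8"
    proof -
      have "p \<bullet> N x \<le> norm p * norm (N x)" by (rule norm_cauchy_schwarz)
      also have "\<dots> \<le> norm p * L" using N_le[OF x] by (intro mult_left_mono) auto
      finally show ?thesis using p(1) by linarith
    qed
    moreover have "?l \<bullet> N x = X * (\<mu> * (e \<bullet> N x) - a * \<tau> * (N x \<bullet> N x)) + p \<bullet> N x"
      by (simp add: inner_add_left inner_diff_left)
    ultimately have "?l \<bullet> N x \<le> - (X * a / 8)" by simp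
    then have "m * (?l \<bullet> N x) \<le> m * (- (X * a / 8))" using m by (intro mult_left_mono) auto
    then show ?thesis by (simp add: mult_ac)
  qed simp
  have "?l \<bullet> D = ?l \<bullet> (D - m *\<^sub>R N x) + m * (?l \<bullet> N x)" by (simp add: inner_diff_right)
  then show ?thesis using 1 2 by linarith
qed

text \<open>The linear parts of the barrier are subtracted from \<open>u\<close> at each point
  before averaging and return as products with the drifts. For the remainders, equal displacements
  have no transversal loss, while unequal ones lose at most
  \<open>4 * \<epsilon>\<^sup>2 / t\<close>; the latter is weighted only with the share of volume
  that cannot be matched.\<close>

lemma noise_estimate:
  fixes x x' x\<^sub>0 :: "real^'n" and \<sigma> a A B :: real
  assumes dpp: "normalized_dpp \<Omega> \<alpha> \<gamma> \<epsilon> G u"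
    and \<sigma>: "0 < \<sigma>" "\<sigma> < 1" and a: "0 \<le> a" and A: "0 \<le> A" and B: "0 \<le> B"
    and x: "x \<in> closure \<Omega>" "dist z x < r / 2" and x': "x' \<in> closure \<Omega>" "dist z x' < r / 2"
    and eps: "\<epsilon> < r / 2" "8 * L * \<epsilon> \<le> 1"
    and ne: "x \<noteq> x'" and t1: "norm (x - x') \<le> 1" and t4: "4 * \<epsilon> \<le> norm (x - x')"
    and W: "\<And>y y'. y \<in> closure \<Omega> \<Longrightarrow> y' \<in> closure \<Omega> \<Longrightarrow> norm (y - x) \<le> \<epsilon> \<Longrightarrow> norm (y' - x') \<le> \<epsilon> \<Longrightarrow>
        u y - u y' \<le> S + barrier \<sigma> a A B \<rho> x\<^sub>0 y y'"
  defines "t \<equiv> norm (x - x')" and "e \<equiv> sgn (x - x')" and "V \<equiv> sqrt ((norm (x - x'))\<^sup>2 + (\<rho> x)\<^sup>2)" and "V' \<equiv> sqrt ((norm (x - x'))\<^sup>2 + (\<rho> x')\<^sup>2)"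
  defines "X \<equiv> A * \<sigma> * qdist a \<rho> x x' powr (\<sigma> - 1)"
  shows "avg (step_set \<Omega> \<epsilon> x) u - avg (step_set \<Omega> \<epsilon> x') u \<le> S + barrier \<sigma> a A B \<rho> x\<^sub>0 x x'
    + (X * (a * (4 + 4 * L\<^sup>2 + 2 * L) * \<epsilon>\<^sup>2 / t) + B * \<epsilon>\<^sup>2)
    + X * (4 * \<epsilon>\<^sup>2 / t) * (hit \<Omega> \<epsilon> x + hit \<Omega> \<epsilon> x')
    + (X *\<^sub>R ((1 + a * (t / V + t / V')) *\<^sub>R e - (a * (1 - \<rho> x / V)) *\<^sub>R N x) + (2 * B) *\<^sub>R (x - x\<^sub>0)) \<bullet> drift \<Omega> \<epsilon> x
    + (X *\<^sub>R ((1 + a * (t / V + t / V')) *\<^sub>R (- e) - (a * (1 - \<rho> x' / V')) *\<^sub>R N x')) \<bullet> drift \<Omega> \<epsilon> x'"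
proof -
  interpret normalized_dpp \<Omega> \<alpha> \<gamma> \<epsilon> G u by (rule dpp)
  let ?F = "barrier \<sigma> a A B \<rho> x\<^sub>0" and ?A = "step_set \<Omega> \<epsilon>"
  define l where "l = X *\<^sub>R ((1 + a * (t / V + t / V')) *\<^sub>R e - (a * (1 - \<rho> x / V)) *\<^sub>R N x) + (2 * B) *\<^sub>R (x - x\<^sub>0)"
  define l' where "l' = X *\<^sub>R ((1 + a * (t / V + t / V')) *\<^sub>R (- e) - (a * (1 - \<rho> x' / V')) *\<^sub>R N x')"
  define Q where "Q = a * (4 + 4 * L\<^sup>2 + 2 * L) * \<epsilon>\<^sup>2 / t"
  \<comment> \<open>\<open>q0\<close> is the bound for arbitrary pairs of displacements,
    \<open>q1\<close> the bound for equal ones.\<close>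
  define q0 where "q0 = S + ?F x x' + X * (4 * \<epsilon>\<^sup>2 / t + Q) + B * \<epsilon>\<^sup>2"
  define q1 where "q1 = S + ?F x x' + X * Q + B * \<epsilon>\<^sup>2"
  define g where "g y = u y - l \<bullet> (y - x)" for y
  define h where "h y = u y - (- l') \<bullet> (y - x')" for y
  have t0: "0 < t" using ne by (simp add: t_def)
  have X0: "0 \<le> X" using A \<sigma> by (simp add: X_def)
  have xb: "x \<in> ball z r" "0 \<le> \<rho> x" using x_in_chart[OF x \<epsilon> eps] rho_nonneg[OF x(1)] by auto
  have xb': "x' \<in> ball z r" "0 \<le> \<rho> x'" using x_in_chart[OF x' \<epsilon> eps] rho_nonneg[OF x'(1)] by auto
  have sS: "?A y \<in> lmeasurable" for y by (rule step_set_lmeasurable[OF open_\<Omega>])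
  have Wexp: "g (x + k) - h (x' + k') \<le> S + ?F x x' + X * (((norm (k - k'))\<^sup>2 - (e \<bullet> (k - k'))\<^sup>2) / t + Q) + B * \<epsilon>\<^sup>2"
    if k: "x + k \<in> ?A x" "x' + k' \<in> ?A x'" for k k'
  proof -
    have nk: "norm k \<le> \<epsilon>" "norm k' \<le> \<epsilon>" using k by (auto simp: step_set_def dist_norm)
    have "x + k \<in> closure \<Omega>" "x' + k' \<in> closure \<Omega>" using k closure_subset by (auto simp: step_set_def)
    then have "u (x + k) - u (x' + k') \<le> S + ?F (x + k) (x' + k')" by (rule W) (use nk in auto)
    also have "?F (x + k) (x' + k') \<le> ?F x x' + l \<bullet> k + l' \<bullet> k' + X * (((norm (k - k'))\<^sup>2 - (e \<bullet> (k - k'))\<^sup>2) / t + Q) + B * \<epsilon>\<^sup>2"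
      unfolding l_def l'_def Q_def X_def t_def e_def V_def V'_def
      by (rule barrier_expand[OF \<sigma> a A B xb xb' ne t1 nk t4])
    finally show ?thesis by (simp add: g_def h_def)
  qed
  have ig: "set_integrable lebesgue (?A x) (\<lambda>y. l \<bullet> (y - x))" for l x
  proof (rule set_integrable_continuous_bounded[of _ _ x \<epsilon>])
    show "?A x \<in> sets lebesgue" by (rule fmeasurableD[OF sS])
  qed (auto intro!: continuous_intros simp: step_set_def)
  have gi: "set_integrable lebesgue (?A x) g" "set_integrable lebesgue (?A x') h"
    unfolding g_def h_def by (intro set_integral_diff(1) u_integrable ig)+
  have ag: "avg (?A x) g = avg (?A x) u - l \<bullet> drift \<Omega> \<epsilon> x" "avg (?A x') h = avg (?A x') u - (- l') \<bullet> drift \<Omega> \<epsilon> x'"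
    unfolding g_def h_def by (subst avg_diff[OF u_integrable ig], simp only: avg_inner_drift[OF open_\<Omega>])+
  \<comment> \<open>In displacement coordinates both step sets are subsets of one ball about 0, and
    synchronous motion means the same displacement \<open>k\<close>.\<close>
  let ?S = "{k. x + k \<in> ?A x}" and ?S' = "{k. x' + k \<in> ?A x'}"
  note tr = lmeasurable_translation_preimage[OF sS]
  have pos: "0 < measure lebesgue (?A x)" "0 < measure lebesgue (?A x')"
    by (rule step_set_measure(1)[OF x \<epsilon> eps], rule step_set_measure(1)[OF x' \<epsilon> eps])
  have q10: "q1 \<le> q0" using X0 t0 by (simp add: q0_def q1_def distrib_left)
  have "avg ?S (\<lambda>k. g (x + k)) - avg ?S' (\<lambda>k. h (x' + k)) \<le>
    q1 + (q0 - q1) * (measure lebesgue (cball 0 \<epsilon> - ?S) + measure lebesgue (cball 0 \<epsilon> - ?S')) / measure lebesgue (cball (0::real^'n) \<epsilon>)"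
  proof (rule avg_coupling)
    show "?S \<in> lmeasurable" "?S' \<in> lmeasurable" by (rule tr)+
    show "0 < measure lebesgue ?S" "0 < measure lebesgue ?S'" unfolding tr(2) by (rule pos)+
    show "?S \<subseteq> cball 0 \<epsilon>" "?S' \<subseteq> cball 0 \<epsilon>" by (auto simp: step_set_def dist_norm)
    show "set_integrable lebesgue ?S (\<lambda>k. g (x + k))" "set_integrable lebesgue ?S' (\<lambda>k. h (x' + k))"
      by (rule set_integrable_translation[OF gi(1)], rule set_integrable_translation[OF gi(2)])
    show "g (x + k) - h (x' + k') \<le> q0" if "k \<in> ?S" "k' \<in> ?S'" for k k'
    proof -
      have "norm k \<le> \<epsilon>" "norm k' \<le> \<epsilon>" using that by (auto simp: step_set_def dist_norm)
      then have "norm (k - k') \<le> 2 * \<epsilon>" using norm_triangle_ineq4[of k k'] by linarith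
      then have k4: "(norm (k - k'))\<^sup>2 \<le> (2 * \<epsilon>)\<^sup>2" by (intro power_mono) auto
      have "(norm (k - k'))\<^sup>2 - (e \<bullet> (k - k'))\<^sup>2 \<le> 4 * \<epsilon>\<^sup>2"
      proof -
        have "(2 * \<epsilon>)\<^sup>2 = 4 * \<epsilon>\<^sup>2" by (simp add: power_mult_distrib)
        then show ?thesis using k4 zero_le_power2[of "e \<bullet> (k - k')"] by linarith
      qed
      then have "((norm (k - k'))\<^sup>2 - (e \<bullet> (k - k'))\<^sup>2) / t + Q \<le> 4 * \<epsilon>\<^sup>2 / t + Q"
        using t0 by (intro add_mono divide_right_mono) auto
      then have "X * (((norm (k - k'))\<^sup>2 - (e \<bullet> (k - k'))\<^sup>2) / t + Q) \<le> X * (4 * \<epsilon>\<^sup>2 / t + Q)"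
        using X0 by (rule mult_left_mono)
      moreover have "g (x + k) - h (x' + k') \<le> S + ?F x x' + X * (((norm (k - k'))\<^sup>2 - (e \<bullet> (k - k'))\<^sup>2) / t + Q) + B * \<epsilon>\<^sup>2"
        by (rule Wexp) (use that in auto)
      ultimately show ?thesis unfolding q0_def by linarith
    qed
    show "g (x + k) - h (x' + k) \<le> q1" if "k \<in> ?S" "k \<in> ?S'" for k
      using Wexp[of k k] that by (simp add: q1_def)
  qed (use q10 in auto)
  moreover have hh: "measure lebesgue (cball 0 \<epsilon> - {k. y + k \<in> ?A y}) / measure lebesgue (cball (0::real^'n) \<epsilon>) = hit \<Omega> \<epsilon> y" for y
  proof -
    have "cball 0 \<epsilon> - {k. y + k \<in> ?A y} = {k. y + k \<in> cball y \<epsilon> - ?A y}" by (auto simp: dist_norm)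
    moreover have "cball y \<epsilon> - ?A y \<in> lmeasurable" by (intro fmeasurable.Diff sS) simp
    ultimately have "measure lebesgue (cball 0 \<epsilon> - {k. y + k \<in> ?A y}) = measure lebesgue (cball y \<epsilon> - ?A y)"
      by (simp only: lmeasurable_translation_preimage(2))
    moreover have "measure lebesgue (cball (0::real^'n) \<epsilon>) = measure lebesgue (cball y \<epsilon>)"
      using \<epsilon> by (simp add: content_cball)
    ultimately show ?thesis by (simp only: hit_def)
  qed
  ultimately have "avg ?S (\<lambda>k. g (x + k)) - avg ?S' (\<lambda>k. h (x' + k)) \<le> q1 + (q0 - q1) * (hit \<Omega> \<epsilon> x + hit \<Omega> \<epsilon> x')"
    by (simp only: hh[symmetric] add_divide_distrib[symmetric] times_divide_eq_right)
  moreover have "q0 - q1 = X * (4 * \<epsilon>\<^sup>2 / t)" by (simp add: q0_def q1_def distrib_left)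
  moreover have "avg ?S (\<lambda>k. g (x + k)) = avg (?A x) u - l \<bullet> drift \<Omega> \<epsilon> x"
    "avg ?S' (\<lambda>k. h (x' + k)) = avg (?A x') u - (- l') \<bullet> drift \<Omega> \<epsilon> x'"
    by (simp_all only: avg_translation[OF sS gi(1)] avg_translation[OF sS gi(2)] ag)
  ultimately show ?thesis
    unfolding l_def[symmetric] l'_def[symmetric] Q_def[symmetric] q1_def by simp
qed

text \<open>The sizes of the data are arranged so that all errors are absorbed by one of the two
  gains. The resulting gain is a fixed multiple of \<open>\<epsilon>\<^sup>2\<close> and does not
  depend on the pair, so it contradicts near-maximality.\<close>

lemma large_step:
  fixes x x' x\<^sub>0 :: "real^'n" and \<sigma> a A B C s m m' :: real
  defines "\<kappa> \<equiv> \<sigma> * (1 - \<sigma>) / 8"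
  defines "\<theta> \<equiv> \<kappa> / 64"
  defines "K \<equiv> 4 + 4 * L\<^sup>2 + 2 * L"
  assumes dpp: "normalized_dpp \<Omega> \<alpha> \<gamma> \<epsilon> G u" and \<sigma>: "0 < \<sigma>" "\<sigma> < 1"
    and a: "0 < a" "a \<le> 1/4" "a * (2 + L) \<le> \<theta> / 16" "a * K \<le> \<kappa> / 32" "1024 * a * (K + 1) \<le> \<alpha> * \<kappa>"
    and C: "1 \<le> C" and B: "0 \<le> B"
    and A: "0 < A" "16 * B \<le> A * \<kappa>" "24 * B * s \<le> A * \<sigma> * \<theta>" "16 * B * s * L \<le> A * \<sigma> * a"
      "2 * B * s \<le> A * \<sigma>" "B \<le> A * \<sigma>" "64 * \<gamma> * C \<le> A * \<sigma> * a"
    and x: "x \<in> closure \<Omega>" "dist z x < r / 2" and x': "x' \<in> closure \<Omega>" "dist z x' < r / 2"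
    and t: "norm (x - x') \<le> 1/2" "norm (x - x') * (2 * (3 + L) * C + 4) \<le> a" "16 * L * norm (x - x') \<le> a"
    and eps: "\<epsilon> < r / 2" "8 * L * \<epsilon> \<le> 1" "2 * C * \<epsilon> \<le> 1"
    and big: "16 * \<epsilon> \<le> \<theta> * norm (x - x')" "32 * L * \<epsilon> \<le> a * norm (x - x')"
      "128 * C * \<epsilon> \<le> a * norm (x - x')" "64 * C * (K + 1) * \<epsilon> \<le> norm (x - x')"
    and s: "norm (x - x\<^sub>0) \<le> s" "\<epsilon> \<le> s"
    and dr: "0 \<le> m" "norm (drift \<Omega> \<epsilon> x - m *\<^sub>R N x) \<le> C * \<epsilon>\<^sup>2" "hit \<Omega> \<epsilon> x \<le> C * (m / \<epsilon> + \<epsilon>)"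
        "s_eps \<Omega> \<epsilon> x \<le> C * (m + \<epsilon>\<^sup>2)" "bdist \<Omega> x < \<epsilon> / 4 \<Longrightarrow> \<epsilon> \<le> C * (m + \<epsilon>\<^sup>2)" "\<epsilon> \<le> bdist \<Omega> x \<Longrightarrow> m = 0"
    and dr': "0 \<le> m'" "norm (drift \<Omega> \<epsilon> x' - m' *\<^sub>R N x') \<le> C * \<epsilon>\<^sup>2" "hit \<Omega> \<epsilon> x' \<le> C * (m' / \<epsilon> + \<epsilon>)"
        "s_eps \<Omega> \<epsilon> x' \<le> C * (m' + \<epsilon>\<^sup>2)" "\<epsilon> \<le> bdist \<Omega> x' \<Longrightarrow> m' = 0"
    and W: "\<And>y y'. y \<in> closure \<Omega> \<Longrightarrow> y' \<in> closure \<Omega> \<Longrightarrow> norm (y - x) \<le> \<epsilon> \<Longrightarrow> norm (y' - x') \<le> \<epsilon> \<Longrightarrow>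
        u y - u y' \<le> S + barrier \<sigma> a A B \<rho> x\<^sub>0 y y'"
  shows "u x - u x' \<le> S + barrier \<sigma> a A B \<rho> x\<^sub>0 x x'
    - min (\<alpha> * \<kappa> / 512 * A) ((1 - \<alpha>) * (A * \<sigma> * a / (64 * C))) * \<epsilon>\<^sup>2"
proof -
  interpret normalized_dpp \<Omega> \<alpha> \<gamma> \<epsilon> G u by (rule dpp)
  let ?F = "barrier \<sigma> a A B \<rho> x\<^sub>0"
  define d where "d = norm (x - x')"
  define e where "e = sgn (x - x')"
  define V where "V = sqrt (d\<^sup>2 + (\<rho> x)\<^sup>2)"
  define V' where "V' = sqrt (d\<^sup>2 + (\<rho> x')\<^sup>2)"
  define q where "q = qdist a \<rho> x x'"
  define X where "X = A * \<sigma> * q powr (\<sigma> - 1)"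
  define D where "D = q powr (\<sigma> - 2)"
  define R where "R = tug_radius x + tug_radius x'"
  define \<mu> where "\<mu> = 1 + a * (d / V + d / V')"
  define M where "M = m + m'"
  have \<kappa>: "0 < \<kappa>" using \<sigma> by (simp add: \<kappa>_def)
  have K: "0 \<le> K" "4 \<le> K" using L by (auto simp: K_def)
  have C0: "0 < C" using C by simp
  have d0: "0 < d"
  proof -
    have "0 < 64 * C * (K + 1) * \<epsilon>" using C K \<epsilon> by (intro mult_pos_pos) auto
    then show ?thesis using big(4) unfolding d_def by linarith
  qed
  note t' = t[folded d_def] and big' = big[folded d_def]
  have ne: "x \<noteq> x'" using d0 by (auto simp: d_def)
  have e1: "norm e = 1" using ne by (simp add: e_def norm_sgn)
  have xb: "x \<in> ball z r" "0 \<le> \<rho> x" using x_in_chart[OF x \<epsilon> eps(1,2)] rho_nonneg[OF x(1)] by auto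
  have xb': "x' \<in> ball z r" "0 \<le> \<rho> x'" using x_in_chart[OF x' \<epsilon> eps(1,2)] rho_nonneg[OF x'(1)] by auto
  have q: "d \<le> q" "q \<le> 3/2 * d"
  proof -
    show "d \<le> q" using qdist_bounds(1)[of a x x' \<rho>] a by (simp add: q_def d_def)
    have "q \<le> (1 + 2 * a) * d" using qdist_bounds(3)[of a \<rho> x x'] a xb xb' by (simp add: q_def d_def)
    also have "\<dots> \<le> 3/2 * d" using a d0 by (intro mult_right_mono) auto
    finally show "q \<le> 3/2 * d" .
  qed
  have q0: "0 < q" "q \<le> 1" using q d0 t' by auto
  have X1: "A * \<sigma> \<le> X"
  proof -
    have "1 powr (\<sigma> - 1) \<le> q powr (\<sigma> - 1)" using q0 \<sigma> by (intro powr_mono2') auto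
    then have "A * \<sigma> * 1 \<le> A * \<sigma> * q powr (\<sigma> - 1)" using A \<sigma> by (intro mult_left_mono) auto
    then show ?thesis by (simp add: X_def)
  qed
  have As: "0 < A * \<sigma>" using A \<sigma> by simp
  have X0: "0 < X" using X1 As by linarith
  have D1: "1 \<le> D"
  proof -
    have "1 powr (\<sigma> - 2) \<le> q powr (\<sigma> - 2)" using q0 \<sigma> by (intro powr_mono2') auto
    then show ?thesis by (simp add: D_def)
  qed
  \<comment> \<open>\<open>X\<close> is the slope of the power part of the barrier and
    \<open>A * D\<close> the scale of its curvature; this compares the corrector error with the
    concavity gain.\<close>
  have XD: "X / d \<le> 2 * A * D"
  proof -
    have "q powr (\<sigma> - 1) = q powr (\<sigma> - 2 + 1)" by simp
    also have "\<dots> = D * q powr 1" unfolding D_def by (rule powr_add)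
    also have "q powr 1 = q" using q0 by simp
    finally have "X = A * \<sigma> * D * q" by (simp add: X_def)
    also have "\<dots> \<le> A * 1 * D * (2 * d)"
      using A \<sigma> D1 q d0 by (intro mult_mono) auto
    finally show ?thesis using d0 by (simp add: pos_divide_le_eq mult_ac)
  qed
  have aX: "A * \<sigma> * a \<le> X * a" using X1 a by (intro mult_right_mono) auto
  note lp = linear_part_bound(2-9)[OF less_imp_le[OF a(1)] xb xb' ne, of 0 0 0, folded d_def, folded V_def V'_def, simplified]
  have \<mu>: "1 \<le> \<mu>" "\<mu> \<le> 2"
  proof -
    have "0 \<le> a * (d / V + d / V')" using a lp by (intro mult_nonneg_nonneg) auto
    then show "1 \<le> \<mu>" by (simp add: \<mu>_def)
    have "a * (d / V + d / V') \<le> 1/4 * (1 + 1)" using a lp by (intro mult_mono add_mono) auto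
    also have "1/4 * (1 + 1) = (1/2::real)" by simp
    finally show "\<mu> \<le> 2" unfolding \<mu>_def by linarith
  qed
  have near: "\<rho> w \<le> 2 * L * \<epsilon>" if "bdist \<Omega> w < \<epsilon>" "dist z w < r / 2" for w
  proof -
    have "2 * L * bdist \<Omega> w \<le> 2 * L * \<epsilon>" using that L by (intro mult_left_mono) auto
    then show ?thesis using rho_le_bdist'[OF that(2)] by linarith
  qed
  \<comment> \<open>The other point is in the closed domain, so \<open>0 \<le> \<rho> w'\<close>,
    and the expansion of \<rho> at \<open>w\<close> bounds
    \<open>d * (sgn (w - w') \<bullet> N w)\<close> by \<open>\<rho> w\<close> plus curvature. Both
    are small compared with \<open>a * d\<close> when \<open>w\<close> is within order \<epsilon> of
    the boundary.\<close>
  have angle: "sgn (w - w') \<bullet> N w \<le> a / 8"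
    if w: "\<rho> w \<le> 2 * L * \<epsilon>" "0 \<le> \<rho> w'" "norm (w - w') = d" for w w'
  proof -
    have e': "w' - w = - (d *\<^sub>R sgn (w - w'))" using w(3) d0 by (simp add: sgn_div_norm)
    have "0 \<le> \<rho> w + N w \<bullet> (w' - w) + L * d\<^sup>2" using rho_expand(1)[of w' w d] w by (simp add: norm_minus_commute)
    then have "d * (sgn (w - w') \<bullet> N w) \<le> 2 * L * \<epsilon> + L * d\<^sup>2"
      using w(1) by (simp add: e' inner_commute)
    also have "\<dots> \<le> a / 16 * d + a / 16 * d"
    proof -
      have "16 * L * d * d \<le> a * d" using t'(3) d0 by (intro mult_right_mono) auto
      then show ?thesis using big'(2) by (simp add: power2_eq_square)
    qed
    also have "\<dots> = d * (a / 8)" by simp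
    finally show ?thesis using d0 by (simp add: mult_le_cancel_left_pos)
  qed
  \<comment> \<open>Close to the boundary \<rho> is at most half the distance of the pair, so the
    corrector has at least half of its full slope.\<close>
  have half: "1/2 \<le> 1 - b / sqrt (d\<^sup>2 + b\<^sup>2)" if "0 \<le> b" "b \<le> 2 * L * \<epsilon>" for b
  proof -
    have "a * d \<le> 1 * d" using a d0 by (intro mult_right_mono) auto
    then have "32 * (L * \<epsilon>) \<le> d" using big'(2) by linarith
    moreover have "0 \<le> L * \<epsilon>" using L \<epsilon> by simp
    ultimately have "2 * b \<le> d" using that by linarith
    moreover have "d \<le> sqrt (d\<^sup>2 + b\<^sup>2)" by (rule real_le_rsqrt) simp
    ultimately have "b \<le> 1/2 * sqrt (d\<^sup>2 + b\<^sup>2)" "0 < sqrt (d\<^sup>2 + b\<^sup>2)" using d0 by linarith+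
    then have "b / sqrt (d\<^sup>2 + b\<^sup>2) \<le> 1/2" by (simp only: pos_divide_le_eq)
    then show ?thesis by simp
  qed
  let ?p = "(2 * B) *\<^sub>R (x - x\<^sub>0)"
  have p: "norm ?p * L \<le> X * a / 8" "norm ?p \<le> X"
  proof -
    have np: "norm ?p \<le> 2 * B * s" using s B by (simp add: mult_left_mono)
    then show "norm ?p \<le> X" using A(5) X1 by linarith
    have "norm ?p * L \<le> 2 * B * s * L" using np L by (intro mult_right_mono) auto
    then show "norm ?p * L \<le> X * a / 8" using A(4) aX by linarith
  qed
  have g1: "(X *\<^sub>R (\<mu> *\<^sub>R e - (a * (1 - \<rho> x / V)) *\<^sub>R N x) + ?p) \<bullet> drift \<Omega> \<epsilon> x \<le> - (X * a * m / 8) + X * (3 + L) * C * \<epsilon>\<^sup>2"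
  proof (rule drift_gain[OF xb(1) less_imp_le[OF X0] less_imp_le[OF a(1)] a(2) e1 \<mu> _ _ dr(1) _ _ p dr(2)])
    assume "0 < m"
    then have "\<rho> x \<le> 2 * L * \<epsilon>" using near[OF _ x(2)] dr(6) by force
    then show "e \<bullet> N x \<le> a / 8" "1/2 \<le> 1 - \<rho> x / V"
      unfolding e_def V_def using angle[of x x'] xb' xb half by (auto simp: d_def)
  qed (use lp in auto)
  \<comment> \<open>At the second point the roles are exchanged, \<open>- e\<close> being the
    direction from the first point to it, and there is no localising term.\<close>
  have g2: "(X *\<^sub>R (\<mu> *\<^sub>R (- e) - (a * (1 - \<rho> x' / V')) *\<^sub>R N x') + 0) \<bullet> drift \<Omega> \<epsilon> x' \<le> - (X * a * m' / 8) + X * (3 + L) * C * \<epsilon>\<^sup>2"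
  proof (rule drift_gain[OF xb'(1) less_imp_le[OF X0] less_imp_le[OF a(1)] a(2) _ \<mu> _ _ dr'(1) _ _ _ _ dr'(2)])
    assume "0 < m'"
    then have "\<rho> x' \<le> 2 * L * \<epsilon>" using near[OF _ x'(2)] dr'(5) by force
    moreover have "- e = sgn (x' - x)" unfolding e_def by (metis minus_diff_eq sgn_minus)
    ultimately show "- e \<bullet> N x' \<le> a / 8" "1/2 \<le> 1 - \<rho> x' / V'"
      unfolding V'_def using angle[of x' x] xb' xb half by (auto simp: d_def norm_minus_commute)
  qed (use lp e1 X0 a in auto)
  have noise: "avg (step_set \<Omega> \<epsilon> x) u - avg (step_set \<Omega> \<epsilon> x') u \<le> S + ?F x x'
    + (X * (a * K * \<epsilon>\<^sup>2 / d) + B * \<epsilon>\<^sup>2) + X * (4 * \<epsilon>\<^sup>2 / d) * (hit \<Omega> \<epsilon> x + hit \<Omega> \<epsilon> x')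
    + (- (X * a * m / 8) + X * (3 + L) * C * \<epsilon>\<^sup>2) + (- (X * a * m' / 8) + X * (3 + L) * C * \<epsilon>\<^sup>2)"
  proof -
    have "4 * \<epsilon> \<le> d"
    proof -
      have "4 * \<epsilon> \<le> 128 * C * \<epsilon>" using C \<epsilon> by (intro mult_right_mono) auto
      also have "\<dots> \<le> a * d" by (rule big'(3))
      also have "\<dots> \<le> 1 * d" using a d0 by (intro mult_right_mono) auto
      finally show ?thesis by simp
    qed
    then have t4: "4 * \<epsilon> \<le> norm (x - x')" by (simp add: d_def)
    have t1: "norm (x - x') \<le> 1" using t(1) by simp
    show ?thesis
      using noise_estimate[OF dpp \<sigma> less_imp_le[OF a(1)] less_imp_le[OF A(1)] B x x' eps(1,2) ne t1 t4 W] g1 g2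
      unfolding q_def[symmetric] d_def[symmetric] e_def[symmetric] K_def[symmetric] add_0_right
      unfolding X_def[symmetric] V_def[symmetric] V'_def[symmetric] unfolding \<mu>_def[symmetric] by linarith
  qed
  have tug: "\<exists>w\<in>cball x (tug_radius x). \<exists>w'\<in>cball x' (tug_radius x'). (u y - u y') + (u w - u w') \<le> 2 * S + 2 * ?F x x' - \<kappa> / 8 * A * D * R\<^sup>2"
    if y: "y \<in> cball x (tug_radius x)" "y' \<in> cball x' (tug_radius x')" for y y'
  proof -
    have R\<epsilon>: "tug_radius x + tug_radius x' \<le> \<epsilon>" using tug_radius(3)[of x] tug_radius(3)[of x'] by linarith
    then have "16 * (tug_radius x + tug_radius x') \<le> 16 * \<epsilon>" by (intro mult_left_mono) auto
    then have 16: "16 * (tug_radius x + tug_radius x') \<le> \<theta> * norm (x - x')" using big(1) by (rule order_trans)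
    have ny: "norm (y - x) \<le> tug_radius x" "norm (y' - x') \<le> tug_radius x'"
      using y by (auto simp: dist_norm norm_minus_commute)
    obtain v v' where v: "norm v \<le> tug_radius x" "norm v' \<le> tug_radius x'"
      "?F (x + (y - x)) (x' + (y' - x')) + ?F (x + v) (x' + v') \<le> 2 * ?F x x' - \<kappa> / 8 * A * D * R\<^sup>2"
      using tug_gain[OF \<sigma> a(1,2) a(3)[unfolded \<theta>_def \<kappa>_def] a(4)[unfolded \<kappa>_def K_def] xb xb' ne t(1) ny
        16[unfolded \<theta>_def \<kappa>_def] s(1) order_trans[OF R\<epsilon> s(2)] B A(1) A(2)[unfolded \<kappa>_def] A(3)[unfolded \<theta>_def \<kappa>_def]]
      unfolding D_def q_def R_def \<kappa>_def by blast
    have w: "x + v \<in> cball x (tug_radius x)" "x' + v' \<in> cball x' (tug_radius x')" using v by (auto simp: dist_norm)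
    have bnd: "u w - u w' \<le> S + ?F w w'" if "w \<in> cball x (tug_radius x)" "w' \<in> cball x' (tug_radius x')" for w w'
    proof (rule W)
      show "w \<in> closure \<Omega>" "w' \<in> closure \<Omega>" using that tug_ball[OF x(1)] tug_ball[OF x'(1)] by blast+
      show "norm (w - x) \<le> \<epsilon>" "norm (w' - x') \<le> \<epsilon>"
        using that tug_radius(3)[of x] tug_radius(3)[of x'] \<epsilon> by (auto simp: dist_norm norm_minus_commute)
    qed
    have "(u y - u y') + (u (x + v) - u (x' + v')) \<le> 2 * S + 2 * ?F x x' - \<kappa> / 8 * A * D * R\<^sup>2"
      using bnd[OF y] bnd[OF w] v(3) by simp
    then show ?thesis using w by blast
  qed
  have diff: "u x - u x' \<le> \<alpha> / 2 * (2 * S + 2 * ?F x x' - \<kappa> / 8 * A * D * R\<^sup>2)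
    + (1 - \<alpha>) * (avg (step_set \<Omega> \<epsilon> x) u - avg (step_set \<Omega> \<epsilon> x') u)
    + 2 * (1 - \<alpha>) * \<gamma> * (s_eps \<Omega> \<epsilon> x + s_eps \<Omega> \<epsilon> x')"
    by (rule dpp_diff[OF x(1) x'(1) tug])
  define T where "T = \<epsilon>\<^sup>2 / d"
  have T0: "0 \<le> T" using d0 by (simp add: T_def)
  have M0: "0 \<le> M" using dr(1) dr'(1) by (simp add: M_def)
  have eT: "X * (2 * (3 + L) * C + 4) * \<epsilon>\<^sup>2 \<le> X * a * T"
  proof -
    have "(2 * (3 + L) * C + 4) * \<epsilon>\<^sup>2 = d * (2 * (3 + L) * C + 4) * T" using d0 by (simp add: T_def)
    also have "\<dots> \<le> a * T" by (rule mult_right_mono[OF t'(2) T0])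
    finally have "X * ((2 * (3 + L) * C + 4) * \<epsilon>\<^sup>2) \<le> X * (a * T)" using X0 by (intro mult_left_mono) auto
    then show ?thesis by (simp add: mult.assoc)
  qed
  have hits: "X * (4 * \<epsilon>\<^sup>2 / d) * (hit \<Omega> \<epsilon> x + hit \<Omega> \<epsilon> x') \<le> X * a * M / 32 + X * \<epsilon>\<^sup>2"
  proof -
    have "hit \<Omega> \<epsilon> x + hit \<Omega> \<epsilon> x' \<le> C * (M / \<epsilon> + 2 * \<epsilon>)"
      using dr(3) dr'(3) by (simp add: M_def add_divide_distrib algebra_simps)
    then have "X * (4 * \<epsilon>\<^sup>2 / d) * (hit \<Omega> \<epsilon> x + hit \<Omega> \<epsilon> x') \<le> X * (4 * \<epsilon>\<^sup>2 / d) * (C * (M / \<epsilon> + 2 * \<epsilon>))"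
      using X0 d0 by (intro mult_left_mono) auto
    also have "\<dots> = X * (128 * C * \<epsilon>) / d * (M / 32 + \<epsilon>\<^sup>2 / 16)"
      using \<epsilon> d0 by (simp add: field_simps power2_eq_square)
    also have "\<dots> \<le> X * (a * d) / d * (M / 32 + \<epsilon>\<^sup>2 / 16)"
      using big'(3) X0 d0 M0 by (intro mult_right_mono divide_right_mono mult_left_mono) auto
    also have "\<dots> = X * a * M / 32 + X * (a * \<epsilon>\<^sup>2 / 16)" using d0 by (simp add: algebra_simps)
    also have "X * (a * \<epsilon>\<^sup>2 / 16) \<le> X * (1 * \<epsilon>\<^sup>2)"
    proof (intro mult_left_mono)
      show "a * \<epsilon>\<^sup>2 / 16 \<le> 1 * \<epsilon>\<^sup>2" using mult_right_mono[OF a(2), of "\<epsilon>\<^sup>2"] zero_le_power2[of \<epsilon>] by linarith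
    qed (use X0 in simp)
    finally show ?thesis by simp
  qed
  have seps: "2 * \<gamma> * (s_eps \<Omega> \<epsilon> x + s_eps \<Omega> \<epsilon> x') \<le> X * a * M / 32 + X * \<epsilon>\<^sup>2"
  proof -
    have "s_eps \<Omega> \<epsilon> x + s_eps \<Omega> \<epsilon> x' \<le> C * (M + 2 * \<epsilon>\<^sup>2)"
      using dr(4) dr'(4) by (simp add: M_def algebra_simps)
    then have "2 * \<gamma> * (s_eps \<Omega> \<epsilon> x + s_eps \<Omega> \<epsilon> x') \<le> 2 * \<gamma> * (C * (M + 2 * \<epsilon>\<^sup>2))"
      using \<gamma> by (intro mult_left_mono) auto
    also have "\<dots> = 64 * \<gamma> * C * (M / 32 + \<epsilon>\<^sup>2 / 16)" by (simp add: algebra_simps)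
    also have "\<dots> \<le> X * a * (M / 32 + \<epsilon>\<^sup>2 / 16)" using A(7) aX M0 by (intro mult_right_mono) auto
    also have "\<dots> = X * a * M / 32 + X * (a * \<epsilon>\<^sup>2 / 16)" by (simp add: algebra_simps)
    also have "X * (a * \<epsilon>\<^sup>2 / 16) \<le> X * (1 * \<epsilon>\<^sup>2)"
    proof (intro mult_left_mono)
      show "a * \<epsilon>\<^sup>2 / 16 \<le> 1 * \<epsilon>\<^sup>2" using mult_right_mono[OF a(2), of "\<epsilon>\<^sup>2"] zero_le_power2[of \<epsilon>] by linarith
    qed (use X0 in simp)
    finally show ?thesis by simp
  qed
  have BX: "B * \<epsilon>\<^sup>2 \<le> X * \<epsilon>\<^sup>2" using A(6) X1 by (intro mult_right_mono) auto
  let ?N = "avg (step_set \<Omega> \<epsilon> x) u - avg (step_set \<Omega> \<epsilon> x') u"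
  \<comment> \<open>The drift gain \<open>X * a * M / 8\<close> loses a quarter of its size to the
    lost volume and another quarter to killing. All errors proportional to
    \<open>X * \<epsilon>\<^sup>2\<close> together are at most \<open>X * a * T\<close>, because the
    distance of the pair is small.\<close>
  have bracket: "?N + 2 * \<gamma> * (s_eps \<Omega> \<epsilon> x + s_eps \<Omega> \<epsilon> x') \<le> S + ?F x x' - X * a * M / 16 + X * a * (K + 1) * T"
  proof -
    have "X * (a * K * \<epsilon>\<^sup>2 / d) = X * a * K * T" by (simp add: T_def)
    moreover have "X * a * m / 8 + X * a * m' / 8 = X * a * M / 8" by (simp add: M_def algebra_simps)
    moreover have "X * (2 * (3 + L) * C + 4) * \<epsilon>\<^sup>2 = 2 * (X * (3 + L) * C * \<epsilon>\<^sup>2) + 4 * (X * \<epsilon>\<^sup>2)" by (simp add: algebra_simps)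
    moreover have "X * a * (K + 1) * T = X * a * K * T + X * a * T" by (simp add: algebra_simps)
    moreover have "0 \<le> X * \<epsilon>\<^sup>2" using X0 by simp
    ultimately show ?thesis using noise hits seps BX eT by linarith
  qed
  have "u x - u x' \<le> \<alpha> / 2 * (2 * S + 2 * ?F x x' - \<kappa> / 8 * A * D * R\<^sup>2)
      + (1 - \<alpha>) * (?N + 2 * \<gamma> * (s_eps \<Omega> \<epsilon> x + s_eps \<Omega> \<epsilon> x'))"
    using diff by (simp add: algebra_simps)
  also have "\<dots> \<le> \<alpha> / 2 * (2 * S + 2 * ?F x x' - \<kappa> / 8 * A * D * R\<^sup>2)
      + (1 - \<alpha>) * (S + ?F x x' - X * a * M / 16 + X * a * (K + 1) * T)"
    using bracket \<alpha> by (intro add_left_mono mult_left_mono) auto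
  also have "\<dots> = S + ?F x x' - \<alpha> * \<kappa> / 16 * A * D * R\<^sup>2 + (1 - \<alpha>) * (X * a * (K + 1) * T - X * a * M / 16)"
    by (simp add: algebra_simps)
  finally have main: "u x - u x' \<le> S + ?F x x' - \<alpha> * \<kappa> / 16 * A * D * R\<^sup>2 + (1 - \<alpha>) * (X * a * (K + 1) * T - X * a * M / 16)" .
  let ?c1 = "\<alpha> * \<kappa> / 512 * A" and ?c2 = "(1 - \<alpha>) * (A * \<sigma> * a / (64 * C))"
  have e2: "0 \<le> \<epsilon>\<^sup>2" by simp
  show ?thesis
  \<comment> \<open>With room for the tug-of-war, the concavity gain beats the corrector error by
    the smallness of \<open>a\<close>. Without it, \<open>x\<close> is closer than
    \<open>\<epsilon> / 4\<close> to the boundary, so the drift is at least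
    \<open>\<epsilon> / (2 * C)\<close> and beats the same error because the pair is far apart on
    the scale \<epsilon>.\<close>
  proof (cases "\<epsilon> / 4 \<le> R")
    case True
    have "(\<epsilon> / 4)\<^sup>2 \<le> R\<^sup>2" using True \<epsilon> by (intro power_mono) auto
    then have "\<alpha> * \<kappa> / 16 * A * D * (\<epsilon> / 4)\<^sup>2 \<le> \<alpha> * \<kappa> / 16 * A * D * R\<^sup>2"
      using \<alpha> \<kappa> A D1 by (intro mult_left_mono) auto
    then have 1: "\<alpha> * \<kappa> / 256 * (A * D * \<epsilon>\<^sup>2) \<le> \<alpha> * \<kappa> / 16 * A * D * R\<^sup>2" by (simp add: power_divide)
    have "X * a * (K + 1) * T = X / d * (a * (K + 1)) * \<epsilon>\<^sup>2" by (simp add: T_def)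
    also have "\<dots> \<le> 2 * A * D * (a * (K + 1)) * \<epsilon>\<^sup>2" using XD a K by (intro mult_right_mono) auto
    also have "\<dots> = (1024 * a * (K + 1)) / 512 * (A * D * \<epsilon>\<^sup>2)" by simp
    also have "\<dots> \<le> \<alpha> * \<kappa> / 512 * (A * D * \<epsilon>\<^sup>2)"
      using a(5) A D1 by (intro mult_right_mono divide_right_mono) auto
    finally have 2: "X * a * (K + 1) * T \<le> \<alpha> * \<kappa> / 512 * (A * D * \<epsilon>\<^sup>2)" .
    have "0 \<le> X * a * M / 16" using X0 a M0 by simp
    then have "X * a * (K + 1) * T - X * a * M / 16 \<le> \<alpha> * \<kappa> / 512 * (A * D * \<epsilon>\<^sup>2)" using 2 by linarith
    then have "(1 - \<alpha>) * (X * a * (K + 1) * T - X * a * M / 16) \<le> (1 - \<alpha>) * (\<alpha> * \<kappa> / 512 * (A * D * \<epsilon>\<^sup>2))"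
      using \<alpha> by (intro mult_left_mono) auto
    also have "\<dots> \<le> 1 * (\<alpha> * \<kappa> / 512 * (A * D * \<epsilon>\<^sup>2))"
      using \<alpha> \<kappa> A D1 by (intro mult_right_mono) auto
    finally have 3: "u x - u x' \<le> S + ?F x x' - \<alpha> * \<kappa> / 512 * (A * D * \<epsilon>\<^sup>2)" using main 1 by linarith
    have "min ?c1 ?c2 * \<epsilon>\<^sup>2 \<le> ?c1 * \<epsilon>\<^sup>2" by (rule mult_right_mono[OF min.cobounded1 e2])
    also have "\<dots> \<le> ?c1 * \<epsilon>\<^sup>2 * D" using mult_left_mono[OF D1, of "?c1 * \<epsilon>\<^sup>2"] \<alpha> \<kappa> A by simp
    also have "\<dots> = \<alpha> * \<kappa> / 512 * (A * D * \<epsilon>\<^sup>2)" by simp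
    finally show ?thesis using 3 by linarith
  next
    case False
    have "bdist \<Omega> x < \<epsilon> / 4"
      using False tug_radius(1)[of x'] \<epsilon> unfolding R_def tug_radius_eq[of x] by (auto simp: min_def split: if_splits)
    then have "\<epsilon> \<le> C * m + C * \<epsilon> * \<epsilon>" using dr(5) by (simp add: power2_eq_square algebra_simps)
    moreover have "2 * C * \<epsilon> * \<epsilon> \<le> 1 * \<epsilon>" using eps(3) \<epsilon> by (intro mult_right_mono) auto
    ultimately have "\<epsilon> \<le> 2 * C * m" by simp
    also have "\<dots> \<le> 2 * C * M" using dr'(1) C0 by (intro mult_left_mono) (auto simp: M_def)
    finally have M: "\<epsilon> / (2 * C) \<le> M" using C0 by (simp add: pos_divide_le_eq mult.commute)
    have "64 * C * (K + 1) * \<epsilon> * \<epsilon> \<le> d * \<epsilon>" using big'(4) \<epsilon> by (intro mult_right_mono) auto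
    then have "(K + 1) * T \<le> \<epsilon> / (64 * C)"
      using d0 C0 by (simp add: T_def field_simps power2_eq_square)
    then have "X * a * ((K + 1) * T) \<le> X * a * (\<epsilon> / (64 * C))" using X0 a by (intro mult_left_mono) auto
    moreover have "X * a / 16 * (\<epsilon> / (2 * C)) \<le> X * a / 16 * M" using M X0 a by (intro mult_left_mono) auto
    moreover have "X * a / 16 * (\<epsilon> / (2 * C)) = 2 * (X * a * (\<epsilon> / (64 * C)))" using C0 by (simp add: field_simps)
    moreover have "X * a * (K + 1) * T = X * a * ((K + 1) * T)" "X * a / 16 * M = X * a * M / 16" by simp_all
    ultimately have "X * a * (K + 1) * T - X * a * M / 16 \<le> - (X * a * (\<epsilon> / (64 * C)))" by linarith
    also have "\<dots> \<le> - (A * \<sigma> * a * (\<epsilon>\<^sup>2 / (64 * C)))"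
    proof -
      have "2 * \<epsilon> \<le> 2 * C * \<epsilon>" using C \<epsilon> by simp
      then have "\<epsilon> \<le> 1" using eps(3) by linarith
      then have "\<epsilon>\<^sup>2 \<le> \<epsilon>" using \<epsilon> by (simp add: power2_eq_square mult_left_le)
      then have "A * \<sigma> * a * (\<epsilon>\<^sup>2 / (64 * C)) \<le> X * a * (\<epsilon> / (64 * C))"
        using aX X0 a C0 by (intro mult_mono divide_right_mono) auto
      then show ?thesis by simp
    qed
    finally have "(1 - \<alpha>) * (X * a * (K + 1) * T - X * a * M / 16) \<le> (1 - \<alpha>) * (- (A * \<sigma> * a * (\<epsilon>\<^sup>2 / (64 * C))))"
      using \<alpha> by (intro mult_left_mono) auto
    also have "\<dots> = - (?c2 * \<epsilon>\<^sup>2)" by simp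
    finally have "(1 - \<alpha>) * (X * a * (K + 1) * T - X * a * M / 16) \<le> - (?c2 * \<epsilon>\<^sup>2)" .
    moreover have "0 \<le> \<alpha> * \<kappa> / 16 * A * D * R\<^sup>2" using \<alpha> \<kappa> A D1 by simp
    moreover have "min ?c1 ?c2 * \<epsilon>\<^sup>2 \<le> ?c2 * \<epsilon>\<^sup>2" by (rule mult_right_mono[OF min.cobounded2 e2])
    ultimately show ?thesis using main by linarith
  qed
qed

end

section \<open>Pairs at a distance comparable to the step size\<close>

text \<open>The two steps are taken independently. They land in \<open>E\<close> and
  \<open>E'\<close> with probability at least \<open>c\<close> each, so the favourable event has
  probability at least \<open>c * c\<close>.\<close>

lemma avg_diff_le:
  fixes g :: "'a::euclidean_space \<Rightarrow> real"
  assumes A: "A \<in> lmeasurable" "0 < measure lebesgue A" "set_integrable lebesgue A g"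
    and A': "A' \<in> lmeasurable" "0 < measure lebesgue A'" "set_integrable lebesgue A' g"
    and E: "E \<in> sets lebesgue" "E \<subseteq> A" "c * measure lebesgue A \<le> measure lebesgue E"
    and E': "E' \<in> sets lebesgue" "E' \<subseteq> A'" "c * measure lebesgue A' \<le> measure lebesgue E'"
    and c: "0 \<le> c" and d: "0 \<le> d"
    and Y: "\<And>y y'. y \<in> A \<Longrightarrow> y' \<in> A' \<Longrightarrow> g y - g y' \<le> Y"
    and Yd: "\<And>y y'. y \<in> E \<Longrightarrow> y' \<in> E' \<Longrightarrow> g y - g y' \<le> Y - d"
  shows "avg A g - avg A' g \<le> Y - c * (c * d)"
proof -
  have neg: "avg A' (\<lambda>y. - g y) = - avg A' g" using avg_cmult[of A' "-1" g] by simp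
  have i': "set_integrable lebesgue A' (\<lambda>y. - g y)" using A'(3) set_integrable_mult_right[of "-1" lebesgue A' g] by simp
  have 1: "g y \<le> avg A' g + Y" if "y \<in> A" for y
  proof -
    have "avg A' (\<lambda>y. - g y) \<le> Y - g y"
      by (rule avg_le[OF i' A'(1,2)]) (use Y[OF that] in force)
    then show ?thesis using neg by simp
  qed
  have 2: "g y \<le> avg A' g + Y - c * d" if "y \<in> E" for y
  proof -
    have "avg A' (\<lambda>y. - g y) \<le> (Y - g y) - c * d"
    proof (rule avg_le_subset[OF i' A'(1,2) E' d])
      show "- g y' \<le> Y - g y" if "y' \<in> A'" for y' using Y[of y y'] E(2) \<open>y \<in> E\<close> that by fastforce
      show "- g y' \<le> Y - g y - d" if "y' \<in> E'" for y' using Yd[OF \<open>y \<in> E\<close> that] by simp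
    qed
    then show ?thesis using neg by simp
  qed
  have "avg A g \<le> (avg A' g + Y) - c * (c * d)"
    by (rule avg_le_subset[OF A(3,1,2) E]) (use c d 1 2 in auto)
  then show ?thesis by simp
qed

context boundary_chart
begin

text \<open>With weight \<open>\<alpha> / 2\<close> one move takes \<open>y\<close> a step of length
  \<open>b\<close> towards \<open>y'\<close>, which stays put; every other outcome is bounded by
  \<open>Y\<close>. After \<open>j\<close> such moves the points coincide. The distance of the
  segment from the boundary makes each step admissible, and each round costs one killing
  term.\<close>

lemma tug_walk:
  fixes x y y' :: "real^'n"
  assumes dpp: "normalized_dpp \<Omega> \<alpha> \<gamma> \<epsilon> G u"
    and eps: "\<epsilon> < r / 2" "8 * L * \<epsilon> \<le> 1" and Y: "0 \<le> Y"
    and W: "\<And>w w'. w \<in> closure \<Omega> \<Longrightarrow> w' \<in> closure \<Omega> \<Longrightarrow> norm (w - x) \<le> D + \<epsilon> \<Longrightarrow> norm (w' - x) \<le> D + \<epsilon> \<Longrightarrow> u w - u w' \<le> Y"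
    and b: "0 < b" "b \<le> \<epsilon> / 2"
    and seg: "\<And>w. w \<in> closed_segment y y' \<Longrightarrow> w \<in> closure \<Omega> \<and> b \<le> bdist \<Omega> w \<and> norm (w - x) \<le> D \<and> dist z w < r / 2"
    and len: "norm (y - y') \<le> real j * b"
  shows "u y - u y' \<le> (1 - (\<alpha> / 2) ^ j) * Y + real j * (4 * (1 - \<alpha>) * \<gamma> * s_const TYPE('n) * \<epsilon>)"
  using seg len
proof (induction j arbitrary: y)
  case 0
  then show ?case by simp
next
  case (Suc j)
  interpret normalized_dpp \<Omega> \<alpha> \<gamma> \<epsilon> G u by (rule dpp)
  let ?k = "4 * (1 - \<alpha>) * \<gamma> * s_const TYPE('n) * \<epsilon>"
  have k0: "0 \<le> ?k" using \<alpha> \<gamma> \<epsilon> s_const_nonneg[where 'n='n] by simp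
  obtain w where w: "w \<in> closed_segment y y'" "norm (w - y) \<le> b" "norm (w - y') \<le> real j * b"
  proof (cases "norm (y - y') \<le> b")
    case True
    show thesis by (rule that[of y']) (use True b in \<open>auto simp: norm_minus_commute\<close>)
  next
    case False
    define \<tau> where "\<tau> = b / norm (y - y')"
    have \<tau>: "0 \<le> \<tau>" "\<tau> \<le> 1" "\<tau> * norm (y - y') = b"
    proof -
      have "b < norm (y - y')" using False by simp
      then have "0 < norm (y - y')" "b \<le> norm (y - y')" using b by linarith+
      then show "0 \<le> \<tau>" "\<tau> \<le> 1" "\<tau> * norm (y - y') = b" using b(1) by (simp_all add: \<tau>_def)
    qed
    show thesis
    proof (rule that[of "(1 - \<tau>) *\<^sub>R y + \<tau> *\<^sub>R y'"])
      show "(1 - \<tau>) *\<^sub>R y + \<tau> *\<^sub>R y' \<in> closed_segment y y'" using \<tau> by (auto simp: closed_segment_def)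
      have "(1 - \<tau>) *\<^sub>R y + \<tau> *\<^sub>R y' - y = - (\<tau> *\<^sub>R (y - y'))" by (simp add: algebra_simps)
      then show "norm ((1 - \<tau>) *\<^sub>R y + \<tau> *\<^sub>R y' - y) \<le> b" using \<tau> by simp
      have "(1 - \<tau>) *\<^sub>R y + \<tau> *\<^sub>R y' - y' = (1 - \<tau>) *\<^sub>R (y - y')" by (simp add: algebra_simps)
      then have "norm ((1 - \<tau>) *\<^sub>R y + \<tau> *\<^sub>R y' - y') = norm (y - y') - b" using \<tau> by (simp add: left_diff_distrib)
      then show "norm ((1 - \<tau>) *\<^sub>R y + \<tau> *\<^sub>R y' - y') \<le> real j * b" using Suc.prems(2) by (simp add: algebra_simps)
    qed
  qed
  have sub: "closed_segment w y' \<subseteq> closed_segment y y'" using w(1) by (simp add: subset_closed_segment)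
  define Yj where "Yj = (1 - (\<alpha> / 2) ^ j) * Y + real j * ?k"
  have IH: "u w - u y' \<le> Yj" unfolding Yj_def by (rule Suc.IH) (use Suc.prems(1) sub w in auto)
  have y: "y \<in> closure \<Omega>" "b \<le> bdist \<Omega> y" "norm (y - x) \<le> D" "dist z y < r / 2" using Suc.prems(1)[of y] by auto
  have y': "y' \<in> closure \<Omega>" "b \<le> bdist \<Omega> y'" "norm (y' - x) \<le> D" "dist z y' < r / 2" using Suc.prems(1)[of y'] by auto
  have close: "norm (p - x) \<le> D + \<epsilon>" if "norm (p - c) \<le> \<epsilon>" "norm (c - x) \<le> D" for p c
    using norm_triangle_ineq[of "p - c" "c - x"] that by simp
  have step: "\<exists>v\<in>cball y (tug_radius y). \<exists>v'\<in>cball y' (tug_radius y'). (u p - u p') + (u v - u v') \<le> Y + Yj"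
    \<comment> \<open>Whatever the given pair of moves, the answer is to step to \<open>w\<close>
      and to keep \<open>y'\<close>.\<close>
    if p: "p \<in> cball y (tug_radius y)" "p' \<in> cball y' (tug_radius y')" for p p'
  proof -
    have "p \<in> closure \<Omega>" "p' \<in> closure \<Omega>" using p tug_ball[OF y(1)] tug_ball[OF y'(1)] by blast+
    moreover have "norm (p - y) \<le> \<epsilon>" "norm (p' - y') \<le> \<epsilon>"
      using p tug_radius(3)[of y] tug_radius(3)[of y'] \<epsilon> by (auto simp: dist_norm norm_minus_commute)
    ultimately have "u p - u p' \<le> Y" using W close y y' by blast
    moreover have "w \<in> cball y (tug_radius y)" using w(2) b y(2) by (simp add: tug_radius_eq dist_norm norm_minus_commute)
    moreover have "y' \<in> cball y' (tug_radius y')" using tug_radius(1) by simp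
    ultimately show ?thesis using IH by (intro bexI[of _ w] bexI[of _ y']) linarith+
  qed
  have sS: "step_set \<Omega> \<epsilon> y \<in> lmeasurable" for y by (rule step_set_lmeasurable[OF open_dom])
  \<comment> \<open>Empty events with \<open>c = d = 0\<close> reduce the estimate to the plain
    bound \<open>Y\<close>.\<close>
  have av: "avg (step_set \<Omega> \<epsilon> y) u - avg (step_set \<Omega> \<epsilon> y') u \<le> Y - 0 * (0 * 0)"
  proof (rule avg_diff_le[OF sS _ u_integrable sS _ u_integrable, where E = "{}" and E' = "{}"])
    show "0 < measure lebesgue (step_set \<Omega> \<epsilon> y)" by (rule step_set_measure(1)[OF y(1,4) \<epsilon> eps])
    show "0 < measure lebesgue (step_set \<Omega> \<epsilon> y')" by (rule step_set_measure(1)[OF y'(1,4) \<epsilon> eps])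
    fix p p' assume p: "p \<in> step_set \<Omega> \<epsilon> y" "p' \<in> step_set \<Omega> \<epsilon> y'"
    show "u p - u p' \<le> Y"
    proof (rule W)
      show "p \<in> closure \<Omega>" "p' \<in> closure \<Omega>" using p closure_subset by (auto simp: step_set_def)
      show "norm (p - x) \<le> D + \<epsilon>" "norm (p' - x) \<le> D + \<epsilon>"
        using p close[of p y] close[of p' y'] y y' by (auto simp: step_set_def dist_norm norm_minus_commute)
    qed
  qed auto
  have "u y - u y' \<le> \<alpha> / 2 * (Y + Yj) + (1 - \<alpha>) * (avg (step_set \<Omega> \<epsilon> y) u - avg (step_set \<Omega> \<epsilon> y') u)
    + 2 * (1 - \<alpha>) * \<gamma> * (s_eps \<Omega> \<epsilon> y + s_eps \<Omega> \<epsilon> y')"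
    by (rule dpp_diff[OF y(1) y'(1) step])
  also have "\<dots> \<le> \<alpha> / 2 * (Y + Yj) + (1 - \<alpha>) * Y + 2 * (1 - \<alpha>) * \<gamma> * (s_const TYPE('n) * \<epsilon> + s_const TYPE('n) * \<epsilon>)"
    using av \<alpha> \<gamma> s_eps_le_linear[OF \<epsilon>, of \<Omega> y] s_eps_le_linear[OF \<epsilon>, of \<Omega> y']
    by (intro add_mono mult_left_mono) auto
  also have "\<dots> = Y - (\<alpha> / 2) * (\<alpha> / 2) ^ j * Y + \<alpha> / 2 * (real j * ?k) + ?k"
    by (simp add: Yj_def algebra_simps)
  also have "\<alpha> / 2 * (real j * ?k) \<le> 1 * (real j * ?k)" using \<alpha> k0 by (intro mult_right_mono) auto
  finally show ?case by (simp add: algebra_simps)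
qed

text \<open>One noise step puts both points into deep balls with probability at least
  \<open>(1/16) ^ n\<close>; from there \<open>J\<close> tug-of-war steps along a segment merge
  them. The product of the weights is the share of \<open>Y\<close> that is removed, and at most
  \<open>J + 1\<close> killing terms are added.\<close>

lemma small_step:
  fixes x x' :: "real^'n" and K :: real
  assumes dpp: "normalized_dpp \<Omega> \<alpha> \<gamma> \<epsilon> G u" and K: "1 \<le> K"
    and x: "x \<in> closure \<Omega>" "dist z x + (K + 2) * \<epsilon> < r / 2" and x': "x' \<in> closure \<Omega>" "norm (x - x') \<le> K * \<epsilon>"
    and eps: "\<epsilon> < r / 2" "8 * L * \<epsilon> \<le> 1" "16 * L * (K + 2)\<^sup>2 * \<epsilon> \<le> 1" and Y: "0 \<le> Y"
    and W: "\<And>w w'. w \<in> closure \<Omega> \<Longrightarrow> w' \<in> closure \<Omega> \<Longrightarrow> norm (w - x) \<le> (K + 3) * \<epsilon> \<Longrightarrow> norm (w' - x) \<le> (K + 3) * \<epsilon> \<Longrightarrow> u w - u w' \<le> Y"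
    and J: "32 * L * (K + 2) \<le> real J"
  shows "u x - u x' \<le> (1 - (1 - \<alpha>) * (1/16) ^ CARD('n) * (\<alpha> / 2) ^ J) * Y
    + (real J + 1) * (4 * (1 - \<alpha>) * \<gamma> * s_const TYPE('n) * \<epsilon>)"
proof -
  interpret normalized_dpp \<Omega> \<alpha> \<gamma> \<epsilon> G u by (rule dpp)
  let ?k = "4 * (1 - \<alpha>) * \<gamma> * s_const TYPE('n) * \<epsilon>"
  have k0: "0 \<le> ?k" using \<alpha> \<gamma> \<epsilon> s_const_nonneg[where 'n='n] by simp
  have K\<epsilon>: "0 \<le> K * \<epsilon>" "\<epsilon> \<le> K * \<epsilon>" using K \<epsilon> by auto
  have e2: "(K + 2) * \<epsilon> = K * \<epsilon> + 2 * \<epsilon>" "(K + 3) * \<epsilon> = (K + 2) * \<epsilon> + \<epsilon>" by (simp_all add: algebra_simps)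
  have inr: "dist z w < r / 2" if "norm (w - x) \<le> (K + 2) * \<epsilon>" for w
    using dist_triangle[of z w x] that x(2) by (simp add: dist_norm norm_minus_commute)
  have xr: "dist z x < r / 2" using inr[of x] K\<epsilon> \<epsilon> e2 by simp
  have xr': "dist z x' < r / 2" using inr[of x'] x'(2) \<epsilon> e2 by (simp add: norm_minus_commute)
  define E where "E y = cball (y + (\<epsilon> / 2) *\<^sub>R sgn (N y)) (\<epsilon> / 4)" for y
  note dE = deep_ball[OF x(1) xr \<epsilon> eps(1,2), folded E_def] and dE' = deep_ball[OF x'(1) xr' \<epsilon> eps(1,2), folded E_def]
  have deep: "u y - u y' \<le> (1 - (\<alpha> / 2) ^ J) * Y + real J * ?k" if y: "y \<in> E x" "y' \<in> E x'" for y y'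
  \<comment> \<open>On the segment \<rho> is at least \<open>\<epsilon> / 16\<close>, and \<rho> is
    at most \<open>2 * L\<close> times the distance to the boundary; this gives the step length
    \<open>\<epsilon> / (32 * L)\<close>.\<close>
  proof (rule tug_walk[OF dpp eps(1,2) Y, where b = "\<epsilon> / (32 * L)" and D = "(K + 2) * \<epsilon>" and x = x])
    show "u w - u w' \<le> Y" if "w \<in> closure \<Omega>" "w' \<in> closure \<Omega>" "norm (w - x) \<le> (K + 2) * \<epsilon> + \<epsilon>" "norm (w' - x) \<le> (K + 2) * \<epsilon> + \<epsilon>" for w w'
      using W[OF that(1,2)] that(3,4) unfolding e2(2) by blast
    show "0 < \<epsilon> / (32 * L)" using \<epsilon> L by simp
    have "\<epsilon> / (32 * L) \<le> \<epsilon> / 2" using \<epsilon> L by (intro divide_left_mono) auto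
    then show "\<epsilon> / (32 * L) \<le> \<epsilon> / 2" .
    have ny: "norm (y - x) \<le> \<epsilon>" "norm (y' - x') \<le> \<epsilon>"
      using y dE(1) dE'(1) by (auto simp: step_set_def dist_norm norm_minus_commute)
    have ny': "norm (y' - x) \<le> K * \<epsilon> + \<epsilon>"
      using norm_triangle_ineq[of "y' - x'" "x' - x"] ny(2) x'(2) by (simp add: norm_minus_commute)
    have yy: "norm (y - y') \<le> (K + 2) * \<epsilon>"
      using norm_triangle_ineq[of "y - x" "x - y'"] ny(1) ny' e2(1) by (simp add: norm_minus_commute)
    have "(K + 2) * \<epsilon> \<le> real J * (\<epsilon> / (32 * L))"
    proof -
      have "32 * L * (K + 2) * \<epsilon> \<le> real J * \<epsilon>" using J \<epsilon> by (intro mult_right_mono) auto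
      then show ?thesis using L by (simp add: pos_le_divide_eq mult_ac)
    qed
    then show "norm (y - y') \<le> real J * (\<epsilon> / (32 * L))" using yy by linarith
    fix w assume w: "w \<in> closed_segment y y'"
    have "norm (y - x) \<le> (K + 2) * \<epsilon>" "norm (y' - x) \<le> (K + 2) * \<epsilon>"
      using ny(1) ny' K\<epsilon> \<epsilon> unfolding e2(1) by linarith+
    then have "closed_segment y y' \<subseteq> cball x ((K + 2) * \<epsilon>)"
      by (intro closed_segment_subset) (auto simp: dist_norm norm_minus_commute)
    then have wx: "norm (w - x) \<le> (K + 2) * \<epsilon>" using w by (auto simp: dist_norm norm_minus_commute)
    have wr: "dist z w < r / 2" by (rule inr[OF wx])
    obtain \<tau> where \<tau>: "0 \<le> \<tau>" "\<tau> \<le> 1" "w = (1 - \<tau>) *\<^sub>R y + \<tau> *\<^sub>R y'" using w by (auto simp: closed_segment_def)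
    have nw: "norm (y - w) \<le> (K + 2) * \<epsilon>" "norm (y' - w) \<le> (K + 2) * \<epsilon>"
      using segment_bound[OF w] yy by (auto simp: norm_minus_commute)
    let ?Q = "L * ((K + 2) * \<epsilon>)\<^sup>2"
    have "\<epsilon> / 8 \<le> \<rho> w + N w \<bullet> (y - w) + ?Q" "\<epsilon> / 8 \<le> \<rho> w + N w \<bullet> (y' - w) + ?Q"
      using rho_expand(1)[OF nw(1)] rho_expand(1)[OF nw(2)] dE(2)[OF y(1)] dE'(2)[OF y(2)] by linarith+
    \<comment> \<open>The two end points are expanded at \<open>w\<close> and combined with the
      weights that represent \<open>w\<close>, so the gradient terms cancel: \<rho> is concave along
      the segment up to the curvature error.\<close>
    then have "(1 - \<tau>) * (\<epsilon> / 8) + \<tau> * (\<epsilon> / 8) \<le> (1 - \<tau>) * (\<rho> w + N w \<bullet> (y - w) + ?Q) + \<tau> * (\<rho> w + N w \<bullet> (y' - w) + ?Q)"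
      using \<tau> by (intro add_mono mult_left_mono) auto
    also have "\<dots> = \<rho> w + N w \<bullet> ((1 - \<tau>) *\<^sub>R (y - w) + \<tau> *\<^sub>R (y' - w)) + ?Q"
      by (simp add: inner_add_right algebra_simps)
    also have "(1 - \<tau>) *\<^sub>R (y - w) + \<tau> *\<^sub>R (y' - w) = 0" by (simp add: \<tau>(3) algebra_simps)
    finally have "(1 - \<tau>) * (\<epsilon> / 8) + \<tau> * (\<epsilon> / 8) \<le> \<rho> w + ?Q" by simp
    moreover have "(1 - \<tau>) * (\<epsilon> / 8) + \<tau> * (\<epsilon> / 8) = \<epsilon> / 8" by (simp only: distrib_right[symmetric]) simp
    ultimately have "\<epsilon> / 8 - ?Q \<le> \<rho> w" by linarith
    moreover have "?Q \<le> \<epsilon> / 16"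
    proof -
      have "16 * L * (K + 2)\<^sup>2 * \<epsilon> * \<epsilon> \<le> 1 * \<epsilon>" using eps(3) \<epsilon> by (intro mult_right_mono) auto
      then show ?thesis by (simp add: power_mult_distrib power2_eq_square mult_ac)
    qed
    ultimately have \<rho>w: "\<epsilon> / 16 \<le> \<rho> w" by linarith
    have "w \<in> ball z r" using wr r by simp
    then have "w \<in> closure \<Omega>" using dom[of w] \<rho>w \<epsilon> closure_subset by fastforce
    moreover have "\<epsilon> / (32 * L) \<le> bdist \<Omega> w"
      using rho_le_bdist'[OF wr] \<rho>w L by (simp add: pos_divide_le_eq mult_ac)
    ultimately show "w \<in> closure \<Omega> \<and> \<epsilon> / (32 * L) \<le> bdist \<Omega> w \<and> norm (w - x) \<le> (K + 2) * \<epsilon> \<and> dist z w < r / 2"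
      using wx wr by blast
  qed
  have sS: "step_set \<Omega> \<epsilon> y \<in> lmeasurable" for y by (rule step_set_lmeasurable[OF open_dom])
  have clo: "p \<in> closure \<Omega>" "norm (p - x) \<le> (K + 3) * \<epsilon>" if "p \<in> closure \<Omega>" "norm (p - c) \<le> \<epsilon>" "c = x \<or> c = x'" for p c
  proof -
    show "p \<in> closure \<Omega>" by fact
    have cx: "norm (c - x) \<le> K * \<epsilon>" using that(3) x'(2) K\<epsilon> by (auto simp: norm_minus_commute)
    show "norm (p - x) \<le> (K + 3) * \<epsilon>"
    proof -
      have "norm (p - x) \<le> \<epsilon> + K * \<epsilon>" using norm_triangle_ineq[of "p - c" "c - x"] that(2) cx by simp
      moreover have "(K + 3) * \<epsilon> = K * \<epsilon> + 3 * \<epsilon>" by (simp add: algebra_simps)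
      ultimately show ?thesis using \<epsilon> by linarith
    qed
  qed
  let ?d = "(\<alpha> / 2) ^ J * Y" and ?c = "(1/4 :: real) ^ CARD('n)"
  have av: "avg (step_set \<Omega> \<epsilon> x) u - avg (step_set \<Omega> \<epsilon> x') u \<le> (Y + real J * ?k) - ?c * (?c * ?d)"
  proof (rule avg_diff_le[OF sS _ u_integrable sS _ u_integrable, where E = "E x" and E' = "E x'"])
    note m = step_set_measure[OF x(1) xr \<epsilon> eps(1,2)] and m' = step_set_measure[OF x'(1) xr' \<epsilon> eps(1,2)]
    show "0 < measure lebesgue (step_set \<Omega> \<epsilon> x)" "0 < measure lebesgue (step_set \<Omega> \<epsilon> x')" by (rule m(1), rule m'(1))
    show "E x \<in> sets lebesgue" "E x' \<in> sets lebesgue" by (auto simp: E_def)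
    show "E x \<subseteq> step_set \<Omega> \<epsilon> x" "E x' \<subseteq> step_set \<Omega> \<epsilon> x'" by (rule dE(1), rule dE'(1))
    have "measure lebesgue (step_set \<Omega> \<epsilon> y) \<le> measure lebesgue (cball y \<epsilon>)" for y
      by (rule measure_mono_fmeasurable) (use fmeasurableD[OF sS] in \<open>auto simp: step_set_def\<close>)
    then show "?c * measure lebesgue (step_set \<Omega> \<epsilon> x) \<le> measure lebesgue (E x)"
      "?c * measure lebesgue (step_set \<Omega> \<epsilon> x') \<le> measure lebesgue (E x')"
      unfolding dE(3) dE'(3) by (auto intro: mult_left_mono)
    show "0 \<le> ?d" using \<alpha> Y by simp
    show "u p - u p' \<le> Y + real J * ?k" if p: "p \<in> step_set \<Omega> \<epsilon> x" "p' \<in> step_set \<Omega> \<epsilon> x'" for p p'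
    proof -
      have "p \<in> closure \<Omega>" "p' \<in> closure \<Omega>" using p closure_subset by (auto simp: step_set_def)
      moreover have "norm (p - x) \<le> \<epsilon>" "norm (p' - x') \<le> \<epsilon>" using p by (auto simp: step_set_def dist_norm norm_minus_commute)
      ultimately have "u p - u p' \<le> Y" using W clo by blast
      then show ?thesis using k0 by (simp add: add_increasing2)
    qed
    show "u p - u p' \<le> Y + real J * ?k - ?d" if "p \<in> E x" "p' \<in> E x'" for p p'
      using deep[OF that] by (simp add: algebra_simps)
  qed simp
  have step: "\<exists>v\<in>cball x (tug_radius x). \<exists>v'\<in>cball x' (tug_radius x'). (u p - u p') + (u v - u v') \<le> 2 * Y"
    if p: "p \<in> cball x (tug_radius x)" "p' \<in> cball x' (tug_radius x')" for p p'
  proof -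
    have "p \<in> closure \<Omega>" "p' \<in> closure \<Omega>" using p tug_ball[OF x(1)] tug_ball[OF x'(1)] by blast+
    moreover have "norm (p - x) \<le> \<epsilon>" "norm (p' - x') \<le> \<epsilon>"
      using p tug_radius(3)[of x] tug_radius(3)[of x'] \<epsilon> by (auto simp: dist_norm norm_minus_commute)
    ultimately have "u p - u p' \<le> Y" using W clo by blast
    then show ?thesis using p by force
  qed
  have "u x - u x' \<le> \<alpha> / 2 * (2 * Y) + (1 - \<alpha>) * (avg (step_set \<Omega> \<epsilon> x) u - avg (step_set \<Omega> \<epsilon> x') u)
    + 2 * (1 - \<alpha>) * \<gamma> * (s_eps \<Omega> \<epsilon> x + s_eps \<Omega> \<epsilon> x')"
    by (rule dpp_diff[OF x(1) x'(1) step])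
  also have "\<dots> \<le> \<alpha> / 2 * (2 * Y) + (1 - \<alpha>) * ((Y + real J * ?k) - ?c * (?c * ?d))
     + 2 * (1 - \<alpha>) * \<gamma> * (s_const TYPE('n) * \<epsilon> + s_const TYPE('n) * \<epsilon>)"
    using av \<alpha> \<gamma> s_eps_le_linear[OF \<epsilon>, of \<Omega> x] s_eps_le_linear[OF \<epsilon>, of \<Omega> x']
    by (intro add_mono mult_left_mono) auto
  also have "\<dots> = Y - (1 - \<alpha>) * (?c * ?c) * ?d + (1 - \<alpha>) * (real J * ?k) + ?k" by (simp add: algebra_simps)
  also have "?c * ?c = (1/16) ^ CARD('n)" by (simp flip: power_mult_distrib)
  also have "(1 - \<alpha>) * (real J * ?k) \<le> 1 * (real J * ?k)" using \<alpha> k0 by (intro mult_right_mono) auto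
  finally show ?thesis by (simp add: algebra_simps)
qed

end

section \<open>The maximum principle\<close>

lemma avg_uminus: "avg A (\<lambda>y. - f y) = - avg A f"
  using avg_cmult[of A "-1" f] by simp

text \<open>Within \<open>\<epsilon> / 2\<close> of the boundary killing has a positive rate. The
  cut ball is at most the full ball, and \<open>1 - d\<^sup>2\<close> is at least
  \<open>3 / 4\<close>.\<close>

lemma s_eps_ge:
  fixes x :: "real^'n"
  assumes \<epsilon>: "0 < \<epsilon>" and b: "bdist \<Omega> x < \<epsilon> / 2"
  shows "unit_ball_vol (real CARD('n) - 1) / ((real CARD('n) + 1) * unit_ball_vol (real CARD('n)))
    * \<epsilon> * (3/4) powr ((real CARD('n) + 1) / 2) \<le> s_eps \<Omega> \<epsilon> x"
proof -
  let ?n = "real CARD('n)" and ?U = "unit_ball_vol (real CARD('n))" and ?d = "dcut \<Omega> \<epsilon> x"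
  have d: "0 \<le> ?d" "?d \<le> 1/2" using \<epsilon> b bdist_nonneg[of \<Omega> x] by (auto simp: dcut_def min_le_iff_disj pos_divide_le_eq)
  have n1: "0 \<le> ?n - 1" using zero_less_card_finite[where 'a='n] by linarith
  have U: "0 < ?U" by simp
  note c = measure_cut_ball_ge[OF d(1), where 'n='n]
  have cpos: "0 < measure lebesgue (cut_ball ?d :: (real^'n) set)"
    using c(1) U by (smt (verit) divide_pos_pos zero_less_power)
  have "unit_ball_vol (?n - 1) / ((?n + 1) * ?U) \<le> unit_ball_vol (?n - 1) / ((?n + 1) * measure lebesgue (cut_ball ?d :: (real^'n) set))"
    using c(2) cpos n1 by (intro divide_left_mono mult_left_mono mult_pos_pos) auto
  moreover have "(3/4) powr ((?n + 1) / 2) \<le> (1 - ?d\<^sup>2) powr ((?n + 1) / 2)"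
  proof (rule powr_mono2)
    have "?d\<^sup>2 \<le> (1/2)\<^sup>2" using d by (intro power_mono) auto
    then show "3/4 \<le> 1 - ?d\<^sup>2" by (simp add: power2_eq_square)
  qed auto
  ultimately show ?thesis unfolding s_eps_def using \<epsilon> n1
    by (intro mult_mono mult_nonneg_nonneg divide_nonneg_nonneg) auto
qed

text \<open>The barrier \<open>A - g\<close> with \<open>g\<close> exponential in one coordinate: \<open>\<Lambda>\<close> is so large that away from the boundary the
  noise average of \<open>g\<close> is at least \<open>2 * g / (1 - \<alpha>)\<close>, and \<open>A\<close> is so large that near the boundary the killing rate gains
  \<open>g\<close>. The supremum and infimum are never evaluated on \<open>g\<close>: one of them is paired with the value at the centre.\<close>

lemma dpp_max_principle:
  fixes \<Omega> :: "(real^'n) set"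
  assumes om: "open \<Omega>" "bounded \<Omega>" and fr: "frontier \<Omega> \<noteq> {}"
    and \<alpha>: "0 < \<alpha>" "\<alpha> < 1" and \<gamma>: "0 < \<gamma>" and \<epsilon>: "0 < \<epsilon>"
    and sol: "dpp_solution \<Omega> \<alpha> \<gamma> \<epsilon> G v" and ks: "\<And>x. x \<in> closure \<Omega> \<Longrightarrow> (1 - \<alpha>) * \<gamma> * s_eps \<Omega> \<epsilon> x \<le> 1"
    and M: "0 \<le> M" and G: "\<And>x. x \<in> closure \<Omega> \<Longrightarrow> bdist \<Omega> x < \<epsilon> \<Longrightarrow> \<bar>G x\<bar> \<le> M"
    and x: "x \<in> closure \<Omega>"
  shows "\<bar>v x\<bar> \<le> M"
proof -
  let ?A = "step_set \<Omega> \<epsilon>" and ?n = "CARD('n)"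
  define i :: 'n where "i = (SOME i. True)"
  define k where "k x = (1 - \<alpha>) * \<gamma> * s_eps \<Omega> \<epsilon> x" for x
  define tr where "tr x = \<epsilon> * dcut' \<Omega> \<epsilon> x" for x
  have tr_eq: "tr x = min (\<epsilon> / 2) (bdist \<Omega> x)" for x
    using \<epsilon> by (simp add: tr_def dcut'_def min_mult_distrib_left)
  have tr: "0 \<le> tr x" "tr x \<le> bdist \<Omega> x" for x using \<epsilon> bdist_nonneg[of \<Omega> x] by (auto simp: tr_eq)
  have tb: "cball x (tr x) \<subseteq> closure \<Omega>" if "x \<in> closure \<Omega>" for x
    by (rule cball_bdist_subset[OF om(1) fr that tr(2)])
  obtain R where R: "0 < R" "\<And>x. x \<in> closure \<Omega> \<Longrightarrow> norm x \<le> R"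
    using bounded_closure[OF om(2)] by (auto simp: bounded_pos)
  obtain V where V: "0 < V" "\<And>x. x \<in> closure \<Omega> \<Longrightarrow> \<bar>v x\<bar> \<le> V"
    using sol unfolding dpp_solution_def bounded_pos by fastforce
  define s0 where "s0 = unit_ball_vol (real ?n - 1) / ((real ?n + 1) * unit_ball_vol (real ?n)) * \<epsilon> * (3/4) powr ((real ?n + 1) / 2)"
  have s0: "0 < s0"
  proof -
    have "0 \<le> real ?n - 1" using zero_less_card_finite[where 'a='n] by linarith
    then show ?thesis unfolding s0_def using \<epsilon> by (intro mult_pos_pos divide_pos_pos) auto
  qed
  \<comment> \<open>An upward displacement of \<open>\<epsilon> / 8\<close> has probability at least
    \<open>(1/8) ^ n\<close> away from the boundary; \<Lambda> makes the growth of \<open>g\<close>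
    over it compensate this probability and the factor \<open>1 - \<alpha>\<close>, with a factor 2
    left over.\<close>
  define \<Lambda> where "\<Lambda> = 8 / \<epsilon> * ln (2 * 8 ^ ?n / (1 - \<alpha>))"
  have \<Lambda>: "(1 - \<alpha>) * ((1/8) ^ ?n * exp (\<Lambda> * (\<epsilon> / 8))) = 2" "0 \<le> \<Lambda>"
  proof -
    have "1 \<le> 2 * 8 ^ ?n / (1 - \<alpha>)"
    proof -
      have "(1::real) \<le> 8 ^ ?n" by simp
      then have "1 - \<alpha> \<le> 2 * 8 ^ ?n" using \<alpha> by linarith
      then show ?thesis using \<alpha> by (simp add: pos_le_divide_eq)
    qed
    then show "0 \<le> \<Lambda>" using \<epsilon> by (simp add: \<Lambda>_def)
    have "\<Lambda> * (\<epsilon> / 8) = ln (2 * 8 ^ ?n / (1 - \<alpha>))" using \<epsilon> by (simp add: \<Lambda>_def)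
    then have "exp (\<Lambda> * (\<epsilon> / 8)) = 2 * 8 ^ ?n / (1 - \<alpha>)" using \<alpha> by simp
    then show "(1 - \<alpha>) * ((1/8) ^ ?n * exp (\<Lambda> * (\<epsilon> / 8))) = 2" using \<alpha> by (simp add: power_divide field_simps)
  qed
  define g where "g y = exp (\<Lambda> * (y $ i))" for y :: "real^'n"
  define g0 g1 where "g0 = exp (- (\<Lambda> * R))" and "g1 = exp (\<Lambda> * R)"
  have g: "g0 \<le> g y" "g y \<le> g1" if "y \<in> closure \<Omega>" for y
  proof -
    have yR: "y $ i \<le> R" "- R \<le> y $ i" using component_le_norm_cart[of y i] R(2)[OF that] by linarith+
    have "\<Lambda> * (y $ i) \<le> \<Lambda> * R" "\<Lambda> * (- R) \<le> \<Lambda> * (y $ i)"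
      by (rule mult_left_mono[OF yR(1) \<Lambda>(2)], rule mult_left_mono[OF yR(2) \<Lambda>(2)])
    then show "g0 \<le> g y" "g y \<le> g1" by (auto simp: g_def g0_def g1_def)
  qed
  have g0: "0 < g0" "0 < g1" by (auto simp: g0_def g1_def)
  \<comment> \<open>The first summand keeps \<open>A - 2 * g\<close> nonnegative, as needed where
    killing is dropped; the second makes the killing term near the boundary at least
    \<open>g + g0\<close>.\<close>
  define A where "A = 2 * g1 + (g1 + g0) / ((1 - \<alpha>) * \<gamma> * s0)"
  have A: "2 * g1 \<le> A" "g1 + g0 \<le> (1 - \<alpha>) * \<gamma> * s0 * A" "0 < A"
  proof -
    have p: "0 < (1 - \<alpha>) * \<gamma> * s0" using \<alpha> \<gamma> s0 by simp
    have q: "0 \<le> (g1 + g0) / ((1 - \<alpha>) * \<gamma> * s0)" using p g0 by (intro divide_nonneg_pos) auto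
    then show "2 * g1 \<le> A" by (simp add: A_def)
    then show "0 < A" using g0 by linarith
    have "g1 + g0 = (1 - \<alpha>) * \<gamma> * s0 * ((g1 + g0) / ((1 - \<alpha>) * \<gamma> * s0))"
      by (simp only: times_divide_eq_right nonzero_mult_div_cancel_left[OF less_imp_neq[OF p, symmetric]])
    also have "\<dots> \<le> (1 - \<alpha>) * \<gamma> * s0 * A" using p g0 by (intro mult_left_mono) (auto simp: A_def)
    finally show "g1 + g0 \<le> (1 - \<alpha>) * \<gamma> * s0 * A" .
  qed
  have sS: "?A y \<in> lmeasurable" for y by (rule step_set_lmeasurable[OF om(1)])
  have Acl: "?A y \<subseteq> closure \<Omega>" for y using closure_subset by (auto simp: step_set_def)
  have vi: "set_integrable lebesgue (?A y) v" for y
    by (rule set_integrable_bounded_measurable[where S = "closure \<Omega>" and M = V])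
       (use sol V sS Acl in \<open>auto simp: dpp_solution_def\<close>)
  have vi': "set_integrable lebesgue (?A y) (\<lambda>y. - v y)" for y
    using set_integrable_mult_right[of "-1" lebesgue "?A y" v] vi by simp
  define Su where "Su x = (SUP y\<in>cball x (tr x). v y)" for x
  define In where "In x = (INF y\<in>cball x (tr x). v y)" for x
  have eq: "v x = (1 - k x) * (\<alpha> / 2 * (Su x + In x) + (1 - \<alpha>) * avg (?A x) v) + k x * G x" if "x \<in> closure \<Omega>" for x
    using sol that unfolding dpp_solution_def k_def Su_def In_def tr_def avg_def step_set_def
    by (simp add: mult.assoc)
  \<comment> \<open>One application of the equation improves the bound by the fixed amount
    \<open>t * g0\<close>. No point of maximum of \<open>v\<close> is at hand, so the excess over
    \<open>M\<close> is contracted instead of being excluded at a maximum.\<close>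
  have improve: "\<bar>v x\<bar> \<le> M + t * (A - g x - g0)"
    if t: "0 \<le> t" and le: "\<And>y. y \<in> closure \<Omega> \<Longrightarrow> \<bar>v y\<bar> \<le> M + t * (A - g y)" and x: "x \<in> closure \<Omega>" for t x
  proof -
    have leA: "\<bar>v y\<bar> \<le> M + t * A" if "y \<in> closure \<Omega>" for y
    proof -
      have "t * (A - g y) \<le> t * A" using t g[OF that] g0 by (intro mult_left_mono) auto
      then show ?thesis using le[OF that] by linarith
    qed
    have k0: "0 \<le> k x" "k x \<le> 1" using \<alpha> \<gamma> s_eps_nonneg[of \<epsilon> \<Omega> x] \<epsilon> ks[OF x] by (auto simp: k_def)
    have kG: "\<bar>k x * G x\<bar> \<le> k x * M"
    proof (cases "bdist \<Omega> x < \<epsilon>")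
      case True
      then show ?thesis using G[OF x True] k0 by (simp add: abs_mult mult_left_mono)
    next
      case False
      then have "k x = 0" using s_eps_eq_0[OF \<epsilon>, of \<Omega> x] by (simp add: k_def)
      then show ?thesis by simp
    qed
    have ne: "cball x (tr x) \<noteq> {}" using tr(1)[of x] by simp
    have inb: "\<bar>v y\<bar> \<le> M + t * A" if "y \<in> cball x (tr x)" for y using leA tb[OF x] that by blast
    have bd: "bdd_above (v ` cball x (tr x))" "bdd_below (v ` cball x (tr x))"
      using inb by (auto intro!: bdd_aboveI[of _ "M + t * A"] bdd_belowI[of _ "- (M + t * A)"] simp: abs_le_iff) force
    have xin: "x \<in> cball x (tr x)" using tr(1)[of x] by simp
    have S: "Su x \<le> M + t * A" unfolding Su_def by (rule cSUP_least[OF ne]) (use inb in \<open>auto simp: abs_le_iff\<close>)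
    have I: "- (M + t * A) \<le> In x" unfolding In_def by (rule cINF_greatest[OF ne]) (use inb in \<open>force simp: abs_le_iff\<close>)
    have SI: "In x \<le> v x" "v x \<le> Su x" unfolding Su_def In_def using xin bd by (auto intro: cSUP_upper cINF_lower)
    have si: "\<bar>Su x + In x\<bar> \<le> 2 * (M + t * A) - t * g x"
      using S I SI le[OF x] by (simp add: abs_le_iff right_diff_distrib)
    define c where "c = \<alpha> / 2 * (Su x + In x) + (1 - \<alpha>) * avg (?A x) v"
    have vc: "\<bar>v x\<bar> \<le> (1 - k x) * \<bar>c\<bar> + k x * M"
    proof -
      have "\<bar>v x\<bar> \<le> \<bar>(1 - k x) * c\<bar> + \<bar>k x * G x\<bar>" unfolding eq[OF x] c_def[symmetric] by (rule abs_triangle_ineq)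
      then show ?thesis using k0 kG by (simp add: abs_mult)
    qed
    have cb: "\<bar>c\<bar> \<le> \<alpha> / 2 * b1 + (1 - \<alpha>) * b2" if "\<bar>Su x + In x\<bar> \<le> b1" "\<bar>avg (?A x) v\<bar> \<le> b2" for b1 b2
    proof -
      have "\<bar>c\<bar> \<le> \<bar>\<alpha> / 2 * (Su x + In x)\<bar> + \<bar>(1 - \<alpha>) * avg (?A x) v\<bar>" unfolding c_def by (rule abs_triangle_ineq)
      also have "\<dots> \<le> \<alpha> / 2 * b1 + (1 - \<alpha>) * b2"
        unfolding abs_mult using \<alpha> that by (intro add_mono mult_mono) auto
      finally show ?thesis .
    qed
    show ?thesis
    proof (cases "bdist \<Omega> x < \<epsilon> / 2")
      case True
      have "\<bar>avg (?A x) v\<bar> \<le> M + t * A"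
        by (rule avg_abs_le[OF vi sS]) (use leA Acl M t A in \<open>auto simp: subset_iff\<close>)
      moreover have "\<bar>Su x + In x\<bar> \<le> 2 * (M + t * A)"
        using si mult_nonneg_nonneg[OF t, of "g x"] g(1)[OF x] g0 by linarith
      ultimately have "\<bar>c\<bar> \<le> \<alpha> / 2 * (2 * (M + t * A)) + (1 - \<alpha>) * (M + t * A)" by (intro cb)
      then have "\<bar>c\<bar> \<le> M + t * A" by (simp add: algebra_simps)
      then have "(1 - k x) * \<bar>c\<bar> \<le> (1 - k x) * (M + t * A)" using k0 by (intro mult_left_mono) auto
      then have 1: "\<bar>v x\<bar> \<le> M + t * A - t * (k x * A)" using vc by (simp add: algebra_simps)
      have "g x + g0 \<le> (1 - \<alpha>) * \<gamma> * s0 * A" using g(2)[OF x] A(2) by linarith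
      also have "\<dots> \<le> k x * A"
        unfolding k_def using s_eps_ge[OF \<epsilon> True] \<alpha> \<gamma> A(3) by (intro mult_right_mono mult_left_mono) (auto simp: s0_def)
      finally have "t * (g x + g0) \<le> t * (k x * A)" using t by (intro mult_left_mono)
      then show ?thesis using 1 by (simp add: algebra_simps)
    next
      case False
      \<comment> \<open>All points of this ball are higher than \<open>x\<close> by at least
        \<open>\<epsilon> / 8\<close> in the coordinate \<open>i\<close> and closer to it than
        \<open>\<epsilon> / 2\<close>, hence inside the domain.\<close>
      define E where "E = cball (x + (\<epsilon> / 4) *\<^sub>R axis i 1) (\<epsilon> / 8)"
      have E: "norm (y - x) < \<epsilon> / 2 \<and> x $ i + \<epsilon> / 8 \<le> y $ i" if "y \<in> E" for y
      proof -
        let ?w = "y - x - (\<epsilon> / 4) *\<^sub>R axis i 1"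
        have w: "norm ?w \<le> \<epsilon> / 8" using that by (simp add: E_def dist_norm norm_minus_commute algebra_simps)
        have "norm (y - x) \<le> norm ?w + norm ((\<epsilon> / 4) *\<^sub>R axis i (1::real))"
          using norm_triangle_ineq[of ?w "(\<epsilon> / 4) *\<^sub>R axis i 1"] by simp
        moreover have "\<bar>?w $ i\<bar> \<le> \<epsilon> / 8" using component_le_norm_cart[of ?w i] w by linarith
        moreover have "?w $ i = y $ i - x $ i - \<epsilon> / 4" "norm ((\<epsilon> / 4) *\<^sub>R axis i (1::real)) = \<epsilon> / 4"
          using \<epsilon> by simp_all
        ultimately show ?thesis using w \<epsilon> by linarith
      qed
      have "ball x (bdist \<Omega> x) \<subseteq> \<Omega>" by (rule ball_bdist_subset[OF om(1) fr x]) (use False \<epsilon> in linarith)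
      then have EA: "E \<subseteq> ?A x" using E False \<epsilon> by (force simp: step_set_def dist_norm norm_minus_commute subset_iff)
      have mE: "measure lebesgue E = (1/8) ^ ?n * measure lebesgue (cball x \<epsilon>)"
        using \<epsilon> by (simp add: E_def content_cball power_divide)
      have "0 < measure lebesgue E" using \<epsilon> by (simp add: E_def)
      moreover have "measure lebesgue E \<le> measure lebesgue (?A x)"
        by (rule measure_mono_fmeasurable[OF EA _ sS]) (simp add: E_def)
      ultimately have pos: "0 < measure lebesgue (?A x)" by linarith
      have "measure lebesgue (?A x) \<le> measure lebesgue (cball x \<epsilon>)"
        by (rule measure_mono_fmeasurable) (use fmeasurableD[OF sS] in \<open>auto simp: step_set_def\<close>)
      then have c: "(1/8) ^ ?n * measure lebesgue (?A x) \<le> measure lebesgue E" unfolding mE by (intro mult_left_mono) auto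
      define d where "d = t * (exp (\<Lambda> * (\<epsilon> / 8)) * g x)"
      have d: "0 \<le> d" using t by (simp add: d_def g_def)
      have Eb: "\<bar>v y\<bar> \<le> (M + t * A) - d" if "y \<in> E" for y
      proof -
        have "exp (\<Lambda> * (\<epsilon> / 8)) * g x = exp (\<Lambda> * (x $ i + \<epsilon> / 8))"
          unfolding g_def by (simp add: algebra_simps flip: exp_add)
        also have "\<dots> \<le> g y" unfolding g_def using E[OF that] \<Lambda>(2) by (auto intro: mult_left_mono)
        finally have "d \<le> t * g y" unfolding d_def using t by (intro mult_left_mono)
        moreover have "y \<in> closure \<Omega>" using that EA Acl by blast
        ultimately show ?thesis using le[of y] by (simp add: right_diff_distrib)
      qed
      have Es: "E \<in> sets lebesgue" by (simp add: E_def)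
      have lA: "\<bar>v y\<bar> \<le> M + t * A" if "y \<in> ?A x" for y using leA that Acl by blast
      have "avg (?A x) v \<le> (M + t * A) - (1/8) ^ ?n * d"
        by (rule avg_le_subset[OF vi sS pos Es EA c d]) (use lA Eb in \<open>auto simp: abs_le_iff\<close>)
      moreover have "avg (?A x) (\<lambda>y. - v y) \<le> (M + t * A) - (1/8) ^ ?n * d"
        by (rule avg_le_subset[OF vi' sS pos Es EA c d]) (use lA Eb in \<open>auto simp: abs_le_iff\<close>)
      ultimately have av: "\<bar>avg (?A x) v\<bar> \<le> (M + t * A) - (1/8) ^ ?n * d" by (simp add: avg_uminus abs_le_iff)
      have "\<bar>c\<bar> \<le> \<alpha> / 2 * (2 * (M + t * A) - t * g x) + (1 - \<alpha>) * ((M + t * A) - (1/8) ^ ?n * d)"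
        by (rule cb[OF si av])
      also have "\<dots> = (M + t * A) - \<alpha> / 2 * (t * g x) - (1 - \<alpha>) * ((1/8) ^ ?n * exp (\<Lambda> * (\<epsilon> / 8))) * (t * g x)"
        by (simp add: d_def algebra_simps)
      also have "\<dots> = (M + t * A) - \<alpha> / 2 * (t * g x) - 2 * (t * g x)" by (simp only: \<Lambda>(1))
      also have "\<dots> \<le> M + t * (A - 2 * g x)"
      proof -
        have "0 \<le> \<alpha> / 2 * (t * g x)" using \<alpha> t by (simp add: g_def)
        moreover have "t * (A - 2 * g x) = t * A - 2 * (t * g x)" by (simp add: algebra_simps)
        ultimately show ?thesis by linarith
      qed
      finally have c1: "\<bar>c\<bar> \<le> M + t * (A - 2 * g x)" .
      have "0 \<le> t * (A - 2 * g x)" using t A(1) g(2)[OF x] by (intro mult_nonneg_nonneg) auto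
      then have "(1 - k x) * (t * (A - 2 * g x)) \<le> 1 * (t * (A - 2 * g x))" using k0 by (intro mult_right_mono) auto
      moreover have "(1 - k x) * \<bar>c\<bar> \<le> (1 - k x) * (M + t * (A - 2 * g x))" using c1 k0 by (intro mult_left_mono) auto
      ultimately have "\<bar>v x\<bar> \<le> M + t * (A - 2 * g x)" using vc by (simp add: algebra_simps)
      moreover have "t * (A - 2 * g x) \<le> t * (A - g x - g0)" using t g(1)[OF x] by (intro mult_left_mono) auto
      ultimately show ?thesis by linarith
    qed
  qed
  \<comment> \<open>Since \<open>A - g \<le> A\<close>, the amount \<open>g0\<close> is at least the
    fraction \<eta> of \<open>A - g\<close>, so each round shrinks the excess by the factor
    \<open>1 - \<eta>\<close>. The iteration starts from \<open>V / g1\<close>, for which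
    \<open>A - g \<ge> g1\<close> makes the bound trivial.\<close>
  define \<eta> where "\<eta> = g0 / A"
  have \<eta>: "0 < \<eta>" "\<eta> \<le> 1"
  proof -
    show "0 < \<eta>" using g0 A by (simp add: \<eta>_def)
    have "g0 \<le> A" using A(1) g[OF x] g0 by linarith
    then show "\<eta> \<le> 1" using A by (simp add: \<eta>_def)
  qed
  have iter: "\<bar>v y\<bar> \<le> M + (V / g1 * (1 - \<eta>) ^ j) * (A - g y)" if "y \<in> closure \<Omega>" for y j
    using that
  proof (induction j arbitrary: y)
    case 0
    have "V * g1 \<le> V * (A - g y)" using V A(1) g(2)[OF 0] by (intro mult_left_mono) auto
    then have "V \<le> V / g1 * (A - g y)" using g0 by (simp add: pos_le_divide_eq)
    then show ?case using V(2)[OF 0] M by simp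
  next
    case (Suc j)
    let ?t = "V / g1 * (1 - \<eta>) ^ j"
    have t: "0 \<le> ?t" using V g0 \<eta> by simp
    have "\<bar>v y\<bar> \<le> M + ?t * (A - g y - g0)" by (rule improve[OF t Suc.IH Suc.prems])
    also have "?t * (A - g y - g0) \<le> ?t * ((1 - \<eta>) * (A - g y))"
    proof (rule mult_left_mono[OF _ t])
      have "\<eta> * (A - g y) \<le> \<eta> * A" using \<eta> g(1)[OF Suc.prems] g0 by (intro mult_left_mono) auto
      also have "\<eta> * A = g0" using A by (simp add: \<eta>_def)
      finally show "A - g y - g0 \<le> (1 - \<eta>) * (A - g y)" by (simp add: algebra_simps)
    qed
    finally show ?case by (simp add: mult_ac)
  qed
  have "(\<lambda>j. M + (V / g1 * (1 - \<eta>) ^ j) * (A - g x)) \<longlonglongrightarrow> M + (V / g1 * 0) * (A - g x)"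
    using \<eta> by (intro tendsto_intros LIMSEQ_realpow_zero) auto
  then have "(\<lambda>j. M + (V / g1 * (1 - \<eta>) ^ j) * (A - g x)) \<longlonglongrightarrow> M" by simp
  then show ?thesis by (rule LIMSEQ_le_const) (use iter[OF x] in auto)
qed

section \<open>Charts of a bounded domain of class C11\<close>

lemma bdist_lipschitz: "bdist \<Omega> y \<le> bdist \<Omega> x + dist x y"
  unfolding bdist_def using infdist_triangle[of y "frontier \<Omega>" x] by (simp add: dist_commute)

text \<open>Every such point is a limit of nonempty open pieces of the domain inside the strip.
  These are not null sets, so each contains a point at which the essential supremum bounds the
  datum, and continuity carries the bound to \<open>x\<close>. The strict inequality leaves room for
  the open pieces.\<close>

lemma Linf_norm_bound:
  fixes \<Omega> :: "(real^'n) set"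
  assumes om: "open \<Omega>" "bounded \<Omega>" and G: "continuous_on (strip \<Omega> \<epsilon>) G"
    and x: "x \<in> closure \<Omega>" "bdist \<Omega> x < \<epsilon>"
  shows "\<bar>G x\<bar> \<le> Linf_norm (strip \<Omega> \<epsilon>) G"
proof -
  let ?S = "strip \<Omega> \<epsilon>" and ?f = "\<lambda>x. ereal \<bar>G x\<bar>"
  define E where "E = esssup (lebesgue_on ?S) ?f"
  have "closed {x. bdist \<Omega> x \<le> \<epsilon>}"
    unfolding bdist_def by (intro closed_Collect_le continuous_intros)
  moreover have "?S = closure \<Omega> \<inter> {x. bdist \<Omega> x \<le> \<epsilon>}" by (auto simp: strip_def)
  ultimately have cS: "compact ?S" using om(2) by (simp add: compact_Int_closed)
  then have mS: "?S \<in> sets lebesgue" by (intro fmeasurableD lmeasurable_compact)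
  have "(\<lambda>x. \<bar>G x\<bar>) \<in> borel_measurable (lebesgue_on ?S)"
    by (rule continuous_imp_measurable_on_sets_lebesgue[OF _ mS]) (intro continuous_intros G)
  then have f: "?f \<in> borel_measurable (lebesgue_on ?S)" by simp
  obtain b where b: "\<And>y. y \<in> ?S \<Longrightarrow> \<bar>G y\<bar> \<le> b"
    using compact_imp_bounded[OF compact_continuous_image[OF G cS]] by (auto simp: bounded_iff)
  have Eb: "E \<le> ereal b" unfolding E_def
    by (rule esssup_I[OF f]) (use b in \<open>auto intro!: AE_I2\<close>)
  have ae: "AE y in lebesgue. y \<in> ?S \<longrightarrow> ?f y \<le> E"
    using esssup_AE[of ?f "lebesgue_on ?S"] mS unfolding E_def by (subst (asm) AE_restrict_space_iff) auto
  have pick: "\<exists>y\<in>U. ?f y \<le> E" if U: "open U" "U \<noteq> {}" "U \<subseteq> ?S" for U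
  proof (rule ccontr)
    assume "\<not> (\<exists>y\<in>U. ?f y \<le> E)"
    then have "AE y in lebesgue. y \<notin> U" using ae U(3) by (auto elim!: eventually_mono)
    moreover have "U \<in> sets lebesgue" using U(1) by (simp add: borel_open)
    ultimately have "U \<in> null_sets lebesgue" by (simp add: AE_iff_null_sets)
    then show False using open_not_negligible[OF U(1,2)] by (simp add: negligible_iff_null_sets)
  qed
  have near: "\<exists>y\<in>?S. dist x y < \<delta> \<and> ?f y \<le> E" if "0 < \<delta>" for \<delta>
  proof -
    let ?U = "ball x (min \<delta> (\<epsilon> - bdist \<Omega> x)) \<inter> \<Omega>"
    have "open ?U" using om(1) by auto
    moreover have "?U \<noteq> {}"
      using x that closure_iff_nhds_not_empty[of x \<Omega>] by (metis centre_in_ball diff_gt_0_iff_gt min_less_iff_conj open_ball order_refl inf_commute)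
    moreover have "?U \<subseteq> ?S"
    proof
      fix y assume y: "y \<in> ?U"
      then have "bdist \<Omega> y \<le> \<epsilon>" using bdist_lipschitz[of \<Omega> y x] by auto
      then show "y \<in> ?S" using y closure_subset[of \<Omega>] by (auto simp: strip_def)
    qed
    ultimately obtain y where "y \<in> ?U" "?f y \<le> E" using pick by blast
    then show ?thesis using \<open>?U \<subseteq> ?S\<close> by auto
  qed
  \<comment> \<open>The essential supremum is finite, by compactness from above and by a point where
    it bounds an absolute value from below, so the conversion to a real number loses
    nothing.\<close>
  obtain c where c: "E = ereal c"
  proof -
    obtain y where "?f y \<le> E" using near[of 1] by auto
    then show thesis using Eb that by (cases E) auto
  qed
  have "\<bar>G x\<bar> \<le> c"
  proof (rule field_le_epsilon)
    fix \<eta> :: real assume "0 < \<eta>"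
    have "x \<in> ?S" using x by (simp add: strip_def)
    then obtain \<delta> where \<delta>: "0 < \<delta>" "\<And>y. y \<in> ?S \<Longrightarrow> dist y x < \<delta> \<Longrightarrow> dist (G y) (G x) < \<eta>"
      using G \<open>0 < \<eta>\<close> unfolding continuous_on_iff by metis
    obtain y where y: "y \<in> ?S" "dist x y < \<delta>" "?f y \<le> E" using near[OF \<delta>(1)] by blast
    have "dist (G y) (G x) < \<eta>" by (rule \<delta>(2)) (use y in \<open>auto simp: dist_commute\<close>)
    moreover have "\<bar>G y\<bar> \<le> c" using y(3) c by simp
    ultimately show "\<bar>G x\<bar> \<le> c + \<eta>" by (simp add: dist_real_def)
  qed
  then show ?thesis using c by (simp add: Linf_norm_def E_def)
qed

lemma C11_taylor:
  fixes \<phi> :: "real^'n \<Rightarrow> real"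
  assumes d: "\<And>x. (\<phi> has_derivative (\<lambda>h. g x \<bullet> h)) (at x)" and L: "L-lipschitz_on UNIV g"
  shows "\<bar>\<phi> y - \<phi> x - g x \<bullet> (y - x)\<bar> \<le> L * (norm (y - x))\<^sup>2"
proof -
  let ?h = "y - x"
  define f where "f t = \<phi> (x + t *\<^sub>R ?h) - t * (g x \<bullet> ?h)" for t
  define f' where "f' t = g (x + t *\<^sub>R ?h) \<bullet> ?h - g x \<bullet> ?h" for t
  have der: "(f has_real_derivative f' t) (at t)" for t
  proof -
    have "((\<lambda>t. x + t *\<^sub>R ?h) has_derivative (\<lambda>s. s *\<^sub>R ?h)) (at t)" by (auto intro!: derivative_eq_intros)
    from has_derivative_compose[OF this d]
    have c: "((\<lambda>t. \<phi> (x + t *\<^sub>R ?h)) has_derivative (\<lambda>s. g (x + t *\<^sub>R ?h) \<bullet> (s *\<^sub>R ?h))) (at t)" .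
    have "((\<lambda>t. \<phi> (x + t *\<^sub>R ?h)) has_real_derivative g (x + t *\<^sub>R ?h) \<bullet> ?h) (at t)"
    proof -
      have "(\<lambda>s. g (x + t *\<^sub>R ?h) \<bullet> (s *\<^sub>R ?h)) = (\<lambda>s. (g (x + t *\<^sub>R ?h) \<bullet> ?h) * s)" by (simp add: fun_eq_iff)
      with c show ?thesis by (simp only: has_field_derivative_def)
    qed
    then show ?thesis unfolding f_def f'_def by (auto intro!: derivative_eq_intros)
  qed
  obtain t where t: "0 < t" "t < 1" "f 1 - f 0 = (1 - 0) * f' t"
    using MVT2[of 0 1 f f'] der by auto
  have "\<phi> y - \<phi> x - g x \<bullet> ?h = f' t" using t(3) by (simp add: f_def)
  also have "\<bar>f' t\<bar> \<le> norm (g (x + t *\<^sub>R ?h) - g x) * norm ?h"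
    unfolding f'_def inner_diff_left[symmetric] by (rule Cauchy_Schwarz_ineq2)
  also have "norm (g (x + t *\<^sub>R ?h) - g x) \<le> L * norm (t *\<^sub>R ?h)"
    using lipschitz_onD[OF L, of "x + t *\<^sub>R ?h" x] by (simp add: dist_norm)
  also have "L * norm (t *\<^sub>R ?h) \<le> L * norm ?h"
    using t lipschitz_on_nonneg[OF L] by (intro mult_left_mono) (auto simp: mult_left_le_one_le)
  finally show ?thesis by (simp add: power2_eq_square mult.assoc mult_right_mono)
qed

lemma boundary_chart_mono:
  assumes "boundary_chart \<Omega> z r L \<rho> N" "0 < r'" "r' \<le> r" "L \<le> L'"
  shows "boundary_chart \<Omega> z r' L' \<rho> N"
proof -
  interpret boundary_chart \<Omega> z r L \<rho> N by fact
  have sub: "ball z r' \<subseteq> ball z r" using assms by (intro subset_ball)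
  show ?thesis
  proof
    show "\<bar>\<rho> y - \<rho> x - N x \<bullet> (y - x)\<bar> \<le> L' * (norm (y - x))\<^sup>2" for x y
      using expand[of y x] mult_right_mono[OF assms(4), of "(norm (y - x))\<^sup>2"] by simp
    show "norm (N x) \<le> L'" if "x \<in> ball z r'" for x using N_le[of x] that sub assms by auto
  qed (use open_dom r L assms N_ge dom z sub in auto)
qed

text \<open>The defining function is the height above the graph. Its gradient has component 1 along
  the axis \<nu>, whence the lower bound for its norm. One graph serves all boundary points near
  \<open>z\<close>, which prepares the compactness argument.\<close>

lemma local_chart:
  fixes \<Omega> :: "(real^'n) set"
  assumes "C11_domain \<Omega>" "z \<in> frontier \<Omega>"
  obtains r L \<rho> N where "0 < r" "\<And>z'. z' \<in> frontier \<Omega> \<Longrightarrow> dist z z' < r \<Longrightarrow> boundary_chart \<Omega> z' r L \<rho> N"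
proof -
  obtain R \<nu> \<phi> where R: "0 < R" and nu: "norm \<nu> = 1" and phi: "C11_function \<phi>"
    and dom: "\<Omega> \<inter> ball z R = {x \<in> ball z R. x \<bullet> \<nu> > \<phi> (x - (x \<bullet> \<nu>) *\<^sub>R \<nu>)}" and op: "open \<Omega>"
    using assms unfolding C11_domain_def by blast
  obtain g L0 where g: "\<And>x. (\<phi> has_derivative (\<lambda>h. g x \<bullet> h)) (at x)" and L0: "L0-lipschitz_on UNIV g"
    using phi unfolding C11_function_def by blast
  have L00: "0 \<le> L0" by (rule lipschitz_on_nonneg[OF L0])
  have \<nu>\<nu>: "\<nu> \<bullet> \<nu> = 1" using nu by (simp add: power2_norm_eq_inner[symmetric])
  define P where "P x = x - (x \<bullet> \<nu>) *\<^sub>R \<nu>" for x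
  have P: "P x - P y = P (x - y)" for x y by (simp add: P_def inner_diff_left algebra_simps)
  have nP: "norm (P h) \<le> norm h" for h
  proof -
    have "(norm (P h))\<^sup>2 = (norm h)\<^sup>2 - (h \<bullet> \<nu>)\<^sup>2"
      unfolding power2_norm_eq_inner P_def
      by (simp add: inner_diff_left inner_diff_right \<nu>\<nu> inner_commute[of \<nu> h] power2_eq_square)
    then have "(norm (P h))\<^sup>2 \<le> (norm h)\<^sup>2" by simp
    then show ?thesis by (rule power2_le_imp_le) simp
  qed
  have adj: "g0 \<bullet> P h = P g0 \<bullet> h" for g0 h by (simp add: P_def inner_diff_left inner_diff_right inner_commute[of \<nu> h])
  define \<rho> where "\<rho> x = x \<bullet> \<nu> - \<phi> (P x)" for x
  define N where "N x = \<nu> - P (g (P x))" for x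
  define r where "r = min 1 (R / 2)"
  \<comment> \<open>The second summand bounds the quadratic error; the others bound the gradient:
    the axis, the slope at \<open>z\<close>, and its variation over the ball.\<close>
  define L where "L = 1 + L0 + norm (g (P z)) + L0 * R"
  have exp: "\<bar>\<rho> y - \<rho> x - N x \<bullet> (y - x)\<bar> \<le> L * (norm (y - x))\<^sup>2" for x y
  proof -
    have "\<rho> y - \<rho> x - N x \<bullet> (y - x) = - (\<phi> (P y) - \<phi> (P x) - g (P x) \<bullet> (P y - P x))"
      unfolding \<rho>_def N_def P adj by (simp add: inner_diff_left inner_diff_right inner_commute[of \<nu>])
    then have "\<bar>\<rho> y - \<rho> x - N x \<bullet> (y - x)\<bar> \<le> L0 * (norm (P y - P x))\<^sup>2"
      using C11_taylor[OF g L0, of "P y" "P x"] by simp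
    also have "\<dots> \<le> L * (norm (y - x))\<^sup>2"
      unfolding P using nP[of "y - x"] L00 R by (intro mult_mono power_mono) (auto simp: L_def)
    finally show ?thesis .
  qed
  have Nge: "1 \<le> norm (N x)" for x
  proof -
    have "N x \<bullet> \<nu> = 1" by (simp add: N_def P_def inner_diff_left \<nu>\<nu>)
    then show ?thesis using norm_cauchy_schwarz[of "N x" \<nu>] nu by simp
  qed
  have Nle: "norm (N x) \<le> L" if "dist z x < R" for x
  proof -
    have "norm (N x) \<le> norm \<nu> + norm (P (g (P x)))" unfolding N_def by (rule norm_triangle_ineq4)
    also have "norm (P (g (P x))) \<le> norm (g (P z)) + norm (g (P x) - g (P z))"
      using nP[of "g (P x)"] norm_triangle_ineq[of "g (P z)" "g (P x) - g (P z)"] by simp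
    also have "norm (g (P x) - g (P z)) \<le> L0 * norm (P x - P z)"
      using lipschitz_onD[OF L0, of "P x" "P z"] by (simp add: dist_norm)
    also have "\<dots> \<le> L0 * R"
      using nP[of "x - z"] that L00 unfolding P by (intro mult_left_mono) (auto simp: dist_norm norm_minus_commute)
    finally show ?thesis using nu L00 by (simp add: L_def)
  qed
  show thesis
  proof (rule that[of r L \<rho> N])
    show "0 < r" using R by (simp add: r_def)
    fix z' assume z': "z' \<in> frontier \<Omega>" "dist z z' < r"
    have sub: "dist z x < R" if "x \<in> ball z' r" for x
    proof -
      have "dist z x \<le> dist z z' + dist z' x" by (rule dist_triangle)
      also have "\<dots> < r + r" using z'(2) that by simp
      also have "\<dots> \<le> R" by (simp add: r_def)
      finally show ?thesis .
    qed
    show "boundary_chart \<Omega> z' r L \<rho> N"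
    proof
      show "x \<in> \<Omega> \<longleftrightarrow> 0 < \<rho> x" if "x \<in> ball z' r" for x
      proof -
        have "x \<in> ball z R" using sub[OF that] by simp
        then have "x \<in> \<Omega> \<longleftrightarrow> x \<bullet> \<nu> > \<phi> (x - (x \<bullet> \<nu>) *\<^sub>R \<nu>)" using dom by blast
        then show ?thesis by (simp add: \<rho>_def P_def)
      qed
      show "1 \<le> L" using L00 R by (simp add: L_def)
    qed (use op z' exp Nge Nle sub R in \<open>auto simp: r_def\<close>)
  qed
qed

lemma uniform_charts:
  fixes \<Omega> :: "(real^'n) set"
  assumes b: "bounded \<Omega>" and dom: "C11_domain \<Omega>"
  obtains r L where "0 < r" "r \<le> 1" "1 \<le> L" "\<And>z. z \<in> frontier \<Omega> \<Longrightarrow> \<exists>\<rho> N. boundary_chart \<Omega> z r L \<rho> N"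
proof -
  have "\<forall>z\<in>frontier \<Omega>. \<exists>r L. 0 < r \<and> (\<forall>z'. z' \<in> frontier \<Omega> \<and> dist z z' < r \<longrightarrow> (\<exists>\<rho> N. boundary_chart \<Omega> z' r L \<rho> N))"
    using local_chart[OF dom] by metis
  then obtain rr LL where rL: "\<And>z. z \<in> frontier \<Omega> \<Longrightarrow> 0 < rr z"
    "\<And>z z'. z \<in> frontier \<Omega> \<Longrightarrow> z' \<in> frontier \<Omega> \<Longrightarrow> dist z z' < rr z \<Longrightarrow> \<exists>\<rho> N. boundary_chart \<Omega> z' (rr z) (LL z) \<rho> N"
    by metis
  have "compact (frontier \<Omega>)" using b by (rule compact_frontier_bounded)
  moreover have "frontier \<Omega> \<subseteq> (\<Union>z\<in>frontier \<Omega>. ball z (rr z))" using rL(1) by force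
  ultimately obtain F where F: "F \<subseteq> frontier \<Omega>" "finite F" "frontier \<Omega> \<subseteq> (\<Union>z\<in>F. ball z (rr z))"
    using compactE_image[of "frontier \<Omega>" "frontier \<Omega>" "\<lambda>z. ball z (rr z)"] by (metis open_ball)
  \<comment> \<open>Charts survive shrinking the radius and enlarging the constant, so the extremes
    over the finite cover serve every boundary point.\<close>
  define r where "r = Min (insert 1 (rr ` F))"
  define L where "L = Max (insert 1 (LL ` F))"
  show thesis
  proof (rule that[of r L])
    show "0 < r" using F rL(1) by (auto simp: r_def)
    show "r \<le> 1" "1 \<le> L" using F(2) by (auto simp: r_def L_def)
    fix z' assume z': "z' \<in> frontier \<Omega>"
    then obtain z where z: "z \<in> F" "dist z z' < rr z" using F(3) by auto
    then obtain \<rho> N where "boundary_chart \<Omega> z' (rr z) (LL z) \<rho> N" using rL(2) F(1) z' by blast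
    moreover have "r \<le> rr z" "LL z \<le> L" using z F(2) by (auto simp: r_def L_def)
    ultimately have "boundary_chart \<Omega> z' r L \<rho> N" using boundary_chart_mono \<open>0 < r\<close> by metis
    then show "\<exists>\<rho> N. boundary_chart \<Omega> z' r L \<rho> N" by blast
  qed
qed

section \<open>The Hoelder estimate at the boundary\<close>

text \<open>All constants are fixed before the domain, the chart and the solution, so they depend
  only on the dimension and on the listed parameters.\<close>

lemma local_estimate:
  fixes r L \<sigma> \<alpha> \<gamma> :: real
  assumes r: "0 < r" "r \<le> 1" and L: "1 \<le> L" and \<sigma>: "0 < \<sigma>" "\<sigma> < 1" and \<alpha>: "0 < \<alpha>" "\<alpha> < 1" and \<gamma>: "0 < \<gamma>"
  obtains C\<^sub>2 d\<^sub>0 \<epsilon>\<^sub>0 where "0 < C\<^sub>2" "0 < d\<^sub>0" "0 < \<epsilon>\<^sub>0"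
    "\<And>(\<Omega>::(real^'n) set) z \<rho> N G u \<epsilon> x x'. boundary_chart \<Omega> z r L \<rho> N \<Longrightarrow> normalized_dpp \<Omega> \<alpha> \<gamma> \<epsilon> G u \<Longrightarrow> \<epsilon> < \<epsilon>\<^sub>0 \<Longrightarrow>
      x \<in> closure \<Omega> \<Longrightarrow> x' \<in> closure \<Omega> \<Longrightarrow> dist z x < r / 8 \<Longrightarrow> norm (x - x') \<le> d\<^sub>0 \<Longrightarrow>
      u x - u x' \<le> C\<^sub>2 * (norm (x - x') powr \<sigma> + \<epsilon> powr \<sigma>)"
proof -
  obtain C where C: "1 \<le> C" and dr: "\<And>(\<Omega>::(real^'n) set) z r \<rho> N x \<epsilon>. boundary_chart \<Omega> z r L \<rho> N \<Longrightarrow> x \<in> closure \<Omega> \<Longrightarrow> dist z x < r / 2 \<Longrightarrow>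
      0 < \<epsilon> \<Longrightarrow> \<epsilon> < r / 2 \<Longrightarrow> 8 * L * \<epsilon> \<le> 1 \<Longrightarrow>
      \<exists>m\<ge>0. norm (drift \<Omega> \<epsilon> x - m *\<^sub>R N x) \<le> C * \<epsilon>\<^sup>2 \<and> hit \<Omega> \<epsilon> x \<le> C * (m / \<epsilon> + \<epsilon>) \<and>
        s_eps \<Omega> \<epsilon> x \<le> C * (m + \<epsilon>\<^sup>2) \<and> (bdist \<Omega> x < \<epsilon> / 4 \<longrightarrow> \<epsilon> \<le> C * (m + \<epsilon>\<^sup>2)) \<and>
        (\<epsilon> \<le> bdist \<Omega> x \<longrightarrow> m = 0)"
    using drift_estimate[OF L] by blast
  define \<kappa> where "\<kappa> = \<sigma> * (1 - \<sigma>) / 8"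
  define \<theta> where "\<theta> = \<kappa> / 64"
  define K where "K = 4 + 4 * L\<^sup>2 + 2 * L"
  have pos: "0 < \<kappa>" "0 < \<theta>" "0 < K" "0 < C" using \<sigma> L C by (auto simp: \<kappa>_def \<theta>_def K_def intro!: add_pos_pos)
  define a where "a = min (1/4) (min (\<theta> / 16 / (2 + L)) (min (\<kappa> / 32 / K) (\<alpha> * \<kappa> / (1024 * (K + 1)))))"
  have a: "0 < a" "a \<le> 1/4" "a * (2 + L) \<le> \<theta> / 16" "a * K \<le> \<kappa> / 32" "1024 * a * (K + 1) \<le> \<alpha> * \<kappa>"
  proof -
    show "0 < a" unfolding a_def using pos L \<alpha> by (simp add: divide_pos_pos)
    show "a \<le> 1/4" unfolding a_def by (rule min.cobounded1)
    have "a \<le> \<theta> / 16 / (2 + L)" "a \<le> \<kappa> / 32 / K" "a \<le> \<alpha> * \<kappa> / (1024 * (K + 1))" by (auto simp: a_def)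
    then have "a * (2 + L) \<le> \<theta> / 16" "a * K \<le> \<kappa> / 32" "a * (1024 * (K + 1)) \<le> \<alpha> * \<kappa>"
      using pos L pos_le_divide_eq[of "2 + L" a "\<theta> / 16"] pos_le_divide_eq[of K a "\<kappa> / 32"]
        pos_le_divide_eq[of "1024 * (K + 1)" a "\<alpha> * \<kappa>"] by auto
    then show "a * (2 + L) \<le> \<theta> / 16" "a * K \<le> \<kappa> / 32" "1024 * a * (K + 1) \<le> \<alpha> * \<kappa>" by (auto simp: mult_ac)
  qed
  \<comment> \<open>Solutions oscillate by at most 2, and \<open>B * s\<^sup>2 = 2\<close>: the
    localising term makes the comparison trivial outside the ball of radius \<open>s\<close>, which
    keeps the maximising pairs inside the chart.\<close>
  define s where "s = r / 16"
  define B where "B = 2 / s\<^sup>2"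
  have s: "0 < s" and B: "0 < B" "B * s\<^sup>2 = 2" using r by (auto simp: s_def B_def)
  define e where "e = 2 * (3 + L) * C + 4"
  have e: "0 < e" using L C by (simp add: e_def add_pos_pos)
  define d where "d = min (1/2) (min (r / 16) (min (a / e) (a / (16 * L))))"
  have d: "0 < d" "d \<le> 1/2" "d \<le> r / 16" "d * e \<le> a" "16 * L * d \<le> a"
  proof -
    show "0 < d" unfolding d_def using a r e L by simp
    show "d \<le> 1/2" "d \<le> r / 16" unfolding d_def by (rule min.cobounded1, rule min.coboundedI2[OF min.cobounded1])
    have "d \<le> a / e" "d \<le> a / (16 * L)" by (auto simp: d_def)
    then show "d * e \<le> a" "16 * L * d \<le> a"
      using e L pos_le_divide_eq[of e d a] pos_le_divide_eq[of "16 * L" d a] by (auto simp: mult_ac)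
  qed
  \<comment> \<open>The first summand makes the comparison trivial for pairs at distance
    \<open>d\<close> or more; the others serve the largeness conditions of \<open>large_step\<close>
    one by one.\<close>
  define A where "A = 2 / d powr \<sigma> + 16 * B / \<kappa> + 24 * B * s / (\<sigma> * \<theta>) + 16 * B * s * L / (\<sigma> * a) + 2 * B * s / \<sigma> + B / \<sigma> + 64 * \<gamma> * C / (\<sigma> * a)"
  have dp: "0 < d powr \<sigma>" using d by simp
  have A: "0 < A" "2 \<le> A * d powr \<sigma>" "16 * B \<le> A * \<kappa>" "24 * B * s \<le> A * \<sigma> * \<theta>" "16 * B * s * L \<le> A * \<sigma> * a"
      "2 * B * s \<le> A * \<sigma>" "B \<le> A * \<sigma>" "64 * \<gamma> * C \<le> A * \<sigma> * a"
  proof -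
    let ?t1 = "2 / d powr \<sigma>" and ?t2 = "16 * B / \<kappa>" and ?t3 = "24 * B * s / (\<sigma> * \<theta>)" and ?t4 = "16 * B * s * L / (\<sigma> * a)"
      and ?t5 = "2 * B * s / \<sigma>" and ?t6 = "B / \<sigma>" and ?t7 = "64 * \<gamma> * C / (\<sigma> * a)"
    have t: "0 < ?t1" "0 < ?t2" "0 < ?t3" "0 < ?t4" "0 < ?t5" "0 < ?t6" "0 < ?t7"
      using dp pos B s \<sigma> L a \<gamma> by (auto intro!: divide_pos_pos mult_pos_pos)
    then have le: "?t1 \<le> A" "?t2 \<le> A" "?t3 \<le> A" "?t4 \<le> A" "?t5 \<le> A" "?t6 \<le> A" "?t7 \<le> A"
      unfolding A_def by linarith+
    show "0 < A" using t(1) le(1) by linarith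
    have st: "0 < \<sigma> * \<theta>" "0 < \<sigma> * a" using \<sigma> pos a by auto
    show "2 \<le> A * d powr \<sigma>" using le(1) dp by (simp only: pos_divide_le_eq)
    show "16 * B \<le> A * \<kappa>" using le(2) pos(1) by (simp only: pos_divide_le_eq)
    show "24 * B * s \<le> A * \<sigma> * \<theta>" using le(3) st(1) by (simp only: pos_divide_le_eq mult.assoc)
    show "16 * B * s * L \<le> A * \<sigma> * a" using le(4) st(2) by (simp only: pos_divide_le_eq mult.assoc)
    show "2 * B * s \<le> A * \<sigma>" using le(5) \<sigma>(1) by (simp only: pos_divide_le_eq)
    show "B \<le> A * \<sigma>" using le(6) \<sigma>(1) by (simp only: pos_divide_le_eq)
    show "64 * \<gamma> * C \<le> A * \<sigma> * a" using le(7) st(2) by (simp only: pos_divide_le_eq mult.assoc)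
  qed
  \<comment> \<open>The threshold between the two regimes, in units of \<epsilon>; each summand
    supplies one of the conditions that the pair be far apart.\<close>
  define k where "k = 1 + 16 / \<theta> + 32 * L / a + 128 * C / a + 64 * C * (K + 1)"
  have k: "1 \<le> k" "16 \<le> \<theta> * k" "32 * L \<le> a * k" "128 * C \<le> a * k" "64 * C * (K + 1) \<le> k"
  proof -
    have t: "0 < 16 / \<theta>" "0 < 32 * L / a" "0 < 128 * C / a" "0 < 64 * C * (K + 1)"
      using pos L a by (auto intro!: divide_pos_pos mult_pos_pos add_pos_pos)
    then have le: "16 / \<theta> \<le> k" "32 * L / a \<le> k" "128 * C / a \<le> k" unfolding k_def by linarith+
    show "1 \<le> k" "64 * C * (K + 1) \<le> k" using t unfolding k_def by linarith+
    show "16 \<le> \<theta> * k" using le(1) pos(2) by (simp only: pos_divide_le_eq mult.commute)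
    show "32 * L \<le> a * k" "128 * C \<le> a * k" using le(2,3) a(1) by (simp_all only: pos_divide_le_eq mult.commute[of a])
  qed
  obtain J :: nat where J: "32 * L * (k + 2) \<le> real J" using real_arch_simple by blast
  define \<epsilon>\<^sub>0 where "\<epsilon>\<^sub>0 = min (r / (16 * (k + 3))) (min (1 / (8 * L)) (min (1 / (2 * C)) (1 / (16 * L * (k + 2)\<^sup>2))))"
  have \<epsilon>0: "0 < \<epsilon>\<^sub>0" unfolding \<epsilon>\<^sub>0_def using r k L C by (auto intro!: divide_pos_pos mult_pos_pos)
  define D where "D = 4 * (1 - \<alpha>) * \<gamma> * s_const TYPE('n)"
  have D: "0 \<le> D" using \<alpha> \<gamma> s_const_nonneg[where 'n='n] by (simp add: D_def)
  \<comment> \<open>The probability of merging in the short-distance regime.\<close>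
  define \<delta> where "\<delta> = (1 - \<alpha>) * (1/16) ^ CARD('n) * (\<alpha> / 2) ^ J"
  have \<delta>: "0 < \<delta>" "\<delta> \<le> 1"
  proof -
    show "0 < \<delta>" using \<alpha> by (simp add: \<delta>_def)
    have "(1 - \<alpha>) * (1/16) ^ CARD('n) \<le> 1 * 1" using \<alpha> by (intro mult_mono power_le_one) auto
    then have "(1 - \<alpha>) * (1/16) ^ CARD('n) * (\<alpha> / 2) ^ J \<le> 1 * 1" using \<alpha> by (intro mult_mono power_le_one) auto
    then show "\<delta> \<le> 1" by (simp add: \<delta>_def)
  qed
  \<comment> \<open>The increase of the barrier between nearby pairs. Within
    \<open>(k + 3) * \<epsilon>\<close> of \<open>x\<close> the corrected distance is at most
    \<open>4 * (k + 3) * \<epsilon>\<close>; the second summand is the change of the localising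
    term, in which \<epsilon> is replaced by the larger
    \<open>\<epsilon> powr \<sigma>\<close>.\<close>
  define Cf where "Cf = A * (4 * (k + 3)) powr \<sigma> + 3 * B * s * (k + 3)"
  have Cf: "0 \<le> Cf" using A B s k by (simp add: Cf_def)
  define C' where "C' = (Cf + (real J + 1) * D + 1) / \<delta>"
  have C': "0 < C'" unfolding C'_def using Cf D \<delta> by (intro divide_pos_pos) (auto intro: add_nonneg_pos)
  define C2 where "C2 = A * 2 powr \<sigma> + C'"
  show thesis
  proof (rule that[of C2 d \<epsilon>\<^sub>0])
    show "0 < C2" using A C' by (simp add: C2_def add_pos_pos)
    show "0 < d" "0 < \<epsilon>\<^sub>0" by fact+
    fix \<Omega> :: "(real^'n) set" and z \<rho> N G u \<epsilon> x\<^sub>0 x\<^sub>0'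
    assume ch: "boundary_chart \<Omega> z r L \<rho> N" and dpp: "normalized_dpp \<Omega> \<alpha> \<gamma> \<epsilon> G u" and small: "\<epsilon> < \<epsilon>\<^sub>0"
      and x0: "x\<^sub>0 \<in> closure \<Omega>" "x\<^sub>0' \<in> closure \<Omega>" "dist z x\<^sub>0 < r / 8" "norm (x\<^sub>0 - x\<^sub>0') \<le> d"
    interpret boundary_chart \<Omega> z r L \<rho> N by (rule ch)
    interpret normalized_dpp \<Omega> \<alpha> \<gamma> \<epsilon> G u by (rule dpp)
    let ?F = "barrier \<sigma> a A B \<rho> x\<^sub>0"
    have eps: "(k + 3) * \<epsilon> \<le> r / 16" "8 * L * \<epsilon> \<le> 1" "2 * C * \<epsilon> \<le> 1" "16 * L * (k + 2)\<^sup>2 * \<epsilon> \<le> 1" "\<epsilon> < r / 2" "\<epsilon> \<le> 1" "\<epsilon> \<le> s"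
    proof -
      have "\<epsilon> \<le> r / (16 * (k + 3))" "\<epsilon> \<le> 1 / (8 * L)" "\<epsilon> \<le> 1 / (2 * C)" "\<epsilon> \<le> 1 / (16 * L * (k + 2)\<^sup>2)"
        using small by (auto simp: \<epsilon>\<^sub>0_def)
      moreover have "0 < 16 * (k + 3)" "0 < 8 * L" "0 < 2 * C" "0 < 16 * L * (k + 2)\<^sup>2" using k L pos by (auto intro!: mult_pos_pos)
      ultimately have "\<epsilon> * (16 * (k + 3)) \<le> r" "\<epsilon> * (8 * L) \<le> 1" "\<epsilon> * (2 * C) \<le> 1" "\<epsilon> * (16 * L * (k + 2)\<^sup>2) \<le> 1"
        by (simp_all only: pos_le_divide_eq)
      then show 1: "(k + 3) * \<epsilon> \<le> r / 16" "8 * L * \<epsilon> \<le> 1" "2 * C * \<epsilon> \<le> 1" "16 * L * (k + 2)\<^sup>2 * \<epsilon> \<le> 1"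
        by (simp_all add: mult_ac)
      have "1 * \<epsilon> \<le> (k + 3) * \<epsilon>" using k \<epsilon> by (intro mult_right_mono) auto
      then show "\<epsilon> < r / 2" "\<epsilon> \<le> 1" "\<epsilon> \<le> s" using 1 r unfolding s_def by linarith+
    qed
    have F0: "0 \<le> ?F y y'" for y y' using A B by (simp add: barrier_def)
    define Z where "Z = {p. fst p \<in> closure \<Omega> \<and> snd p \<in> closure \<Omega> \<and> norm (fst p - x\<^sub>0) < s \<and> norm (fst p - snd p) < d}"
    define h where "h p = u (fst p) - u (snd p) - ?F (fst p) (snd p)" for p
    have Zin: "(x\<^sub>0, x\<^sub>0) \<in> Z" using x0 s d by (simp add: Z_def)
    have u2: "u y - u y' \<le> 2" if "y \<in> closure \<Omega>" "y' \<in> closure \<Omega>" for y y'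
      using u1[OF that(1)] u1[OF that(2)] by (simp add: abs_le_iff)
    have bdd: "bdd_above (h ` Z)"
    proof (rule bdd_aboveI[of _ 2])
      fix t assume "t \<in> h ` Z"
      then obtain p where p: "p \<in> Z" "t = h p" by blast
      then show "t \<le> 2" using u2[of "fst p" "snd p"] F0[of "fst p" "snd p"] by (simp add: h_def Z_def)
    qed
    define S0 where "S0 = Sup (h ` Z)"
    \<comment> \<open>Nonnegativity makes the comparison valid also for pairs outside
      \<open>Z\<close>, where the barrier alone exceeds the oscillation.\<close>
    define S where "S = max S0 0"
    have W: "u y - u y' \<le> S + ?F y y'" if y: "y \<in> closure \<Omega>" "y' \<in> closure \<Omega>" for y y'
    proof (cases "norm (y - x\<^sub>0) < s \<and> norm (y - y') < d")
      case True
      then have "(y, y') \<in> Z" using y by (simp add: Z_def)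
      then have "h (y, y') \<le> S0" unfolding S0_def using bdd by (intro cSUP_upper)
      then show ?thesis by (simp add: h_def S_def)
    next
      case False
      have "2 \<le> ?F y y'"
      proof (cases "norm (y - x\<^sub>0) < s")
        case True
        then have "d \<le> norm (y - y')" using False by simp
        also have "\<dots> \<le> qdist a \<rho> y y'" using a by (intro qdist_bounds(1)) auto
        finally have "d powr \<sigma> \<le> qdist a \<rho> y y' powr \<sigma>" using d \<sigma> by (intro powr_mono2) auto
        then have "A * d powr \<sigma> \<le> A * qdist a \<rho> y y' powr \<sigma>" using A(1) by (intro mult_left_mono) auto
        moreover have "0 \<le> B * (norm (y - x\<^sub>0))\<^sup>2" using B by simp
        ultimately show ?thesis using A(2) by (simp add: barrier_def)
      next
        case False
        then have "s\<^sup>2 \<le> (norm (y - x\<^sub>0))\<^sup>2" using s by (intro power_mono) auto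
        then have "B * s\<^sup>2 \<le> B * (norm (y - x\<^sub>0))\<^sup>2" using B by (intro mult_left_mono) auto
        moreover have "0 \<le> A * qdist a \<rho> y y' powr \<sigma>" using A(1) by simp
        ultimately show ?thesis using B(2) by (simp add: barrier_def)
      qed
      then show ?thesis using u2[OF y] by (simp add: S_def)
    qed
    have Sle: "S \<le> C' * \<epsilon> powr \<sigma>"
    proof (rule ccontr)
      assume neg: "\<not> S \<le> C' * \<epsilon> powr \<sigma>"
      have "0 \<le> C' * \<epsilon> powr \<sigma>" using C' by simp
      then have S0: "S = S0" "0 \<le> S" using neg by (auto simp: S_def max_def split: if_splits)
      define c where "c = min (\<alpha> * \<kappa> / 512 * A) ((1 - \<alpha>) * (A * \<sigma> * a / (64 * C)))"
      have c: "0 < c" using \<alpha> pos A(1) \<sigma> a by (simp add: c_def)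
      \<comment> \<open>The tolerance in approaching the supremum: not above the gain for distant
        pairs, and not above \<epsilon>, hence not above \<open>\<epsilon> powr \<sigma>\<close>,
        for close ones.\<close>
      define \<eta> where "\<eta> = min (c * \<epsilon>\<^sup>2) \<epsilon>"
      have \<eta>: "0 < \<eta>" "\<eta> \<le> c * \<epsilon>\<^sup>2" "\<eta> \<le> \<epsilon>" using c \<epsilon> by (auto simp: \<eta>_def)
      have "S0 - \<eta> < Sup (h ` Z)" using \<eta> by (simp add: S0_def)
      then obtain p where p: "p \<in> Z" "S0 - \<eta> < h p" using less_cSup_iff[of "h ` Z"] bdd Zin by blast
      obtain x x' where px: "p = (x, x')" by force
      have x: "x \<in> closure \<Omega>" "x' \<in> closure \<Omega>" "norm (x - x\<^sub>0) < s" "norm (x - x') < d"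
        and gt: "S + ?F x x' - \<eta> < u x - u x'"
        using p S0(1) by (auto simp: px Z_def h_def)
      have zx: "dist z x < 3 * r / 16"
        using dist_triangle[of z x x\<^sub>0] x0(3) x(3) by (simp add: s_def dist_norm norm_minus_commute)
      have zx': "dist z x' < r / 2"
        using dist_triangle[of z x' x] zx x(4) d(3) r by (simp add: dist_norm)
      have zx2: "dist z x < r / 2" using zx r by linarith
      show False
      proof (cases "k * \<epsilon> \<le> norm (x - x')")
        case True
        let ?t = "norm (x - x')"
        obtain m where m: "0 \<le> m" "norm (drift \<Omega> \<epsilon> x - m *\<^sub>R N x) \<le> C * \<epsilon>\<^sup>2" "hit \<Omega> \<epsilon> x \<le> C * (m / \<epsilon> + \<epsilon>)"
          "s_eps \<Omega> \<epsilon> x \<le> C * (m + \<epsilon>\<^sup>2)" "bdist \<Omega> x < \<epsilon> / 4 \<Longrightarrow> \<epsilon> \<le> C * (m + \<epsilon>\<^sup>2)" "\<epsilon> \<le> bdist \<Omega> x \<Longrightarrow> m = 0"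
          using dr[OF ch x(1) zx2 \<epsilon> eps(5,2)] by blast
        obtain m' where m': "0 \<le> m'" "norm (drift \<Omega> \<epsilon> x' - m' *\<^sub>R N x') \<le> C * \<epsilon>\<^sup>2" "hit \<Omega> \<epsilon> x' \<le> C * (m' / \<epsilon> + \<epsilon>)"
          "s_eps \<Omega> \<epsilon> x' \<le> C * (m' + \<epsilon>\<^sup>2)" "\<epsilon> \<le> bdist \<Omega> x' \<Longrightarrow> m' = 0"
          using dr[OF ch x(2) zx' \<epsilon> eps(5,2)] by blast
        have t: "?t \<le> 1/2" "?t * (2 * (3 + L) * C + 4) \<le> a" "16 * L * ?t \<le> a"
        proof -
          show "?t \<le> 1/2" using x(4) d(2) by linarith
          have "?t * e \<le> d * e" using x(4) e by (intro mult_right_mono) auto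
          then show "?t * (2 * (3 + L) * C + 4) \<le> a" using d(4) by (simp add: e_def)
          have "16 * L * ?t \<le> 16 * L * d" using x(4) L by (intro mult_left_mono) auto
          then show "16 * L * ?t \<le> a" using d(5) by linarith
        qed
        have scale: "q * \<epsilon> \<le> w * ?t" if "q \<le> w * k" "0 \<le> w" for q w
        proof -
          have "q * \<epsilon> \<le> w * k * \<epsilon>" using that(1) \<epsilon> by (intro mult_right_mono) auto
          also have "\<dots> = w * (k * \<epsilon>)" by simp
          also have "\<dots> \<le> w * ?t" using True that(2) by (rule mult_left_mono)
          finally show ?thesis .
        qed
        have big: "16 * \<epsilon> \<le> \<theta> * ?t" "32 * L * \<epsilon> \<le> a * ?t" "128 * C * \<epsilon> \<le> a * ?t" "64 * C * (K + 1) * \<epsilon> \<le> ?t"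
          using scale[OF k(2)] scale[OF k(3)] scale[OF k(4)] scale[of "64 * C * (K + 1)" 1] k(5) pos a by auto
        have "u x - u x' \<le> S + ?F x x' - c * \<epsilon>\<^sup>2"
          unfolding c_def \<kappa>_def
          by (rule large_step[OF dpp \<sigma> a(1,2) a(3)[unfolded \<theta>_def \<kappa>_def] a(4)[unfolded \<kappa>_def K_def] a(5)[unfolded \<kappa>_def K_def] C less_imp_le[OF B(1)]
              A(1) A(3)[unfolded \<kappa>_def] A(4)[unfolded \<theta>_def \<kappa>_def] A(5-8) x(1) zx2 x(2) zx' t eps(5,2,3)
              big(1)[unfolded \<theta>_def \<kappa>_def] big(2,3) big(4)[unfolded K_def] less_imp_le[OF x(3)] eps(7) m m'])
             (use W in auto)
        then show False using gt \<eta>(2) by linarith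
      next
        case False
        define Y where "Y = S + ?F x x' + Cf * \<epsilon> powr \<sigma>"
        have ep: "\<epsilon> \<le> \<epsilon> powr \<sigma>"
        proof -
          have "\<epsilon> powr 1 \<le> \<epsilon> powr \<sigma>" using \<epsilon> eps(6) \<sigma> by (intro powr_mono') auto
          then show ?thesis using \<epsilon> by simp
        qed
        have Y0: "0 \<le> Y" using S0(2) F0 Cf by (simp add: Y_def)
        have WY: "u w - u w' \<le> Y"
          if w: "w \<in> closure \<Omega>" "w' \<in> closure \<Omega>" "norm (w - x) \<le> (k + 3) * \<epsilon>" "norm (w' - x) \<le> (k + 3) * \<epsilon>" for w w'
        proof -
          have inr: "v \<in> ball z r" if "norm (v - x) \<le> (k + 3) * \<epsilon>" for v
            using dist_triangle[of z v x] zx that eps(1) r by (simp add: dist_norm norm_minus_commute)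
          have "norm (w - w') \<le> norm (w - x) + norm (w' - x)" using norm_triangle_ineq4[of "w - x" "w' - x"] by simp
          then have ww: "norm (w - w') \<le> 2 * ((k + 3) * \<epsilon>)" using w(3,4) by linarith
          have "qdist a \<rho> w w' \<le> (1 + 2 * a) * norm (w - w')"
            using a rho_nonneg[OF w(1) inr[OF w(3)]] rho_nonneg[OF w(2) inr[OF w(4)]] by (intro qdist_bounds(3)) auto
          also have "\<dots> \<le> 2 * (2 * ((k + 3) * \<epsilon>))" using a ww by (intro mult_mono) auto
          also have "\<dots> = 4 * (k + 3) * \<epsilon>" by simp
          finally have "qdist a \<rho> w w' powr \<sigma> \<le> (4 * (k + 3) * \<epsilon>) powr \<sigma>"
            using qdist_bounds(2)[of a \<rho> w w'] a \<sigma> by (intro powr_mono2) auto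
          also have "\<dots> = (4 * (k + 3)) powr \<sigma> * \<epsilon> powr \<sigma>" by (rule powr_mult)
          finally have 1: "A * qdist a \<rho> w w' powr \<sigma> \<le> A * (4 * (k + 3)) powr \<sigma> * \<epsilon> powr \<sigma>"
            using A(1) by (simp add: mult.assoc mult_left_mono)
          have ks: "(k + 3) * \<epsilon> \<le> s" "0 \<le> (k + 3) * \<epsilon>" using eps(1) k \<epsilon> by (auto simp: s_def)
          have "norm (w - x\<^sub>0) \<le> norm (x - x\<^sub>0) + (k + 3) * \<epsilon>"
            using norm_triangle_ineq[of "w - x" "x - x\<^sub>0"] w(3) by simp
          then have "(norm (w - x\<^sub>0))\<^sup>2 \<le> (norm (x - x\<^sub>0) + (k + 3) * \<epsilon>)\<^sup>2" by (intro power_mono) auto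
          also have "\<dots> = (norm (x - x\<^sub>0))\<^sup>2 + 2 * (norm (x - x\<^sub>0) * ((k + 3) * \<epsilon>)) + ((k + 3) * \<epsilon>) * ((k + 3) * \<epsilon>)"
            by (simp add: power2_eq_square algebra_simps)
          also have "\<dots> \<le> (norm (x - x\<^sub>0))\<^sup>2 + 2 * (s * ((k + 3) * \<epsilon>)) + s * ((k + 3) * \<epsilon>)"
            using ks x(3) by (intro add_mono mult_left_mono mult_right_mono) auto
          also have "\<dots> = (norm (x - x\<^sub>0))\<^sup>2 + 3 * (s * ((k + 3) * \<epsilon>))" by simp
          finally have "B * (norm (w - x\<^sub>0))\<^sup>2 \<le> B * ((norm (x - x\<^sub>0))\<^sup>2 + 3 * (s * ((k + 3) * \<epsilon>)))"
            using less_imp_le[OF B(1)] by (rule mult_left_mono)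
          then have 2: "B * (norm (w - x\<^sub>0))\<^sup>2 \<le> B * (norm (x - x\<^sub>0))\<^sup>2 + 3 * B * s * (k + 3) * \<epsilon>"
            by (simp add: algebra_simps)
          have 3: "3 * B * s * (k + 3) * \<epsilon> \<le> 3 * B * s * (k + 3) * \<epsilon> powr \<sigma>"
            using ep B(1) s k by (intro mult_left_mono) auto
          have 4: "Cf * \<epsilon> powr \<sigma> = A * (4 * (k + 3)) powr \<sigma> * \<epsilon> powr \<sigma> + 3 * B * s * (k + 3) * \<epsilon> powr \<sigma>"
            by (simp add: Cf_def distrib_right)
          have 5: "0 \<le> A * qdist a \<rho> x x' powr \<sigma>" using A(1) by simp
          have "?F w w' \<le> ?F x x' + Cf * \<epsilon> powr \<sigma>" unfolding barrier_def using 1 2 3 4 5 by linarith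
          then show ?thesis using W[OF w(1,2)] by (simp add: Y_def)
        qed
        have zk: "dist z x + (k + 2) * \<epsilon> < r / 2"
        proof -
          have "(k + 2) * \<epsilon> \<le> (k + 3) * \<epsilon>" using \<epsilon> by (intro mult_right_mono) auto
          then show ?thesis using zx eps(1) r by linarith
        qed
        have "u x - u x' \<le> (1 - \<delta>) * Y + (real J + 1) * (D * \<epsilon>)"
          using small_step[OF dpp k(1) x(1) zk x(2) _ eps(5,2,4) Y0 WY J] False unfolding \<delta>_def D_def by simp
        moreover have "(real J + 1) * (D * \<epsilon>) \<le> (real J + 1) * D * \<epsilon> powr \<sigma>"
          using mult_left_mono[OF ep, of "(real J + 1) * D"] D by (simp add: mult.assoc)
        moreover have "(1 - \<delta>) * (Cf * \<epsilon> powr \<sigma>) \<le> 1 * (Cf * \<epsilon> powr \<sigma>)"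
          using \<delta> Cf by (intro mult_right_mono) auto
        moreover have "(1 - \<delta>) * Y = S + ?F x x' - \<delta> * S - \<delta> * ?F x x' + (1 - \<delta>) * (Cf * \<epsilon> powr \<sigma>)"
          by (simp add: Y_def algebra_simps)
        moreover have "0 \<le> \<delta> * ?F x x'" using \<delta> F0 by simp
        \<comment> \<open>The merging removes the fraction \<delta> of \<open>S\<close>, while
          near-maximality allows only a loss of order \<open>\<epsilon> powr \<sigma>\<close>; the
          constant \<open>C'\<close> was chosen as the quotient.\<close>
        ultimately have "\<delta> * S \<le> Cf * \<epsilon> powr \<sigma> + (real J + 1) * D * \<epsilon> powr \<sigma> + \<epsilon> powr \<sigma>"
          using gt \<eta>(3) ep by linarith
        also have "\<dots> = (Cf + (real J + 1) * D + 1) * \<epsilon> powr \<sigma>" by (simp add: algebra_simps)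
        also have "\<dots> = \<delta> * (C' * \<epsilon> powr \<sigma>)" using \<delta> by (simp add: C'_def)
        finally show False using neg \<delta> by (simp add: mult_le_cancel_left_pos)
      qed
    qed
    have "u x\<^sub>0 - u x\<^sub>0' \<le> S + ?F x\<^sub>0 x\<^sub>0'" by (rule W[OF x0(1,2)])
    \<comment> \<open>The localising term vanishes at its centre, which is the first of the two
      points to be compared.\<close>
    also have "?F x\<^sub>0 x\<^sub>0' \<le> A * 2 powr \<sigma> * norm (x\<^sub>0 - x\<^sub>0') powr \<sigma>"
    proof -
      have b: "x\<^sub>0 \<in> ball z r" "x\<^sub>0' \<in> ball z r"
        using x0(3,4) d(3) r dist_triangle[of z x\<^sub>0' x\<^sub>0] by (auto simp: dist_norm)
      have "qdist a \<rho> x\<^sub>0 x\<^sub>0' \<le> (1 + 2 * a) * norm (x\<^sub>0 - x\<^sub>0')"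
        using a rho_nonneg[OF x0(1) b(1)] rho_nonneg[OF x0(2) b(2)] by (intro qdist_bounds(3)) auto
      also have "\<dots> \<le> 2 * norm (x\<^sub>0 - x\<^sub>0')" using a by (intro mult_right_mono) auto
      finally have "qdist a \<rho> x\<^sub>0 x\<^sub>0' powr \<sigma> \<le> (2 * norm (x\<^sub>0 - x\<^sub>0')) powr \<sigma>"
        using qdist_bounds(2)[of a \<rho> x\<^sub>0 x\<^sub>0'] a \<sigma> by (intro powr_mono2) auto
      also have "\<dots> = 2 powr \<sigma> * norm (x\<^sub>0 - x\<^sub>0') powr \<sigma>" by (rule powr_mult)
      finally have "A * qdist a \<rho> x\<^sub>0 x\<^sub>0' powr \<sigma> \<le> A * (2 powr \<sigma> * norm (x\<^sub>0 - x\<^sub>0') powr \<sigma>)"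
        using A(1) by (intro mult_left_mono) auto
      then show ?thesis by (simp add: barrier_def mult.assoc)
    qed
    also have "S + A * 2 powr \<sigma> * norm (x\<^sub>0 - x\<^sub>0') powr \<sigma> \<le> C2 * (norm (x\<^sub>0 - x\<^sub>0') powr \<sigma> + \<epsilon> powr \<sigma>)"
    proof -
      have "0 \<le> C' * norm (x\<^sub>0 - x\<^sub>0') powr \<sigma>" "0 \<le> A * 2 powr \<sigma> * \<epsilon> powr \<sigma>" using C' A(1) by auto
      then show ?thesis using Sle by (simp add: C2_def algebra_simps)
    qed
    finally show "u x\<^sub>0 - u x\<^sub>0' \<le> C2 * (norm (x\<^sub>0 - x\<^sub>0') powr \<sigma> + \<epsilon> powr \<sigma>)" by simp
  qed
qed

section \<open>Normalisation of the data\<close>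

lemma real_SUP_INF_scale:
  fixes f :: "'a \<Rightarrow> real"
  assumes c: "0 < c" and ne: "S \<noteq> {}" and b: "\<And>y. y \<in> S \<Longrightarrow> \<bar>f y\<bar> \<le> b"
  shows "(SUP y\<in>S. c * f y) = c * (SUP y\<in>S. f y)" "(INF y\<in>S. c * f y) = c * (INF y\<in>S. f y)"
proof -
  have cb: "\<bar>c * f y\<bar> \<le> c * b" if "y \<in> S" for y using b[OF that] c by (simp add: abs_mult)
  have bdd: "bdd_above (f ` S)" "bdd_below (f ` S)"
    using b by (force intro!: bdd_aboveI[of _ b] bdd_belowI[of _ "- b"] simp: abs_le_iff)+
  have cbdd: "bdd_above ((\<lambda>y. c * f y) ` S)" "bdd_below ((\<lambda>y. c * f y) ` S)"
    using cb by (force intro!: bdd_aboveI[of _ "c * b"] bdd_belowI[of _ "- (c * b)"] simp: abs_le_iff)+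
  show "(SUP y\<in>S. c * f y) = c * (SUP y\<in>S. f y)"
  proof (rule antisym)
    show "(SUP y\<in>S. c * f y) \<le> c * (SUP y\<in>S. f y)"
      by (rule cSUP_least[OF ne]) (use c bdd in \<open>auto intro: cSUP_upper\<close>)
    have "(SUP y\<in>S. f y) \<le> (SUP y\<in>S. c * f y) / c"
    proof (rule cSUP_least[OF ne])
      fix y assume "y \<in> S"
      then have "c * f y \<le> (SUP y\<in>S. c * f y)" using cbdd by (intro cSUP_upper)
      then show "f y \<le> (SUP y\<in>S. c * f y) / c" using c by (simp add: pos_le_divide_eq mult.commute)
    qed
    then show "c * (SUP y\<in>S. f y) \<le> (SUP y\<in>S. c * f y)" using c by (simp add: pos_le_divide_eq mult.commute)
  qed
  show "(INF y\<in>S. c * f y) = c * (INF y\<in>S. f y)"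
  proof (rule antisym)
    show "c * (INF y\<in>S. f y) \<le> (INF y\<in>S. c * f y)"
      by (rule cINF_greatest[OF ne]) (use c bdd in \<open>auto intro: cINF_lower\<close>)
    have "(INF y\<in>S. c * f y) / c \<le> (INF y\<in>S. f y)"
    proof (rule cINF_greatest[OF ne])
      fix y assume "y \<in> S"
      then have "(INF y\<in>S. c * f y) \<le> c * f y" using cbdd by (intro cINF_lower)
      then show "(INF y\<in>S. c * f y) / c \<le> f y" using c by (simp add: pos_divide_le_eq mult.commute)
    qed
    then show "(INF y\<in>S. c * f y) \<le> c * (INF y\<in>S. f y)" using c by (simp add: pos_divide_le_eq mult.commute)
  qed
qed

text \<open>The equation is homogeneous of degree 1 in the pair of datum and solution; positivity of
  \<open>c\<close> is needed for suprema and infima to keep their roles.\<close>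

lemma dpp_solution_scale:
  fixes \<Omega> :: "(real^'n) set"
  assumes c: "0 < c" and om: "open \<Omega>" "frontier \<Omega> \<noteq> {}" and \<epsilon>: "0 < \<epsilon>"
    and sol: "dpp_solution \<Omega> \<alpha> \<gamma> \<epsilon> G v"
  shows "dpp_solution \<Omega> \<alpha> \<gamma> \<epsilon> (\<lambda>x. c * G x) (\<lambda>x. c * v x)"
proof -
  obtain V where V: "\<And>x. x \<in> closure \<Omega> \<Longrightarrow> \<bar>v x\<bar> \<le> V"
    using sol unfolding dpp_solution_def bounded_iff by fastforce
  have "bounded ((\<lambda>x. c * v x) ` closure \<Omega>)"
    unfolding bounded_iff using V c by (intro exI[of _ "c * V"]) (auto simp: abs_mult)
  moreover have "(\<lambda>x. c * v x) \<in> borel_measurable (lebesgue_on (closure \<Omega>))"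
    using sol by (auto simp: dpp_solution_def)
  moreover have "c * v x = (1 - (1 - \<alpha>) * \<gamma> * s_eps \<Omega> \<epsilon> x) *
                (\<alpha> / 2 * ((SUP y\<in>cball x (\<epsilon> * dcut' \<Omega> \<epsilon> x). c * v y) + (INF y\<in>cball x (\<epsilon> * dcut' \<Omega> \<epsilon> x). c * v y))
                 + (1 - \<alpha>) / measure lebesgue (cball x \<epsilon> \<inter> \<Omega>) * (LINT y:(cball x \<epsilon> \<inter> \<Omega>)|lebesgue. c * v y))
              + (1 - \<alpha>) * \<gamma> * s_eps \<Omega> \<epsilon> x * (c * G x)" if x: "x \<in> closure \<Omega>" for x
  proof -
    let ?B = "cball x (\<epsilon> * dcut' \<Omega> \<epsilon> x)"
    have eq: "\<epsilon> * dcut' \<Omega> \<epsilon> x = min (\<epsilon> / 2) (bdist \<Omega> x)"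
      using \<epsilon> by (simp add: dcut'_def min_mult_distrib_left)
    have "?B \<subseteq> closure \<Omega>" by (rule cball_bdist_subset[OF om x]) (simp add: eq)
    then have b: "\<bar>v y\<bar> \<le> V" if "y \<in> ?B" for y using V that by blast
    have ne: "?B \<noteq> {}" using \<epsilon> bdist_nonneg[of \<Omega> x] by (simp add: eq)
    have "v x = (1 - (1 - \<alpha>) * \<gamma> * s_eps \<Omega> \<epsilon> x) *
                (\<alpha> / 2 * ((SUP y\<in>?B. v y) + (INF y\<in>?B. v y))
                 + (1 - \<alpha>) / measure lebesgue (cball x \<epsilon> \<inter> \<Omega>) * (LINT y:(cball x \<epsilon> \<inter> \<Omega>)|lebesgue. v y))
              + (1 - \<alpha>) * \<gamma> * s_eps \<Omega> \<epsilon> x * G x" using sol x by (simp add: dpp_solution_def)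
    then have "c * v x = c * ((1 - (1 - \<alpha>) * \<gamma> * s_eps \<Omega> \<epsilon> x) *
                (\<alpha> / 2 * ((SUP y\<in>?B. v y) + (INF y\<in>?B. v y))
                 + (1 - \<alpha>) / measure lebesgue (cball x \<epsilon> \<inter> \<Omega>) * (LINT y:(cball x \<epsilon> \<inter> \<Omega>)|lebesgue. v y))
              + (1 - \<alpha>) * \<gamma> * s_eps \<Omega> \<epsilon> x * G x)" by simp
    moreover have S: "(SUP y\<in>?B. c * v y) = c * (SUP y\<in>?B. v y)" by (rule real_SUP_INF_scale(1)[OF c ne b])
    moreover have I: "(INF y\<in>?B. c * v y) = c * (INF y\<in>?B. v y)" by (rule real_SUP_INF_scale(2)[OF c ne b])
    ultimately show ?thesis
      by (simp only: S I set_integral_mult_right) (simp add: distrib_left mult_ac)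
  qed
  ultimately show ?thesis unfolding dpp_solution_def by blast
qed

theorem theorem4p4:
  fixes \<Omega> :: "(real^'n) set" and \<alpha> \<gamma> \<sigma> :: real
  assumes "bounded \<Omega>" and "C11_domain \<Omega>"
    and "0 < \<alpha>" and "\<alpha> < 1" and "0 < \<gamma>"
    and "interior_Hoelder_exponent \<Omega> \<alpha> \<gamma> \<sigma>"
  shows "\<exists>\<delta>\<^sub>0 C. 0 < \<delta>\<^sub>0 \<and> \<delta>\<^sub>0 < 1 \<and> 0 < C \<and>
    (\<forall>\<delta>. 0 < \<delta> \<and> \<delta> < \<delta>\<^sub>0 \<longrightarrow>
      (\<exists>\<epsilon>\<^sub>0>0. \<forall>\<epsilon>\<^sub>1 G u. dpp_family \<Omega> \<alpha> \<gamma> \<epsilon>\<^sub>1 G u \<longrightarrow>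
        (\<forall>\<epsilon>. 0 < \<epsilon> \<and> \<epsilon> < \<epsilon>\<^sub>1 \<and> \<epsilon> < \<epsilon>\<^sub>0 \<longrightarrow>
          (\<forall>x\<^sub>0\<in>closure \<Omega>. \<forall>y\<^sub>0\<in>closure \<Omega>.
             norm (x\<^sub>0 - y\<^sub>0) \<le> \<delta> \<and>
             bdist \<Omega> x\<^sub>0 \<le> sqrt \<delta> \<and> bdist \<Omega> y\<^sub>0 \<le> sqrt \<delta> \<longrightarrow>
             \<bar>u \<epsilon> x\<^sub>0 - u \<epsilon> y\<^sub>0\<bar> \<le> C * Linf_norm (strip \<Omega> \<epsilon>) G * \<delta> powr (\<sigma> / 2)))))"
proof -
  have \<sigma>: "0 < \<sigma>" "\<sigma> < 1" using assms(6) by (auto simp: interior_Hoelder_exponent_def)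
  have om: "open \<Omega>" "\<Omega> \<noteq> {}" using assms(2) by (auto simp: C11_domain_def)
  have front: "frontier \<Omega> \<noteq> {}" using assms(1) om(2) by (metis frontier_eq_empty not_bounded_UNIV)
  obtain r L where r: "0 < r" "r \<le> 1" and L: "1 \<le> L"
    and chart: "\<And>z. z \<in> frontier \<Omega> \<Longrightarrow> \<exists>\<rho> N. boundary_chart \<Omega> z r L \<rho> N"
    using uniform_charts[OF assms(1,2)] by metis
  obtain C d \<epsilon>\<^sub>2 where C: "0 < C" "0 < d" "0 < \<epsilon>\<^sub>2"
    and loc: "\<And>(\<Omega>::(real^'n) set) z \<rho> N G u \<epsilon> x x'. boundary_chart \<Omega> z r L \<rho> N \<Longrightarrow> normalized_dpp \<Omega> \<alpha> \<gamma> \<epsilon> G u \<Longrightarrow> \<epsilon> < \<epsilon>\<^sub>2 \<Longrightarrow>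
      x \<in> closure \<Omega> \<Longrightarrow> x' \<in> closure \<Omega> \<Longrightarrow> dist z x < r / 8 \<Longrightarrow> norm (x - x') \<le> d \<Longrightarrow>
      u x - u x' \<le> C * (norm (x - x') powr \<sigma> + \<epsilon> powr \<sigma>)"
    using local_estimate[OF r L \<sigma> assms(3-5)] by metis
  \<comment> \<open>The last entry ensures \<open>sqrt \<delta> < r / 8\<close>, so a point within
    \<open>sqrt \<delta>\<close> of the boundary lies in the inner part of the chart at a nearest
    boundary point.\<close>
  define \<delta>\<^sub>0 where "\<delta>\<^sub>0 = min (1/2) (min d ((r / 8)\<^sup>2))"
  have \<delta>0: "0 < \<delta>\<^sub>0" "\<delta>\<^sub>0 < 1" "\<delta>\<^sub>0 \<le> d" "\<delta>\<^sub>0 \<le> (r / 8)\<^sup>2" using C r by (auto simp: \<delta>\<^sub>0_def)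
  have main: "\<bar>u \<epsilon> x\<^sub>0 - u \<epsilon> y\<^sub>0\<bar> \<le> 2 * C * Linf_norm (strip \<Omega> \<epsilon>) G * \<delta> powr (\<sigma> / 2)"
    if \<delta>: "0 < \<delta>" "\<delta> < \<delta>\<^sub>0" and fam: "dpp_family \<Omega> \<alpha> \<gamma> \<epsilon>\<^sub>1 G u" and \<epsilon>: "0 < \<epsilon>" "\<epsilon> < \<epsilon>\<^sub>1" "\<epsilon> < min \<epsilon>\<^sub>2 \<delta>"
      and x: "x\<^sub>0 \<in> closure \<Omega>" "y\<^sub>0 \<in> closure \<Omega>" "norm (x\<^sub>0 - y\<^sub>0) \<le> \<delta>" "bdist \<Omega> x\<^sub>0 \<le> sqrt \<delta>" "bdist \<Omega> y\<^sub>0 \<le> sqrt \<delta>"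
    for \<delta> \<epsilon>\<^sub>1 G u \<epsilon> x\<^sub>0 y\<^sub>0
  proof -
    define M where "M = Linf_norm (strip \<Omega> \<epsilon>) G"
    have cont: "continuous_on (strip \<Omega> \<epsilon>) G" and ks: "\<And>x. x \<in> closure \<Omega> \<Longrightarrow> (1 - \<alpha>) * \<gamma> * s_eps \<Omega> \<epsilon> x \<le> 1"
      and sol: "dpp_solution \<Omega> \<alpha> \<gamma> \<epsilon> G (u \<epsilon>)" using fam \<epsilon> unfolding dpp_family_def by blast+
    have GM: "\<bar>G x\<bar> \<le> M" if "x \<in> closure \<Omega>" "bdist \<Omega> x < \<epsilon>" for x
      unfolding M_def by (rule Linf_norm_bound[OF om(1) assms(1) cont that])
    \<comment> \<open>A boundary point belongs to every strip; the bound for the datum there shows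
      that the norm is nonnegative.\<close>
    obtain z0 where "z0 \<in> frontier \<Omega>" using front by blast
    then have "\<bar>G z0\<bar> \<le> M" using \<epsilon>(1) by (intro GM) (auto simp: frontier_def bdist_def)
    then have M0: "0 \<le> M" using abs_ge_zero[of "G z0"] by linarith
    have uM: "\<bar>u \<epsilon> x\<bar> \<le> M" if "x \<in> closure \<Omega>" for x
      by (rule dpp_max_principle[OF om(1) assms(1) front assms(3-5) \<epsilon>(1) sol ks M0 GM that])
    show ?thesis
    proof (cases "M = 0")
      case True
      then have "u \<epsilon> x\<^sub>0 = 0" "u \<epsilon> y\<^sub>0 = 0" using uM[OF x(1)] uM[OF x(2)] by auto
      then show ?thesis using True by (simp add: M_def)
    next
      case False
      then have Mpos: "0 < M" using M0 by simp
      let ?v = "\<lambda>x. 1 / M * u \<epsilon> x" and ?g = "\<lambda>x. 1 / M * G x"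
      have dpp: "normalized_dpp \<Omega> \<alpha> \<gamma> \<epsilon> ?g ?v"
      proof
        show "dpp_solution \<Omega> \<alpha> \<gamma> \<epsilon> ?g ?v"
          using Mpos by (intro dpp_solution_scale om(1) front \<epsilon>(1) sol) simp
        show "\<bar>?v x\<bar> \<le> 1" if "x \<in> closure \<Omega>" for x using uM[OF that] Mpos by (simp add: abs_mult)
        show "\<bar>?g x\<bar> \<le> 1" if "x \<in> closure \<Omega>" "bdist \<Omega> x < \<epsilon>" for x using GM[OF that] Mpos by (simp add: abs_mult)
      qed (use om front assms \<epsilon> in auto)
      \<comment> \<open>The one-sided estimate uses a chart near its first argument; with both
        points near the boundary it applies in either order and gives the absolute value.\<close>
      have one: "u \<epsilon> x - u \<epsilon> y \<le> M * (C * (2 * \<delta> powr (\<sigma> / 2)))"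
        if xy: "x \<in> closure \<Omega>" "y \<in> closure \<Omega>" "norm (x - y) \<le> \<delta>" "bdist \<Omega> x \<le> sqrt \<delta>" for x y
      proof -
        obtain z where z: "z \<in> frontier \<Omega>" "bdist \<Omega> x = dist x z" using bdist_attained[OF front] by blast
        obtain \<rho> N where ch: "boundary_chart \<Omega> z r L \<rho> N" using chart[OF z(1)] by blast
        have "sqrt \<delta> < sqrt ((r / 8)\<^sup>2)" using \<delta> \<delta>0(4) by (simp only: real_sqrt_less_iff)
        then have "dist z x < r / 8" using z(2) xy(4) r by (simp add: dist_commute)
        moreover have "norm (x - y) \<le> d" using xy(3) \<delta>(2) \<delta>0(3) by linarith
        ultimately have "?v x - ?v y \<le> C * (norm (x - y) powr \<sigma> + \<epsilon> powr \<sigma>)"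
          using loc[OF ch dpp _ xy(1,2)] \<epsilon>(3) by simp
        also have "\<dots> \<le> C * (\<delta> powr (\<sigma> / 2) + \<delta> powr (\<sigma> / 2))"
        proof (intro mult_left_mono add_mono)
          \<comment> \<open>Both the distance of the points and \<epsilon> are at most \<delta>, and
            \<delta> is below 1, so the smaller exponent gives the larger power.\<close>
          have \<delta>1: "\<delta> powr \<sigma> \<le> \<delta> powr (\<sigma> / 2)" using \<delta> \<delta>0(2) \<sigma> by (intro powr_mono') auto
          have "norm (x - y) powr \<sigma> \<le> \<delta> powr \<sigma>" "\<epsilon> powr \<sigma> \<le> \<delta> powr \<sigma>"
            using xy(3) \<epsilon> \<sigma> by (auto intro!: powr_mono2)
          then show "norm (x - y) powr \<sigma> \<le> \<delta> powr (\<sigma> / 2)" "\<epsilon> powr \<sigma> \<le> \<delta> powr (\<sigma> / 2)" using \<delta>1 by linarith+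
        qed (use C in simp)
        finally have "M * (?v x - ?v y) \<le> M * (C * (2 * \<delta> powr (\<sigma> / 2)))" using Mpos by simp
        moreover have "M * (?v x - ?v y) = u \<epsilon> x - u \<epsilon> y" using Mpos by (simp add: right_diff_distrib)
        ultimately show ?thesis by simp
      qed
      have "\<bar>u \<epsilon> x\<^sub>0 - u \<epsilon> y\<^sub>0\<bar> \<le> M * (C * (2 * \<delta> powr (\<sigma> / 2)))"
        using one[OF x(1,2,3,4)] one[OF x(2,1) _ x(5)] x(3) by (simp add: abs_le_iff norm_minus_commute)
      then show ?thesis by (simp add: M_def mult_ac)
    qed
  qed
  show ?thesis
  proof (rule exI[of _ \<delta>\<^sub>0], rule exI[of _ "2 * C"], intro conjI allI impI)
    fix \<delta> assume \<delta>: "0 < \<delta> \<and> \<delta> < \<delta>\<^sub>0"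
    show "\<exists>\<epsilon>\<^sub>0>0. \<forall>\<epsilon>\<^sub>1 G u. dpp_family \<Omega> \<alpha> \<gamma> \<epsilon>\<^sub>1 G u \<longrightarrow>
        (\<forall>\<epsilon>. 0 < \<epsilon> \<and> \<epsilon> < \<epsilon>\<^sub>1 \<and> \<epsilon> < \<epsilon>\<^sub>0 \<longrightarrow>
          (\<forall>x\<^sub>0\<in>closure \<Omega>. \<forall>y\<^sub>0\<in>closure \<Omega>.
             norm (x\<^sub>0 - y\<^sub>0) \<le> \<delta> \<and> bdist \<Omega> x\<^sub>0 \<le> sqrt \<delta> \<and> bdist \<Omega> y\<^sub>0 \<le> sqrt \<delta> \<longrightarrow>
             \<bar>u \<epsilon> x\<^sub>0 - u \<epsilon> y\<^sub>0\<bar> \<le> 2 * C * Linf_norm (strip \<Omega> \<epsilon>) G * \<delta> powr (\<sigma> / 2)))"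
    proof (intro exI[of _ "min \<epsilon>\<^sub>2 \<delta>"] conjI allI impI ballI)
      show "0 < min \<epsilon>\<^sub>2 \<delta>" using C \<delta> by simp
    qed (use main \<delta> in blast)
  qed (use \<delta>0 C in auto)
qed

end
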